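(* For every integer $\ell\geq 2$ and every integer $r\geq 3$, asymptotically almost surely the following holds: $$ {\rm ex}\left(G_{n,p}^{(r)}, C_{2\ell}^{(r)}\right) \leq \begin{cases} p^{\frac{1}{2\ell-1}}\,n^{1+\frac{r-1}{2\ell-1}+o(1)}, & \text{if } n^{-(r-2)+o(1)}\leq p\leq n^{-(r-2)+\frac{1}{2\ell-2}+o(1)}, \\ p\,n^{r-1+o(1)},& \text{otherwise,} \end{cases}$$ where all $o(1)$ error terms in the exponents are $O(\log\log n /\log n)$.
   Context: An $r$-graph is an $r$-uniform hypergraph. For $r$-graphs $G$ and $H$, the Turán number ${\rm ex}(G,H)$ is the maximum number of edges in a subgraph of $G$ containing no copy of $H$. $G_{n,p}^{(r)}$ is the random $r$-graph on $n$ labelled vertices in which each of the $\binom{n}{r}$ possible edges is present independently with probability $p=p(n)$. The linear cycle $C_k^{(r)}$ is the $r$-graph obtained from the graph cycle $C_k$ by adding $r-2$ new vertices of degree one to each graph edge (so each graph edge becomes an $r$-edge, consecutive edges share exactly one vertex, non-consecutive edges are disjoint). A statement depending on $n$ holds asymptotically almost surely (a.a.s.) if the probability that it holds tends to $1$ as $n\to\infty$.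
   Formalization: Stated only for p ≥ n^{-(r-2)+o(1)}, so "otherwise" means p above the stated interval; below it the claim is false, e.g. for p = n^{-(r-1)} the Turán number is a.a.s. at least cn while p n^{r-1+o(1)} is polylogarithmic. *)

theory Defs
  imports "HOL-Probability.Probability" "HOL-Library.Landau_Symbols"
begin

text \<open>A hypergraph is a pair of a vertex set and an edge set.\<close>

type_synonym 'a hypergraph = "'a set \<times> 'a set set"

abbreviation verts :: "'a hypergraph \<Rightarrow> 'a set" where "verts \<equiv> fst"

abbreviation edges :: "'a hypergraph \<Rightarrow> 'a set set" where "edges \<equiv> snd"

definition subhypergraph :: "'a hypergraph \<Rightarrow> 'a hypergraph \<Rightarrow> bool" where
  "subhypergraph F G \<longleftrightarrow>
     verts F \<subseteq> verts G \<and> edges F \<subseteq> edges G \<and> (\<forall>e\<in>edges F. e \<subseteq> verts F)"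

text \<open>Copies need not be induced.\<close>

definition contains_copy :: "'a hypergraph \<Rightarrow> 'b hypergraph \<Rightarrow> bool" where
  "contains_copy G H \<longleftrightarrow>
     (\<exists>\<phi>. inj_on \<phi> (verts H) \<and> \<phi> ` verts H \<subseteq> verts G \<and> (\<forall>e\<in>edges H. \<phi> ` e \<in> edges G))"

text \<open>For finite \<open>G\<close> and nonempty \<open>H\<close> the set below is finite and contains \<open>0\<close>.\<close>

definition turan_number :: "'a hypergraph \<Rightarrow> 'b hypergraph \<Rightarrow> nat" where
  "turan_number G H = Max {card (edges F) | F. subhypergraph F G \<and> \<not> contains_copy F H}"

text \<open>
  \<open>linear_cycle r k\<close> is intended for \<open>r \<ge> 2\<close> and \<open>k \<ge> 3\<close>. The vertices \<open>Inl i\<close> are those of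
  the graph cycle; \<open>Inr (i, j)\<close> with \<open>j < r - 2\<close> are the new vertices of degree one that
  enlarge the graph edge from \<open>i\<close> to \<open>i + 1\<close>, indices being taken modulo \<open>k\<close>.
\<close>

definition linear_cycle_edge :: "nat \<Rightarrow> nat \<Rightarrow> nat \<Rightarrow> (nat + nat \<times> nat) set" where
  "linear_cycle_edge r k i =
     {Inl i, Inl (Suc i mod k)} \<union> (\<lambda>j. Inr (i, j)) ` {..<r - 2}"

definition linear_cycle :: "nat \<Rightarrow> nat \<Rightarrow> (nat + nat \<times> nat) hypergraph" where
  "linear_cycle r k =
     (Inl ` {..<k} \<union> Inr ` ({..<k} \<times> {..<r - 2}), linear_cycle_edge r k ` {..<k})"

definition random_hypergraph :: "nat \<Rightarrow> nat \<Rightarrow> real \<Rightarrow> nat hypergraph pmf" where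
  "random_hypergraph r n p =
     (let K = {e. e \<subseteq> {..<n} \<and> card e = r}
      in map_pmf (\<lambda>present. ({..<n}, {e\<in>K. present e}))
           (Pi_pmf K False (\<lambda>_. bernoulli_pmf p)))"

definition asymptotically_almost_surely ::
    "(nat \<Rightarrow> 'a pmf) \<Rightarrow> (nat \<Rightarrow> 'a \<Rightarrow> bool) \<Rightarrow> bool" where
  "asymptotically_almost_surely M P \<longleftrightarrow>
     (\<lambda>n. measure_pmf.prob (M n) {x. P n x}) \<longlonglongrightarrow> 1"

text \<open>The admissible error terms \<open>o(1)\<close> in exponents; \<open>n powr \<epsilon> n\<close> is then polylogarithmic.\<close>

definition exponent_errors :: "(nat \<Rightarrow> real) set" where
  "exponent_errors = O(\<lambda>n. ln (ln (real n)) / ln (real n))"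

end

theory Submission
  imports Defs "HOL-Real_Asymp.Real_Asymp"
begin

text \<open>
  The proof is the container method, driven by a balanced supersaturation theorem: a hypergraph
  \<open>H\<close> with \<open>t n\<^sup>r\<^sup>-\<^sup>1\<close> edges, \<open>t\<close> at least polylogarithmic, carries a weighting of its linear
  \<open>2l\<close>-cycles in which no set of edges has a large degree.

  After deleting edges one may assume that every \<open>(r - 1)\<close>-subset of an edge lies in at least
  \<open>t / 2\<close> edges. A dyadic pigeonhole on codegrees of pairs, with separate arguments according to
  whether most edges contain a pair of small codegree, then produces a graph, the skeleton, of
  minimum degree \<open>\<Delta>\<close> at least about \<open>sqrt (t n)\<close>, each of whose edges extends to at least \<open>D\<close>
  edges of \<open>H\<close>, only few of which meet a given further vertex. Extending the edges of a closed
  walk independently at random gives a linear cycle with probability at least \<open>1 / 2\<close>, so it is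
  enough to find a weighting of closed walks in the skeleton.

  For this, random walks are followed as long as their transition probabilities stay below
  \<open>\<kappa> s = 1 / (\<Delta> G\<^sup>s\<^sup>-\<^sup>1)\<close>, where \<open>G\<close> is chosen such that \<open>\<kappa> l\<close> is too small to be kept for \<open>l\<close> steps.
  Hence there is a level \<open>s \<le> l\<close> at which many flat walks, the rays, end in a vertex that is hit with
  probability above \<open>\<kappa> s\<close>. Two rays from the same vertex, joined by a zigzag of \<open>2 (l - s)\<close> steps
  between end points and penultimate vertices of rays, form a closed walk of length \<open>2l\<close>. Every
  prescribed step costs a factor \<open>O(G / \<Delta>)\<close>.

  The container lemma chooses a fingerprint greedily, one element at a time, passing to the link
  and discarding sets whose degree becomes saturated. Iterating it polylogarithmically often
  leaves few containers of at most about \<open>t n\<^sup>r\<^sup>-\<^sup>1\<close> edges. A union bound over them finishes the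
  proof, for \<open>t\<close> a polylogarithm times the larger of \<open>1\<close> and the density at which the expected number
  \<open>p t n\<^sup>r\<^sup>-\<^sup>1\<close> of edges in a container equals the size \<open>n (n / t) powr (1 / (2l - 2))\<close> of a fingerprint.
\<close>

text \<open>The size of a fingerprint has the following origin. The thresholds
  \<open>\<kappa> s\<close> run geometrically from 1 / \<Delta> to 1 / (2 n) in l - 1 steps, so G is
  about (n / \<Delta>) powr (1 / (l - 1)), which is (n / t) powr (1 / (2 l - 2)) when \<Delta> is
  about sqrt (t n). Let h be the number of edges. After normalisation a set of j < 2 l edges has
  degree at most about (n G)^(j - 1) / h^j, so a fingerprint of size n G serves for it. A set of 2 l
  edges fixes the whole closed walk; there the powers of G cancel against n, and the bound is about
  n^(2 l) / h^(2 l), which asks for a fingerprint of size n powr (1 + 1 / (2 l - 1)). At p near n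
  powr (- (r - 2)) this second size meets the first bound of the theorem, and that is where the
  range of p begins. The obstacle is that a skeleton can be very irregular: a uniform weighting of
  its closed walks may concentrate on few of them. Weighting by random walk probabilities keeps the
  total mass under control, because degrees are an invariant measure, and excluding large transition
  probabilities keeps single walks light.\<close>

section \<open>Containers from balanced weights\<close>

text \<open>Removing a class \<open>M c\<close> whose remaining weight is below
  \<open>\<tau> c\<close> loses less than \<open>\<tau> c\<close>, and no class is removed twice, so
  at most \<open>sum \<tau> K\<close> is lost. Instead of iterating, the proof takes a largest set
  of removed classes that satisfies this account; a further light class would enlarge it. Rays,
  pairs of vertices, labelled pairs and (r - 1)-sets are all cleaned in this way.\<close>

lemma weighted_cleaning:
  fixes w :: "'e \<Rightarrow> real" and \<tau> :: "'c \<Rightarrow> real" and M :: "'c \<Rightarrow> 'e set"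
  assumes E: "finite E" and K: "finite K" and w: "\<And>e. e \<in> E \<Longrightarrow> 0 \<le> w e"
    and \<tau>: "\<And>c. c \<in> K \<Longrightarrow> 0 \<le> \<tau> c"
  obtains E' where "E' \<subseteq> E" "\<And>c. c \<in> K \<Longrightarrow> E' \<inter> M c \<noteq> {} \<Longrightarrow> \<tau> c \<le> sum w (E' \<inter> M c)"
    "sum w E - sum \<tau> K \<le> sum w E'"
proof -
  define P where "P K' \<longleftrightarrow> K' \<subseteq> K \<and> sum w E - sum \<tau> K' \<le> sum w (E - \<Union>(M ` K'))" for K'
  have "P {}" by (simp add: P_def)
  moreover have "card K' \<le> card K" if "P K'" for K'
    using that K by (simp add: P_def card_mono)
  ultimately obtain K' where K': "P K'" and max: "\<And>L. P L \<Longrightarrow> card L \<le> card K'"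
    using ex_has_greatest_nat[of P "{}" card "Suc (card K)"] by (auto simp: less_Suc_eq_le)
  define E' where "E' = E - \<Union>(M ` K')"
  have fin: "finite K'" using K' K by (auto simp: P_def intro: finite_subset)
  show ?thesis
  proof
    show "E' \<subseteq> E" by (auto simp: E'_def)
    have "sum \<tau> K' \<le> sum \<tau> K" using K' K \<tau> by (intro sum_mono2) (auto simp: P_def)
    then show "sum w E - sum \<tau> K \<le> sum w E'" using K' by (auto simp: P_def E'_def)
    fix c assume c: "c \<in> K" and ne: "E' \<inter> M c \<noteq> {}"
    show "\<tau> c \<le> sum w (E' \<inter> M c)"
    proof (rule ccontr)
      assume *: "\<not> ?thesis"
      have cK: "c \<notin> K'" using ne by (auto simp: E'_def)
      have "sum w E' = sum w (E' \<inter> M c) + sum w (E' - M c)"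
        using E by (subst sum.Int_Diff[of _ _ "M c"]) (auto simp: E'_def)
      moreover have "E' - M c = E - \<Union>(M ` insert c K')" by (auto simp: E'_def)
      ultimately have "P (insert c K')"
        using K' c cK fin * by (auto simp: P_def E'_def)
      from max[OF this] show False using cK fin by simp
    qed
  qed
qed

section \<open>Weighted degrees, links and the greedy choice of a fingerprint\<close>

definition wdeg :: "'a set \<Rightarrow> ('a set \<Rightarrow> real) \<Rightarrow> 'a set \<Rightarrow> real" where
  "wdeg A w T = sum w {C \<in> Pow A. T \<subseteq> C}"

lemma wdeg_alt: "finite A \<Longrightarrow> wdeg A w T = (\<Sum>C \<in> Pow A. if T \<subseteq> C then w C else 0)"
  by (simp only: wdeg_def sum.inter_filter finite_Pow_iff)

lemma wdeg_mono:
  assumes "\<And>C. C \<subseteq> A \<Longrightarrow> v C \<le> w C"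
  shows "wdeg A v T \<le> wdeg A w T"
  unfolding wdeg_def by (rule sum_mono) (use assms in auto)

lemma wdeg_nonneg: "(\<And>C. 0 \<le> w C) \<Longrightarrow> 0 \<le> wdeg A w T"
  unfolding wdeg_def by (rule sum_nonneg) auto

lemma sum_insert_link:
  fixes g :: "'a set \<Rightarrow> real"
  assumes "v \<in> A" "finite A"
  shows "(\<Sum>C \<in> {C \<in> Pow A. T \<subseteq> C}. if v \<in> C then 0 else g (insert v C)) =
         (if v \<in> T then 0 else wdeg A g (insert v T))"
proof (cases "v \<in> T")
  case True
  then show ?thesis by (auto intro!: sum.neutral)
next
  case False
  have "(\<Sum>C \<in> {C \<in> Pow A. T \<subseteq> C}. if v \<in> C then 0 else g (insert v C)) =
        (\<Sum>C \<in> {C \<in> Pow A. T \<subseteq> C \<and> v \<notin> C}. g (insert v C))"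
    using assms by (intro sum.mono_neutral_cong_right) auto
  also have "\<dots> = sum g {C \<in> Pow A. insert v T \<subseteq> C}"
    by (rule sum.reindex_bij_witness[of _ "\<lambda>C. C - {v}" "insert v"]) (use False assms in auto)
  finally show ?thesis using False by (simp add: wdeg_def)
qed

text \<open>A set \<open>T\<close> is saturated once its degree in the link \<open>u\<close> built
  so far reaches \<open>s (card T)\<close>. Sets above a saturated one are withheld, since their
  links could push the degree of \<open>T\<close> further up.\<close>

definition unsat :: "'a set \<Rightarrow> ('a set \<Rightarrow> real) \<Rightarrow> (nat \<Rightarrow> real) \<Rightarrow> ('a set \<Rightarrow> real) \<Rightarrow> 'a set \<Rightarrow> real" where
  "unsat A w s u C = (if \<exists>T. T \<noteq> {} \<and> T \<subseteq> C \<and> s (card T) \<le> wdeg A u T then 0 else w C)"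

text \<open>The list is processed from its end: in \<open>v # vs\<close> the element
  \<open>v\<close> is chosen after \<open>vs\<close>. Each chosen element contributes its link,
  restricted to sets without a saturated subset. The result depends on the independent set only
  through the fingerprint, so a container can be computed from the fingerprint.\<close>

fun link_run :: "'a set \<Rightarrow> ('a set \<Rightarrow> real) \<Rightarrow> (nat \<Rightarrow> real) \<Rightarrow> 'a list \<Rightarrow> 'a set \<Rightarrow> real" where
  "link_run A w s [] C = 0"
| "link_run A w s (v # vs) C =
    link_run A w s vs C + (if v \<in> C then 0 else unsat A w s (link_run A w s vs) (insert v C))"

lemma unsat_le: "(\<And>C. 0 \<le> w C) \<Longrightarrow> unsat A w s u C \<le> w C"
  and unsat_nonneg: "(\<And>C. 0 \<le> w C) \<Longrightarrow> 0 \<le> unsat A w s u C"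
  by (auto simp: unsat_def)

lemma link_run_nonneg: "(\<And>C. 0 \<le> w C) \<Longrightarrow> 0 \<le> link_run A w s vs C"
  by (induction vs arbitrary: C) (auto simp: unsat_nonneg)

text \<open>This carries independence over to the link: a set of positive link weight becomes a set
  of positive \<open>w\<close>-weight when some fingerprint element is added, so a set that contains
  the fingerprint and is independent for \<open>w\<close> is independent for the link.\<close>

lemma link_run_pos:
  assumes "\<And>C. 0 \<le> w C" "link_run A w s vs C \<noteq> 0"
  shows "\<exists>v \<in> set vs. v \<notin> C \<and> w (insert v C) \<noteq> 0"
  using assms(2) by (induction vs) (auto simp: unsat_def split: if_splits)

declare link_run.simps(2) [simp del]

lemma wdeg_link_run_Cons:
  assumes "finite A" "v \<in> A"
  shows "wdeg A (link_run A w s (v # vs)) T = wdeg A (link_run A w s vs) T +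
    (if v \<in> T then 0 else wdeg A (unsat A w s (link_run A w s vs)) (insert v T))"
proof -
  have "wdeg A (link_run A w s (v # vs)) T = wdeg A (link_run A w s vs) T +
    (\<Sum>C \<in> {C \<in> Pow A. T \<subseteq> C}. if v \<in> C then 0 else unsat A w s (link_run A w s vs) (insert v C))"
    by (simp add: wdeg_def link_run.simps sum.distrib)
  also note sum_insert_link[OF assms(2,1)]
  finally show ?thesis .
qed

text \<open>The degree of \<open>T\<close> changes only while \<open>T\<close> is unsaturated, hence
  from a value below \<open>s (card T)\<close>, and one step adds at most the original degree of
  \<open>insert v T\<close>. The threshold is therefore overshot by at most a single
  \<open>\<kappa> (Suc (card T))\<close>.\<close>

lemma wdeg_link_run_le:
  assumes A: "finite A" and w: "\<And>C. 0 \<le> w C" and vs: "set vs \<subseteq> A" and T: "T \<noteq> {}"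
    and deg: "\<And>T. T \<noteq> {} \<Longrightarrow> T \<subseteq> A \<Longrightarrow> wdeg A w T \<le> \<kappa> (card T)"
    and s: "\<And>j. 0 \<le> s j" and \<kappa>: "\<And>j. 0 \<le> \<kappa> j" and TA: "T \<subseteq> A"
  shows "wdeg A (link_run A w s vs) T \<le> s (card T) + \<kappa> (Suc (card T))"
  using vs
proof (induction vs)
  case Nil
  then show ?case using s \<kappa> by (simp add: wdeg_def)
next
  case (Cons v vs)
  let ?u = "link_run A w s vs"
  show ?case
  proof (cases "v \<in> T \<or> s (card T) \<le> wdeg A ?u T")
    case True
    have "unsat A w s ?u C = 0" if "v \<notin> T" "insert v T \<subseteq> C" for C
    proof -
      have "\<exists>T. T \<noteq> {} \<and> T \<subseteq> C \<and> s (card T) \<le> wdeg A ?u T"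
        using True that T by (intro exI[of _ T]) simp
      then show ?thesis unfolding unsat_def by (rule if_P)
    qed
    then have "v \<notin> T \<Longrightarrow> wdeg A (unsat A w s ?u) (insert v T) = 0"
      unfolding wdeg_def by (intro sum.neutral ballI) blast
    then have "wdeg A (link_run A w s (v # vs)) T = wdeg A ?u T"
      using wdeg_link_run_Cons[of A v w s vs T] A Cons.prems by simp
    also have "\<dots> \<le> s (card T) + \<kappa> (Suc (card T))" using Cons by simp
    finally show ?thesis .
  next
    case False
    have "wdeg A (unsat A w s ?u) (insert v T) \<le> wdeg A w (insert v T)"
      by (rule wdeg_mono) (simp add: unsat_le w)
    also have "\<dots> \<le> \<kappa> (card (insert v T))" using Cons TA by (intro deg) auto
    also have "card (insert v T) = Suc (card T)"
      using False TA A by (simp add: finite_subset)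
    finally have "wdeg A (unsat A w s ?u) (insert v T) \<le> \<kappa> (Suc (card T))" .
    moreover have "wdeg A (link_run A w s (v # vs)) T =
        wdeg A ?u T + wdeg A (unsat A w s ?u) (insert v T)"
      using wdeg_link_run_Cons[of A v w s vs T] A Cons.prems False by simp
    ultimately show ?thesis using False by linarith
  qed
qed

lemma unsat_antimono:
  assumes "\<And>C. 0 \<le> w C" "\<And>T. wdeg A u T \<le> wdeg A u' T"
  shows "unsat A w s u' C \<le> unsat A w s u C"
  using assms(1)[of C] assms(2) unfolding unsat_def by (auto intro: order_trans)

text \<open>Every step picks an element of largest remaining degree. These degrees only fall as
  saturation spreads (\<open>unsat_antimono\<close>), so the final degree of an unchosen element is
  at most the mass gained in each of the \<open>b\<close> steps, where mass means the degree of the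
  empty set.\<close>

lemma greedy_run:
  assumes A: "finite A" and w: "\<And>C. 0 \<le> w C" and I: "I \<subseteq> A" and b: "b \<le> card I"
  shows "\<exists>vs. length vs = b \<and> set vs \<subseteq> I \<and> (\<forall>u \<in> I - set vs.
      real b * wdeg A (unsat A w s (link_run A w s vs)) {u} \<le> wdeg A (link_run A w s vs) {})"
  using b
proof (induction b)
  case 0
  then show ?case by (simp add: wdeg_def)
next
  case (Suc b)
  then obtain vs where vs: "length vs = b" "set vs \<subseteq> I"
    and le: "\<And>u. u \<in> I - set vs \<Longrightarrow>
    real b * wdeg A (unsat A w s (link_run A w s vs)) {u} \<le> wdeg A (link_run A w s vs) {}"
    by auto
  let ?d = "\<lambda>u. wdeg A (unsat A w s (link_run A w s vs)) {u}"
  have fin: "finite (I - set vs)" using A I by (auto intro: finite_subset)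
  have "card (set vs) \<le> b" using vs card_length by metis
  with Suc.prems have "I - set vs \<noteq> {}"
    using vs by (metis Diff_eq_empty_iff List.finite_set card_mono le_trans not_less_eq_eq)
  then have "Max (?d ` (I - set vs)) \<in> ?d ` (I - set vs)" using fin by (intro Max_in) auto
  then obtain v where v: "v \<in> I - set vs" and v': "Max (?d ` (I - set vs)) = ?d v" by blast
  have vmax: "?d u \<le> ?d v" if "u \<in> I - set vs" for u
    unfolding v'[symmetric] using that fin by (intro Max_ge) auto
  have deg: "wdeg A (link_run A w s (v # vs)) T \<ge> wdeg A (link_run A w s vs) T" for T
  proof -
    have "0 \<le> wdeg A (unsat A w s (link_run A w s vs)) (insert v T)"
      by (intro wdeg_nonneg unsat_nonneg w)
    then show ?thesis
      using wdeg_link_run_Cons[of A v w s vs T] A v I by auto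
  qed
  have mass: "wdeg A (link_run A w s (v # vs)) {} = wdeg A (link_run A w s vs) {} + ?d v"
    using wdeg_link_run_Cons[of A v w s vs "{}"] A v I by auto
  have "real (Suc b) * wdeg A (unsat A w s (link_run A w s (v # vs))) {u}
      \<le> wdeg A (link_run A w s (v # vs)) {}" if u: "u \<in> I - set (v # vs)" for u
  proof -
    have "wdeg A (unsat A w s (link_run A w s (v # vs))) {u} \<le> ?d u"
      by (intro wdeg_mono unsat_antimono w deg)
    then have "real (Suc b) * wdeg A (unsat A w s (link_run A w s (v # vs))) {u} \<le> real (Suc b) * ?d u"
      by (intro mult_left_mono) auto
    also have "\<dots> = real b * ?d u + ?d u" by (simp add: algebra_simps)
    also have "\<dots> \<le> wdeg A (link_run A w s vs) {} + ?d v"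
      using le[of u] vmax[of u] u by (intro add_mono) auto
    finally show ?thesis using mass by simp
  qed
  then show ?case using vs v by (intro exI[of _ "v # vs"]) auto
qed

lemma sum_wdeg:
  assumes A: "finite A" and u: "\<And>C. u C \<noteq> 0 \<Longrightarrow> card C = i"
  shows "(\<Sum>T \<in> Pow A. wdeg A u T) = 2 ^ i * wdeg A u {}"
proof -
  have "(\<Sum>T \<in> Pow A. wdeg A u T) = (\<Sum>T \<in> Pow A. \<Sum>C \<in> Pow A. if T \<subseteq> C then u C else 0)"
    using A by (simp add: wdeg_alt)
  also have "\<dots> = (\<Sum>C \<in> Pow A. \<Sum>T \<in> Pow A. if T \<subseteq> C then u C else 0)"
    by (rule sum.swap)
  also have "\<dots> = (\<Sum>C \<in> Pow A. 2 ^ i * u C)"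
  proof (rule sum.cong)
    fix C assume C: "C \<in> Pow A"
    have "(\<Sum>T \<in> Pow A. if T \<subseteq> C then u C else 0) = (\<Sum>T \<in> Pow C. u C)"
      using A C by (intro sum.mono_neutral_cong_right) auto
    also have "\<dots> = 2 ^ card C * u C"
      using C A by (simp add: card_Pow finite_subset)
    finally show "(\<Sum>T \<in> Pow A. if T \<subseteq> C then u C else 0) = 2 ^ i * u C"
      using u[of C] by (cases "u C = 0") auto
  qed simp
  finally show ?thesis using A by (simp add: wdeg_alt sum_distrib_left)
qed

lemma sum_wdeg_singleton:
  assumes A: "finite A" and u: "\<And>C. u C \<noteq> 0 \<Longrightarrow> card C = i"
  shows "(\<Sum>x \<in> A. wdeg A u {x}) = real i * wdeg A u {}"
proof -
  have "(\<Sum>x \<in> A. wdeg A u {x}) = (\<Sum>x \<in> A. \<Sum>C \<in> Pow A. if x \<in> C then u C else 0)"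
    using A by (simp add: wdeg_alt)
  also have "\<dots> = (\<Sum>C \<in> Pow A. \<Sum>x \<in> A. if x \<in> C then u C else 0)"
    by (rule sum.swap)
  also have "\<dots> = (\<Sum>C \<in> Pow A. real i * u C)"
  proof (rule sum.cong)
    fix C assume C: "C \<in> Pow A"
    have "(\<Sum>x \<in> A. if x \<in> C then u C else 0) = (\<Sum>x \<in> C. u C)"
      using A C by (intro sum.mono_neutral_cong_right) auto
    then show "(\<Sum>x \<in> A. if x \<in> C then u C else 0) = real i * u C"
      using u[of C] by (cases "u C = 0") auto
  qed simp
  finally show ?thesis using A by (simp add: wdeg_alt sum_distrib_left)
qed

text \<open>Deleting the sets that contain a saturated set costs little: a saturated \<open>T\<close> carries
  \<open>u\<close>-degree at least \<open>s (card T)\<close>, and these degrees sum to a multiple of the mass of \<open>u\<close>.\<close>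

lemma wdeg_unsat_ge:
  assumes A: "finite A" and w: "\<And>C. 0 \<le> w C" and u: "\<And>C. 0 \<le> u C"
    and cu: "\<And>C. u C \<noteq> 0 \<Longrightarrow> card C = i"
    and deg: "\<And>T. T \<noteq> {} \<Longrightarrow> T \<subseteq> A \<Longrightarrow> q * wdeg A w T \<le> s (card T)" and q: "q > 0"
  shows "wdeg A w {} - 2 ^ i * wdeg A u {} / q \<le> wdeg A (unsat A w s u) {}"
proof -
  define S where "S = {T \<in> Pow A. T \<noteq> {} \<and> s (card T) \<le> wdeg A u T}"
  have finS: "finite S" using A by (simp add: S_def)
  have "w C - unsat A w s u C \<le> (\<Sum>T \<in> S. if T \<subseteq> C then w C else 0)" if C: "C \<in> Pow A" for C
  proof (cases "\<exists>T. T \<noteq> {} \<and> T \<subseteq> C \<and> s (card T) \<le> wdeg A u T")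
    case True
    then obtain T where T: "T \<in> S" "T \<subseteq> C" using C by (auto simp: S_def)
    have "w C = (if T \<subseteq> C then w C else 0)" using T by simp
    also have "\<dots> \<le> (\<Sum>T \<in> S. if T \<subseteq> C then w C else 0)"
      by (rule member_le_sum[OF T(1)]) (auto simp: finS w)
    finally show ?thesis using True by (simp add: unsat_def)
  next
    case False
    then have "unsat A w s u C = w C" unfolding unsat_def by (rule if_not_P)
    then show ?thesis by (simp add: sum_nonneg w)
  qed
  then have "wdeg A w {} - wdeg A (unsat A w s u) {} \<le>
      (\<Sum>C \<in> Pow A. \<Sum>T \<in> S. if T \<subseteq> C then w C else 0)"
    using A by (auto simp add: wdeg_alt sum_subtractf[symmetric] intro!: sum_mono)
  also have "\<dots> = (\<Sum>T \<in> S. \<Sum>C \<in> Pow A. if T \<subseteq> C then w C else 0)" by (rule sum.swap)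
  also have "\<dots> = (\<Sum>T \<in> S. wdeg A w T)"
    using A by (simp add: wdeg_alt)
  also have "\<dots> \<le> (\<Sum>T \<in> S. wdeg A u T / q)"
  proof (rule sum_mono)
    fix T assume "T \<in> S"
    then have "q * wdeg A w T \<le> wdeg A u T" using deg[of T] by (auto simp: S_def)
    then show "wdeg A w T \<le> wdeg A u T / q" using q by (simp add: field_simps)
  qed
  also have "\<dots> \<le> (\<Sum>T \<in> Pow A. wdeg A u T / q)"
    using A q by (intro sum_mono2) (auto simp: S_def wdeg_nonneg u)
  also have "\<dots> = 2 ^ i * wdeg A u {} / q"
    using sum_wdeg[OF A cu] by (simp add: sum_divide_distrib[symmetric])
  finally show ?thesis by simp
qed

text \<open>Induction on the uniformity. Either the greedy link has mass of order c q, and the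
  induction hypothesis applies to it with the scale c multiplied by q; or its mass is small. Then
  few sets were withheld, yet every unchosen element of \<open>I\<close> has small remaining degree,
  so \<open>I\<close> avoids the many elements of larger degree. The exponent
  \<open>(i + 3) ^ 2\<close> grows fast enough to absorb the factors by which d and K worsen from
  one level to the next.\<close>

lemma container_step:
  fixes A :: "'a set" and w :: "'a set \<Rightarrow> real" and q d K c :: real
  assumes A: "finite A" "A \<noteq> {}" and w: "\<And>C. 0 \<le> w C"
    and supp: "\<And>C. w C \<noteq> 0 \<Longrightarrow> C \<subseteq> A \<and> card C = Suc i"
    and pos: "q > 0" "d > 0" "K > 0" "c > 0"
    and mass: "d * c \<le> wdeg A w {}"
    and deg: "\<And>T. T \<noteq> {} \<Longrightarrow> T \<subseteq> A \<Longrightarrow> wdeg A w T \<le> K * c * q ^ (card T - 1) / card A"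
    and b: "q * card A \<le> real b"
  shows "\<exists>f. (\<forall>xs. f xs \<subseteq> A \<and> real (card (f xs)) \<le> (1 - d / (K * 2 ^ ((i + 3) ^ 2))) * card A) \<and>
    (\<forall>I. I \<subseteq> A \<longrightarrow> (\<forall>C. w C \<noteq> 0 \<longrightarrow> \<not> C \<subseteq> I) \<longrightarrow> b \<le> card I \<longrightarrow>
      (\<exists>xs. set xs \<subseteq> I \<and> length xs \<le> i * b \<and> I - set xs \<subseteq> f xs))"
  using w supp pos mass deg
proof (induction i arbitrary: w d K c)
  case (0 w d K c)
  note w = 0(1) and supp = 0(2) and pos = 0(3-6) and mass = 0(7) and deg = 0(8)
  define Z where "Z = {x \<in> A. w {x} \<noteq> 0}"
  have cA: "card A > 0" using A by (simp add: card_gt_0_iff)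
  have "wdeg A w {} = (\<Sum>x \<in> A. wdeg A w {x})"
    using sum_wdeg_singleton[OF A(1), of w 1] supp by simp
  also have "\<dots> = (\<Sum>x \<in> Z. wdeg A w {x})"
  proof (rule sum.mono_neutral_right)
    show "\<forall>x \<in> A - Z. wdeg A w {x} = 0"
    proof
      fix x assume x: "x \<in> A - Z"
      show "wdeg A w {x} = 0" unfolding wdeg_def
      proof (rule sum.neutral, rule ballI)
        fix C assume "C \<in> {C \<in> Pow A. {x} \<subseteq> C}"
        then show "w C = 0" using supp[of C] x by (auto simp: Z_def card_Suc_eq)
      qed
    qed
  qed (auto simp: Z_def A)
  also have "\<dots> \<le> (\<Sum>x \<in> Z. K * c / card A)"
    using deg[of "{x}" for x] by (intro sum_mono) (auto simp: Z_def)
  finally have "d * c \<le> real (card Z) * (K * c / card A)" using mass by simp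
  then have Z: "d / K * card A \<le> card Z" using pos cA by (simp add: field_simps)
  define f where "f = (\<lambda>xs :: 'a list. A - Z)"
  have "real (card (A - Z)) = card A - real (card Z)"
    using A by (subst card_Diff_subset) (auto simp: Z_def card_mono of_nat_diff)
  also have "\<dots> \<le> (1 - d / K) * card A" using Z by (simp add: algebra_simps)
  also have "\<dots> \<le> (1 - d / (K * 2 ^ ((0 + 3) ^ 2))) * card A"
    using pos by (intro mult_right_mono) (auto simp: field_simps)
  finally have "\<forall>xs. f xs \<subseteq> A \<and> real (card (f xs)) \<le> (1 - d / (K * 2 ^ ((0 + 3) ^ 2))) * card A"
    by (auto simp: f_def)
  moreover have "\<exists>xs. set xs \<subseteq> I \<and> length xs \<le> 0 * b \<and> I - set xs \<subseteq> f xs"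
    if "I \<subseteq> A" "\<forall>C. w C \<noteq> 0 \<longrightarrow> \<not> C \<subseteq> I" for I
    using that by (intro exI[of _ "[]"]) (auto simp: f_def Z_def)
  ultimately show ?case by blast
next
  case (Suc i w d K c)
  note w = Suc(2) and supp = Suc(3) and pos = Suc(4-7) and mass = Suc(8) and deg = Suc(9)
  have cA: "card A > 0" using A by (simp add: card_gt_0_iff)
  \<comment> \<open>The threshold equals the largest possible overshoot
    \<open>\<kappa> (Suc j)\<close>, so degrees in the link are at most twice the desired bound at
    scale c q.\<close>
  define s where "s j = K * c * q * q ^ (j - 1) / card A" for j
  define \<kappa> where "\<kappa> j = K * c * q ^ (j - 1) / card A" for j
  define u where "u = link_run A w s"
  \<comment> \<open>With this choice saturation withholds at most a quarter of the mass d c,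
    elements of low degree account for at most another quarter, and half of it is left for the other
    elements.\<close>
  define d' where "d' = d / 2 ^ (i + 3)"
  have d': "d' > 0" using pos by (simp add: d'_def)
  have u0: "0 \<le> u ys C" for ys C by (simp add: u_def link_run_nonneg w)
  have usupp: "C \<subseteq> A \<and> card C = Suc i" if nz: "u ys C \<noteq> 0" for ys C
  proof -
    have "\<exists>v \<in> set ys. v \<notin> C \<and> w (insert v C) \<noteq> 0"
      by (rule link_run_pos[of w A s ys C]) (use w nz in \<open>simp_all add: u_def\<close>)
    then obtain v where v: "v \<notin> C" "w (insert v C) \<noteq> 0" by blast
    have "finite C" using finite_subset[of "insert v C" A] supp[OF v(2)] A(1) by simp
    then show ?thesis using supp[OF v(2)] v by auto
  qed
  have udeg: "wdeg A (u ys) T \<le> 2 * K * (c * q) * q ^ (card T - 1) / card A"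
    if "set ys \<subseteq> A" "T \<noteq> {}" "T \<subseteq> A" for ys T
  proof -
    have "finite T" using that A finite_subset by blast
    then have cT: "card T = Suc (card T - 1)" using that by (simp add: card_gt_0_iff)
    have "wdeg A (u ys) T \<le> s (card T) + \<kappa> (Suc (card T))" unfolding u_def
      by (rule wdeg_link_run_le) (use that A w pos deg in \<open>auto simp: s_def \<kappa>_def\<close>)
    also have "q * q ^ (card T - 1) = q ^ card T"
      by (metis cT power_Suc)
    then have "s (card T) + \<kappa> (Suc (card T)) = 2 * K * (c * q) * q ^ (card T - 1) / card A"
      by (simp add: s_def \<kappa>_def field_simps)
    finally show ?thesis .
  qed
  define \<theta> where "\<theta> = d' * c / card A"
  define low where "low ys = {x \<in> A. wdeg A (unsat A w s (u ys)) {x} \<le> \<theta>}" for ys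
  define big where "big ys \<longleftrightarrow> d' * (c * q) \<le> wdeg A (u ys) {}" for ys
  define \<epsilon> where "\<epsilon> = d / (K * 2 ^ ((Suc i + 3) ^ 2))"
  have lowcard: "real (card (low ys)) \<le> (1 - \<epsilon>) * card A" if "\<not> big ys" for ys
  proof -
    let ?r = "unsat A w s (u ys)"
    have r0: "0 \<le> ?r C" "?r C \<le> w C" for C by (auto simp: unsat_nonneg unsat_le w)
    have rs: "card C = Suc (Suc i)" if "?r C \<noteq> 0" for C
      using supp[of C] that by (auto simp: unsat_def split: if_splits)
    have "wdeg A w {} - 2 ^ Suc i * wdeg A (u ys) {} / q \<le> wdeg A ?r {}"
    proof (rule wdeg_unsat_ge)
      show "q * wdeg A w T \<le> s (card T)" if "T \<noteq> {}" "T \<subseteq> A" for T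
        using mult_left_mono[OF deg[OF that], of q] pos by (simp add: s_def mult_ac)
    qed (use A w u0 usupp pos in auto)
    moreover have "2 ^ Suc i * wdeg A (u ys) {} / q \<le> 2 ^ Suc i * (d' * c)"
    proof -
      have "wdeg A (u ys) {} / q \<le> d' * c"
        using that pos by (simp add: big_def divide_simps mult_ac)
      then show ?thesis by (simp add: mult_left_mono flip: times_divide_eq_right)
    qed
    moreover have "2 ^ Suc i * (d' * c) = d * c / 4"
      by (simp add: d'_def field_simps power_add)
    ultimately have r1: "3 / 4 * (d * c) \<le> wdeg A ?r {}" using mass by linarith
    also have "wdeg A ?r {} \<le> real (Suc (Suc i)) * wdeg A ?r {}"
      using wdeg_nonneg[of ?r A "{}"] r0 by (simp add: algebra_simps)
    also have "\<dots> = (\<Sum>x \<in> A. wdeg A ?r {x})"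
      using sum_wdeg_singleton[OF A(1) rs] by simp
    also have "\<dots> = (\<Sum>x \<in> low ys. wdeg A ?r {x}) + (\<Sum>x \<in> A - low ys. wdeg A ?r {x})"
      by (subst add.commute, rule sum.subset_diff) (auto simp: low_def A)
    also have "(\<Sum>x \<in> low ys. wdeg A ?r {x}) \<le> (\<Sum>x \<in> low ys. \<theta>)"
      by (rule sum_mono) (simp add: low_def)
    also have "(\<Sum>x \<in> low ys. \<theta>) \<le> card A * \<theta>"
    proof -
      have "card (low ys) \<le> card A" using A by (intro card_mono) (auto simp: low_def)
      moreover have "0 \<le> \<theta>" using pos d' by (simp add: \<theta>_def)
      ultimately show ?thesis by (simp add: mult_right_mono)
    qed
    also have "card A * \<theta> = d' * c" using cA by (simp add: \<theta>_def)
    also have "(\<Sum>x \<in> A - low ys. wdeg A ?r {x}) \<le> (\<Sum>x \<in> A - low ys. K * c / card A)"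
    proof (rule sum_mono)
      fix x assume "x \<in> A - low ys"
      then have "wdeg A w {x} \<le> K * c / card A" using deg[of "{x}"] by simp
      then show "wdeg A ?r {x} \<le> K * c / card A"
        using wdeg_mono[of A ?r w "{x}"] r0 by (meson order_trans)
    qed
    also have "\<dots> = real (card (A - low ys)) * (K * c / card A)" by simp
    finally have *: "3 / 4 * (d * c) \<le> d' * c + real (card (A - low ys)) * (K * c / card A)"
      by simp
    have "d' \<le> d / 4"
      unfolding d'_def using pos power_increasing[of 2 "i + 3" "2::real"]
      by (intro divide_left_mono) auto
    then have "d' * c \<le> d / 4 * c" using pos by (intro mult_right_mono) auto
    with * have "d * c / 2 \<le> real (card (A - low ys)) * (K * c / card A)" by linarith
    then have "d / (2 * K) * card A \<le> card (A - low ys)" using pos cA by (simp add: field_simps)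
    moreover have "real (card (A - low ys)) = card A - real (card (low ys))"
      using A by (subst card_Diff_subset) (auto simp: low_def card_mono of_nat_diff)
    ultimately have "real (card (low ys)) \<le> (1 - d / (2 * K)) * card A"
      by (simp add: algebra_simps)
    also have "\<epsilon> \<le> d / (2 * K)"
    proof -
      have "(2::real) ^ 1 \<le> 2 ^ ((Suc i + 3) ^ 2)" by (rule power_increasing) auto
      then show ?thesis using pos by (auto simp: \<epsilon>_def field_simps)
    qed
    then have "(1 - d / (2 * K)) * card A \<le> (1 - \<epsilon>) * card A"
      by (intro mult_right_mono) auto
    finally show ?thesis .
  qed
  define Q where "Q ys f \<longleftrightarrow> (\<forall>xs. f xs \<subseteq> A \<and> real (card (f xs)) \<le> (1 - \<epsilon>) * card A) \<and>
    (\<forall>I. I \<subseteq> A \<longrightarrow> (\<forall>C. u ys C \<noteq> 0 \<longrightarrow> \<not> C \<subseteq> I) \<longrightarrow> b \<le> card I \<longrightarrow>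
      (\<exists>xs. set xs \<subseteq> I \<and> length xs \<le> i * b \<and> I - set xs \<subseteq> f xs))" for ys f
  have "\<exists>f. Q ys f"
    if ys: "set ys \<subseteq> A" "big ys" for ys
  proof -
    have "\<epsilon> \<le> d' / (2 * K * 2 ^ ((i + 3) ^ 2))"
    proof -
      have "(i + 3) + 1 + (i + 3) ^ 2 \<le> (Suc i + 3) ^ 2"
        by (simp add: power2_eq_square algebra_simps)
      then have "(2::real) ^ ((i + 3) + 1 + (i + 3) ^ 2) \<le> 2 ^ ((Suc i + 3) ^ 2)"
        by (rule power_increasing) auto
      then have "K * 2 ^ ((i + 3) + 1 + (i + 3) ^ 2) \<le> K * (2::real) ^ ((Suc i + 3) ^ 2)"
        using pos by simp
      then have "\<epsilon> \<le> d / (K * 2 ^ ((i + 3) + 1 + (i + 3) ^ 2))"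
        unfolding \<epsilon>_def using pos by (intro divide_left_mono) auto
      also have "\<dots> = d' / (2 * K * 2 ^ ((i + 3) ^ 2))"
        by (simp only: d'_def power_add) (simp add: field_simps)
      finally show ?thesis .
    qed
    then have le: "(1 - d' / (2 * K * 2 ^ ((i + 3) ^ 2))) * card A \<le> (1 - \<epsilon>) * card A"
      by (intro mult_right_mono) auto
    have "\<exists>f. (\<forall>xs. f xs \<subseteq> A \<and> real (card (f xs)) \<le> (1 - d' / (2 * K * 2 ^ ((i + 3) ^ 2))) * card A) \<and>
    (\<forall>I. I \<subseteq> A \<longrightarrow> (\<forall>C. u ys C \<noteq> 0 \<longrightarrow> \<not> C \<subseteq> I) \<longrightarrow> b \<le> card I \<longrightarrow>
      (\<exists>xs. set xs \<subseteq> I \<and> length xs \<le> i * b \<and> I - set xs \<subseteq> f xs))"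
    proof (rule Suc.IH[where c = "c * q"])
      show "d' * (c * q) \<le> wdeg A (u ys) {}" using ys by (simp add: big_def)
      show "0 \<le> u ys C" for C by (rule u0)
      show "C \<subseteq> A \<and> card C = Suc i" if "u ys C \<noteq> 0" for C using that by (rule usupp)
      show "wdeg A (u ys) T \<le> 2 * K * (c * q) * q ^ (card T - 1) / card A"
        if "T \<noteq> {}" "T \<subseteq> A" for T using ys(1) that by (rule udeg)
    qed (use pos d' in simp_all)
    then obtain f where f: "\<And>xs. f xs \<subseteq> A"
        "\<And>xs. real (card (f xs)) \<le> (1 - d' / (2 * K * 2 ^ ((i + 3) ^ 2))) * card A"
      and f': "\<forall>I. I \<subseteq> A \<longrightarrow> (\<forall>C. u ys C \<noteq> 0 \<longrightarrow> \<not> C \<subseteq> I) \<longrightarrow> b \<le> card I \<longrightarrow>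
      (\<exists>xs. set xs \<subseteq> I \<and> length xs \<le> i * b \<and> I - set xs \<subseteq> f xs)" by blast
    have "real (card (f xs)) \<le> (1 - \<epsilon>) * card A" for xs
      using f(2)[of xs] le by (rule order_trans)
    then have "Q ys f" unfolding Q_def using f(1) by (intro conjI f') simp
    then show ?thesis by blast
  qed
  then have "\<forall>ys. \<exists>f. set ys \<subseteq> A \<longrightarrow> big ys \<longrightarrow> Q ys f" by blast
  then obtain g where g: "\<forall>ys. set ys \<subseteq> A \<longrightarrow> big ys \<longrightarrow> Q ys (g ys)"
    using choice[of "\<lambda>ys f. set ys \<subseteq> A \<longrightarrow> big ys \<longrightarrow> Q ys f"] by blast
  \<comment> \<open>A list is decoded in two parts: its first \<open>b\<close> entries are the
    fingerprint of this level, the others are handed to the lower level. The empty set is the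
    default for big prefixes that leave \<open>A\<close>.\<close>
  define f where "f xs = (let ys = take b xs in
     if \<not> big ys then low ys else if set ys \<subseteq> A then g ys (drop b xs) else {})" for xs
  \<comment> \<open>The empty run has no mass, so \<open>lowcard\<close> applies to it and shows
    that the size bound is nonnegative, as the default container requires.\<close>
  have "\<not> big []" using d' pos by (simp add: big_def u_def wdeg_def not_le)
  then have \<epsilon>1: "0 \<le> (1 - \<epsilon>) * card A" using lowcard[of "[]"] by (meson of_nat_0_le_iff order_trans)
  have "\<forall>xs. f xs \<subseteq> A \<and> real (card (f xs)) \<le> (1 - \<epsilon>) * card A"
    using lowcard g \<epsilon>1 by (auto simp: f_def Let_def low_def Q_def)
  moreover have "\<exists>xs. set xs \<subseteq> I \<and> length xs \<le> Suc i * b \<and> I - set xs \<subseteq> f xs"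
    if I: "I \<subseteq> A" "\<forall>C. w C \<noteq> 0 \<longrightarrow> \<not> C \<subseteq> I" "b \<le> card I" for I
  proof -
    have "\<exists>ys. length ys = b \<and> set ys \<subseteq> I \<and> (\<forall>x \<in> I - set ys.
        real b * wdeg A (unsat A w s (u ys)) {x} \<le> wdeg A (u ys) {})"
      unfolding u_def by (rule greedy_run[OF A(1) w I(1) I(3)])
    then obtain ys where ys: "length ys = b" "set ys \<subseteq> I" and
      yl: "\<And>x. x \<in> I - set ys \<Longrightarrow> real b * wdeg A (unsat A w s (u ys)) {x} \<le> wdeg A (u ys) {}"
      by blast
    show ?thesis
    proof (cases "big ys")
      case False
      \<comment> \<open>The run gained mass less than d' c q in total and \<open>b\<close> is at
        least q times \<open>card A\<close>, so by the greedy choice an unchosen element has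
        remaining degree at most \<open>\<theta>\<close>.\<close>
      have "I - set ys \<subseteq> low ys"
      proof
        fix x assume x: "x \<in> I - set ys"
        have "q * card A * wdeg A (unsat A w s (u ys)) {x} \<le> real b * wdeg A (unsat A w s (u ys)) {x}"
          using b by (intro mult_right_mono wdeg_nonneg unsat_nonneg w) auto
        also have "\<dots> \<le> d' * (c * q)" using yl[OF x] False by (simp add: big_def)
        finally have "wdeg A (unsat A w s (u ys)) {x} \<le> \<theta>"
          using pos cA by (simp add: \<theta>_def field_simps)
        then show "x \<in> low ys" using x I by (auto simp: low_def)
      qed
      then show ?thesis using ys False by (intro exI[of _ ys]) (auto simp: f_def)
    next
      case True
      have "\<forall>C. u ys C \<noteq> 0 \<longrightarrow> \<not> C \<subseteq> I"
      proof (intro allI impI notI)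
        fix C assume C: "u ys C \<noteq> 0" "C \<subseteq> I"
        have "\<exists>v \<in> set ys. v \<notin> C \<and> w (insert v C) \<noteq> 0"
          by (rule link_run_pos[of w A s ys C]) (use w C in \<open>simp_all add: u_def\<close>)
        then obtain v where v: "v \<in> set ys" "w (insert v C) \<noteq> 0" by blast
        then show False using I(2) C ys by auto
      qed
      then obtain zs where zs: "set zs \<subseteq> I" "length zs \<le> i * b" "I - set zs \<subseteq> g ys zs"
        using g True ys I unfolding Q_def by (meson subset_trans)
      then show ?thesis using ys True I
        by (intro exI[of _ "ys @ zs"]) (auto simp: f_def)
    qed
  qed
  ultimately show ?case unfolding \<epsilon>_def by blast
qed

text \<open>A set with fewer than \<open>b\<close> elements is too small for the greedy run; it is
  listed in full and serves as its own fingerprint. All other sets are covered by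
  \<open>container_step\<close> with c = d = 1.\<close>

lemma container:
  fixes A :: "'a set" and w :: "'a set \<Rightarrow> real" and q K :: real
  assumes A: "finite A" "A \<noteq> {}" and w: "\<And>C. 0 \<le> w C"
    and supp: "\<And>C. w C \<noteq> 0 \<Longrightarrow> C \<subseteq> A \<and> card C = k" and k: "k > 0"
    and pos: "q > 0" "K > 0" and mass: "1 \<le> wdeg A w {}"
    and deg: "\<And>T. T \<noteq> {} \<Longrightarrow> T \<subseteq> A \<Longrightarrow> wdeg A w T \<le> K * q ^ (card T - 1) / card A"
    and b: "q * card A \<le> real b"
  obtains f where "\<And>xs. f xs \<subseteq> A" "\<And>xs. real (card (f xs)) \<le> (1 - 1 / (K * 2 ^ ((k + 2) ^ 2))) * card A"
    "\<And>I. I \<subseteq> A \<Longrightarrow> (\<And>C. w C \<noteq> 0 \<Longrightarrow> \<not> C \<subseteq> I) \<Longrightarrow>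
      \<exists>xs. set xs \<subseteq> I \<and> length xs \<le> k * b \<and> I - set xs \<subseteq> f xs"
proof -
  obtain i where i: "k = Suc i" using k by (cases k) auto
  have "\<exists>f. (\<forall>xs. f xs \<subseteq> A \<and> real (card (f xs)) \<le> (1 - 1 / (K * 2 ^ ((i + 3) ^ 2))) * card A) \<and>
    (\<forall>I. I \<subseteq> A \<longrightarrow> (\<forall>C. w C \<noteq> 0 \<longrightarrow> \<not> C \<subseteq> I) \<longrightarrow> b \<le> card I \<longrightarrow>
      (\<exists>xs. set xs \<subseteq> I \<and> length xs \<le> i * b \<and> I - set xs \<subseteq> f xs))"
  proof (rule container_step[OF A, where c = 1 and q = q])
    show "0 \<le> w C" for C by (rule w)
    show "C \<subseteq> A \<and> card C = Suc i" if "w C \<noteq> 0" for C using supp[OF that] i by simp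
    show "wdeg A w T \<le> K * 1 * q ^ (card T - 1) / card A" if "T \<noteq> {}" "T \<subseteq> A" for T
      using deg[OF that] by simp
  qed (use pos mass b in simp_all)
  then obtain f where f: "\<And>xs. f xs \<subseteq> A"
    "\<And>xs. real (card (f xs)) \<le> (1 - 1 / (K * 2 ^ ((i + 3) ^ 2))) * card A"
    and f': "\<forall>I. I \<subseteq> A \<longrightarrow> (\<forall>C. w C \<noteq> 0 \<longrightarrow> \<not> C \<subseteq> I) \<longrightarrow> b \<le> card I \<longrightarrow>
      (\<exists>xs. set xs \<subseteq> I \<and> length xs \<le> i * b \<and> I - set xs \<subseteq> f xs)"
    by blast
  show ?thesis
  proof (rule that[of f])
    fix I assume I: "I \<subseteq> A" "\<And>C. w C \<noteq> 0 \<Longrightarrow> \<not> C \<subseteq> I"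
    show "\<exists>xs. set xs \<subseteq> I \<and> length xs \<le> k * b \<and> I - set xs \<subseteq> f xs"
    proof (cases "b \<le> card I")
      case True
      then obtain xs where "set xs \<subseteq> I" "length xs \<le> i * b" "I - set xs \<subseteq> f xs"
        using f' I by blast
      then show ?thesis using i by (intro exI[of _ xs]) auto
    next
      case False
      obtain xs where "set xs = I" "distinct xs"
        using finite_distinct_list[of I] A I finite_subset by blast
      then show ?thesis using False i distinct_card[of xs] by (intro exI[of _ xs]) auto
    qed
  next
    have k2: "k + 2 = i + 3" using i by simp
    show "real (card (f xs)) \<le> (1 - 1 / (K * 2 ^ ((k + 2) ^ 2))) * card A" for xs
      unfolding k2 by (rule f(2))
  qed (rule f(1))
qed

section \<open>Random walks with prescribed steps\<close>

text \<open>A pattern prescribes some of the steps of a walk; \<open>Some (x, y)\<close> is a prescribed step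
  from \<open>x\<close> to \<open>y\<close>.\<close>

fun matches :: "('v \<times> 'v) option list \<Rightarrow> 'v list \<Rightarrow> bool" where
  "matches [] xs = True"
| "matches (s # ps) (x # y # xs) = ((s = None \<or> s = Some (x, y)) \<and> matches ps (y # xs))"
| "matches (s # ps) _ = False"

definition prescribed :: "('v \<times> 'v) option list \<Rightarrow> nat" where
  "prescribed ps = length (filter (\<lambda>s. s \<noteq> None) ps)"

lemma prescribed_simps [simp]:
  "prescribed [] = 0" "prescribed (None # ps) = prescribed ps"
  "prescribed (Some a # ps) = Suc (prescribed ps)"
  "prescribed (ps @ qs) = prescribed ps + prescribed qs" "prescribed (rev ps) = prescribed ps"
  by (auto simp: prescribed_def rev_filter[symmetric])

lemma prescribed_replicate [simp]: "prescribed (replicate a None) = 0"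
  by (induction a) auto

lemma prescribed_le: "prescribed ps \<le> length ps"
  by (simp add: prescribed_def)

text \<open>Estimates for patterns are made at the first prescribed step, before which the walk is
  free.\<close>

lemma prescribed_split:
  "prescribed ps > 0 \<Longrightarrow> \<exists>a x y qs. ps = replicate a None @ Some (x, y) # qs"
proof (induction ps)
  case (Cons s ps)
  show ?case
  proof (cases s)
    case None
    with Cons obtain a x y qs where "ps = replicate a None @ Some (x, y) # qs" by auto
    then have "s # ps = replicate (Suc a) None @ Some (x, y) # qs" using None by simp
    then show ?thesis by blast
  next
    case (Some xy)
    then have "s # ps = replicate 0 None @ Some (fst xy, snd xy) # ps" by simp
    then show ?thesis by blast
  qed
qed simp

lemma prescribed_0: "prescribed ps = 0 \<Longrightarrow> ps = replicate (length ps) None"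
proof (induction ps)
  case (Cons s ps)
  then show ?case by (cases s) auto
qed simp

lemma last_take_Suc: "i < length P \<Longrightarrow> last (take (Suc i) P) = P ! i"
  by (simp add: take_Suc_conv_app_nth)

lemma matches_drop:
  "matches (replicate a None @ ps) xs \<Longrightarrow> matches ps (drop a xs)"
proof (induction a arbitrary: xs)
  case (Suc a)
  then show ?case by (cases xs; cases "tl xs") auto
qed simp

section \<open>The simple random walk: expectations, transition probabilities, invariant
  measure\<close>

locale graph_walks =
  fixes V :: "'v set" and N :: "'v \<Rightarrow> 'v set" and \<Delta> :: real
  assumes finV: "finite V" and NV: "u \<in> V \<Longrightarrow> N u \<subseteq> V"
    and sym: "u \<in> V \<Longrightarrow> v \<in> N u \<Longrightarrow> u \<in> N v"
    and mindeg: "u \<in> V \<Longrightarrow> \<Delta> \<le> real (card (N u))" and \<Delta>1: "1 \<le> \<Delta>"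
begin

abbreviation dg :: "'v \<Rightarrow> real" where "dg u \<equiv> real (card (N u))"

lemma finN: "u \<in> V \<Longrightarrow> finite (N u)"
  using NV finV finite_subset by blast

lemma dg_pos: "u \<in> V \<Longrightarrow> 0 < dg u"
  using mindeg \<Delta>1 by (smt (verit) of_nat_0_less_iff)

lemma inv_dg: "u \<in> V \<Longrightarrow> 1 / dg u \<le> 1 / \<Delta>"
  using mindeg[of u] dg_pos[of u] \<Delta>1 by (intro divide_left_mono) auto

fun walks :: "nat \<Rightarrow> 'v \<Rightarrow> 'v list set" where
  "walks 0 u = {[u]}"
| "walks (Suc s) u = (\<Union>w \<in> N u. (#) u ` walks s w)"

text \<open>The probability that the random walk started at the first vertex follows this
  path.\<close>

fun wt :: "'v list \<Rightarrow> real" where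
  "wt (u # v # P) = wt (v # P) / dg u"
| "wt _ = 1"

lemma walks_Nil [simp]: "[] \<notin> walks s u"
  by (cases s) auto

lemma walks_hd: "P \<in> walks s u \<Longrightarrow> \<exists>Q. P = u # Q"
  by (cases s) auto

lemma walks_length: "P \<in> walks s u \<Longrightarrow> length P = Suc s"
  by (induction s arbitrary: P u) auto

lemma walks_subset: "P \<in> walks s u \<Longrightarrow> u \<in> V \<Longrightarrow> set P \<subseteq> V"
proof (induction s arbitrary: P u)
  case (Suc s)
  then show ?case using NV by fastforce
qed auto

lemma walks_last: "P \<in> walks s u \<Longrightarrow> u \<in> V \<Longrightarrow> last P \<in> V"
  using walks_subset walks_length by (metis last_in_set length_0_conv nat.distinct(1) subset_iff)

lemma walks_adj: "P \<in> walks s u \<Longrightarrow> i < s \<Longrightarrow> P ! Suc i \<in> N (P ! i)"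
proof (induction s arbitrary: P u i)
  case (Suc s)
  then obtain w Q where Q: "P = u # Q" "w \<in> N u" "Q \<in> walks s w" by auto
  then show ?case using Suc walks_hd[OF Q(3)] by (cases i) auto
qed simp

lemma finite_walks: "u \<in> V \<Longrightarrow> finite (walks s u)"
proof (induction s arbitrary: u)
  case (Suc s)
  then show ?case using NV finN by fastforce
qed simp

lemma wt_nonneg: "0 \<le> wt P"
  by (induction P rule: wt.induct) auto

lemma wt_Cons: "P \<in> walks s w \<Longrightarrow> wt (u # P) = wt P / dg u"
  using walks_hd by fastforce

text \<open>Expectation over the \<open>s\<close>-step random walk from \<open>u\<close>.\<close>

definition wsum :: "nat \<Rightarrow> 'v \<Rightarrow> ('v list \<Rightarrow> real) \<Rightarrow> real" where
  "wsum s u F = (\<Sum>P \<in> walks s u. wt P * F P)"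

lemma wsum_0 [simp]: "wsum 0 u F = F [u]"
  by (simp add: wsum_def)

lemma wsum_Suc:
  assumes "u \<in> V"
  shows "wsum (Suc s) u F = (\<Sum>w \<in> N u. wsum s w (\<lambda>P. F (u # P))) / dg u"
proof -
  have "wsum (Suc s) u F = (\<Sum>w \<in> N u. \<Sum>P \<in> (#) u ` walks s w. wt P * F P)"
    unfolding wsum_def walks.simps
  proof (rule sum.UNION_disjoint)
    show "\<forall>w \<in> N u. finite ((#) u ` walks s w)" using NV assms finite_walks by blast
    show "\<forall>w \<in> N u. \<forall>w' \<in> N u. w \<noteq> w' \<longrightarrow> (#) u ` walks s w \<inter> (#) u ` walks s w' = {}"
      by (auto dest!: walks_hd)
  qed (rule finN[OF assms])
  also have "\<dots> = (\<Sum>w \<in> N u. wsum s w (\<lambda>P. F (u # P)) / dg u)"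
  proof (rule sum.cong)
    fix w assume "w \<in> N u"
    have "(\<Sum>P \<in> (#) u ` walks s w. wt P * F P) = (\<Sum>P \<in> walks s w. wt (u # P) * F (u # P))"
      by (rule sum.reindex_cong[of "(#) u"]) auto
    also have "\<dots> = (\<Sum>P \<in> walks s w. wt P * F (u # P) / dg u)"
      using wt_Cons by (intro sum.cong) (auto simp: mult_ac)
    finally show "(\<Sum>P \<in> (#) u ` walks s w. wt P * F P) = wsum s w (\<lambda>P. F (u # P)) / dg u"
      by (simp add: wsum_def sum_divide_distrib)
  qed simp
  finally show ?thesis by (simp add: sum_divide_distrib)
qed

lemma wsum_mono: "(\<And>P. P \<in> walks s u \<Longrightarrow> F P \<le> F' P) \<Longrightarrow> wsum s u F \<le> wsum s u F'"
  unfolding wsum_def by (intro sum_mono mult_left_mono wt_nonneg)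

lemma wsum_cong: "(\<And>P. P \<in> walks s u \<Longrightarrow> F P = F' P) \<Longrightarrow> wsum s u F = wsum s u F'"
  unfolding wsum_def by (rule sum.cong) auto

lemma wsum_add: "wsum s u (\<lambda>P. F P + F' P) = wsum s u F + wsum s u F'"
  unfolding wsum_def by (simp add: algebra_simps sum.distrib)

lemma wsum_cmult: "wsum s u (\<lambda>P. c * F P) = c * wsum s u F"
  unfolding wsum_def by (simp add: sum_distrib_left mult_ac)

lemma wsum_sum: "wsum s u (\<lambda>P. \<Sum>i \<in> I. F i P) = (\<Sum>i \<in> I. wsum s u (F i))"
  unfolding wsum_def by (simp add: sum_distrib_left) (rule sum.swap)

lemma wsum_const: "u \<in> V \<Longrightarrow> wsum s u (\<lambda>_. c) = c"
proof (induction s arbitrary: u)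
  case (Suc s)
  have "(\<Sum>w \<in> N u. wsum s w (\<lambda>P. c)) = (\<Sum>w \<in> N u. c)"
    using Suc NV by (intro sum.cong) auto
  then show ?case using dg_pos[OF Suc.prems] Suc.prems by (simp add: wsum_Suc)
qed simp

text \<open>The Markov property at time \<open>a\<close>. The vertex at that time belongs to both
  parts, as the end of \<open>take (Suc a) P\<close> and the start of
  \<open>drop a P\<close>.\<close>

lemma wsum_split:
  assumes "u \<in> V"
  shows "wsum (a + s) u (\<lambda>P. F (take (Suc a) P) (drop a P)) =
    wsum a u (\<lambda>P. wsum s (last P) (F P))"
  using assms
proof (induction a arbitrary: u F)
  case 0
  have "wsum s u (\<lambda>P. F (take (Suc 0) P) P) = wsum s u (F [u])"
    using walks_hd by (intro wsum_cong) fastforce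
  then show ?case by simp
next
  case (Suc a)
  have "wsum (a + s) w (\<lambda>P. F (take (Suc (Suc a)) (u # P)) (drop (Suc a) (u # P))) =
        wsum a w (\<lambda>P. wsum s (last (u # P)) (F (u # P)))" if "w \<in> N u" for w
  proof -
    have "wsum (a + s) w (\<lambda>P. F (u # take (Suc a) P) (drop a P)) =
          wsum a w (\<lambda>P. wsum s (last P) (F (u # P)))"
      by (rule Suc.IH[where F = "\<lambda>P. F (u # P)"]) (use that NV Suc.prems in blast)
    also have "\<dots> = wsum a w (\<lambda>P. wsum s (last (u # P)) (F (u # P)))"
      by (rule wsum_cong) auto
    finally show ?thesis by simp
  qed
  then show ?case using Suc.prems by (simp add: wsum_Suc)
qed

fun tr :: "nat \<Rightarrow> 'v \<Rightarrow> 'v \<Rightarrow> real" where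
  "tr 0 u v = of_bool (u = v)"
| "tr (Suc s) u v = (\<Sum>w \<in> N u. tr s w v) / dg u"

lemma tr_nonneg: "0 \<le> tr s u v"
  by (induction s arbitrary: u) (auto intro!: sum_nonneg divide_nonneg_nonneg)

lemma wsum_last: "u \<in> V \<Longrightarrow> wsum s u (\<lambda>P. \<phi> (last P)) = (\<Sum>v \<in> V. tr s u v * \<phi> v)"
proof (induction s arbitrary: u)
  case 0
  have "(\<Sum>v \<in> V. of_bool (u = v) * \<phi> v) = (\<Sum>v \<in> V. if v = u then \<phi> v else 0)"
    by (intro sum.cong) auto
  also have "\<dots> = \<phi> u" using 0 finV by simp
  finally show ?case by simp
next
  case (Suc s)
  have "(\<Sum>w \<in> N u. wsum s w (\<lambda>P. \<phi> (last (u # P)))) = (\<Sum>w \<in> N u. \<Sum>v \<in> V. tr s w v * \<phi> v)"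
  proof (rule sum.cong)
    fix w assume "w \<in> N u"
    have "wsum s w (\<lambda>P. \<phi> (last (u # P))) = wsum s w (\<lambda>P. \<phi> (last P))"
      by (rule wsum_cong) auto
    then show "wsum s w (\<lambda>P. \<phi> (last (u # P))) = (\<Sum>v \<in> V. tr s w v * \<phi> v)"
      using Suc NV \<open>w \<in> N u\<close> by auto
  qed simp
  also have "\<dots> = (\<Sum>v \<in> V. (\<Sum>w \<in> N u. tr s w v) * \<phi> v)"
    by (subst sum.swap) (simp add: sum_distrib_right)
  finally show ?case using Suc.prems by (simp add: wsum_Suc sum_divide_distrib[where A = V])
qed

lemma wsum_last_eq: "u \<in> V \<Longrightarrow> wsum s u (\<lambda>P. of_bool (last P = v)) = (if v \<in> V then tr s u v else 0)"
proof -
  assume u: "u \<in> V"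
  have "(\<Sum>w \<in> V. tr s u w * of_bool (w = v)) = (\<Sum>w \<in> V. if w = v then tr s u w else 0)"
    by (intro sum.cong) auto
  then show ?thesis using wsum_last[OF u, of s "\<lambda>w. of_bool (w = v)"] finV by simp
qed

lemma wsum_last_le: "u \<in> V \<Longrightarrow> wsum s u (\<lambda>P. of_bool (last P = v)) \<le> tr s u v"
  by (simp add: wsum_last_eq tr_nonneg)

lemma tr_sum: "u \<in> V \<Longrightarrow> (\<Sum>v \<in> V. tr s u v) = 1"
  using wsum_last[of u s "\<lambda>_. 1"] wsum_const[of u s 1] by simp

lemma tr_le: "u \<in> V \<Longrightarrow> tr (Suc s) u v \<le> 1 / \<Delta>"
proof (induction s arbitrary: u)
  case 0
  have "(\<Sum>w \<in> N u. of_bool (w = v)) \<le> (1::real)"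
    using finN[OF 0] by (auto simp: of_bool_def)
  then have "tr (Suc 0) u v \<le> 1 / dg u" by (simp add: divide_right_mono)
  then show ?case using inv_dg[OF 0] by linarith
next
  case (Suc s)
  have "(\<Sum>w \<in> N u. tr (Suc s) w v) \<le> (\<Sum>w \<in> N u. 1 / \<Delta>)"
    using Suc NV by (intro sum_mono) blast
  then have "(\<Sum>w \<in> N u. tr (Suc s) w v) / dg u \<le> (dg u * (1 / \<Delta>)) / dg u"
    by (intro divide_right_mono) auto
  then show ?case using dg_pos[OF Suc.prems] by (simp only: tr.simps(2)[of "Suc s"]) simp
qed

text \<open>Degrees form an invariant measure: \<open>dg u\<close> cancels the denominator of the
  first step, and by symmetry of \<open>N\<close> each vertex \<open>w\<close> is entered from
  exactly \<open>dg w\<close> vertices.\<close>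

lemma stationary: "v \<in> V \<Longrightarrow> (\<Sum>u \<in> V. dg u * tr s u v) = dg v"
proof (induction s)
  case 0
  have "(\<Sum>u \<in> V. dg u * of_bool (u = v)) = (\<Sum>u \<in> V. if u = v then dg u else 0)"
    by (intro sum.cong) auto
  then show ?case using 0 finV by simp
next
  case (Suc s)
  have "(\<Sum>u \<in> V. dg u * tr (Suc s) u v) = (\<Sum>u \<in> V. \<Sum>w \<in> N u. tr s w v)"
    by (intro sum.cong) (use dg_pos in fastforce)+
  also have "\<dots> = (\<Sum>u \<in> V. \<Sum>w \<in> V. if w \<in> N u then tr s w v else 0)"
    using NV finV by (intro sum.cong sum.mono_neutral_cong_left) auto
  also have "\<dots> = (\<Sum>w \<in> V. \<Sum>u \<in> V. if w \<in> N u then tr s w v else 0)" by (rule sum.swap)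
  also have "\<dots> = (\<Sum>w \<in> V. dg w * tr s w v)"
  proof (rule sum.cong)
    fix w assume w: "w \<in> V"
    have "(\<Sum>u \<in> V. if w \<in> N u then tr s w v else 0) = (\<Sum>u \<in> N w. tr s w v)"
      using NV[OF w] finV sym w by (intro sum.mono_neutral_cong_right) auto
    then show "(\<Sum>u \<in> V. if w \<in> N u then tr s w v else 0) = dg w * tr s w v" by simp
  qed simp
  finally show ?case using Suc by simp
qed

definition deg_total :: real where "deg_total = (\<Sum>u \<in> V. dg u)"

lemma stationary_sum:
  "(\<Sum>u \<in> V. dg u * (\<Sum>v \<in> V. tr s u v * \<phi> v)) = (\<Sum>v \<in> V. dg v * \<phi> v)"
proof -
  have "(\<Sum>u \<in> V. dg u * (\<Sum>v \<in> V. tr s u v * \<phi> v)) = (\<Sum>v \<in> V. (\<Sum>u \<in> V. dg u * tr s u v) * \<phi> v)"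
    by (simp add: sum_distrib_left sum_distrib_right mult.assoc) (rule sum.swap)
  also have "\<dots> = (\<Sum>v \<in> V. dg v * \<phi> v)"
    using stationary by (intro sum.cong) auto
  finally show ?thesis .
qed

text \<open>The joint law of the positions at times i and i + s: the Markov property is applied at
  both times, and the rest of the walk integrates to 1.\<close>

lemma wsum_window:
  assumes u: "u \<in> V" and t: "i + s \<le> t"
  shows "wsum t u (\<lambda>P. \<psi> (P ! i) (P ! (i + s))) = (\<Sum>a \<in> V. tr i u a * (\<Sum>b \<in> V. tr s a b * \<psi> a b))"
proof -
  obtain r where r: "t = i + (s + r)" using t by (auto simp: le_iff_add add.assoc)
  have "wsum t u (\<lambda>P. \<psi> (P ! i) (P ! (i + s))) =
    wsum (i + (s + r)) u (\<lambda>P. (\<lambda>P1 P2. \<psi> (last P1) (P2 ! s)) (take (Suc i) P) (drop i P))"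
    unfolding r by (rule wsum_cong) (auto dest!: walks_length simp: last_take_Suc)
  also have "\<dots> = wsum i u (\<lambda>P. wsum (s + r) (last P) (\<lambda>Q. \<psi> (last P) (Q ! s)))"
    by (rule wsum_split[OF u])
  also have "\<dots> = wsum i u (\<lambda>P. \<Sum>b \<in> V. tr s (last P) b * \<psi> (last P) b)"
  proof (rule wsum_cong)
    fix P assume P: "P \<in> walks i u"
    have lV: "last P \<in> V" using walks_last[OF P u] .
    have "wsum (s + r) (last P) (\<lambda>Q. \<psi> (last P) (Q ! s)) =
      wsum (s + r) (last P) (\<lambda>Q. (\<lambda>P1 P2. \<psi> (last P) (last P1)) (take (Suc s) Q) (drop s Q))"
      by (rule wsum_cong) (auto dest!: walks_length simp: last_take_Suc)
    also have "\<dots> = wsum s (last P) (\<lambda>Q. wsum r (last Q) (\<lambda>_. \<psi> (last P) (last Q)))"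
      by (rule wsum_split[OF lV])
    also have "\<dots> = wsum s (last P) (\<lambda>Q. \<psi> (last P) (last Q))"
      using walks_last lV by (intro wsum_cong wsum_const) blast
    also have "\<dots> = (\<Sum>b \<in> V. tr s (last P) b * \<psi> (last P) b)"
      by (rule wsum_last[OF lV])
    finally show "wsum (s + r) (last P) (\<lambda>Q. \<psi> (last P) (Q ! s)) =
      (\<Sum>b \<in> V. tr s (last P) b * \<psi> (last P) b)" .
  qed
  also have "\<dots> = (\<Sum>a \<in> V. tr i u a * (\<Sum>b \<in> V. tr s a b * \<psi> a b))"
    by (rule wsum_last[OF u])
  finally show ?thesis .
qed

text \<open>A prescribed first step is taken with probability at most 1 / \<Delta>. The predicate
  \<open>R\<close> lets further conditions on the whole walk, such as its end point and flatness,
  pass through the recursion.\<close>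

lemma wsum_matches_Some:
  assumes v: "v \<in> V" and B: "0 \<le> B" and le: "v = x \<Longrightarrow> y \<in> N v \<Longrightarrow>
    wsum s y (\<lambda>P. of_bool (matches qs P \<and> R (v # P))) \<le> B"
  shows "wsum (Suc s) v (\<lambda>P. of_bool (matches (Some (x, y) # qs) P \<and> R P)) \<le> of_bool (v = x) * (B / \<Delta>)"
proof -
  have "(\<Sum>w \<in> N v. wsum s w (\<lambda>P. of_bool (matches (Some (x, y) # qs) (v # P) \<and> R (v # P))))
      \<le> (\<Sum>w \<in> N v. if w = y then of_bool (v = x) * B else 0)"
  proof (rule sum_mono)
    fix w assume w: "w \<in> N v"
    have "wsum s w (\<lambda>P. of_bool (matches (Some (x, y) # qs) (v # P) \<and> R (v # P))) =
      wsum s w (\<lambda>P. of_bool (v = x \<and> w = y \<and> matches qs P \<and> R (v # P)))"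
      by (rule wsum_cong) (use walks_hd in fastforce)
    also have "\<dots> \<le> (if w = y then of_bool (v = x) * B else 0)"
    proof (cases "v = x \<and> w = y")
      case True
      then show ?thesis using le w by auto
    next
      case False
      then have "wsum s w (\<lambda>P. of_bool (v = x \<and> w = y \<and> matches qs P \<and> R (v # P))) = 0"
        by (auto simp: wsum_def)
      then show ?thesis using B by simp
    qed
    finally show "wsum s w (\<lambda>P. of_bool (matches (Some (x, y) # qs) (v # P) \<and> R (v # P)))
      \<le> (if w = y then of_bool (v = x) * B else 0)" .
  qed
  also have "\<dots> \<le> of_bool (v = x) * B" using finN[OF v] B by simp
  finally have "wsum (Suc s) v (\<lambda>P. of_bool (matches (Some (x, y) # qs) P \<and> R P)) \<le>
      of_bool (v = x) * B / dg v"
    unfolding wsum_Suc[OF v] by (rule divide_right_mono) simp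
  also have "\<dots> = of_bool (v = x) * B * (1 / dg v)" by simp
  also have "\<dots> \<le> of_bool (v = x) * B * (1 / \<Delta>)"
    using inv_dg[OF v] B by (intro mult_left_mono) auto
  finally show ?thesis by simp
qed

lemma wsum_matches_le:
  assumes "u \<in> V" "length ps = s"
  shows "wsum s u (\<lambda>P. of_bool (matches ps P)) \<le> (1 / \<Delta>) ^ prescribed ps"
  using assms
proof (induction ps arbitrary: u s)
  case Nil
  then show ?case by simp
next
  case (Cons q qs)
  obtain s' where s': "s = Suc s'" "length qs = s'" using Cons.prems by auto
  show ?case
  proof (cases q)
    case None
    have "(\<Sum>w \<in> N u. wsum s' w (\<lambda>P. of_bool (matches (q # qs) (u # P)))) \<le>
        (\<Sum>w \<in> N u. (1 / \<Delta>) ^ prescribed qs)"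
    proof (rule sum_mono)
      fix w assume w: "w \<in> N u"
      have "wsum s' w (\<lambda>P. of_bool (matches (q # qs) (u # P))) = wsum s' w (\<lambda>P. of_bool (matches qs P))"
        by (rule wsum_cong) (use walks_hd None in fastforce)
      also have "\<dots> \<le> (1 / \<Delta>) ^ prescribed qs" using Cons.IH s' NV Cons.prems w by blast
      finally show "wsum s' w (\<lambda>P. of_bool (matches (q # qs) (u # P))) \<le> (1 / \<Delta>) ^ prescribed qs" .
    qed
    then show ?thesis
      using s' None dg_pos[OF Cons.prems(1)] Cons.prems(1)
      by (simp add: wsum_Suc divide_le_eq mult.commute)
  next
    case (Some xy)
    obtain x y where xy: "xy = (x, y)" by (cases xy)
    have "wsum (Suc s') u (\<lambda>P. of_bool (matches (Some (x, y) # qs) P \<and> True)) \<le>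
        of_bool (u = x) * ((1 / \<Delta>) ^ prescribed qs / \<Delta>)"
    proof (rule wsum_matches_Some)
      show "wsum s' y (\<lambda>P. of_bool (matches qs P \<and> True)) \<le> (1 / \<Delta>) ^ prescribed qs"
        if "y \<in> N u" using Cons.IH[of y s'] s' NV[OF Cons.prems(1)] that by auto
    qed (use Cons.prems \<Delta>1 in auto)
    also have "\<dots> \<le> (1 / \<Delta>) ^ prescribed qs / \<Delta>" using \<Delta>1 by (auto simp: of_bool_def)
    finally show ?thesis using s' Some xy by (simp add: power_divide mult.commute)
  qed
qed

text \<open>One prescribed step is free because the start vertices carry the degree measure, which
  is invariant and not normalised: the edge (x, y) of the first prescribed step is traversed with
  measure dg x / dg x = 1. For this cancellation the proof keeps the factor 1 / dg x exact instead
  of bounding it by 1 / \<Delta>.\<close>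

lemma marginal_matches:
  assumes ps: "length ps = s" "prescribed ps > 0"
  shows "(\<Sum>u \<in> V. dg u * wsum s u (\<lambda>P. of_bool (matches ps P))) \<le> (1 / \<Delta>) ^ (prescribed ps - 1)"
proof -
  obtain a x y qs where d: "ps = replicate a None @ Some (x, y) # qs"
    using prescribed_split ps(2) by blast
  define B where "B = (1 / \<Delta>) ^ prescribed qs"
  have B: "B \<ge> 0" using \<Delta>1 by (simp add: B_def)
  have s: "s = a + Suc (length qs)" using ps d by simp
  have "wsum s u (\<lambda>P. of_bool (matches ps P)) \<le> (\<Sum>v \<in> V. tr a u v * (of_bool (v = x) * (B / dg v)))"
    if u: "u \<in> V" for u
  proof -
    have "wsum s u (\<lambda>P. of_bool (matches ps P)) \<le>
      wsum (a + Suc (length qs)) u (\<lambda>P. (\<lambda>P1 P2. of_bool (matches (Some (x, y) # qs) P2)) (take (Suc a) P) (drop a P))"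
      unfolding s d by (rule wsum_mono) (auto dest: matches_drop)
    also have "\<dots> = wsum a u (\<lambda>P. wsum (Suc (length qs)) (last P) (\<lambda>Q. of_bool (matches (Some (x, y) # qs) Q)))"
      by (rule wsum_split[OF u])
    also have "\<dots> \<le> wsum a u (\<lambda>P. of_bool (last P = x) * (B / dg (last P)))"
    proof (rule wsum_mono)
      fix P assume "P \<in> walks a u"
      then have v: "last P \<in> V" using walks_last u by blast
      let ?v = "last P"
      have "(\<Sum>w \<in> N ?v. wsum (length qs) w (\<lambda>P. of_bool (matches (Some (x, y) # qs) (?v # P))))
        \<le> (\<Sum>w \<in> N ?v. if w = y then of_bool (?v = x) * B else 0)"
      proof (rule sum_mono)
        fix w assume w: "w \<in> N ?v"
        have "wsum (length qs) w (\<lambda>P. of_bool (matches (Some (x, y) # qs) (?v # P))) =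
          wsum (length qs) w (\<lambda>P. of_bool (?v = x \<and> w = y) * of_bool (matches qs P))"
          by (rule wsum_cong) (use walks_hd in fastforce)
        also have "\<dots> = of_bool (?v = x \<and> w = y) * wsum (length qs) w (\<lambda>P. of_bool (matches qs P))"
          by (rule wsum_cmult)
        also have "\<dots> \<le> of_bool (?v = x \<and> w = y) * B"
          using wsum_matches_le[of w qs] NV[OF v] w by (intro mult_left_mono) (auto simp: B_def)
        finally show "wsum (length qs) w (\<lambda>P. of_bool (matches (Some (x, y) # qs) (?v # P)))
          \<le> (if w = y then of_bool (?v = x) * B else 0)" by (auto split: if_splits)
      qed
      also have "\<dots> \<le> of_bool (?v = x) * B" using finN[OF v] B by simp
      finally show "wsum (Suc (length qs)) ?v (\<lambda>Q. of_bool (matches (Some (x, y) # qs) Q)) \<le>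
          of_bool (last P = x) * (B / dg (last P))"
        unfolding wsum_Suc[OF v] by (simp add: divide_right_mono)
    qed
    also have "\<dots> = (\<Sum>v \<in> V. tr a u v * (of_bool (v = x) * (B / dg v)))"
      by (rule wsum_last[OF u])
    finally show ?thesis .
  qed
  then have "(\<Sum>u \<in> V. dg u * wsum s u (\<lambda>P. of_bool (matches ps P))) \<le>
     (\<Sum>u \<in> V. dg u * (\<Sum>v \<in> V. tr a u v * (of_bool (v = x) * (B / dg v))))"
    by (intro sum_mono mult_left_mono) auto
  also have "\<dots> = (\<Sum>v \<in> V. dg v * (of_bool (v = x) * (B / dg v)))" by (rule stationary_sum)
  also have "\<dots> = (\<Sum>v \<in> V. if v = x then B else 0)"
    using dg_pos by (intro sum.cong) (auto simp: of_bool_def)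
  also have "\<dots> \<le> B" using B finV by simp
  finally show ?thesis using d by (simp add: B_def)
qed

end

section \<open>Flat walks\<close>

locale flat_walks = graph_walks V N \<Delta> for V :: "'v set" and N :: "'v \<Rightarrow> 'v set" and \<Delta> :: real +
  fixes l :: nat and nn G :: real
  assumes l2: "2 \<le> l" and cardV: "real (card V) \<le> nn" and VE: "V \<noteq> {}"
    and G_eq: "\<Delta> * G ^ (l - 1) = 2 * nn" and G1: "1 \<le> G" and G\<Delta>: "G \<le> \<Delta>"
begin

text \<open>\<open>\<kappa> s\<close> is the largest admissible probability of an \<open>s\<close>-step transition; by the choice of
  \<open>G\<close>, the last value \<open>\<kappa> l\<close> is half the uniform probability.\<close>

definition \<kappa> :: "nat \<Rightarrow> real" where
  "\<kappa> s = (if s = 0 then 1 else 1 / (\<Delta> * G ^ (s - 1)))"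

lemma \<kappa>_pos: "0 < \<kappa> s"
  using \<Delta>1 G1 by (simp add: \<kappa>_def)

lemma \<kappa>_0 [simp]: "\<kappa> 0 = 1" and \<kappa>_1 [simp]: "\<kappa> (Suc 0) = 1 / \<Delta>"
  by (auto simp: \<kappa>_def)

lemma \<kappa>_ratio:
  assumes "1 \<le> s" "s \<le> t"
  shows "\<kappa> s = \<kappa> t * G ^ (t - s)"
proof -
  have "G ^ (t - 1) = G ^ (s - 1) * G ^ (t - s)"
    using assms by (simp flip: power_add)
  then show ?thesis using assms G1 \<Delta>1 by (simp add: \<kappa>_def field_simps)
qed

text \<open>Prescribed steps cut a walk into free pieces; this merges the bounds for two pieces into
  one. It rests on \<open>G\<Delta>\<close>.\<close>

lemma \<kappa>_mult: "\<kappa> a * \<kappa> b \<le> \<kappa> (a + b)"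
proof (cases "a = 0 \<or> b = 0")
  case True
  then show ?thesis by auto
next
  case False
  then have e: "a + b - 1 = (a - 1) + (b - 1) + 1" by arith
  have "\<Delta> * G ^ (a + b - 1) = \<Delta> * G ^ (a - 1) * (G ^ (b - 1) * G)"
    unfolding e by (simp add: power_add)
  also have "\<dots> \<le> \<Delta> * G ^ (a - 1) * (G ^ (b - 1) * \<Delta>)"
    using G\<Delta> G1 \<Delta>1 by (intro mult_left_mono) auto
  finally have "\<Delta> * G ^ (a + b - 1) \<le> (\<Delta> * G ^ (a - 1)) * (\<Delta> * G ^ (b - 1))"
    by (simp add: mult_ac)
  then have "1 / ((\<Delta> * G ^ (a - 1)) * (\<Delta> * G ^ (b - 1))) \<le> 1 / (\<Delta> * G ^ (a + b - 1))"
    using G1 \<Delta>1 by (intro divide_left_mono) auto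
  then show ?thesis using False by (simp add: \<kappa>_def)
qed

text \<open>Windows of length \<open>t\<close> are exempt: rays have length \<open>t\<close> and are
  chosen so that their end points are hit with probability above \<open>\<kappa> t\<close>.\<close>

definition flat_walk :: "nat \<Rightarrow> 'v list \<Rightarrow> bool" where
  "flat_walk t P \<longleftrightarrow> (\<forall>i s. 1 \<le> s \<longrightarrow> s < t \<longrightarrow> i + s < length P \<longrightarrow> tr s (P ! i) (P ! (i + s)) \<le> \<kappa> s)"

lemma flat_take: "flat_walk t P \<Longrightarrow> flat_walk t (take a P)"
  by (auto simp: flat_walk_def)

lemma flat_drop: "flat_walk t P \<Longrightarrow> flat_walk t (drop a P)"
  unfolding flat_walk_def
proof (intro allI impI)
  fix i s
  assume *: "\<forall>i s. 1 \<le> s \<longrightarrow> s < t \<longrightarrow> i + s < length P \<longrightarrow> tr s (P ! i) (P ! (i + s)) \<le> \<kappa> s"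
    and s: "1 \<le> s" "s < t" "i + s < length (drop a P)"
  show "tr s (drop a P ! i) (drop a P ! (i + s)) \<le> \<kappa> s"
    using *[rule_format, of s "a + i"] s by (simp add: add.assoc)
qed

text \<open>If a flat walk from \<open>u\<close> to \<open>z\<close> exists at all, its flatness
  bounds the transition probability from \<open>u\<close> to \<open>z\<close>, and this in turn
  bounds the sum over all such walks.\<close>

lemma wsum_flat_le:
  assumes u: "u \<in> V" and s: "s < t"
  shows "wsum s u (\<lambda>P. of_bool (last P = z \<and> flat_walk t P)) \<le> \<kappa> s"
proof (cases "s = 0")
  case False
  show ?thesis
  proof (cases "\<exists>P \<in> walks s u. last P = z \<and> flat_walk t P")
    case True
    then obtain P where P: "P \<in> walks s u" "last P = z" "flat_walk t P" by blast
    have len: "length P = Suc s" using walks_length[OF P(1)] .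
    have "P ! 0 = u" using walks_hd[OF P(1)] by auto
    moreover have "P ! s = z" using P(2) len last_conv_nth[of P] by (cases P) auto
    moreover have "tr s (P ! 0) (P ! (0 + s)) \<le> \<kappa> s"
      using P(3)[unfolded flat_walk_def, rule_format, of s 0] len s False by simp
    ultimately have t: "tr s u z \<le> \<kappa> s" by simp
    have "wsum s u (\<lambda>P. of_bool (last P = z \<and> flat_walk t P)) \<le> wsum s u (\<lambda>P. of_bool (last P = z))"
      by (rule wsum_mono) auto
    then show ?thesis using wsum_last_le[OF u, of s z] t by linarith
  next
    case False
    then have "wsum s u (\<lambda>P. of_bool (last P = z \<and> flat_walk t P)) = 0"
      unfolding wsum_def by (intro sum.neutral) auto
    then show ?thesis using \<kappa>_pos[of s] by simp
  qed
qed auto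

text \<open>Flatness says nothing about a free walk of full length \<open>t\<close>, hence the last
  assumption: a prescribed step cuts the walk into pieces shorter than \<open>t\<close>. A piece is
  bounded by \<open>\<kappa>\<close> of its length, a prescribed step by 1 / \<Delta>, and
  \<open>\<kappa>_mult\<close> joins the pieces.\<close>

lemma wsum_pattern_le:
  assumes "u \<in> V" "length ps = s" "s \<le> t" "s < t \<or> prescribed ps > 0"
  shows "wsum s u (\<lambda>P. of_bool (last P = z \<and> flat_walk t P \<and> matches ps P)) \<le>
    (1 / \<Delta>) ^ prescribed ps * \<kappa> (s - prescribed ps)"
  using assms
proof (induction s arbitrary: u ps rule: less_induct)
  case (less s u ps)
  show ?case
  proof (cases "prescribed ps = 0")
    case True
    have "wsum s u (\<lambda>P. of_bool (last P = z \<and> flat_walk t P \<and> matches ps P)) \<le>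
      wsum s u (\<lambda>P. of_bool (last P = z \<and> flat_walk t P))" by (rule wsum_mono) auto
    then show ?thesis using wsum_flat_le[of u s t z] less.prems True by auto
  next
    case False
    then obtain a x y qs where d: "ps = replicate a None @ Some (x, y) # qs"
      using prescribed_split by blast
    define n where "n = length qs"
    define B where "B = (1 / \<Delta>) ^ prescribed qs * \<kappa> (n - prescribed qs)"
    have B: "B \<ge> 0" using \<Delta>1 \<kappa>_pos[of "n - prescribed qs"] by (simp add: B_def)
    have s: "s = a + Suc n" using less.prems d by (simp add: n_def)
    let ?R = "\<lambda>P. last P = z \<and> flat_walk t P"
    have "wsum s u (\<lambda>P. of_bool (last P = z \<and> flat_walk t P \<and> matches ps P)) \<le>
      wsum (a + Suc n) u (\<lambda>P. (\<lambda>P1 P2. of_bool (flat_walk t P1) * of_bool (matches (Some (x, y) # qs) P2 \<and> ?R P2))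
        (take (Suc a) P) (drop a P))"
      unfolding s d
    proof (rule wsum_mono)
      fix P assume P: "P \<in> walks (a + Suc n) u"
      show "of_bool (last P = z \<and> flat_walk t P \<and> matches (replicate a None @ Some (x, y) # qs) P) \<le>
        of_bool (flat_walk t (take (Suc a) P)) *
          (of_bool (matches (Some (x, y) # qs) (drop a P) \<and> ?R (drop a P)) :: real)"
        using walks_length[OF P] matches_drop[of a "Some (x, y) # qs" P]
          flat_take[of t P "Suc a"] flat_drop[of t P a] by auto
    qed
    also have "\<dots> = wsum a u (\<lambda>P. wsum (Suc n) (last P)
        (\<lambda>Q. of_bool (flat_walk t P) * of_bool (matches (Some (x, y) # qs) Q \<and> ?R Q)))"
      by (rule wsum_split) (use less.prems in auto)
    also have "\<dots> \<le> wsum a u (\<lambda>P. B / \<Delta> * of_bool (last P = x \<and> flat_walk t P))"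
    proof (rule wsum_mono)
      fix P assume P: "P \<in> walks a u"
      have v: "last P \<in> V" using walks_last[OF P] less.prems by blast
      have "wsum (Suc n) (last P) (\<lambda>Q. of_bool (flat_walk t P) * of_bool (matches (Some (x, y) # qs) Q \<and> ?R Q)) =
        of_bool (flat_walk t P) * wsum (Suc n) (last P) (\<lambda>Q. of_bool (matches (Some (x, y) # qs) Q \<and> ?R Q))"
        by (rule wsum_cmult)
      also have "\<dots> \<le> of_bool (flat_walk t P) * (of_bool (last P = x) * (B / \<Delta>))"
      proof (intro mult_left_mono wsum_matches_Some v B)
        assume y: "y \<in> N (last P)"
        then have yV: "y \<in> V" using NV v by blast
        have "wsum n y (\<lambda>Q. of_bool (matches qs Q \<and> ?R (last P # Q))) \<le>
          wsum n y (\<lambda>Q. of_bool (last Q = z \<and> flat_walk t Q \<and> matches qs Q))"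
        proof (rule wsum_mono)
          fix Q assume "Q \<in> walks n y"
          then show "of_bool (matches qs Q \<and> ?R (last P # Q)) \<le>
            (of_bool (last Q = z \<and> flat_walk t Q \<and> matches qs Q) :: real)"
            using flat_drop[of t "last P # Q" 1] by auto
        qed
        also have "\<dots> \<le> B"
          unfolding B_def by (rule less.IH) (use s less.prems yV in \<open>auto simp: n_def\<close>)
        finally show "wsum n y (\<lambda>Q. of_bool (matches qs Q \<and> ?R (last P # Q))) \<le> B" .
      qed auto
      finally show "wsum (Suc n) (last P)
        (\<lambda>Q. of_bool (flat_walk t P) * of_bool (matches (Some (x, y) # qs) Q \<and> ?R Q)) \<le>
        B / \<Delta> * of_bool (last P = x \<and> flat_walk t P)" by (auto simp: of_bool_def split: if_splits)
    qed
    also have "\<dots> = B / \<Delta> * wsum a u (\<lambda>P. of_bool (last P = x \<and> flat_walk t P))"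
      by (rule wsum_cmult)
    also have "\<dots> \<le> B / \<Delta> * \<kappa> a"
      using less.prems s B \<Delta>1 by (intro mult_left_mono wsum_flat_le) auto
    also have "\<dots> = (1 / \<Delta>) ^ prescribed ps * (\<kappa> a * \<kappa> (n - prescribed qs))"
      using d by (simp add: B_def)
    also have "\<dots> \<le> (1 / \<Delta>) ^ prescribed ps * \<kappa> (a + (n - prescribed qs))"
      using \<Delta>1 by (intro mult_left_mono \<kappa>_mult) auto
    also have "a + (n - prescribed qs) = s - prescribed ps"
      using prescribed_le[of qs] d s by (simp add: n_def)
    finally show ?thesis .
  qed
qed

definition bad :: "nat \<Rightarrow> real" where
  "bad s = (\<Sum>u \<in> V. dg u * (\<Sum>v \<in> V. tr s u v * of_bool (\<kappa> s < tr s u v)))"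

text \<open>Thresholds on the share of bad walks. Each level exceeds the previous one by the factor
  8 l ^ 2, so that bad windows of all shorter lengths, at most l ^ 2 choices of length and position,
  together amount to at most an eighth of \<open>\<eta> t\<close>.\<close>

definition \<eta> :: "nat \<Rightarrow> real" where
  "\<eta> s = 1 / 2 * (1 / (8 * real l ^ 2)) ^ (l - s)"

lemma l_sq: "1 \<le> 8 * real l ^ 2"
proof -
  have "1 \<le> real l ^ 2" using l2 by (intro one_le_power) simp
  then show ?thesis by linarith
qed

lemma \<eta>_pos: "0 < \<eta> s"
  using l2 by (simp add: \<eta>_def)

lemma \<eta>_le_1: "\<eta> s \<le> 1"
proof -
  have "(1 / (8 * real l ^ 2)) ^ (l - s) \<le> 1" using l_sq by (intro power_le_one) (auto simp: divide_le_eq)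
  then show ?thesis by (simp add: \<eta>_def)
qed

lemma \<eta>_step:
  assumes "s < t" "t \<le> l"
  shows "\<eta> s \<le> \<eta> t * (1 / (8 * real l ^ 2))"
proof -
  note * = l_sq
  have "(1 / (8 * real l ^ 2)) ^ (l - s) \<le> (1 / (8 * real l ^ 2)) ^ (l - t + 1)"
    using assms * by (intro power_decreasing) auto
  then show ?thesis by (simp add: \<eta>_def field_simps)
qed

lemma \<eta>_mono: "t \<le> l \<Longrightarrow> \<eta> 0 \<le> \<eta> t"
proof (cases "t = 0")
  case False
  assume t: "t \<le> l"
  have "\<eta> t * (1 / (8 * real l ^ 2)) \<le> \<eta> t * 1"
    using \<eta>_pos[of t] l_sq by (intro mult_left_mono) (auto simp: divide_le_eq)
  then show ?thesis using \<eta>_step[of 0 t] False t by auto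
qed auto

lemma deg_total_nonneg: "0 \<le> deg_total"
  by (auto simp: deg_total_def intro: sum_nonneg)

text \<open>Since \<open>\<kappa> l\<close> is half of 1 / nn, the vertices hit with probability at
  most \<open>\<kappa> l\<close> receive at most 1 / 2 in total.\<close>

lemma bad_l: "\<eta> l * deg_total \<le> bad l"
proof -
  have kl: "\<kappa> l = 1 / (2 * nn)" using G_eq l2 by (simp add: \<kappa>_def)
  have nn: "nn > 0" using cardV VE finV by (metis card_gt_0_iff of_nat_0_less_iff order_less_le_trans)
  have "1 / 2 \<le> (\<Sum>v \<in> V. tr l u v * of_bool (\<kappa> l < tr l u v))" if u: "u \<in> V" for u
  proof -
    have "1 = (\<Sum>v \<in> V. tr l u v)" using tr_sum[OF u] by simp
    also have "\<dots> \<le> (\<Sum>v \<in> V. tr l u v * of_bool (\<kappa> l < tr l u v) + \<kappa> l)"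
      using \<kappa>_pos[of l] by (intro sum_mono) (auto simp: of_bool_def)
    also have "\<dots> = (\<Sum>v \<in> V. tr l u v * of_bool (\<kappa> l < tr l u v)) + card V * \<kappa> l"
      by (simp add: sum.distrib)
    also have "card V * \<kappa> l \<le> 1 / 2" using cardV nn by (simp add: kl divide_le_eq)
    finally show ?thesis by simp
  qed
  then have "(\<Sum>u \<in> V. dg u * (1 / 2)) \<le> bad l"
    unfolding bad_def by (intro sum_mono mult_left_mono) auto
  moreover have "(\<Sum>u \<in> V. dg u * (1 / 2)) = \<eta> l * deg_total"
    by (simp add: \<eta>_def deg_total_def sum_divide_distrib)
  ultimately show ?thesis by simp
qed

text \<open>The least bad level is taken. No transition of length 1 exceeds
  \<open>\<kappa> 1\<close>, by \<open>tr_le\<close>, so the search starts at 2.\<close>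

lemma exists_level:
  obtains t where "2 \<le> t" "t \<le> l" "\<eta> t * deg_total \<le> bad t"
    "\<And>s. 2 \<le> s \<Longrightarrow> s < t \<Longrightarrow> bad s < \<eta> s * deg_total"
proof -
  define P where "P t \<longleftrightarrow> 2 \<le> t \<and> \<eta> t * deg_total \<le> bad t" for t
  have Pl: "P l" using l2 bad_l by (simp add: P_def)
  show ?thesis
  proof (rule that[of "LEAST t. P t"])
    show "bad s < \<eta> s * deg_total" if "2 \<le> s" "s < (LEAST t. P t)" for s
      using not_less_Least[OF that(2)] that(1) by (simp add: P_def)
  qed (use LeastI[of P, OF Pl] Least_le[of P, OF Pl] in \<open>auto simp: P_def\<close>)
qed

definition good_walks :: "nat \<Rightarrow> 'v \<Rightarrow> 'v list set" where
  "good_walks t u = {P \<in> walks t u. distinct P \<and> \<kappa> t < tr t u (last P) \<and> flat_walk t P}"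

text \<open>A union bound over the ways in which a walk with a bad end point can fail to be good: a
  bad shorter window, charged to \<open>bad s\<close> by invariance of the degree measure, or a
  repeated vertex, of probability at most 1 / \<Delta> for each pair of times. The shares lost are
  at most \<open>\<eta> t\<close> / 8 and \<open>\<eta> t\<close> / 4.\<close>

lemma good_walks_mass:
  assumes t: "2 \<le> t" "t \<le> l" and bt: "\<eta> t * deg_total \<le> bad t"
    and bs: "\<And>s. 2 \<le> s \<Longrightarrow> s < t \<Longrightarrow> bad s < \<eta> s * deg_total"
    and big: "4 * (real l + 1) ^ 2 \<le> \<Delta> * \<eta> 0"
  shows "\<eta> t / 2 * deg_total \<le> (\<Sum>u \<in> V. dg u * wsum t u (\<lambda>P. of_bool (P \<in> good_walks t u)))"
proof -
  let ?w = "\<lambda>P. \<Sum>s \<in> {2..<t}. \<Sum>i \<in> {..t - s}. of_bool (\<kappa> s < tr s (P ! i) (P ! (i + s))) :: real"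
  let ?c = "\<lambda>P. \<Sum>s \<in> {1..t}. \<Sum>i \<in> {..t - s}. of_bool (P ! i = P ! (i + s)) :: real"
  have ind: "of_bool (\<kappa> t < tr t u (last P)) \<le> of_bool (P \<in> good_walks t u) + (?w P + ?c P)"
    if u: "u \<in> V" and P: "P \<in> walks t u" for u P
  proof -
    have w0: "?w P \<ge> 0" and c0: "?c P \<ge> 0" by (auto intro!: sum_nonneg)
    have len: "length P = Suc t" using walks_length[OF P] .
    show ?thesis
    proof (cases "distinct P")
      case False
      then obtain i j where ij: "i < j" "j < length P" "P ! i = P ! j"
      proof -
        obtain i j where "i < length P" "j < length P" "i \<noteq> j" "P ! i = P ! j"
          using False unfolding distinct_conv_nth by blast
        then show ?thesis using that[of i j] that[of j i] by (cases "i < j") auto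
      qed
      define s where "s = j - i"
      have s: "s \<in> {1..t}" "i \<in> {..t - s}" "j = i + s" using ij len by (auto simp: s_def)
      have "1 = (of_bool (P ! i = P ! (i + s)) :: real)" using ij s by simp
      also have "\<dots> \<le> (\<Sum>i \<in> {..t - s}. of_bool (P ! i = P ! (i + s)))"
        by (rule member_le_sum) (use s in auto)
      also have "\<dots> \<le> ?c P"
        by (rule member_le_sum[of s]) (use s in \<open>auto intro: sum_nonneg\<close>)
      finally show ?thesis using w0 by (auto simp: of_bool_def)
    next
      case d: True
      show ?thesis
      proof (cases "flat_walk t P")
        case False
        then obtain i s where s: "1 \<le> s" "s < t" "i + s < length P"
          and v: "\<kappa> s < tr s (P ! i) (P ! (i + s))"
          unfolding flat_walk_def by (auto simp: not_le)
        have "P ! i \<in> V" using walks_subset[OF P u] s by (meson add_lessD1 nth_mem subset_iff)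
        then have "s \<noteq> 1" using v tr_le[of "P ! i" 0 "P ! (i + s)"] by auto
        then have s': "s \<in> {2..<t}" "i \<in> {..t - s}" using s len by auto
        have "1 = (of_bool (\<kappa> s < tr s (P ! i) (P ! (i + s))) :: real)" using v by simp
        also have "\<dots> \<le> (\<Sum>i \<in> {..t - s}. of_bool (\<kappa> s < tr s (P ! i) (P ! (i + s))))"
          by (rule member_le_sum) (use s' in auto)
        also have "\<dots> \<le> ?w P"
          by (rule member_le_sum[of s]) (use s' in \<open>auto intro: sum_nonneg\<close>)
        finally show ?thesis using c0 by (auto simp: of_bool_def)
      next
        case True
        then show ?thesis using P d w0 c0 by (auto simp: good_walks_def)
      qed
    qed
  qed
  have "bad t = (\<Sum>u \<in> V. dg u * wsum t u (\<lambda>P. of_bool (\<kappa> t < tr t u (last P))))"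
    unfolding bad_def
    by (intro sum.cong refl arg_cong2[of _ _ _ _ "(*)"] wsum_last[symmetric, where \<phi> = "\<lambda>v. of_bool (\<kappa> t < tr t _ v)"])
  also have "\<dots> \<le> (\<Sum>u \<in> V. dg u * wsum t u (\<lambda>P. of_bool (P \<in> good_walks t u) + (?w P + ?c P)))"
    by (intro sum_mono mult_left_mono wsum_mono ind) auto
  also have "\<dots> = (\<Sum>u \<in> V. dg u * wsum t u (\<lambda>P. of_bool (P \<in> good_walks t u))) +
      ((\<Sum>u \<in> V. dg u * wsum t u ?w) + (\<Sum>u \<in> V. dg u * wsum t u ?c))"
    by (simp add: wsum_add algebra_simps sum.distrib)
  finally have *: "bad t \<le> \<dots>" .
  have win: "(\<Sum>u \<in> V. dg u * wsum t u (\<lambda>P. \<psi> (P ! i) (P ! (i + s)))) =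
      (\<Sum>a \<in> V. dg a * (\<Sum>b \<in> V. tr s a b * \<psi> a b))" if "i + s \<le> t" for i s \<psi>
  proof -
    have "(\<Sum>u \<in> V. dg u * wsum t u (\<lambda>P. \<psi> (P ! i) (P ! (i + s)))) =
      (\<Sum>u \<in> V. dg u * (\<Sum>a \<in> V. tr i u a * (\<Sum>b \<in> V. tr s a b * \<psi> a b)))"
      using wsum_window that by (intro sum.cong) auto
    then show ?thesis by (simp only: stationary_sum)
  qed
  have swap: "(\<Sum>u \<in> V. dg u * wsum t u (\<lambda>P. \<Sum>s \<in> S. \<Sum>i \<in> T s. F s i P)) =
      (\<Sum>s \<in> S. \<Sum>i \<in> T s. \<Sum>u \<in> V. dg u * wsum t u (F s i))"
    for S :: "nat set" and T :: "nat \<Rightarrow> nat set" and F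
  proof -
    have "(\<Sum>u \<in> V. dg u * wsum t u (\<lambda>P. \<Sum>s \<in> S. \<Sum>i \<in> T s. F s i P)) =
      (\<Sum>u \<in> V. \<Sum>s \<in> S. \<Sum>i \<in> T s. dg u * wsum t u (F s i))"
      by (simp add: wsum_sum sum_distrib_left)
    also have "\<dots> = (\<Sum>s \<in> S. \<Sum>u \<in> V. \<Sum>i \<in> T s. dg u * wsum t u (F s i))" by (rule sum.swap)
    also have "\<dots> = (\<Sum>s \<in> S. \<Sum>i \<in> T s. \<Sum>u \<in> V. dg u * wsum t u (F s i))"
      by (rule sum.cong[OF refl], rule sum.swap)
    finally show ?thesis .
  qed
  have "(\<Sum>u \<in> V. dg u * wsum t u ?w) = (\<Sum>s \<in> {2..<t}. \<Sum>i \<in> {..t - s}. bad s)"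
    unfolding swap by (intro sum.cong refl) (subst win, auto simp: bad_def)
  also have "\<dots> \<le> (\<Sum>s \<in> {2..<t}. \<Sum>i \<in> {..t - s}. \<eta> t * (1 / (8 * real l ^ 2)) * deg_total)"
  proof (intro sum_mono)
    fix s i assume s: "s \<in> {2..<t}"
    have "bad s \<le> \<eta> s * deg_total" using bs[of s] s by auto
    also have "\<dots> \<le> \<eta> t * (1 / (8 * real l ^ 2)) * deg_total"
      using s t \<eta>_step[of s t] deg_total_nonneg by (intro mult_right_mono) auto
    finally show "bad s \<le> \<eta> t * (1 / (8 * real l ^ 2)) * deg_total" .
  qed
  also have "\<dots> \<le> (\<Sum>s \<in> {2..<t}. real l * (\<eta> t * (1 / (8 * real l ^ 2)) * deg_total))"
  proof (rule sum_mono)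
    fix s assume s: "s \<in> {2..<t}"
    then have "real (Suc (t - s)) \<le> real l" using t by auto
    then have "real (Suc (t - s)) * (\<eta> t * (1 / (8 * real l ^ 2)) * deg_total) \<le>
      real l * (\<eta> t * (1 / (8 * real l ^ 2)) * deg_total)"
      using \<eta>_pos[of t] deg_total_nonneg by (intro mult_right_mono) auto
    then show "(\<Sum>i \<in> {..t - s}. \<eta> t * (1 / (8 * real l ^ 2)) * deg_total) \<le>
      real l * (\<eta> t * (1 / (8 * real l ^ 2)) * deg_total)" by simp
  qed
  also have "\<dots> = real (t - 2) * (real l * (\<eta> t * (1 / (8 * real l ^ 2)) * deg_total))" by simp
  also have "\<dots> \<le> real l * (real l * (\<eta> t * (1 / (8 * real l ^ 2)) * deg_total))"
    using t \<eta>_pos[of t] deg_total_nonneg by (intro mult_right_mono) auto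
  also have "\<dots> = \<eta> t / 8 * deg_total" using l2 by (simp add: power2_eq_square field_simps)
  finally have W: "(\<Sum>u \<in> V. dg u * wsum t u ?w) \<le> \<eta> t / 8 * deg_total" .
  have "(\<Sum>u \<in> V. dg u * wsum t u ?c) =
    (\<Sum>s \<in> {1..t}. \<Sum>i \<in> {..t - s}. \<Sum>a \<in> V. dg a * (\<Sum>b \<in> V. tr s a b * of_bool (a = b)))"
    unfolding swap by (rule sum.cong[OF refl], rule sum.cong[OF refl],
        rule win[of _ _ "\<lambda>a b. of_bool (a = b)"]) auto
  also have "\<dots> \<le> (\<Sum>s \<in> {1..t}. \<Sum>i \<in> {..t - s}. deg_total / \<Delta>)"
  proof (intro sum_mono)
    fix s i assume s: "s \<in> {1..t}"
    then obtain s' where s': "s = Suc s'" by (cases s) auto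
    have "(\<Sum>a \<in> V. dg a * (\<Sum>b \<in> V. tr s a b * of_bool (a = b))) \<le> (\<Sum>a \<in> V. dg a * (1 / \<Delta>))"
    proof (intro sum_mono mult_left_mono)
      fix a assume a: "a \<in> V"
      have "(\<Sum>b \<in> V. tr s a b * of_bool (a = b)) = (\<Sum>b \<in> V. if b = a then tr s a b else 0)"
        by (intro sum.cong) auto
      then show "(\<Sum>b \<in> V. tr s a b * of_bool (a = b)) \<le> 1 / \<Delta>"
        using a finV tr_le[OF a, of s' a] s' by simp
    qed auto
    then show "(\<Sum>a \<in> V. dg a * (\<Sum>b \<in> V. tr s a b * of_bool (a = b))) \<le> deg_total / \<Delta>"
      by (simp add: deg_total_def sum_divide_distrib)
  qed
  also have "\<dots> \<le> (\<Sum>s \<in> {1..t}. (real l + 1) * (deg_total / \<Delta>))"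
  proof (rule sum_mono)
    fix s assume s: "s \<in> {1..t}"
    have "real (Suc (t - s)) * (deg_total / \<Delta>) \<le> (real l + 1) * (deg_total / \<Delta>)"
      using t deg_total_nonneg \<Delta>1 by (intro mult_right_mono) auto
    then show "(\<Sum>i \<in> {..t - s}. deg_total / \<Delta>) \<le> (real l + 1) * (deg_total / \<Delta>)" by simp
  qed
  also have "\<dots> = real t * ((real l + 1) * (deg_total / \<Delta>))" by simp
  also have "\<dots> \<le> (real l + 1) * ((real l + 1) * (deg_total / \<Delta>))"
    using t deg_total_nonneg \<Delta>1 by (intro mult_right_mono) auto
  also have "\<dots> = (4 * (real l + 1) ^ 2) * (deg_total / (4 * \<Delta>))"
    by (simp add: power2_eq_square)
  also have "\<dots> \<le> (\<Delta> * \<eta> 0) * (deg_total / (4 * \<Delta>))"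
    using big deg_total_nonneg \<Delta>1 by (intro mult_right_mono) auto
  also have "\<dots> = \<eta> 0 / 4 * deg_total" using \<Delta>1 by simp
  also have "\<dots> \<le> \<eta> t / 4 * deg_total"
    using \<eta>_mono[OF t(2)] deg_total_nonneg by (intro mult_right_mono) auto
  finally have C: "(\<Sum>u \<in> V. dg u * wsum t u ?c) \<le> \<eta> t / 4 * deg_total" .
  have "0 \<le> \<eta> t * deg_total" using \<eta>_pos[of t] deg_total_nonneg by simp
  then show ?thesis using * bt W C by (simp add: algebra_simps)
qed

text \<open>Two cleanings at once. Afterwards every end point in use carries ray weight of order
  \<open>\<kappa> t\<close>, and every penultimate vertex in use a fixed fraction of its transition
  probability. Each costs at most \<open>\<eta> t\<close> / 8: there are at most 1 /
  \<open>\<kappa> t\<close> end points, as each is hit with probability above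
  \<open>\<kappa> t\<close>, and the transition probabilities to penultimate vertices sum to at most
  1.\<close>

lemma exists_rays:
  assumes big: "4 * (real l + 1) ^ 2 \<le> \<Delta> * \<eta> 0"
  obtains t R where "2 \<le> t" "t \<le> l"
    "\<And>u. u \<in> V \<Longrightarrow> R u \<subseteq> walks t u"
    "\<And>u P. u \<in> V \<Longrightarrow> P \<in> R u \<Longrightarrow> distinct P \<and> flat_walk t P"
    "\<And>u P. u \<in> V \<Longrightarrow> P \<in> R u \<Longrightarrow> \<eta> t / 8 * \<kappa> t \<le> sum wt {Q \<in> R u. last Q = last P}"
    "\<And>u P. u \<in> V \<Longrightarrow> P \<in> R u \<Longrightarrow>
      \<eta> t / 8 * tr (t - 1) u (P ! (t - 1)) \<le> sum wt {Q \<in> R u. Q ! (t - 1) = P ! (t - 1)}"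
    "\<eta> t / 4 * deg_total \<le> (\<Sum>u \<in> V. dg u * sum wt (R u))"
proof -
  obtain t where t: "2 \<le> t" "t \<le> l" and bt: "\<eta> t * deg_total \<le> bad t"
    and bs: "\<And>s. 2 \<le> s \<Longrightarrow> s < t \<Longrightarrow> bad s < \<eta> s * deg_total"
    using exists_level by blast
  have mass: "\<eta> t / 2 * deg_total \<le> (\<Sum>u \<in> V. dg u * wsum t u (\<lambda>P. of_bool (P \<in> good_walks t u)))"
    by (rule good_walks_mass[OF t bt bs big])
  have "\<exists>R. R \<subseteq> good_walks t u \<and> (\<forall>P \<in> R. \<eta> t / 8 * \<kappa> t \<le> sum wt {Q \<in> R. last Q = last P}) \<and>
    (\<forall>P \<in> R. \<eta> t / 8 * tr (t - 1) u (P ! (t - 1)) \<le> sum wt {Q \<in> R. Q ! (t - 1) = P ! (t - 1)}) \<and>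
    sum wt (good_walks t u) - \<eta> t / 4 \<le> sum wt R" if u: "u \<in> V" for u
  proof -
    define Z where "Z = {z \<in> V. \<kappa> t < tr t u z}"
    define \<tau> :: "'v + 'v \<Rightarrow> real" where "\<tau> = case_sum (\<lambda>z. \<eta> t / 8 * \<kappa> t) (\<lambda>y. \<eta> t / 8 * tr (t - 1) u y)"
    define M where "M = case_sum (\<lambda>z. {P :: 'v list. last P = z}) (\<lambda>y. {P. P ! (t - 1) = y})"
    have fin: "finite (good_walks t u)"
      using finite_walks[OF u] by (auto simp: good_walks_def)
    have finZ: "finite Z" using finV by (simp add: Z_def)
    obtain R where R: "R \<subseteq> good_walks t u"
      and Rc: "\<And>c. c \<in> Z <+> V \<Longrightarrow> R \<inter> M c \<noteq> {} \<Longrightarrow> \<tau> c \<le> sum wt (R \<inter> M c)"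
      and Rs: "sum wt (good_walks t u) - sum \<tau> (Z <+> V) \<le> sum wt R"
    proof (rule weighted_cleaning[of "good_walks t u" "Z <+> V" wt \<tau> M])
      show "0 \<le> \<tau> c" for c
        using \<eta>_pos[of t] \<kappa>_pos[of t] tr_nonneg by (auto simp: \<tau>_def split: sum.split)
    qed (use fin finZ finV wt_nonneg in auto)
    have "(\<Sum>y \<in> V. \<eta> t / 8 * tr (t - 1) u y) = \<eta> t / 8"
      unfolding sum_distrib_left[symmetric] tr_sum[OF u] by simp
    then have "sum \<tau> (Z <+> V) = card Z * (\<eta> t / 8 * \<kappa> t) + \<eta> t / 8"
      using finZ finV by (simp add: sum.Plus \<tau>_def)
    also have "card Z * \<kappa> t \<le> 1"
    proof -
      have "card Z * \<kappa> t \<le> (\<Sum>z \<in> Z. tr t u z)"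
        using sum_mono[of Z "\<lambda>_. \<kappa> t" "tr t u"] by (simp add: Z_def)
      also have "\<dots> \<le> (\<Sum>z \<in> V. tr t u z)"
        using finV tr_nonneg by (intro sum_mono2) (auto simp: Z_def)
      finally show ?thesis using tr_sum[OF u] by simp
    qed
    then have "\<eta> t / 8 * (card Z * \<kappa> t) \<le> \<eta> t / 8 * 1"
      using \<eta>_pos[of t] by (intro mult_left_mono) auto
    then have "card Z * (\<eta> t / 8 * \<kappa> t) \<le> \<eta> t / 8" by (simp add: mult_ac)
    finally have st: "sum \<tau> (Z <+> V) \<le> \<eta> t / 4" by simp
    have "\<eta> t / 8 * \<kappa> t \<le> sum wt {Q \<in> R. last Q = last P}" if "P \<in> R" for P
    proof -
      have "P \<in> good_walks t u" using that R by blast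
      then have "Inl (last P) \<in> Z <+> V"
        using walks_last u by (auto simp: good_walks_def Z_def)
      moreover have "R \<inter> M (Inl (last P)) = {Q \<in> R. last Q = last P}" by (auto simp: M_def)
      ultimately show ?thesis using Rc[of "Inl (last P)"] that by (auto simp: \<tau>_def)
    qed
    moreover have "\<eta> t / 8 * tr (t - 1) u (P ! (t - 1)) \<le> sum wt {Q \<in> R. Q ! (t - 1) = P ! (t - 1)}"
      if "P \<in> R" for P
    proof -
      have P: "P \<in> walks t u" using that R by (auto simp: good_walks_def)
      have "P ! (t - 1) \<in> set P" using walks_length[OF P] by (intro nth_mem) auto
      then have "Inr (P ! (t - 1)) \<in> Z <+> V" using walks_subset[OF P u] by auto
      moreover have "R \<inter> M (Inr (P ! (t - 1))) = {Q \<in> R. Q ! (t - 1) = P ! (t - 1)}"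
        by (auto simp: M_def)
      ultimately show ?thesis using Rc[of "Inr (P ! (t - 1))"] that by (auto simp: \<tau>_def)
    qed
    ultimately show ?thesis using R Rs st by (intro exI[of _ R]) auto
  qed
  from bchoice[OF ballI, OF this] obtain R where
    R0: "\<forall>u \<in> V. R u \<subseteq> good_walks t u \<and>
      (\<forall>P \<in> R u. \<eta> t / 8 * \<kappa> t \<le> sum wt {Q \<in> R u. last Q = last P}) \<and>
      (\<forall>P \<in> R u. \<eta> t / 8 * tr (t - 1) u (P ! (t - 1)) \<le> sum wt {Q \<in> R u. Q ! (t - 1) = P ! (t - 1)}) \<and>
      sum wt (good_walks t u) - \<eta> t / 4 \<le> sum wt (R u)" ..
  have R: "R u \<subseteq> good_walks t u" and R3: "sum wt (good_walks t u) - \<eta> t / 4 \<le> sum wt (R u)"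
    if "u \<in> V" for u
    using R0 that by blast+
  have R1: "\<eta> t / 8 * \<kappa> t \<le> sum wt {Q \<in> R u. last Q = last P}"
    and R2: "\<eta> t / 8 * tr (t - 1) u (P ! (t - 1)) \<le> sum wt {Q \<in> R u. Q ! (t - 1) = P ! (t - 1)}"
    if "u \<in> V" "P \<in> R u" for u P
    using R0 that by blast+
  show ?thesis
  proof (rule that[OF t, of R])
    have ws: "wsum t u (\<lambda>P. of_bool (P \<in> good_walks t u)) = sum wt (good_walks t u)" if "u \<in> V" for u
      unfolding wsum_def using finite_walks[OF that]
      by (intro sum.mono_neutral_cong_right) (auto simp: good_walks_def)
    have "(\<Sum>u \<in> V. dg u * wsum t u (\<lambda>P. of_bool (P \<in> good_walks t u))) =
      (\<Sum>u \<in> V. dg u * sum wt (good_walks t u))"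
      using ws by (intro sum.cong) auto
    also have "\<dots> \<le> (\<Sum>u \<in> V. dg u * (sum wt (R u) + \<eta> t / 4))"
      using R3 by (intro sum_mono mult_left_mono) (auto simp: algebra_simps)
    also have "\<dots> = (\<Sum>u \<in> V. dg u * sum wt (R u)) + \<eta> t / 4 * deg_total"
      by (simp add: deg_total_def algebra_simps sum.distrib sum_distrib_left)
    finally show "\<eta> t / 4 * deg_total \<le> (\<Sum>u \<in> V. dg u * sum wt (R u))"
      using mass by (simp add: algebra_simps)
  qed (use R R1 R2 in \<open>auto simp: good_walks_def\<close>)
qed

definition long_lists :: "'v list set" where
  "long_lists = {xs. set xs \<subseteq> V \<and> length xs = Suc (2 * l)}"

lemma finite_long_lists: "finite long_lists"
  unfolding long_lists_def by (rule finite_lists_length_eq[OF finV])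

end

section \<open>Closed walks from pairs of rays\<close>

lemma matches_nth:
  "length xs = Suc (length ps) \<Longrightarrow>
    matches ps xs \<longleftrightarrow> (\<forall>i < length ps. ps ! i = None \<or> ps ! i = Some (xs ! i, xs ! Suc i))"
proof (induction ps arbitrary: xs)
  case (Cons p ps)
  then obtain x y zs where xs: "xs = x # y # zs" by (cases xs; cases "tl xs") auto
  then show ?case using Cons by (simp add: All_less_Suc2)
qed simp

lemma matches_append:
  "length xs = length ps \<Longrightarrow>
    matches (ps @ qs) (xs @ v # ys) \<longleftrightarrow> matches ps (xs @ [v]) \<and> matches qs (v # ys)"
proof (induction ps arbitrary: xs)
  case (Cons p ps)
  then obtain x zs where xs: "xs = x # zs" by (cases xs) auto
  then show ?case using Cons.IH[of zs] Cons.prems by (cases zs) auto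
qed simp

definition rswap :: "('v \<times> 'v) option list \<Rightarrow> ('v \<times> 'v) option list" where
  "rswap ps = rev (map (map_option prod.swap) ps)"

lemma length_rswap [simp]: "length (rswap ps) = length ps"
  by (simp add: rswap_def)

lemma prescribed_rswap [simp]: "prescribed (rswap ps) = prescribed ps"
proof -
  have "prescribed (map (map_option prod.swap) ps) = prescribed ps"
  proof (induction ps)
    case (Cons p ps)
    then show ?case by (cases p) auto
  qed simp
  then show ?thesis by (simp add: rswap_def)
qed

lemma rswap_append: "rswap (ps @ qs) = rswap qs @ rswap ps"
  by (simp add: rswap_def)

lemma matches_rev:
  assumes "length xs = Suc (length ps)"
  shows "matches ps (rev xs) \<longleftrightarrow> matches (rswap ps) xs"
proof -
  let ?n = "length ps"
  have 1: "(ps ! i = None \<or> ps ! i = Some (rev xs ! i, rev xs ! Suc i)) \<longleftrightarrow>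
    (rswap ps ! (?n - 1 - i) = None \<or>
     rswap ps ! (?n - 1 - i) = Some (xs ! (?n - 1 - i), xs ! Suc (?n - 1 - i)))" if i: "i < ?n" for i
  proof -
    have "rswap ps ! (?n - 1 - i) = map_option prod.swap (ps ! i)"
      using i by (simp add: rswap_def rev_nth)
    moreover have "rev xs ! i = xs ! Suc (?n - 1 - i)" "rev xs ! Suc i = xs ! (?n - 1 - i)"
      using i assms by (auto simp: rev_nth Suc_diff_Suc)
    ultimately show ?thesis by (cases "ps ! i") (auto simp: prod.swap_def)
  qed
  have "matches ps (rev xs) \<longleftrightarrow>
      (\<forall>i < ?n. ps ! i = None \<or> ps ! i = Some (rev xs ! i, rev xs ! Suc i))"
    using assms by (intro matches_nth) simp
  also have "\<dots> \<longleftrightarrow> (\<forall>i < ?n. rswap ps ! (?n - 1 - i) = None \<or>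
     rswap ps ! (?n - 1 - i) = Some (xs ! (?n - 1 - i), xs ! Suc (?n - 1 - i)))"
    using 1 by blast
  also have "\<dots> \<longleftrightarrow> (\<forall>j < ?n. rswap ps ! j = None \<or> rswap ps ! j = Some (xs ! j, xs ! Suc j))"
  proof safe
    fix j y assume *: "\<forall>i < ?n. rswap ps ! (?n - 1 - i) = None \<or>
     rswap ps ! (?n - 1 - i) = Some (xs ! (?n - 1 - i), xs ! Suc (?n - 1 - i))"
      and j: "j < ?n" "rswap ps ! j \<noteq> Some (xs ! j, xs ! Suc j)"
    show "rswap ps ! j = None"
      using *[rule_format, of "?n - 1 - j"] j by auto
  next
    fix i y assume *: "\<forall>j < ?n. rswap ps ! j = None \<or> rswap ps ! j = Some (xs ! j, xs ! Suc j)"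
      and i: "i < ?n"
        "rswap ps ! (?n - 1 - i) \<noteq> Some (xs ! (?n - 1 - i), xs ! Suc (?n - 1 - i))"
    have "?n - 1 - i < ?n" using i by auto
    then show "rswap ps ! (?n - 1 - i) = None" using * i by blast
  qed
  also have "\<dots> \<longleftrightarrow> matches (rswap ps) xs"
    using assms by (simp add: matches_nth)
  finally show ?thesis .
qed

locale ray_system = flat_walks V N \<Delta> l nn G
  for V :: "'v set" and N :: "'v \<Rightarrow> 'v set" and \<Delta> :: real and l :: nat and nn G :: real +
  fixes t :: nat and R :: "'v \<Rightarrow> 'v list set"
  assumes t2: "2 \<le> t" and tl: "t \<le> l"
    and R_walks: "u \<in> V \<Longrightarrow> R u \<subseteq> walks t u"
    and R_flat: "u \<in> V \<Longrightarrow> P \<in> R u \<Longrightarrow> distinct P \<and> flat_walk t P"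
    and R_last: "u \<in> V \<Longrightarrow> P \<in> R u \<Longrightarrow> \<eta> t / 8 * \<kappa> t \<le> sum wt {Q \<in> R u. last Q = last P}"
    and R_pen: "u \<in> V \<Longrightarrow> P \<in> R u \<Longrightarrow>
      \<eta> t / 8 * tr (t - 1) u (P ! (t - 1)) \<le> sum wt {Q \<in> R u. Q ! (t - 1) = P ! (t - 1)}"
    and R_mass: "\<eta> t / 4 * deg_total \<le> (\<Sum>u \<in> V. dg u * sum wt (R u))"
begin

text \<open>\<open>\<theta>\<close> bounds the weight of every end point in use from below.
  \<open>\<gamma>\<close> is the price of a prescribed step relative to such a weight, and
  \<open>\<gamma>'\<close> the price of a step out of a penultimate vertex. That they differ by the
  factor \<open>G\<close> matters for fully prescribed cycles.\<close>

definition \<theta> :: real where "\<theta> = \<eta> t / 8 * \<kappa> t"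
definition \<gamma> :: real where "\<gamma> = 8 / \<eta> t * (G / \<Delta>)"
definition \<gamma>' :: real where "\<gamma>' = 8 / (\<eta> t * \<Delta>)"

lemma \<theta>_pos: "0 < \<theta>" and \<gamma>_pos: "0 < \<gamma>" and \<gamma>'_pos: "0 < \<gamma>'"
  using \<eta>_pos[of t] \<kappa>_pos[of t] G1 \<Delta>1 by (auto simp: \<theta>_def \<gamma>_def \<gamma>'_def)

lemma \<gamma>'_le: "\<gamma>' \<le> \<gamma>"
  using \<eta>_pos[of t] G1 \<Delta>1 by (simp add: \<gamma>_def \<gamma>'_def divide_right_mono)

lemma inv_\<Delta>_le: "1 / \<Delta> \<le> \<gamma>"
proof -
  have "1 * 1 \<le> 8 / \<eta> t * G"
    using \<eta>_pos[of t] \<eta>_le_1[of t] G1 by (intro mult_mono) (auto simp: le_divide_eq)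
  then have "1 / \<Delta> \<le> 8 / \<eta> t * G / \<Delta>" using \<Delta>1 by (intro divide_right_mono) auto
  then show ?thesis by (simp add: \<gamma>_def)
qed

lemma \<kappa>_pen: "\<kappa> (t - 1) / \<Delta> = \<gamma> * \<theta>"
proof -
  have "\<kappa> (t - 1) = \<kappa> t * G" using \<kappa>_ratio[of "t - 1" t] t2 by simp
  then show ?thesis using \<eta>_pos[of t] by (simp add: \<gamma>_def \<theta>_def)
qed

context
  fixes u :: 'v
  assumes u: "u \<in> V"
begin

lemma finR: "finite (R u)"
  using R_walks[OF u] finite_walks[OF u] finite_subset by blast

lemma R_length: "P \<in> R u \<Longrightarrow> length P = Suc t"
  using R_walks[OF u] walks_length by blast

lemma R_nth_V: "P \<in> R u \<Longrightarrow> i \<le> t \<Longrightarrow> P ! i \<in> V"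
proof -
  assume P: "P \<in> R u" and i: "i \<le> t"
  have "P ! i \<in> set P" using R_length[OF P] i by (intro nth_mem) simp
  moreover have "set P \<subseteq> V" using R_walks[OF u] walks_subset[OF _ u] P by blast
  ultimately show "P ! i \<in> V" by blast
qed

lemma R_last_nth: "P \<in> R u \<Longrightarrow> last P = P ! t"
  using R_length[of P] by (subst last_conv_nth) auto

lemma R_hd: "P \<in> R u \<Longrightarrow> P ! 0 = u"
  using R_walks[OF u] walks_hd by fastforce

lemma sum_R_le: "(\<Sum>P \<in> {P \<in> R u. Q P}. wt P) \<le> wsum t u (\<lambda>P. of_bool (Q P \<and> P \<in> R u))"
proof -
  have "(\<Sum>P \<in> {P \<in> R u. Q P}. wt P) = wsum t u (\<lambda>P. of_bool (Q P \<and> P \<in> R u))"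
    unfolding wsum_def using finite_walks[OF u] R_walks[OF u]
    by (intro sum.mono_neutral_cong_left) auto
  then show ?thesis by simp
qed

text \<open>Marginals of the rays from \<open>u\<close> by end point, by penultimate vertex
  (\<open>aw\<close>) and by last edge (\<open>Aw\<close>). The last are the edge weights of the
  bipartite graph on which the zigzag moves.\<close>

definition bw :: "'v \<Rightarrow> real" where "bw z = sum wt {P \<in> R u. last P = z}"
definition aw :: "'v \<Rightarrow> real" where "aw y = sum wt {P \<in> R u. P ! (t - 1) = y}"
definition Aw :: "'v \<Rightarrow> 'v \<Rightarrow> real" where
  "Aw y z = sum wt {P \<in> R u. P ! (t - 1) = y \<and> last P = z}"

lemma bw_nonneg: "0 \<le> bw z" and aw_nonneg: "0 \<le> aw y" and Aw_nonneg: "0 \<le> Aw y z"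
  by (auto simp: bw_def aw_def Aw_def intro: sum_nonneg wt_nonneg)

lemma bw_ge: "P \<in> R u \<Longrightarrow> \<theta> \<le> bw (last P)"
  using R_last[OF u] by (simp add: \<theta>_def bw_def)

lemma Aw_pos: "Aw y z \<noteq> 0 \<Longrightarrow> \<exists>P \<in> R u. P ! (t - 1) = y \<and> last P = z"
  unfolding Aw_def by (metis (mono_tags, lifting) empty_Collect_eq sum.empty)

text \<open>The factor 1 / dg y is kept because summation over \<open>u\<close> with the degree
  measure cancels it in \<open>closed_sum_mid\<close>.\<close>

lemma Aw_le: "Aw y z \<le> tr (t - 1) u y * (if y \<in> V then 1 / dg y else 0)"
proof -
  have "Aw y z \<le> wsum t u (\<lambda>P. of_bool ((P ! (t - 1) = y \<and> last P = z) \<and> P \<in> R u))"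
    unfolding Aw_def by (rule sum_R_le)
  also have "\<dots> \<le> wsum t u (\<lambda>P. (\<lambda>a b. of_bool (a = y \<and> b = z)) (P ! (t - 1)) (P ! (t - 1 + 1)))"
    by (rule wsum_mono) (use R_last_nth t2 in auto)
  also have "\<dots> = (\<Sum>a \<in> V. tr (t - 1) u a * (\<Sum>b \<in> V. tr 1 a b * of_bool (a = y \<and> b = z)))"
    by (rule wsum_window[OF u]) (use t2 in simp)
  also have "\<dots> \<le> (\<Sum>a \<in> V. if a = y then tr (t - 1) u y * (1 / dg y) else 0)"
  proof (rule sum_mono)
    fix a assume a: "a \<in> V"
    show "tr (t - 1) u a * (\<Sum>b \<in> V. tr 1 a b * of_bool (a = y \<and> b = z))
      \<le> (if a = y then tr (t - 1) u y * (1 / dg y) else 0)"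
    proof (cases "a = y")
      case True
      have "(\<Sum>b \<in> V. tr 1 a b * of_bool (a = y \<and> b = z)) = (\<Sum>b \<in> V. if b = z then tr 1 a b else 0)"
        using True by (intro sum.cong) auto
      also have "\<dots> \<le> tr 1 a z" using finV tr_nonneg[of 1 a z] by simp
      also have "\<dots> \<le> 1 / dg a" using finN[OF a] by (auto simp: of_bool_def divide_right_mono)
      finally have f: "(\<Sum>b \<in> V. tr 1 a b * of_bool (a = y \<and> b = z)) \<le> 1 / dg a" .
      show ?thesis using mult_left_mono[OF f tr_nonneg[of "t - 1" u y]] True by (simp del: tr.simps)
    qed simp
  qed
  also have "\<dots> \<le> tr (t - 1) u y * (if y \<in> V then 1 / dg y else 0)"
    using finV by simp
  finally show ?thesis .
qed

lemma Aw_le': "Aw y z \<le> tr (t - 1) u y / \<Delta>"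
proof -
  have "(if y \<in> V then 1 / dg y else 0) \<le> 1 / \<Delta>" using inv_dg \<Delta>1 by auto
  then have "tr (t - 1) u y * (if y \<in> V then 1 / dg y else 0) \<le> tr (t - 1) u y * (1 / \<Delta>)"
    by (intro mult_left_mono tr_nonneg)
  then show ?thesis using Aw_le[of y z] by simp
qed

text \<open>Flatness bounds the probability of reaching \<open>y\<close> in t - 1 steps by \<kappa>
  (t - 1), so by \<open>\<kappa>_pen\<close> the last edge weighs at most \<gamma> \<theta>, and
  \<theta> is a lower bound for the weight of any end point in use.\<close>

lemma Aw_bw: "Aw y z \<le> \<gamma> * bw z"
proof (cases "Aw y z = 0")
  case False
  then obtain P where P: "P \<in> R u" "P ! (t - 1) = y" "last P = z" using Aw_pos by blast
  have "tr (t - 1) (P ! 0) (P ! (0 + (t - 1))) \<le> \<kappa> (t - 1)"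
    using R_flat[OF u P(1), THEN conjunct2, unfolded flat_walk_def, rule_format, of "t - 1" 0]
      R_length[OF P(1)] t2 by simp
  then have "tr (t - 1) u y / \<Delta> \<le> \<kappa> (t - 1) / \<Delta>"
    using P R_hd \<Delta>1 by (simp add: divide_right_mono)
  then have "Aw y z \<le> \<gamma> * \<theta>" using Aw_le'[of y z] \<kappa>_pen by simp
  also have "\<dots> \<le> \<gamma> * bw z" using bw_ge[OF P(1)] P \<gamma>_pos by simp
  finally show ?thesis .
qed (use \<gamma>_pos bw_nonneg in simp)

text \<open>No factor \<open>G\<close> appears here: cleaning made the weight of \<open>y\<close>
  comparable to its transition probability, so one further step costs only a constant over
  \<Delta>.\<close>

lemma Aw_aw: "Aw y z \<le> \<gamma>' * aw y"
proof (cases "Aw y z = 0")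
  case False
  then obtain P where P: "P \<in> R u" "P ! (t - 1) = y" "last P = z" using Aw_pos by blast
  have "\<gamma>' * (\<eta> t / 8 * tr (t - 1) u y) \<le> \<gamma>' * aw y"
    using R_pen[OF u P(1)] P \<gamma>'_pos by (simp add: aw_def)
  then show ?thesis using Aw_le'[of y z] \<eta>_pos[of t] by (simp add: \<gamma>'_def)
qed (use \<gamma>'_pos aw_nonneg in simp)

section \<open>The zigzag between end points and penultimate vertices\<close>

definition X :: "(bool \<times> 'v) set" where "X = UNIV \<times> V"

lemma finX: "finite X" using finV by (simp add: X_def)

text \<open>The zigzag part of a closed walk alternates between end points of rays, tagged \<open>True\<close>,
  and penultimate vertices of rays, tagged \<open>False\<close>.\<close>

definition S :: "bool \<times> 'v \<Rightarrow> bool \<times> 'v \<Rightarrow> real" where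
  "S x x' = (if fst x = fst x' then 0 else if fst x then Aw (snd x') (snd x) else Aw (snd x) (snd x'))"

text \<open>By \<open>sum_S\<close> these are the row sums of the symmetric matrix \<open>S\<close>,
  so \<open>c\<close> is the reversible measure of the chain with transition probabilities S x x' /
  c x.\<close>

definition c :: "bool \<times> 'v \<Rightarrow> real" where
  "c x = (if fst x then bw (snd x) else aw (snd x))"

lemma S_sym: "S x x' = S x' x" and S_nonneg: "0 \<le> S x x'" and c_nonneg: "0 \<le> c x"
  by (auto simp: S_def c_def Aw_nonneg aw_nonneg bw_nonneg)

lemma S_le: "S x x' \<le> \<gamma> * c x"
  using Aw_bw[of "snd x'" "snd x"] Aw_aw[of "snd x" "snd x'"] aw_nonneg[of "snd x"]
    bw_nonneg[of "snd x"] \<gamma>_pos mult_right_mono[OF \<gamma>'_le, of "aw (snd x)"]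
  by (auto simp: S_def c_def)

lemma S_tag: "S x x' \<noteq> 0 \<Longrightarrow> fst x' = (\<not> fst x)"
  by (cases "fst x"; cases "fst x'") (auto simp: S_def)

lemma sum_S: "(\<Sum>x' \<in> X. S x x') = c x"
proof -
  have grp: "(\<Sum>v \<in> V. sum wt {P \<in> R u. Q P \<and> f P = v}) = sum wt {P \<in> R u. Q P}"
    if "\<And>P. P \<in> R u \<Longrightarrow> f P \<in> V" for f :: "'v list \<Rightarrow> 'v" and Q
  proof -
    have "sum wt {P \<in> R u. Q P} = (\<Sum>v \<in> V. sum wt {P \<in> {P \<in> R u. Q P}. f P = v})"
      using finR finV that by (intro sum.group[symmetric]) auto
    then show ?thesis by (simp add: conj_assoc)
  qed
  have "(\<Sum>x' \<in> X. S x x') = (\<Sum>b \<in> UNIV. \<Sum>v \<in> V. S x (b, v))"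
    unfolding X_def by (simp add: sum.cartesian_product)
  also have "\<dots> = (\<Sum>v \<in> V. S x (\<not> fst x, v))"
    by (cases "fst x") (simp_all add: UNIV_bool S_def)
  also have "\<dots> = c x"
  proof (cases "fst x")
    case True
    have "(\<Sum>v \<in> V. Aw v (snd x)) = (\<Sum>v \<in> V. sum wt {P \<in> R u. last P = snd x \<and> P ! (t - 1) = v})"
      unfolding Aw_def by (intro sum.cong) (auto intro: arg_cong[where f = "sum wt"])
    also have "\<dots> = bw (snd x)" unfolding bw_def by (rule grp) (auto intro: R_nth_V)
    finally show ?thesis using True by (simp add: S_def c_def)
  next
    case False
    have "(\<Sum>v \<in> V. Aw (snd x) v) = aw (snd x)"
      unfolding Aw_def aw_def by (rule grp) (auto simp: R_last_nth intro: R_nth_V)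
    then show ?thesis using False by (simp add: S_def c_def)
  qed
  finally show ?thesis .
qed

text \<open>A free step that reaches a given vertex costs \<gamma> too, because the tag of the next
  vertex is determined by that of \<open>x\<close>.\<close>

lemma sum_S_snd: "(\<Sum>x' \<in> X. S x x' * of_bool (snd x' = w)) \<le> \<gamma> * c x"
proof -
  have "(\<Sum>x' \<in> X. S x x' * of_bool (snd x' = w)) \<le> (\<Sum>x' \<in> X. if x' = (\<not> fst x, w) then S x x' else 0)"
    by (intro sum_mono) (auto simp: S_def)
  also have "\<dots> \<le> \<gamma> * c x"
    using finX S_le[of x] c_nonneg[of x] \<gamma>_pos by simp
  finally show ?thesis .
qed

lemma S_zero: "c x = 0 \<Longrightarrow> S x x' = 0"
  using S_le[of x x'] S_nonneg[of x x'] by simp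

text \<open>Expectation over the remainder of a closed walk: \<open>n\<close> zigzag steps from
  \<open>x\<close>, then a second ray drawn by weight among those that end in the last zigzag
  vertex. \<open>F\<close> receives the whole zigzag and the ray. Division by zero gives the value 0
  where \<open>c\<close> vanishes.\<close>

fun rest :: "nat \<Rightarrow> bool \<times> 'v \<Rightarrow> ((bool \<times> 'v) list \<Rightarrow> 'v list \<Rightarrow> real) \<Rightarrow> real" where
  "rest 0 x F = (\<Sum>P \<in> {P \<in> R u. (True, last P) = x}. wt P * F [x] P) / c x"
| "rest (Suc n) x F = (\<Sum>x' \<in> X. S x x' * rest n x' (\<lambda>L. F (x # L))) / c x"

text \<open>The comparison is required only for zigzags with steps of positive weight that end where
  the ray ends. Later estimates obtain their structural facts about closed walks from these
  premises.\<close>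

lemma rest_mono:
  "(\<And>L P. L \<noteq> [] \<Longrightarrow> hd L = x \<Longrightarrow> length L = Suc n \<Longrightarrow> P \<in> R u \<Longrightarrow>
      last L = (True, last P) \<Longrightarrow> successively (\<lambda>a b. S a b \<noteq> 0) L \<Longrightarrow> F L P \<le> F' L P) \<Longrightarrow>
    rest n x F \<le> rest n x F'"
proof (induction n arbitrary: x F F')
  case 0
  then show ?case by (auto intro!: divide_right_mono sum_mono mult_left_mono wt_nonneg c_nonneg)
next
  case (Suc n)
  have "(\<Sum>x' \<in> X. S x x' * rest n x' (\<lambda>L. F (x # L))) \<le> (\<Sum>x' \<in> X. S x x' * rest n x' (\<lambda>L. F' (x # L)))"
  proof (rule sum_mono)
    fix x'
    show "S x x' * rest n x' (\<lambda>L. F (x # L)) \<le> S x x' * rest n x' (\<lambda>L. F' (x # L))"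
    proof (cases "S x x' = 0")
      case False
      have "rest n x' (\<lambda>L. F (x # L)) \<le> rest n x' (\<lambda>L. F' (x # L))"
        by (rule Suc.IH, rule Suc.prems) (use False in \<open>auto simp: successively_Cons\<close>)
      then show ?thesis by (intro mult_left_mono S_nonneg)
    qed simp
  qed
  then show ?case unfolding rest.simps by (intro divide_right_mono c_nonneg)
qed

lemma rest_0_fun [simp]: "rest n x (\<lambda>L P. 0) = 0"
  by (induction n arbitrary: x) auto

lemma rest_nonneg: "(\<And>L P. 0 \<le> F L P) \<Longrightarrow> 0 \<le> rest n x F"
  using rest_mono[of x n "\<lambda>L P. 0" F] by simp

lemma rest_add: "rest n x (\<lambda>L P. F L P + F' L P) = rest n x F + rest n x F'"
  by (induction n arbitrary: x F F') (auto simp: algebra_simps sum.distrib add_divide_distrib)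

lemma rest_cmult: "rest n x (\<lambda>L P. a * F L P) = a * rest n x F"
  by (induction n arbitrary: x F) (auto simp: sum_distrib_left mult_ac)

lemma rest_one_le: "rest n x (\<lambda>L P. 1) \<le> 1"
proof (induction n arbitrary: x)
  case 0
  have "(\<Sum>P \<in> {P \<in> R u. (True, last P) = x}. wt P) \<le> c x"
    by (cases x; cases "fst x") (auto simp: c_def bw_def aw_nonneg)
  then show ?case using c_nonneg[of x] by (simp add: divide_le_eq)
next
  case (Suc n)
  have "(\<Sum>x' \<in> X. S x x' * rest n x' (\<lambda>L P. 1)) \<le> (\<Sum>x' \<in> X. S x x' * 1)"
    by (intro sum_mono mult_left_mono Suc S_nonneg)
  then show ?case using sum_S[of x] c_nonneg[of x] by (simp add: divide_le_eq)
qed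

lemma rest_one: "c x > 0 \<Longrightarrow> fst x = even n \<Longrightarrow> rest n x (\<lambda>L P. 1) = 1"
proof (induction n arbitrary: x)
  case 0
  then have "(\<Sum>P \<in> {P \<in> R u. (True, last P) = x}. wt P) = c x"
    by (cases x) (auto simp: c_def bw_def)
  then show ?case using 0 by simp
next
  case (Suc n)
  have "(\<Sum>x' \<in> X. S x x' * rest n x' (\<lambda>L P. 1)) = (\<Sum>x' \<in> X. S x x')"
  proof (rule sum.cong)
    fix x' assume "x' \<in> X"
    show "S x x' * rest n x' (\<lambda>L P. 1) = S x x'"
    proof (cases "S x x' = 0")
      case False
      then have "c x' > 0" using S_zero[of x' x] S_sym[of x x'] c_nonneg[of x'] by force
      moreover have "fst x' = even n" using S_tag[OF False] Suc.prems by simp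
      ultimately show ?thesis using Suc.IH by simp
    qed simp
  qed simp
  then show ?case using Suc.prems sum_S[of x] by simp
qed

section \<open>Prices of prescribed steps on the zigzag and the second ray\<close>

definition full :: "('v \<times> 'v) option list \<Rightarrow> bool" where
  "full ps \<longleftrightarrow> prescribed ps = length ps"

lemma full_append [simp]: "full (ps @ qs) \<longleftrightarrow> full ps \<and> full qs"
  using prescribed_le[of ps] prescribed_le[of qs] by (auto simp: full_def)

lemma full_Cons [simp]: "full (p # ps) \<longleftrightarrow> p \<noteq> None \<and> full ps"
  using prescribed_le[of ps] by (cases p) (auto simp: full_def)

lemma full_Nil [simp]: "full []" by (simp add: full_def)

lemma full_rswap [simp]: "full (rswap ps) \<longleftrightarrow> full ps" by (simp add: full_def)

text \<open>Relative to the weight of its end point a ray pays \<gamma> for each prescribed step,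
  since \<open>\<kappa> (t - j)\<close> is \<open>\<kappa> t\<close> times G ^ j. The fully
  prescribed ray is exceptional: \<open>\<kappa> 0\<close> is 1 and not G / \<Delta>, as the
  geometric progression would have it, so one factor \<gamma> is missing
  (\<open>full_ray_bound\<close>).\<close>

lemma ray_pattern:
  assumes ps: "length ps = t"
  shows "(\<Sum>P \<in> {P \<in> R u. last P = z \<and> matches ps P}. wt P) \<le>
    bw z * (if full ps then (1 / \<Delta>) ^ t / \<theta> else \<gamma> ^ prescribed ps)"
proof (cases "{P \<in> R u. last P = z \<and> matches ps P} = {}")
  case True
  show ?thesis unfolding True using bw_nonneg[of z] \<gamma>_pos \<theta>_pos \<Delta>1 by simp
next
  case False
  then have bz: "\<theta> \<le> bw z" using bw_ge by blast
  let ?j = "prescribed ps"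
  have jt: "?j \<le> t" using prescribed_le[of ps] ps by simp
  show ?thesis
  proof (cases "?j = 0")
    case True
    have "(\<Sum>P \<in> {P \<in> R u. last P = z \<and> matches ps P}. wt P) \<le> bw z"
      unfolding bw_def using finR by (intro sum_mono2) (auto intro: wt_nonneg)
    then show ?thesis using True t2 ps by (simp add: full_def)
  next
    case False
    have "(\<Sum>P \<in> {P \<in> R u. last P = z \<and> matches ps P}. wt P) \<le>
      wsum t u (\<lambda>P. of_bool ((last P = z \<and> matches ps P) \<and> P \<in> R u))" by (rule sum_R_le)
    also have "\<dots> \<le> wsum t u (\<lambda>P. of_bool (last P = z \<and> flat_walk t P \<and> matches ps P))"
      by (rule wsum_mono) (use R_flat u in auto)
    also have "\<dots> \<le> (1 / \<Delta>) ^ ?j * \<kappa> (t - ?j)"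
      by (rule wsum_pattern_le) (use u ps False in auto)
    also have "\<dots> \<le> bw z * (if full ps then (1 / \<Delta>) ^ t / \<theta> else \<gamma> ^ ?j)"
    proof (cases "full ps")
      case True
      have "(1 / \<Delta>) ^ t = \<theta> * ((1 / \<Delta>) ^ t / \<theta>)" using \<theta>_pos by simp
      also have "\<dots> \<le> bw z * ((1 / \<Delta>) ^ t / \<theta>)"
        using bz \<theta>_pos \<Delta>1 by (intro mult_right_mono) auto
      finally show ?thesis using True ps by (simp add: full_def)
    next
      case nf: False
      have "\<kappa> (t - ?j) = \<kappa> t * G ^ ?j"
        using \<kappa>_ratio[of "t - ?j" t] nf ps jt by (simp add: full_def)
      then have "(1 / \<Delta>) ^ ?j * \<kappa> (t - ?j) = \<theta> * (8 / \<eta> t * (G / \<Delta>) ^ ?j)"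
        using \<eta>_pos[of t] by (simp add: \<theta>_def power_divide)
      also have "\<dots> \<le> \<theta> * ((8 / \<eta> t) ^ ?j * (G / \<Delta>) ^ ?j)"
      proof -
        have "(8 / \<eta> t) ^ 1 \<le> (8 / \<eta> t) ^ ?j"
          using \<eta>_pos[of t] \<eta>_le_1[of t] False by (intro power_increasing) (auto simp: le_divide_eq)
        then show ?thesis using \<theta>_pos G1 \<Delta>1 by (intro mult_left_mono mult_right_mono) auto
      qed
      also have "\<dots> = \<theta> * \<gamma> ^ ?j" by (simp only: \<gamma>_def power_mult_distrib)
      also have "\<dots> \<le> bw z * \<gamma> ^ ?j" using bz \<gamma>_pos by (intro mult_right_mono) auto
      finally show ?thesis using nf by simp
    qed
    finally show ?thesis .
  qed
qed

lemma full_ray_bound: "(1 / \<Delta>) ^ t / \<theta> \<le> \<gamma> ^ (t - 1)"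
proof -
  have t1: "t = Suc (t - 1)" using t2 by simp
  have *: "8 / \<eta> t \<ge> 1" using \<eta>_pos[of t] \<eta>_le_1[of t] by (simp add: le_divide_eq)
  have \<Delta>t: "\<Delta> ^ t = \<Delta> * \<Delta> ^ (t - 1)" by (metis t1 power_Suc)
  have "(1 / \<Delta>) ^ t / \<theta> = 8 / \<eta> t * (G / \<Delta>) ^ (t - 1)"
    using t2 \<Delta>1 G1 \<eta>_pos[of t]
    by (simp add: \<theta>_def \<kappa>_def power_divide \<Delta>t)
  also have "\<dots> \<le> (8 / \<eta> t) ^ (t - 1) * (G / \<Delta>) ^ (t - 1)"
  proof -
    have "(8 / \<eta> t) ^ 1 \<le> (8 / \<eta> t) ^ (t - 1)" using * t2 by (intro power_increasing) auto
    then show ?thesis using G1 \<Delta>1 by (intro mult_right_mono) auto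
  qed
  finally show ?thesis by (simp only: \<gamma>_def power_mult_distrib)
qed

definition start :: "('v \<times> 'v) option list \<Rightarrow> 'v" where "start ps = fst (the (hd ps))"

abbreviation seg :: "('v \<times> 'v) option list \<Rightarrow> ('v \<times> 'v) option list \<Rightarrow>
    (bool \<times> 'v) list \<Rightarrow> 'v list \<Rightarrow> real" where
  "seg pm pc \<equiv> \<lambda>L P. of_bool (matches pm (map snd L) \<and> matches pc (rev P))"

text \<open>A sharper bound for a fully prescribed remainder. The zigzag stops at an end point of
  rays, so with an even number of steps to go it stands at an end point and pays \<gamma>, and with
  an odd number at a penultimate vertex and pays \<gamma>'.\<close>

fun chain_bound :: "nat \<Rightarrow> real" where
  "chain_bound 0 = (1 / \<Delta>) ^ t / \<theta>"
| "chain_bound (Suc n) = (if even (Suc n) then \<gamma> else \<gamma>') * chain_bound n"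

lemma rest_0_seg:
  assumes "length pc = t"
  shows "rest 0 x (seg [] pc) \<le> of_bool (full pc \<longrightarrow> snd x = start pc) *
    (if full pc then chain_bound 0 else \<gamma> ^ prescribed pc)"
proof (cases "c x = 0")
  case True
  then show ?thesis using \<Delta>1 \<theta>_pos \<gamma>_pos by auto
next
  case False
  let ?B = "if full pc then (1 / \<Delta>) ^ t / \<theta> else \<gamma> ^ prescribed pc"
  have B: "0 \<le> ?B" using \<Delta>1 \<theta>_pos \<gamma>_pos by auto
  have cp: "c x > 0" using False c_nonneg[of x] by simp
  have rv: "matches pc (rev P) \<longleftrightarrow> matches (rswap pc) P" if "P \<in> R u" for P
    using matches_rev[of P pc] R_length[OF that] assms by simp
  have st: "last P = start pc" if P: "P \<in> R u" "full pc" "matches pc (rev P)" for P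
  proof -
    obtain a b pc' where pc: "pc = Some (a, b) # pc'"
      using P(2) assms t2 by (cases pc; cases "hd pc") auto
    obtain y ys where rp: "rev P = last P # y # ys"
      using R_length[OF P(1)] t2 by (cases "rev P"; cases "tl (rev P)") (auto simp: hd_rev[symmetric])
    have "matches pc (last P # y # ys)" using P(3) by (simp only: rp)
    then show ?thesis using pc by (simp add: start_def)
  qed
  have "(\<Sum>P \<in> {P \<in> R u. (True, last P) = x}. wt P * seg [] pc [x] P) =
    (\<Sum>P \<in> {P \<in> R u. (True, last P) = x \<and> matches (rswap pc) P}. wt P)"
    using finR rv by (intro sum.mono_neutral_cong_right) auto
  also have "\<dots> \<le> c x * ?B * of_bool (full pc \<longrightarrow> snd x = start pc)"
  proof (cases "fst x \<and> (full pc \<longrightarrow> snd x = start pc)")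
    case True
    then have e: "{P \<in> R u. (True, last P) = x \<and> matches (rswap pc) P} =
      {P \<in> R u. last P = snd x \<and> matches (rswap pc) P}" by (cases x) auto
    have "sum wt {P \<in> R u. last P = snd x \<and> matches (rswap pc) P} \<le> bw (snd x) * ?B"
      using ray_pattern[of "rswap pc" "snd x"] assms
      by (simp only: full_rswap prescribed_rswap length_rswap)
    moreover have "c x = bw (snd x)" "of_bool (full pc \<longrightarrow> snd x = start pc) = (1::real)"
      using True by (simp_all add: c_def)
    ultimately show ?thesis unfolding e by (simp only: mult_1_right)
  next
    case False
    then have e: "{P \<in> R u. (True, last P) = x \<and> matches (rswap pc) P} = {}"
      using st rv by auto
    show ?thesis unfolding e using B c_nonneg[of x] by simp
  qed
  finally have "rest 0 x (seg [] pc) \<le> c x * ?B * of_bool (full pc \<longrightarrow> snd x = start pc) / c x"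
    unfolding rest.simps using cp by (intro divide_right_mono) auto
  also have "\<dots> = of_bool (full pc \<longrightarrow> snd x = start pc) *
    (if full pc then chain_bound 0 else \<gamma> ^ prescribed pc)" using cp by simp
  finally show ?thesis .
qed

text \<open>The price \<open>g\<close> is left open: it is \<gamma> in \<open>rest_seg\<close> and
  depends on the tag in \<open>rest_full\<close>.\<close>

lemma rest_Suc_Some:
  assumes B: "0 \<le> B" and g: "0 \<le> g" and K: "\<And>x'. S x x' \<le> g * c x"
    and le: "\<And>x'. x' \<in> X \<Longrightarrow> S x x' \<noteq> 0 \<Longrightarrow> rest n x' (seg pm pc) \<le> B"
  shows "rest (Suc n) x (seg (Some (a, b) # pm) pc) \<le> of_bool (snd x = a) * (g * B)"
proof (cases "c x = 0")
  case True
  then show ?thesis using B g by simp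
next
  case False
  then have cp: "c x > 0" using c_nonneg[of x] by simp
  have "(\<Sum>x' \<in> X. S x x' * rest n x' (\<lambda>L. seg (Some (a, b) # pm) pc (x # L))) \<le>
    (\<Sum>x' \<in> X. if x' = (\<not> fst x, b) then of_bool (snd x = a) * (S x x' * B) else 0)"
  proof (rule sum_mono)
    fix x' assume x': "x' \<in> X"
    have "rest n x' (\<lambda>L. seg (Some (a, b) # pm) pc (x # L)) \<le>
      rest n x' (\<lambda>L P. of_bool (snd x = a \<and> snd x' = b) * seg pm pc L P)"
    proof (rule rest_mono)
      fix L P assume "L \<noteq> []" "hd L = x'"
      then show "seg (Some (a, b) # pm) pc (x # L) P \<le> of_bool (snd x = a \<and> snd x' = b) * seg pm pc L P"
        by (cases L) auto
    qed
    also have "\<dots> = of_bool (snd x = a \<and> snd x' = b) * rest n x' (seg pm pc)" by (rule rest_cmult)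
    finally have r: "rest n x' (\<lambda>L. seg (Some (a, b) # pm) pc (x # L)) \<le>
      of_bool (snd x = a \<and> snd x' = b) * rest n x' (seg pm pc)" .
    show "S x x' * rest n x' (\<lambda>L. seg (Some (a, b) # pm) pc (x # L)) \<le>
      (if x' = (\<not> fst x, b) then of_bool (snd x = a) * (S x x' * B) else 0)"
    proof (cases "S x x' = 0")
      case False
      then have f: "fst x' = (\<not> fst x)" by (rule S_tag)
      have "S x x' * rest n x' (\<lambda>L. seg (Some (a, b) # pm) pc (x # L)) \<le>
        S x x' * (of_bool (snd x = a \<and> snd x' = b) * rest n x' (seg pm pc))"
        by (intro mult_left_mono r S_nonneg)
      also have "\<dots> \<le> S x x' * (of_bool (snd x = a \<and> snd x' = b) * B)"
        using le[OF x' False] by (intro mult_left_mono S_nonneg) auto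
      also have "\<dots> = (if x' = (\<not> fst x, b) then of_bool (snd x = a) * (S x x' * B) else 0)"
        using f by (cases x') auto
      finally show ?thesis .
    qed (use B in auto)
  qed
  also have "\<dots> \<le> of_bool (snd x = a) * (g * c x * B)"
    using finX K[of "(\<not> fst x, b)"] S_nonneg[of x "(\<not> fst x, b)"] B by (auto simp: mult_right_mono)
  finally show ?thesis using cp by (simp add: divide_le_eq mult_ac)
qed

lemma rest_Suc_mult: "c x * rest (Suc n) x F = (\<Sum>x' \<in> X. S x x' * rest n x' (\<lambda>L. F (x # L)))"
  using S_zero[of x] by (cases "c x = 0") auto

lemma rest_Suc_None:
  "rest (Suc n) x (seg (None # pm) pc) = (\<Sum>x' \<in> X. S x x' * rest n x' (seg pm pc)) / c x"
proof -
  have "rest n x' (\<lambda>L. seg (None # pm) pc (x # L)) = rest n x' (seg pm pc)" for x'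
  proof (rule antisym)
    show "rest n x' (\<lambda>L. seg (None # pm) pc (x # L)) \<le> rest n x' (seg pm pc)"
    proof (rule rest_mono)
      fix L :: "(bool \<times> 'v) list" and P :: "'v list" assume "L \<noteq> []"
      then show "seg (None # pm) pc (x # L) P \<le> seg pm pc L P" by (cases L) auto
    qed
    show "rest n x' (seg pm pc) \<le> rest n x' (\<lambda>L. seg (None # pm) pc (x # L))"
    proof (rule rest_mono)
      fix L :: "(bool \<times> 'v) list" and P :: "'v list" assume "L \<noteq> []"
      then show "seg pm pc L P \<le> seg (None # pm) pc (x # L) P" by (cases L) auto
    qed
  qed
  then show ?thesis by simp
qed

text \<open>A fully prescribed remainder lacks one factor \<gamma>, but it also determines the
  current vertex, and the indicator records this. The nearest free step before it pays \<gamma> for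
  hitting that vertex (\<open>sum_S_snd\<close>), which restores the factor.\<close>

lemma rest_seg:
  assumes "length pm = n" "length pc = t"
  shows "rest n x (seg pm pc) \<le> (if full (pm @ pc) then of_bool (snd x = start (pm @ pc)) * \<gamma> ^ (n + t - 1)
    else \<gamma> ^ prescribed (pm @ pc))"
  using assms(1)
proof (induction n arbitrary: x pm)
  case 0
  have "chain_bound 0 \<le> \<gamma> ^ (t - 1)" using full_ray_bound by simp
  then have "of_bool (snd x = start pc) * chain_bound 0 \<le> of_bool (snd x = start pc) * \<gamma> ^ (t - 1)"
    by (intro mult_left_mono) auto
  then show ?case using rest_0_seg[OF assms(2), of x] 0 by (cases "full pc") auto
next
  case (Suc n)
  then obtain p pm' where pm: "pm = p # pm'" "length pm' = n" by (cases pm) auto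
  have nt: "Suc n + t - 1 = Suc (n + t - 1)" using t2 by simp
  let ?B = "if full (pm' @ pc) then \<gamma> ^ (n + t - 1) else \<gamma> ^ prescribed (pm' @ pc)"
  have B: "0 \<le> ?B" using \<gamma>_pos by simp
  have leB: "rest n x' (seg pm' pc) \<le> ?B" for x'
    using Suc.IH[OF pm(2), of x'] \<gamma>_pos
    by (cases "snd x' = start (pm' @ pc)") (auto intro: order_trans split: if_splits)
  show ?case
  proof (cases p)
    case (Some ab)
    obtain a b where ab: "ab = (a, b)" by (cases ab)
    have "rest (Suc n) x (seg (Some (a, b) # pm') pc) \<le> of_bool (snd x = a) * (\<gamma> * ?B)"
      by (rule rest_Suc_Some[OF B _ S_le leB]) (use \<gamma>_pos in simp)
    also have "\<dots> \<le> (if full (pm @ pc) then of_bool (snd x = start (pm @ pc)) * \<gamma> ^ (Suc n + t - 1)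
      else \<gamma> ^ prescribed (pm @ pc))"
      unfolding nt using pm Some ab \<gamma>_pos by (auto simp: start_def)
    finally show ?thesis using pm Some ab by simp
  next
    case None
    have "(\<Sum>x' \<in> X. S x x' * rest n x' (seg pm' pc)) \<le> c x * \<gamma> ^ prescribed (pm' @ pc)"
    proof (cases "full (pm' @ pc)")
      case True
      then have pr: "prescribed (pm' @ pc) = Suc (n + t - 1)"
        using pm assms(2) t2 by (simp add: full_def)
      have "(\<Sum>x' \<in> X. S x x' * rest n x' (seg pm' pc)) \<le>
        (\<Sum>x' \<in> X. S x x' * (of_bool (snd x' = start (pm' @ pc)) * \<gamma> ^ (n + t - 1)))"
        using Suc.IH[OF pm(2)] True by (intro sum_mono mult_left_mono S_nonneg) auto
      also have "\<dots> = (\<Sum>x' \<in> X. S x x' * of_bool (snd x' = start (pm' @ pc))) * \<gamma> ^ (n + t - 1)"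
        by (simp only: sum_distrib_right mult.assoc)
      also have "\<dots> \<le> \<gamma> * c x * \<gamma> ^ (n + t - 1)"
        using \<gamma>_pos by (intro mult_right_mono sum_S_snd) auto
      finally show ?thesis unfolding pr by (simp add: mult_ac)
    next
      case False
      have "(\<Sum>x' \<in> X. S x x' * rest n x' (seg pm' pc)) \<le> (\<Sum>x' \<in> X. S x x' * \<gamma> ^ prescribed (pm' @ pc))"
        using leB False by (intro sum_mono mult_left_mono S_nonneg) auto
      then show ?thesis by (simp add: sum_distrib_right[symmetric] sum_S)
    qed
    then have "rest (Suc n) x (seg (None # pm') pc) \<le> \<gamma> ^ prescribed (pm' @ pc)"
      unfolding rest_Suc_None using c_nonneg[of x] \<gamma>_pos
      by (cases "c x = 0") (auto simp: divide_le_eq mult_ac)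
    then show ?thesis using pm None by simp
  qed
qed

lemma chain_bound_nonneg: "0 \<le> chain_bound n"
  using \<gamma>_pos \<gamma>'_pos \<theta>_pos \<Delta>1 by (induction n) auto

lemma rest_full:
  assumes "length pm = n" "length pc = t" "full pm" "full pc" "fst x = even n"
  shows "rest n x (seg pm pc) \<le> chain_bound n"
  using assms(1,3,5)
proof (induction n arbitrary: x pm)
  case 0
  then show ?case using rest_0_seg[OF assms(2), of x] assms(4) chain_bound_nonneg[of 0]
    by (cases "snd x = start pc") auto
next
  case (Suc n)
  then obtain p pm' where pm: "pm = p # pm'" "length pm' = n" by (cases pm) auto
  then obtain a b where p: "p = Some (a, b)" using Suc.prems by (cases p) auto
  let ?g = "if even (Suc n) then \<gamma> else \<gamma>'"
  have "rest (Suc n) x (seg (Some (a, b) # pm') pc) \<le> of_bool (snd x = a) * (?g * chain_bound n)"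
  proof (rule rest_Suc_Some)
    show "S x x' \<le> ?g * c x" for x'
      using S_le[of x x'] Aw_aw[of "snd x" "snd x'"] aw_nonneg[of "snd x"] \<gamma>'_pos Suc.prems(3)
      by (auto simp: S_def c_def split: if_splits)
    show "rest n x' (seg pm' pc) \<le> chain_bound n" if "S x x' \<noteq> 0" for x'
      using Suc.IH[OF pm(2)] S_tag[OF that] Suc.prems pm by auto
  qed (use chain_bound_nonneg \<gamma>_pos \<gamma>'_pos in auto)
  also have "\<dots> \<le> chain_bound (Suc n)" using chain_bound_nonneg[of n] \<gamma>_pos \<gamma>'_pos by auto
  finally show ?case using pm p by simp
qed

text \<open>Started from its reversible measure \<open>c\<close>, the zigzag may drop initial free
  steps, so the first prescribed step becomes its first step. The weight of that step is kept exact
  instead of being bounded by \<gamma>, because it is going to be summed over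
  \<open>u\<close>.\<close>

lemma rest_mid:
  assumes "pm = replicate m None @ Some (a, b) # qs" "length pm = n"
  shows "(\<Sum>x \<in> X. c x * rest n x (seg pm (replicate t None))) \<le>
    (\<Sum>x \<in> X. \<Sum>x' \<in> X. S x x' * of_bool (snd x = a \<and> snd x' = b)) * \<gamma> ^ prescribed qs"
  using assms
proof (induction m arbitrary: pm n)
  case 0
  then obtain n' where n: "n = Suc n'" "length qs = n'" by auto
  let ?pc = "replicate t None :: ('v \<times> 'v) option list"
  have nf: "\<not> full (qs @ ?pc)" using t2 prescribed_le[of qs] by (auto simp: full_def)
  have "c x * rest n x (seg pm ?pc) \<le>
    (\<Sum>x' \<in> X. S x x' * of_bool (snd x = a \<and> snd x' = b)) * \<gamma> ^ prescribed qs" for x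
  proof -
    have "c x * rest n x (seg pm ?pc) = (\<Sum>x' \<in> X. S x x' * rest n' x' (\<lambda>L. seg pm ?pc (x # L)))"
      unfolding n(1) by (rule rest_Suc_mult)
    also have "\<dots> \<le> (\<Sum>x' \<in> X. S x x' * (of_bool (snd x = a \<and> snd x' = b) * \<gamma> ^ prescribed qs))"
    proof (intro sum_mono mult_left_mono S_nonneg)
      fix x'
      have "rest n' x' (\<lambda>L. seg pm ?pc (x # L)) \<le>
        rest n' x' (\<lambda>L P. of_bool (snd x = a \<and> snd x' = b) * seg qs ?pc L P)"
      proof (rule rest_mono)
        fix L P assume "L \<noteq> []" "hd L = x'"
        then show "seg pm ?pc (x # L) P \<le> of_bool (snd x = a \<and> snd x' = b) * seg qs ?pc L P"
          using 0 by (cases L) auto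
      qed
      also have "\<dots> = of_bool (snd x = a \<and> snd x' = b) * rest n' x' (seg qs ?pc)" by (rule rest_cmult)
      also have "\<dots> \<le> of_bool (snd x = a \<and> snd x' = b) * \<gamma> ^ prescribed qs"
        using rest_seg[OF n(2), of ?pc x'] nf by (intro mult_left_mono) (auto split: if_splits)
      finally show "rest n' x' (\<lambda>L. seg pm ?pc (x # L)) \<le>
        of_bool (snd x = a \<and> snd x' = b) * \<gamma> ^ prescribed qs" .
    qed
    finally show ?thesis by (simp add: sum_distrib_right mult.assoc)
  qed
  then show ?case by (simp only: sum_distrib_right sum_mono)
next
  case (Suc m)
  define pm' where "pm' = replicate m None @ Some (a, b) # qs"
  obtain n' where n: "n = Suc n'" "length pm' = n'" using Suc.prems by (auto simp: pm'_def)
  let ?pc = "replicate t None :: ('v \<times> 'v) option list"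
  have pm: "pm = None # pm'" using Suc.prems by (simp add: pm'_def)
  have "(\<Sum>x \<in> X. c x * rest n x (seg pm ?pc)) = (\<Sum>x \<in> X. \<Sum>x' \<in> X. S x x' * rest n' x' (seg pm' ?pc))"
  proof (rule sum.cong)
    fix x
    show "c x * rest n x (seg pm ?pc) = (\<Sum>x' \<in> X. S x x' * rest n' x' (seg pm' ?pc))"
      unfolding n(1) pm rest_Suc_None using S_zero[of x] by (cases "c x = 0") auto
  qed simp
  also have "\<dots> = (\<Sum>x' \<in> X. \<Sum>x \<in> X. S x' x * rest n' x' (seg pm' ?pc))"
    by (subst sum.swap) (simp add: S_sym)
  also have "\<dots> = (\<Sum>x' \<in> X. c x' * rest n' x' (seg pm' ?pc))"
    by (simp add: sum_distrib_right[symmetric] sum_S)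
  finally show ?case using Suc.IH[OF pm'_def n(2)] by simp
qed

section \<open>Collisions\<close>

definition interior :: "'v list \<Rightarrow> 'v set" where "interior P = set (butlast (tl P))"

text \<open>\<open>Z\<close> holds the vertices already in use. The ends of the ray \<open>P\<close>
  are left out, since they are the start vertex of the walk and the last vertex of the
  zigzag.\<close>

definition coll :: "'v set \<Rightarrow> 'v list \<Rightarrow> 'v list \<Rightarrow> bool" where
  "coll Z ms P \<longleftrightarrow> \<not> (distinct ms \<and> set ms \<inter> Z = {} \<and> interior P \<inter> (Z \<union> set ms) = {})"

text \<open>A vertex in the interior cuts the ray into two pieces shorter than \<open>t\<close>, so
  flatness bounds their transition probabilities by \<kappa> i and \<kappa> (t - i). The product of
  these is \<kappa> t times G / \<Delta>.\<close>

lemma ray_hits: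
  assumes i: "0 < i" "i < t"
  shows "(\<Sum>P \<in> {P \<in> R u. last P = z \<and> P ! i = w}. wt P) \<le> \<gamma> * bw z"
proof (cases "{P \<in> R u. last P = z \<and> P ! i = w} = {}")
  case True
  show ?thesis unfolding True using \<gamma>_pos bw_nonneg[of z] by simp
next
  case False
  then obtain P0 where P0: "P0 \<in> R u" "last P0 = z" "P0 ! i = w" by blast
  have wV: "w \<in> V" using R_nth_V[OF P0(1), of i] i P0 by simp
  have "(\<Sum>P \<in> {P \<in> R u. last P = z \<and> P ! i = w}. wt P) \<le>
    wsum t u (\<lambda>P. of_bool ((last P = z \<and> P ! i = w) \<and> P \<in> R u))" by (rule sum_R_le)
  also have "\<dots> \<le> wsum t u (\<lambda>P. (\<lambda>a b. of_bool (a = w \<and> b = z)) (P ! i) (P ! (i + (t - i))))"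
    by (rule wsum_mono) (use R_last_nth i in auto)
  also have "\<dots> = (\<Sum>a \<in> V. tr i u a * (\<Sum>b \<in> V. tr (t - i) a b * of_bool (a = w \<and> b = z)))"
    by (rule wsum_window[OF u]) (use i in simp)
  also have "\<dots> \<le> (\<Sum>a \<in> V. if a = w then tr i u w * tr (t - i) w z else 0)"
  proof (rule sum_mono)
    fix a assume a: "a \<in> V"
    show "tr i u a * (\<Sum>b \<in> V. tr (t - i) a b * of_bool (a = w \<and> b = z))
      \<le> (if a = w then tr i u w * tr (t - i) w z else 0)"
    proof (cases "a = w")
      case True
      have "(\<Sum>b \<in> V. tr (t - i) a b * of_bool (a = w \<and> b = z)) = (\<Sum>b \<in> V. if b = z then tr (t - i) a b else 0)"
        using True by (intro sum.cong) auto
      also have "\<dots> \<le> tr (t - i) a z" using finV tr_nonneg[of "t - i" a z] by simp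
      finally show ?thesis using True by (simp add: mult_left_mono tr_nonneg)
    qed simp
  qed
  also have "\<dots> = tr i u w * tr (t - i) w z" using finV wV by simp
  also have "\<dots> \<le> \<kappa> i * \<kappa> (t - i)"
  proof (intro mult_mono tr_nonneg)
    note fl = R_flat[OF u P0(1), THEN conjunct2, unfolded flat_walk_def, rule_format]
    show "tr i u w \<le> \<kappa> i"
      using fl[of i 0] i R_length[OF P0(1)] P0 R_hd[OF P0(1)] by simp
    show "tr (t - i) w z \<le> \<kappa> (t - i)"
      using fl[of "t - i" i] i R_length[OF P0(1)] P0 R_last_nth[OF P0(1)] by simp
  qed (use \<kappa>_pos[of i] in simp)
  also have "\<kappa> i * \<kappa> (t - i) = G / \<Delta> * \<kappa> t"
  proof -
    define A where "A = G ^ (i - 1)"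
    define B where "B = G ^ (t - i - 1)"
    have AB: "0 < A" "0 < B" using G1 by (auto simp: A_def B_def)
    have e: "t - 1 = Suc ((i - 1) + (t - i - 1))" using i by simp
    have "\<kappa> t = 1 / (\<Delta> * G ^ (t - 1))" using t2 by (simp add: \<kappa>_def)
    also have "G ^ (t - 1) = G * (A * B)" unfolding e by (simp only: A_def B_def power_Suc power_add)
    finally have "\<kappa> t = 1 / (\<Delta> * (G * (A * B)))" .
    moreover have "\<kappa> i = 1 / (\<Delta> * A)" "\<kappa> (t - i) = 1 / (\<Delta> * B)"
      using i by (auto simp: \<kappa>_def A_def B_def)
    ultimately show ?thesis using AB G1 \<Delta>1 by simp
  qed
  also have "\<dots> = \<gamma> * \<theta>" using \<eta>_pos[of t] by (simp add: \<gamma>_def \<theta>_def)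
  also have "\<dots> \<le> \<gamma> * bw z" using bw_ge[OF P0(1)] P0 \<gamma>_pos by simp
  finally show ?thesis .
qed

lemma interior_nth: "P \<in> R u \<Longrightarrow> v \<in> interior P \<Longrightarrow> \<exists>i. 0 < i \<and> i < t \<and> P ! i = v"
proof -
  assume P: "P \<in> R u" and v: "v \<in> interior P"
  obtain j where j: "j < length (butlast (tl P))" "butlast (tl P) ! j = v"
    using v by (auto simp: interior_def in_set_conv_nth)
  then have "P ! Suc j = v" using R_length[OF P] by (simp add: nth_butlast nth_tl)
  then show ?thesis using j R_length[OF P] by (intro exI[of _ "Suc j"]) auto
qed

text \<open>A union bound: hitting a given vertex costs at most \<gamma> at each zigzag step and at
  each interior position of the ray. In the induction every new zigzag vertex joins
  \<open>Z\<close>.\<close>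

lemma rest_coll:
  assumes "finite Z"
  shows "rest n x (\<lambda>L P. of_bool (coll Z (map snd (tl L)) P)) \<le> real (n + t) * real (card Z + n) * \<gamma>"
  using assms
proof (induction n arbitrary: x Z)
  case 0
  show ?case
  proof (cases "c x = 0")
    case True
    then show ?thesis using \<gamma>_pos by simp
  next
    case False
    then have cp: "c x > 0" using c_nonneg[of x] by simp
    have "(\<Sum>P \<in> {P \<in> R u. (True, last P) = x}. wt P * of_bool (coll Z [] P)) \<le>
      (\<Sum>P \<in> {P \<in> R u. (True, last P) = x}. wt P * (\<Sum>i \<in> {1..<t}. \<Sum>w \<in> Z. of_bool (P ! i = w)))"
    proof (intro sum_mono mult_left_mono wt_nonneg)
      fix P assume P: "P \<in> {P \<in> R u. (True, last P) = x}"
      show "of_bool (coll Z [] P) \<le> (\<Sum>i \<in> {1..<t}. \<Sum>w \<in> Z. of_bool (P ! i = w) :: real)"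
      proof (cases "coll Z [] P")
        case True
        then obtain v where v: "v \<in> interior P" "v \<in> Z" by (auto simp: coll_def)
        then obtain i where i: "0 < i" "i < t" "P ! i = v" using interior_nth P by blast
        have "1 = (of_bool (P ! i = v) :: real)" using i by simp
        also have "\<dots> \<le> (\<Sum>w \<in> Z. of_bool (P ! i = w))"
          by (rule member_le_sum) (use v 0 in auto)
        also have "\<dots> \<le> (\<Sum>i \<in> {1..<t}. \<Sum>w \<in> Z. of_bool (P ! i = w))"
          by (rule member_le_sum[of i]) (use i in \<open>auto intro: sum_nonneg\<close>)
        finally show ?thesis using True by simp
      qed (auto intro!: sum_nonneg)
    qed
    also have "\<dots> = (\<Sum>i \<in> {1..<t}. \<Sum>w \<in> Z. \<Sum>P \<in> {P \<in> R u. (True, last P) = x}. wt P * of_bool (P ! i = w))"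
      by (simp only: sum_distrib_left) (subst sum.swap, intro sum.cong refl, rule sum.swap)
    also have "\<dots> \<le> (\<Sum>i \<in> {1..<t}. \<Sum>w \<in> Z. \<gamma> * c x)"
    proof (intro sum_mono)
      fix i w assume i: "i \<in> {1..<t}"
      have "(\<Sum>P \<in> {P \<in> R u. (True, last P) = x}. wt P * of_bool (P ! i = w)) =
        (\<Sum>P \<in> {P \<in> R u. (True, last P) = x \<and> P ! i = w}. wt P)"
        using finR by (intro sum.mono_neutral_cong_right) auto
      also have "\<dots> \<le> \<gamma> * c x"
      proof (cases "fst x")
        case True
        then have e: "{P \<in> R u. (True, last P) = x \<and> P ! i = w} = {P \<in> R u. last P = snd x \<and> P ! i = w}"
          by (cases x) auto
        show ?thesis unfolding e using ray_hits[of i "snd x" w] i True by (simp add: c_def)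
      next
        case False
        then have e: "{P \<in> R u. (True, last P) = x \<and> P ! i = w} = {}" by auto
        show ?thesis unfolding e using \<gamma>_pos cp by simp
      qed
      finally show "(\<Sum>P \<in> {P \<in> R u. (True, last P) = x}. wt P * of_bool (P ! i = w)) \<le> \<gamma> * c x" .
    qed
    also have "\<dots> = real (t - 1) * real (card Z) * \<gamma> * c x" by simp
    also have "\<dots> \<le> real t * real (card Z) * \<gamma> * c x"
      using \<gamma>_pos cp by (intro mult_right_mono) auto
    finally show ?thesis using cp by (simp add: divide_le_eq)
  qed
next
  case (Suc n)
  show ?case
  proof (cases "c x = 0")
    case True
    then show ?thesis using \<gamma>_pos by simp
  next
    case False
    then have cp: "c x > 0" using c_nonneg[of x] by simp
    let ?B = "real (n + t) * real (card Z + Suc n) * \<gamma>"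
    have "rest n x' (\<lambda>L P. of_bool (coll Z (map snd (tl (x # L))) P)) \<le> of_bool (snd x' \<in> Z) + ?B" for x'
    proof -
      have "rest n x' (\<lambda>L P. of_bool (coll Z (map snd (tl (x # L))) P)) \<le>
        rest n x' (\<lambda>L P. of_bool (snd x' \<in> Z) * 1 + of_bool (coll (insert (snd x') Z) (map snd (tl L)) P))"
      proof (rule rest_mono)
        fix L P assume "L \<noteq> []" "hd L = x'"
        then show "of_bool (coll Z (map snd (tl (x # L))) P) \<le>
          of_bool (snd x' \<in> Z) * 1 + (of_bool (coll (insert (snd x') Z) (map snd (tl L)) P) :: real)"
          by (cases L) (auto simp: coll_def)
      qed
      also have "\<dots> = of_bool (snd x' \<in> Z) * rest n x' (\<lambda>L P. 1) +
          rest n x' (\<lambda>L P. of_bool (coll (insert (snd x') Z) (map snd (tl L)) P))"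
        by (simp only: rest_add rest_cmult)
      also have "\<dots> \<le> of_bool (snd x' \<in> Z) * 1 +
          real (n + t) * real (card (insert (snd x') Z) + n) * \<gamma>"
        using rest_one_le Suc.IH[of "insert (snd x') Z" x'] Suc.prems
        by (intro add_mono mult_left_mono) auto
      also have "\<dots> \<le> of_bool (snd x' \<in> Z) * 1 + ?B"
        using Suc.prems \<gamma>_pos by (intro add_mono mult_right_mono mult_left_mono) (auto simp: card_insert_if)
      finally show ?thesis by simp
    qed
    then have "(\<Sum>x' \<in> X. S x x' * rest n x' (\<lambda>L P. of_bool (coll Z (map snd (tl (x # L))) P))) \<le>
      (\<Sum>x' \<in> X. S x x' * (of_bool (snd x' \<in> Z) + ?B))"
      by (intro sum_mono mult_left_mono S_nonneg)
    also have "\<dots> = (\<Sum>x' \<in> X. S x x' * of_bool (snd x' \<in> Z)) + c x * ?B"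
      by (simp add: distrib_left sum.distrib sum_distrib_right[symmetric] sum_S)
    also have "(\<Sum>x' \<in> X. S x x' * of_bool (snd x' \<in> Z)) = (\<Sum>x' \<in> X. \<Sum>w \<in> Z. S x x' * of_bool (snd x' = w))"
    proof (rule sum.cong)
      fix x' :: "bool \<times> 'v"
      have "of_bool (snd x' \<in> Z) = (\<Sum>w \<in> Z. of_bool (snd x' = w) :: real)"
        using Suc.prems by (auto simp: of_bool_def)
      then show "S x x' * of_bool (snd x' \<in> Z) = (\<Sum>w \<in> Z. S x x' * of_bool (snd x' = w))"
        by (simp add: sum_distrib_left)
    qed simp
    also have "\<dots> = (\<Sum>w \<in> Z. \<Sum>x' \<in> X. S x x' * of_bool (snd x' = w))" by (rule sum.swap)
    also have "\<dots> \<le> (\<Sum>w \<in> Z. \<gamma> * c x)" by (intro sum_mono sum_S_snd)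
    also have "(\<Sum>w \<in> Z. \<gamma> * c x) + c x * ?B = c x * (real (card Z) * \<gamma> + ?B)"
      by (simp add: algebra_simps)
    also have "\<dots> \<le> c x * (real (Suc n + t) * real (card Z + Suc n) * \<gamma>)"
      using cp \<gamma>_pos by (intro mult_left_mono) (auto simp: algebra_simps)
    finally show ?thesis using cp by (simp add: divide_le_eq mult_ac)
  qed
qed

end

end

section \<open>The measure on closed walks and its reversal symmetry\<close>

lemma successively_append_Cons:
  "successively Q (as @ [v]) \<Longrightarrow> successively Q (v # bs) \<Longrightarrow> successively Q (as @ v # bs)"
  by (auto simp: successively_append_iff)

context ray_system
begin

lemma walks_successively: "P \<in> walks s u \<Longrightarrow> successively (\<lambda>a b. b \<in> N a) P"
proof (induction s arbitrary: P u)
  case (Suc s)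
  then obtain w Q where "P = u # Q" "w \<in> N u" "Q \<in> walks s w" by auto
  then show ?case using Suc.IH walks_hd[of Q s w] by (auto simp: successively_Cons)
qed auto

lemma successively_subset_V:
  "successively (\<lambda>a b. b \<in> N a) xs \<Longrightarrow> xs = [] \<or> hd xs \<in> V \<Longrightarrow> set xs \<subseteq> V"
proof (induction xs)
  case (Cons x xs)
  then show ?case using NV[of x] by (auto simp: successively_Cons)
qed simp

text \<open>The product of \<open>S\<close> over the steps divided by the product of
  \<open>c\<close> over all vertices, both ends included. Unlike a product of transition
  probabilities it is invariant under reversal (\<open>val_rev\<close>).\<close>

fun val :: "'v \<Rightarrow> (bool \<times> 'v) list \<Rightarrow> real" where
  "val u (x # x' # L) = S u x x' / c u x * val u (x' # L)"
| "val u [x] = 1 / c u x"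
| "val u [] = 1"

lemma val_snoc: "val u (L @ [x, y]) = val u (L @ [x]) * S u x y / c u y"
proof (induction L)
  case (Cons a L)
  then show ?case by (cases L) auto
qed simp

lemma val_rev: "u \<in> V \<Longrightarrow> val u (rev L) = val u L"
proof (induction L rule: induct_list012)
  case (3 x x' L)
  then show ?case using val_snoc[of u "rev L" x' x] S_sym[of u x x'] by simp
qed auto

text \<open>Together with two rays of length \<open>t\<close> this gives length 2 l. The number is
  even, so the zigzag can lead from an end point to an end point.\<close>

definition steps :: nat where "steps = 2 * (l - t)"

definition chains :: "nat \<Rightarrow> (bool \<times> 'v) list set" where
  "chains n = {L. set L \<subseteq> X \<and> length L = Suc n}"

text \<open>Unfolding the recursion into a single sum makes the two rays of a closed walk play
  symmetric parts, which is what \<open>tot_rev\<close> needs.\<close>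

lemma rest_closed:
  assumes u: "u \<in> V" and x: "x \<in> X"
  shows "rest u n x F = (\<Sum>L \<in> chains n. of_bool (hd L = x) * (val u L *
    (\<Sum>P \<in> R u. of_bool (last L = (True, last P)) * (wt P * F L P))))"
  using x
proof (induction n arbitrary: x F)
  case 0
  have ch: "chains 0 = (\<lambda>y. [y]) ` X" by (auto simp: chains_def length_Suc_conv)
  have "(\<Sum>L \<in> chains 0. of_bool (hd L = x) * (val u L *
    (\<Sum>P \<in> R u. of_bool (last L = (True, last P)) * (wt P * F L P)))) =
    (\<Sum>y \<in> X. if y = x then (\<Sum>P \<in> R u. of_bool (y = (True, last P)) * (wt P * F [y] P)) / c u y else 0)"
    unfolding ch by (subst sum.reindex) (auto simp: inj_on_def of_bool_def intro!: sum.cong)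
  also have "\<dots> = (\<Sum>P \<in> R u. of_bool (x = (True, last P)) * (wt P * F [x] P)) / c u x"
    using 0 finX[OF u] by simp
  also have "(\<Sum>P \<in> R u. of_bool (x = (True, last P)) * (wt P * F [x] P)) =
    (\<Sum>P \<in> {P \<in> R u. (True, last P) = x}. wt P * F [x] P)"
    using finR[OF u] by (intro sum.mono_neutral_cong_right) auto
  finally show ?case by (simp only: rest.simps[OF u])
next
  case (Suc n)
  let ?f = "\<lambda>L F. \<Sum>P \<in> R u. of_bool (last L = (True, last P)) * (wt P * F L P)"
  have fin: "finite (chains n)"
    unfolding chains_def using finite_lists_length_eq[OF finX[OF u]] by simp
  have ne: "L \<noteq> []" if "L \<in> chains n" for L using that by (auto simp: chains_def)
  have hdX: "hd L \<in> X" if "L \<in> chains n" for L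
    using that by (cases L) (auto simp: chains_def)
  have "(\<Sum>L \<in> chains (Suc n). of_bool (hd L = x) * (val u L * ?f L F)) =
    (\<Sum>L \<in> (#) x ` chains n. val u L * ?f L F)"
  proof (rule sum.mono_neutral_cong_right)
    show "finite (chains (Suc n))"
      unfolding chains_def using finite_lists_length_eq[OF finX[OF u]] by simp
    show "(#) x ` chains n \<subseteq> chains (Suc n)" using Suc.prems by (auto simp: chains_def)
    show "\<forall>L \<in> chains (Suc n) - (#) x ` chains n. of_bool (hd L = x) * (val u L * ?f L F) = 0"
      by (auto simp: chains_def length_Suc_conv image_iff)
  qed auto
  also have "\<dots> = (\<Sum>L \<in> chains n. val u (x # L) * ?f (x # L) F)"
    by (subst sum.reindex) auto
  also have "\<dots> = (\<Sum>L \<in> chains n. S u x (hd L) * (val u L * ?f L (\<lambda>L. F (x # L))) / c u x)"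
  proof (rule sum.cong)
    fix L assume "L \<in> chains n"
    then obtain y L' where "L = y # L'" using ne by (cases L) auto
    then show "val u (x # L) * ?f (x # L) F = S u x (hd L) * (val u L * ?f L (\<lambda>L. F (x # L))) / c u x"
      by simp
  qed simp
  also have "\<dots> = (\<Sum>L \<in> chains n. S u x (hd L) * (val u L * ?f L (\<lambda>L. F (x # L)))) / c u x"
    by (simp add: sum_divide_distrib)
  also have "(\<Sum>L \<in> chains n. S u x (hd L) * (val u L * ?f L (\<lambda>L. F (x # L)))) =
    (\<Sum>L \<in> chains n. \<Sum>x' \<in> X. S u x x' * (of_bool (hd L = x') * (val u L * ?f L (\<lambda>L. F (x # L)))))"
  proof (rule sum.cong)
    fix L assume L: "L \<in> chains n"
    have "(\<Sum>x' \<in> X. S u x x' * (of_bool (hd L = x') * (val u L * ?f L (\<lambda>L. F (x # L))))) =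
      (\<Sum>x' \<in> X. if x' = hd L then S u x x' * (val u L * ?f L (\<lambda>L. F (x # L))) else 0)"
      by (intro sum.cong) auto
    also have "\<dots> = S u x (hd L) * (val u L * ?f L (\<lambda>L. F (x # L)))"
      using finX[OF u] hdX[OF L] by simp
    finally show "S u x (hd L) * (val u L * ?f L (\<lambda>L. F (x # L))) =
      (\<Sum>x' \<in> X. S u x x' * (of_bool (hd L = x') * (val u L * ?f L (\<lambda>L. F (x # L)))))" by simp
  qed simp
  also have "\<dots> = (\<Sum>x' \<in> X. S u x x' *
    (\<Sum>L \<in> chains n. of_bool (hd L = x') * (val u L * ?f L (\<lambda>L. F (x # L)))))"
    by (subst sum.swap) (simp only: sum_distrib_left)
  also have "\<dots> = (\<Sum>x' \<in> X. S u x x' * rest u n x' (\<lambda>L. F (x # L)))"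
    by (intro sum.cong refl) (simp only: Suc.IH)
  finally show ?case by (simp only: rest.simps[OF u])
qed

definition tot :: "'v \<Rightarrow> ('v list \<Rightarrow> (bool \<times> 'v) list \<Rightarrow> 'v list \<Rightarrow> real) \<Rightarrow> real" where
  "tot u F = (\<Sum>P \<in> R u. wt P * rest u steps (True, last P) (F P))"

lemma last_X: "u \<in> V \<Longrightarrow> P \<in> R u \<Longrightarrow> (True, last P) \<in> X"
  using R_nth_V[of u P t] R_last_nth[of u P] by (simp add: X_def)

lemma tot_rev:
  assumes u: "u \<in> V"
  shows "tot u F = tot u (\<lambda>P L P'. F P' (rev L) P)"
proof -
  have cl: "tot u F = (\<Sum>P \<in> R u. \<Sum>P' \<in> R u. \<Sum>L \<in> chains steps.
      of_bool (hd L = (True, last P) \<and> last L = (True, last P')) * (wt P * wt P' * val u L * F P L P'))" for F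
  proof -
    have "tot u F = (\<Sum>P \<in> R u. \<Sum>L \<in> chains steps. \<Sum>P' \<in> R u.
      of_bool (hd L = (True, last P) \<and> last L = (True, last P')) * (wt P * wt P' * val u L * F P L P'))"
      unfolding tot_def
      by (intro sum.cong refl) (simp add: rest_closed[OF u last_X[OF u]] sum_distrib_left mult_ac of_bool_conj)
    then show ?thesis by (simp only: sum.swap[of _ "chains steps" "R u"])
  qed
  have "tot u F = (\<Sum>P' \<in> R u. \<Sum>P \<in> R u. \<Sum>L \<in> chains steps.
      of_bool (hd L = (True, last P) \<and> last L = (True, last P')) * (wt P * wt P' * val u L * F P L P'))"
    unfolding cl by (rule sum.swap)
  also have "\<dots> = tot u (\<lambda>P L P'. F P' (rev L) P)"
    unfolding cl[of "\<lambda>P L P'. F P' (rev L) P"]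
  proof (rule sum.cong[OF refl], rule sum.cong[OF refl])
    fix P' P
    show "(\<Sum>L \<in> chains steps.
      of_bool (hd L = (True, last P) \<and> last L = (True, last P')) * (wt P * wt P' * val u L * F P L P')) =
      (\<Sum>L \<in> chains steps.
      of_bool (hd L = (True, last P') \<and> last L = (True, last P)) * (wt P' * wt P * val u L * F P (rev L) P'))"
      by (rule sum.reindex_bij_witness[of _ rev rev])
        (auto simp: chains_def val_rev[OF u] hd_rev last_rev)
  qed
  finally show ?thesis .
qed

text \<open>The zigzag shares its first vertex with the end of \<open>P\<close> and its last vertex
  with the end of \<open>P'\<close>, so one copy of each is dropped.\<close>

definition wlk :: "'v list \<Rightarrow> (bool \<times> 'v) list \<Rightarrow> 'v list \<Rightarrow> 'v list" where
  "wlk P L P' = butlast P @ map snd L @ tl (rev P')"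

text \<open>A positive linear functional on functions of closed walks: the start vertex is weighted
  by the invariant measure, the first ray by its probability, and the remainder by
  \<open>rest\<close>.\<close>

definition closed_sum :: "('v list \<Rightarrow> real) \<Rightarrow> real" where
  "closed_sum F = (\<Sum>u \<in> V. dg u * tot u (\<lambda>P L P'. F (wlk P L P')))"

lemma closed_sum_rev: "closed_sum F = closed_sum (\<lambda>xs. F (rev xs))"
proof -
  have "rev (wlk P L P') = wlk P' (rev L) P" for P L P'
    by (simp add: wlk_def rev_map butlast_rev[symmetric]) (metis butlast_rev rev_rev_ident)
  then have "tot u (\<lambda>P L P'. F (rev (wlk P L P'))) = tot u (\<lambda>P L P'. F (wlk P L P'))"
    if "u \<in> V" for u
    using tot_rev[OF that, of "\<lambda>P L P'. F (wlk P L P')"] by (simp only:)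
  then show ?thesis unfolding closed_sum_def by (intro sum.cong refl) (simp only:)
qed

lemma closed_sum_cong_le:
  assumes "\<And>u P L P'. u \<in> V \<Longrightarrow> P \<in> R u \<Longrightarrow> P' \<in> R u \<Longrightarrow> L \<noteq> [] \<Longrightarrow> length L = Suc steps \<Longrightarrow>
    hd L = (True, last P) \<Longrightarrow> last L = (True, last P') \<Longrightarrow> successively (\<lambda>a b. S u a b \<noteq> 0) L \<Longrightarrow>
    F (wlk P L P') \<le> F' (wlk P L P')"
  shows "closed_sum F \<le> closed_sum F'"
  unfolding closed_sum_def tot_def
proof (rule sum_mono, rule mult_left_mono, rule sum_mono, rule mult_left_mono)
  fix u P assume u: "u \<in> V" and P: "P \<in> R u"
  show "rest u steps (True, last P) (\<lambda>L P'. F (wlk P L P')) \<le> rest u steps (True, last P) (\<lambda>L P'. F' (wlk P L P'))"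
  proof (rule rest_mono[OF u])
    fix L P'
    assume "L \<noteq> []" "hd L = (True, last P)" "length L = Suc steps" "P' \<in> R u"
      "last L = (True, last P')" "successively (\<lambda>a b. S u a b \<noteq> 0) L"
    then show "F (wlk P L P') \<le> F' (wlk P L P')" by (intro assms[OF u P])
  qed
qed (auto simp: wt_nonneg)

lemma closed_sum_add: "closed_sum (\<lambda>xs. F xs + F' xs) = closed_sum F + closed_sum F'"
proof -
  have "tot u (\<lambda>P L P'. F (wlk P L P') + F' (wlk P L P')) =
    tot u (\<lambda>P L P'. F (wlk P L P')) + tot u (\<lambda>P L P'. F' (wlk P L P'))" if "u \<in> V" for u
    unfolding tot_def rest_add[OF that] by (simp add: distrib_left sum.distrib)
  then have "closed_sum (\<lambda>xs. F xs + F' xs) = (\<Sum>u \<in> V. dg u * tot u (\<lambda>P L P'. F (wlk P L P')) +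
      dg u * tot u (\<lambda>P L P'. F' (wlk P L P')))"
    unfolding closed_sum_def by (intro sum.cong refl) (simp only: distrib_left)
  then show ?thesis by (simp only: closed_sum_def sum.distrib)
qed

lemma closed_sum_cmult: "closed_sum (\<lambda>xs. a * F xs) = a * closed_sum F"
proof -
  have "tot u (\<lambda>P L P'. a * F (wlk P L P')) = a * tot u (\<lambda>P L P'. F (wlk P L P'))" if "u \<in> V" for u
    unfolding tot_def rest_cmult[OF that] by (simp add: sum_distrib_left mult_ac)
  then have "closed_sum (\<lambda>xs. a * F xs) = (\<Sum>u \<in> V. a * (dg u * tot u (\<lambda>P L P'. F (wlk P L P'))))"
    unfolding closed_sum_def by (intro sum.cong refl) (simp only: mult.left_commute)
  then show ?thesis by (simp only: closed_sum_def sum_distrib_left)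
qed

lemma TT_0: "closed_sum (\<lambda>xs. 0) = 0"
  using closed_sum_cmult[of 0 "\<lambda>_. 0"] by simp

lemma closed_sum_sum: "closed_sum (\<lambda>xs. \<Sum>i \<in> I. F i xs) = (\<Sum>i \<in> I. closed_sum (F i))"
proof (induction I rule: infinite_finite_induct)
  case (insert i I)
  then show ?case by (simp add: closed_sum_add)
qed (auto simp: TT_0)

lemma S_adj: "u \<in> V \<Longrightarrow> S u x x' \<noteq> 0 \<Longrightarrow> snd x' \<in> N (snd x)"
proof -
  assume u: "u \<in> V" and S: "S u x x' \<noteq> 0"
  have adj: "z \<in> N y \<and> y \<in> N z" if A: "Aw u y z \<noteq> 0" for y z
  proof -
    obtain P where P: "P \<in> R u" "P ! (t - 1) = y" "last P = z" using Aw_pos[OF u A] by blast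
    have "P ! Suc (t - 1) \<in> N (P ! (t - 1))"
      using walks_adj[of P t u "t - 1"] R_walks[OF u] P t2 by auto
    then have "z \<in> N y" using P R_last_nth[OF u P(1)] t2 by simp
    moreover have "y \<in> V" using R_nth_V[OF u P(1), of "t - 1"] P by simp
    ultimately show ?thesis using sym by blast
  qed
  show ?thesis using S adj by (auto simp: S_def[OF u] split: if_splits)
qed

definition closed_walk :: "'v list \<Rightarrow> bool" where
  "closed_walk xs \<longleftrightarrow> set xs \<subseteq> V \<and> length xs = Suc (2 * l) \<and> hd xs = last xs \<and>
    successively (\<lambda>a b. b \<in> N a) xs"

lemma wlk_alt:
  assumes "P \<noteq> []" "L \<noteq> []" "hd L = (True, last P)"
  shows "wlk P L P' = P @ map snd (tl L) @ tl (rev P')"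
  using assms append_butlast_last_id[of P] by (cases L) (auto simp: wlk_def)

lemma closed_walk_wlk:
  assumes u: "u \<in> V" and P: "P \<in> R u" and P': "P' \<in> R u" and L: "L \<noteq> []" "length L = Suc steps"
    and hl: "hd L = (True, last P)" "last L = (True, last P')"
    and S: "successively (\<lambda>a b. S u a b \<noteq> 0) L"
  shows "closed_walk (wlk P L P')"
proof -
  have len: "length P = Suc t" "length P' = Suc t" using R_length[OF u] P P' by auto
  have sP: "successively (\<lambda>a b. b \<in> N a) P" and sP': "successively (\<lambda>a b. b \<in> N a) P'"
    using walks_successively R_walks[OF u] P P' by blast+
  have PV: "set P \<subseteq> V" "set P' \<subseteq> V" using walks_subset[OF _ u] R_walks[OF u] P P' by blast+
  have sR: "successively (\<lambda>a b. b \<in> N a) (rev P')"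
    unfolding successively_rev by (rule successively_mono[OF sP']) (use PV sym in blast)
  have sL: "successively (\<lambda>a b. b \<in> N a) (map snd L)"
    unfolding successively_map by (rule successively_mono[OF S]) (use S_adj[OF u] in auto)
  have ne: "P \<noteq> []" "P' \<noteq> []" using len by auto
  obtain L1 where L1: "L = L1 @ [(True, last P')]" using hl L by (metis append_butlast_last_id)
  obtain Q where Q: "rev P' = last P' # Q" using ne by (cases "rev P'") (auto simp: hd_rev[symmetric])
  have tq: "tl (rev P') = Q" by (simp only: Q list.sel)
  have s1: "successively (\<lambda>a b. b \<in> N a) (map snd L @ tl (rev P'))"
    using successively_append_Cons[of "\<lambda>a b. b \<in> N a" "map snd L1" "last P'" Q] sL sR[unfolded Q] L1
    by (simp add: tq)
  obtain L2 where L2: "L = (True, last P) # L2" using hl L by (metis list.collapse)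
  have s2: "successively (\<lambda>a b. b \<in> N a) (wlk P L P')"
    unfolding wlk_def
    using successively_append_Cons[of "\<lambda>a b. b \<in> N a" "butlast P" "last P" "map snd L2 @ tl (rev P')"]
      s1 sP ne L2 by simp
  have "length (wlk P L P') = Suc (2 * l)"
    using len L tl t2 by (simp add: wlk_def steps_def)
  moreover have hd: "hd (wlk P L P') = u"
    using wlk_alt[OF ne(1) L(1) hl(1)] ne R_hd[OF u P] by (simp add: hd_append hd_conv_nth)
  moreover have "last (wlk P L P') = u"
  proof -
    have "Suc (length Q) = length (rev P')" by (simp only: Q length_Cons)
    then have "Q \<noteq> []" using len t2 by auto
    then have "last (wlk P L P') = last Q" by (simp add: wlk_def tq)
    also have "\<dots> = last (rev P')" using \<open>Q \<noteq> []\<close> by (simp only: Q last_ConsR simp_thms)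
    also have "\<dots> = u" using R_hd[OF u P'] ne by (simp add: last_rev hd_conv_nth)
    finally show ?thesis .
  qed
  moreover have "set (wlk P L P') \<subseteq> V"
    using successively_subset_V[OF s2] hd u by auto
  ultimately show ?thesis using s2 by (simp add: closed_walk_def)
qed

lemma closed_sum_mono: "(\<And>xs. closed_walk xs \<Longrightarrow> F xs \<le> F' xs) \<Longrightarrow> closed_sum F \<le> closed_sum F'"
proof (rule closed_sum_cong_le)
  fix u P L P'
  assume le: "\<And>xs. closed_walk xs \<Longrightarrow> F xs \<le> F' xs"
    and *: "u \<in> V" "P \<in> R u" "P' \<in> R u" "L \<noteq> []" "length L = Suc steps"
    "hd L = (True, last P)" "last L = (True, last P')" "successively (\<lambda>a b. S u a b \<noteq> 0) L"
  show "F (wlk P L P') \<le> F' (wlk P L P')" by (rule le, rule closed_walk_wlk[OF *])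
qed

text \<open>End points of rays have positive \<open>c\<close> and the number of zigzag steps is
  even, so by \<open>rest_one\<close> the zigzag and the second ray integrate to 1 and only the mass
  of the first ray remains.\<close>

lemma closed_sum_one: "closed_sum (\<lambda>_. 1) = (\<Sum>u \<in> V. dg u * sum wt (R u))"
proof -
  have "rest u steps (True, last P) (\<lambda>L P'. 1) = 1" if "u \<in> V" "P \<in> R u" for u P
    using bw_ge[OF that] \<theta>_pos by (intro rest_one[OF that(1)]) (auto simp: c_def[OF that(1)] steps_def)
  then have "tot u (\<lambda>P L P'. 1) = sum wt (R u)" if "u \<in> V" for u
    unfolding tot_def using that by (intro sum.cong) auto
  then show ?thesis unfolding closed_sum_def by (intro sum.cong) auto
qed

text \<open>The first ray has distinct vertices by construction; its vertex set is the initial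
  \<open>Z\<close> of \<open>rest_coll\<close>.\<close>

lemma closed_sum_collision:
  "closed_sum (\<lambda>xs. of_bool (\<not> distinct (butlast xs))) \<le> real (2 * l) * real (2 * l + 1) * \<gamma> * closed_sum (\<lambda>_. 1)"
proof -
  have "rest u steps (True, last P) (\<lambda>L P'. of_bool (\<not> distinct (butlast (wlk P L P')))) \<le>
      real (2 * l) * real (2 * l + 1) * \<gamma>" if u: "u \<in> V" and P: "P \<in> R u" for u P
  proof -
    have len: "length P = Suc t" using R_length[OF u P] .
    have dP: "distinct P" using R_flat[OF u P] by simp
    have "rest u steps (True, last P) (\<lambda>L P'. of_bool (\<not> distinct (butlast (wlk P L P')))) \<le>
      rest u steps (True, last P) (\<lambda>L P'. of_bool (coll (set P) (map snd (tl L)) P'))"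
    proof (rule rest_mono[OF u])
      fix L P' assume L: "L \<noteq> []" "hd L = (True, last P)" and P': "P' \<in> R u"
      have len': "length P' = Suc t" using R_length[OF u P'] .
      have "tl (rev P') \<noteq> []" using len' t2 by (cases "rev P'") auto
      moreover have "P \<noteq> []" using len by auto
      ultimately have e: "butlast (wlk P L P') = P @ map snd (tl L) @ butlast (tl (rev P'))"
        using wlk_alt[of P L P'] L by (auto simp: butlast_append)
      have rb: "rev (butlast xs) = tl (rev xs)" for xs :: "'v list"
        using butlast_rev[of "rev xs"] by simp
      have b: "butlast (tl (rev P')) = rev (butlast (tl P'))"
        by (simp only: rb butlast_rev[symmetric] butlast_tl)
      have "distinct P'" using R_flat[OF u P'] by simp
      then have "distinct (butlast (tl P'))" by (simp add: distinct_butlast distinct_tl)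
      then show "of_bool (\<not> distinct (butlast (wlk P L P'))) \<le>
        (of_bool (coll (set P) (map snd (tl L)) P') :: real)"
        using dP unfolding e b by (auto simp: coll_def[OF u] interior_def[OF u])
    qed
    also have "\<dots> \<le> real (steps + t) * real (card (set P) + steps) * \<gamma>"
      by (rule rest_coll[OF u]) simp
    also have "\<dots> \<le> real (2 * l) * real (2 * l + 1) * \<gamma>"
      using tl t2 dP len \<gamma>_pos
      by (intro mult_right_mono mult_mono) (auto simp: steps_def distinct_card)
    finally show ?thesis .
  qed
  then have "tot u (\<lambda>P L P'. of_bool (\<not> distinct (butlast (wlk P L P')))) \<le>
      (\<Sum>P \<in> R u. wt P * (real (2 * l) * real (2 * l + 1) * \<gamma>))" if "u \<in> V" for u
    unfolding tot_def using that by (intro sum_mono mult_left_mono wt_nonneg)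
  then have "closed_sum (\<lambda>xs. of_bool (\<not> distinct (butlast xs))) \<le>
    (\<Sum>u \<in> V. dg u * (\<Sum>P \<in> R u. wt P * (real (2 * l) * real (2 * l + 1) * \<gamma>)))"
    unfolding closed_sum_def by (intro sum_mono mult_left_mono) auto
  also have "\<dots> = real (2 * l) * real (2 * l + 1) * \<gamma> * closed_sum (\<lambda>_. 1)"
    unfolding closed_sum_one by (simp add: sum_distrib_left sum_distrib_right mult_ac)
  finally show ?thesis .
qed

lemma matches_wlk:
  assumes u: "u \<in> V" and P: "P \<in> R u" and P': "P' \<in> R u" and L: "L \<noteq> []" "length L = Suc steps"
    and hl: "hd L = (True, last P)" "last L = (True, last P')"
    and len: "length pa = t" "length pm = steps" "length pc = t"
  shows "matches (pa @ pm @ pc) (wlk P L P') \<longleftrightarrow>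
    matches pa P \<and> matches pm (map snd L) \<and> matches pc (rev P')"
proof -
  have lP: "length P = Suc t" "length P' = Suc t" using R_length[OF u] P P' by auto
  have ne: "P \<noteq> []" "P' \<noteq> []" using lP by auto
  obtain L1 where L1: "L = L1 @ [(True, last P')]" using hl L by (metis append_butlast_last_id)
  obtain L2 where L2: "L = (True, last P) # L2" using hl L by (metis list.collapse)
  obtain Q where Q: "rev P' = last P' # Q" using ne by (cases "rev P'") (auto simp: hd_rev[symmetric])
  have tq: "tl (rev P') = Q" by (simp only: Q list.sel)
  have "matches (pa @ pm @ pc) (butlast P @ last P # (map snd L2 @ Q)) \<longleftrightarrow>
    matches pa (butlast P @ [last P]) \<and> matches (pm @ pc) (last P # (map snd L2 @ Q))"
    using lP len by (intro matches_append) simp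
  moreover have "wlk P L P' = butlast P @ last P # (map snd L2 @ Q)"
    using L2 by (simp add: wlk_def tq)
  moreover have "last P # (map snd L2 @ Q) = map snd L1 @ last P' # Q"
    using L1 L2 by (metis (no_types, lifting) append_Cons append_assoc append_Nil list.simps(8,9) map_append snd_conv)
  moreover have "matches (pm @ pc) (map snd L1 @ last P' # Q) \<longleftrightarrow>
    matches pm (map snd L1 @ [last P']) \<and> matches pc (last P' # Q)"
    using L L1 len by (intro matches_append) simp
  ultimately show ?thesis unfolding Q using L1 ne by simp
qed

text \<open>The first ray is relaxed to an arbitrary walk and charged to
  \<open>marginal_matches\<close>, where one prescribed step is free. The zigzag and the second ray
  are bounded uniformly in the end of the first.\<close>

lemma closed_sum_matches_le:
  assumes len: "length pa = t" "length pm = steps" "length pc = t"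
    and B: "0 \<le> B" and rest: "\<And>u P. u \<in> V \<Longrightarrow> P \<in> R u \<Longrightarrow> rest u steps (True, last P)
      (\<lambda>L P'. of_bool (matches pm (map snd L) \<and> matches pc (rev P'))) \<le> B"
    and pa: "prescribed pa > 0"
  shows "closed_sum (\<lambda>xs. of_bool (matches (pa @ pm @ pc) xs)) \<le> (1 / \<Delta>) ^ (prescribed pa - 1) * B"
proof -
  have "tot u (\<lambda>P L P'. of_bool (matches (pa @ pm @ pc) (wlk P L P'))) \<le>
    wsum t u (\<lambda>P. of_bool (matches pa P)) * B" if u: "u \<in> V" for u
  proof -
    have "tot u (\<lambda>P L P'. of_bool (matches (pa @ pm @ pc) (wlk P L P'))) \<le>
      (\<Sum>P \<in> R u. wt P * (of_bool (matches pa P) * B))"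
      unfolding tot_def
    proof (intro sum_mono mult_left_mono wt_nonneg)
      fix P assume P: "P \<in> R u"
      have "rest u steps (True, last P) (\<lambda>L P'. of_bool (matches (pa @ pm @ pc) (wlk P L P'))) \<le>
        rest u steps (True, last P) (\<lambda>L P'. of_bool (matches pa P) *
          of_bool (matches pm (map snd L) \<and> matches pc (rev P')))"
        using matches_wlk[OF u P _ _ _ _ _ len] by (intro rest_mono[OF u]) auto
      also have "\<dots> = of_bool (matches pa P) * rest u steps (True, last P)
          (\<lambda>L P'. of_bool (matches pm (map snd L) \<and> matches pc (rev P')))"
        by (rule rest_cmult[OF u])
      also have "\<dots> \<le> of_bool (matches pa P) * B" using rest[OF u P] by (intro mult_left_mono) auto
      finally show "rest u steps (True, last P) (\<lambda>L P'. of_bool (matches (pa @ pm @ pc) (wlk P L P'))) \<le>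
        of_bool (matches pa P) * B" .
    qed
    also have "\<dots> = (\<Sum>P \<in> R u. wt P * of_bool (matches pa P)) * B"
      by (simp add: sum_distrib_right mult.assoc)
    also have "\<dots> \<le> wsum t u (\<lambda>P. of_bool (matches pa P)) * B"
      unfolding wsum_def using finite_walks[OF u] R_walks[OF u] B
      by (intro mult_right_mono sum_mono2) (auto intro: wt_nonneg)
    finally show ?thesis .
  qed
  then have "closed_sum (\<lambda>xs. of_bool (matches (pa @ pm @ pc) xs)) \<le>
    (\<Sum>u \<in> V. dg u * (wsum t u (\<lambda>P. of_bool (matches pa P)) * B))"
    unfolding closed_sum_def by (intro sum_mono mult_left_mono) auto
  also have "\<dots> = (\<Sum>u \<in> V. dg u * wsum t u (\<lambda>P. of_bool (matches pa P))) * B"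
    by (simp add: sum_distrib_right mult.assoc)
  also have "\<dots> \<le> (1 / \<Delta>) ^ (prescribed pa - 1) * B"
    using B pa len by (intro mult_right_mono marginal_matches) auto
  finally show ?thesis .
qed

lemma closed_sum_anchor:
  assumes len: "length pa = t" "length pm = steps" "length pc = t"
    and pa: "prescribed pa > 0" and nf: "\<not> full (pm @ pc)"
  shows "closed_sum (\<lambda>xs. of_bool (matches (pa @ pm @ pc) xs)) \<le> \<gamma> ^ (prescribed (pa @ pm @ pc) - 1)"
proof -
  obtain u where u: "u \<in> V" using VE by blast
  have nf': "\<not> full pm \<or> \<not> full pc" using nf full_append[OF u] by blast
  have "closed_sum (\<lambda>xs. of_bool (matches (pa @ pm @ pc) xs)) \<le>
      (1 / \<Delta>) ^ (prescribed pa - 1) * \<gamma> ^ prescribed (pm @ pc)"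
  proof (rule closed_sum_matches_le[OF len _ _ pa])
    show "rest u steps (True, last P) (\<lambda>L P'. of_bool (matches pm (map snd L) \<and> matches pc (rev P'))) \<le>
      \<gamma> ^ prescribed (pm @ pc)" if "u \<in> V" for u P
      using rest_seg[OF that len(2,3), of "(True, last P)"] nf by (auto split: if_splits)
  qed (use \<gamma>_pos in auto)
  also have "\<dots> \<le> \<gamma> ^ (prescribed pa - 1) * \<gamma> ^ prescribed (pm @ pc)"
    using inv_\<Delta>_le \<Delta>1 \<gamma>_pos by (intro mult_right_mono power_mono) auto
  also have "\<dots> = \<gamma> ^ (prescribed (pa @ pm @ pc) - 1)"
    using pa by (simp flip: power_add)
  finally show ?thesis .
qed

text \<open>Here the free prescribed step lies on the zigzag: its edge weight, summed over start
  vertices with the degree measure, is at most 1 by invariance (\<open>Aw1\<close>). The factor 2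
  stems from the two ways of tagging the step, from a penultimate vertex to an end point or the
  other way.\<close>

lemma closed_sum_mid:
  assumes "length pm = steps" "prescribed pm > 0"
  shows "closed_sum (\<lambda>xs. of_bool (matches (replicate t None @ pm @ replicate t None) xs)) \<le> 2 * \<gamma> ^ (prescribed pm - 1)"
proof -
  obtain m a b qs where pm: "pm = replicate m None @ Some (a, b) # qs"
    using prescribed_split assms(2) by blast
  let ?pn = "replicate t None :: ('v \<times> 'v) option list"
  have key: "tot u (\<lambda>P L P'. of_bool (matches (?pn @ pm @ ?pn) (wlk P L P'))) \<le>
    (Aw u a b + Aw u b a) * \<gamma> ^ prescribed qs" if u: "u \<in> V" for u
  proof -
    let ?r = "\<lambda>x. rest u steps x (\<lambda>L P'. of_bool (matches pm (map snd L) \<and> matches ?pn (rev P')))"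
    have r0: "0 \<le> ?r x" for x by (rule rest_nonneg[OF u]) simp
    have "tot u (\<lambda>P L P'. of_bool (matches (?pn @ pm @ ?pn) (wlk P L P'))) \<le> (\<Sum>P \<in> R u. wt P * ?r (True, last P))"
      unfolding tot_def
    proof (intro sum_mono mult_left_mono wt_nonneg rest_mono[OF u])
      fix P L P' assume "P \<in> R u" "L \<noteq> []" "hd L = (True, last P)" "length L = Suc steps" "P' \<in> R u"
        "last L = (True, last P')"
      then show "of_bool (matches (?pn @ pm @ ?pn) (wlk P L P')) \<le>
        (of_bool (matches pm (map snd L) \<and> matches ?pn (rev P')) :: real)"
        using matches_wlk[OF u, of P P' L ?pn pm ?pn] assms by auto
    qed
    also have "\<dots> = (\<Sum>z \<in> V. \<Sum>P \<in> {P \<in> R u. last P = z}. wt P * ?r (True, last P))"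
      using finR[OF u] finV R_nth_V[OF u] R_last_nth[OF u] by (intro sum.group[symmetric]) auto
    also have "\<dots> = (\<Sum>z \<in> V. c u (True, z) * ?r (True, z))"
    proof (rule sum.cong[OF refl])
      fix z
      have "(\<Sum>P \<in> {P \<in> R u. last P = z}. wt P * ?r (True, last P)) =
        (\<Sum>P \<in> {P \<in> R u. last P = z}. wt P * ?r (True, z))"
        by (rule sum.cong) auto
      then show "(\<Sum>P \<in> {P \<in> R u. last P = z}. wt P * ?r (True, last P)) = c u (True, z) * ?r (True, z)"
        by (simp only: c_def[OF u] bw_def[OF u] sum_distrib_right[symmetric] fst_conv snd_conv if_True)
    qed
    also have "\<dots> = (\<Sum>x \<in> {True} \<times> V. c u x * ?r x)"
      by (rule sum.reindex_bij_witness[of _ snd "\<lambda>z. (True, z)"]) auto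
    also have "\<dots> \<le> (\<Sum>x \<in> X. c u x * ?r x)"
      using finX[OF u] c_nonneg[OF u] r0 by (intro sum_mono2) (auto simp: X_def)
    also have "\<dots> \<le> (\<Sum>x \<in> X. \<Sum>x' \<in> X. S u x x' * of_bool (snd x = a \<and> snd x' = b)) * \<gamma> ^ prescribed qs"
      by (rule rest_mid[OF u pm assms(1)])
    also have "\<dots> \<le> (Aw u a b + Aw u b a) * \<gamma> ^ prescribed qs"
    proof (intro mult_right_mono)
      have "(\<Sum>x \<in> X. \<Sum>x' \<in> X. S u x x' * of_bool (snd x = a \<and> snd x' = b)) \<le>
        (\<Sum>x \<in> X. \<Sum>x' \<in> X. (if x' = (False, b) then if x = (True, a) then Aw u b a else 0 else 0) +
          (if x' = (True, b) then if x = (False, a) then Aw u a b else 0 else 0))"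
        using Aw_nonneg[OF u] by (intro sum_mono) (auto simp: S_def[OF u])
      also have "\<dots> \<le> (\<Sum>x \<in> X. (if x = (True, a) then Aw u b a else 0) + (if x = (False, a) then Aw u a b else 0))"
        using finX[OF u] Aw_nonneg[OF u] by (intro sum_mono) (auto simp: sum.distrib)
      also have "\<dots> \<le> Aw u a b + Aw u b a"
        using finX[OF u] Aw_nonneg[OF u] by (auto simp: sum.distrib)
      finally show "(\<Sum>x \<in> X. \<Sum>x' \<in> X. S u x x' * of_bool (snd x = a \<and> snd x' = b)) \<le> Aw u a b + Aw u b a" .
    qed (use \<gamma>_pos in simp)
    finally show ?thesis .
  qed
  have Aw1: "(\<Sum>u \<in> V. dg u * Aw u y z) \<le> 1" for y z
  proof (cases "y \<in> V")
    case True
    have "(\<Sum>u \<in> V. dg u * Aw u y z) \<le> (\<Sum>u \<in> V. dg u * (tr (t - 1) u y * (1 / dg y)))"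
      using Aw_le[of _ y z] True by (intro sum_mono mult_left_mono) auto
    also have "\<dots> = (\<Sum>u \<in> V. dg u * tr (t - 1) u y) / dg y"
      by (simp add: sum_divide_distrib)
    also have "\<dots> = 1" using stationary[OF True, of "t - 1"] dg_pos[OF True] by simp
    finally show ?thesis .
  next
    case False
    have "(\<Sum>u \<in> V. dg u * Aw u y z) \<le> (\<Sum>u \<in> V. 0)"
      using Aw_le[of _ y z] False by (intro sum_mono) (auto intro!: mult_nonneg_nonpos)
    then show ?thesis by simp
  qed
  have "closed_sum (\<lambda>xs. of_bool (matches (?pn @ pm @ ?pn) xs)) \<le>
    (\<Sum>u \<in> V. dg u * ((Aw u a b + Aw u b a) * \<gamma> ^ prescribed qs))"
    unfolding closed_sum_def by (intro sum_mono mult_left_mono key) auto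
  also have "\<dots> = ((\<Sum>u \<in> V. dg u * Aw u a b) + (\<Sum>u \<in> V. dg u * Aw u b a)) * \<gamma> ^ prescribed qs"
    by (simp add: sum_distrib_left algebra_simps sum.distrib)
  also have "\<dots> \<le> (1 + 1) * \<gamma> ^ prescribed qs"
    using Aw1 \<gamma>_pos by (intro mult_right_mono add_mono) auto
  finally show ?thesis using pm by simp
qed

text \<open>If the first ray has a prescribed step, \<open>closed_sum_anchor\<close> applies unless
  everything after that ray is prescribed. In that case the first ray itself is not full, and the
  reversed walk can be used; reversal also treats patterns without a prescribed step on the first
  ray but with one on the second. If both rays are free, \<open>closed_sum_mid\<close>
  applies.\<close>

lemma closed_sum_pattern:
  assumes len: "length ps = 2 * l" and j: "prescribed ps > 0" "prescribed ps < 2 * l"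
  shows "closed_sum (\<lambda>xs. of_bool (matches ps xs)) \<le> 2 * \<gamma> ^ (prescribed ps - 1)"
proof -
  obtain u where u: "u \<in> V" using VE by blast
  define pa where "pa = take t ps"
  define pm where "pm = take steps (drop t ps)"
  define pc where "pc = drop steps (drop t ps)"
  have ps: "ps = pa @ pm @ pc" by (simp only: pa_def pm_def pc_def append_take_drop_id)
  have lens: "length pa = t" "length pm = steps" "length pc = t"
    using len tl by (auto simp: pa_def pm_def pc_def steps_def)
  have \<gamma>0: "0 \<le> \<gamma> ^ (prescribed ps - 1)" using \<gamma>_pos by simp
  have nf: "\<not> (full pa \<and> full pm \<and> full pc)"
    using j len ps full_append[OF u] by (metis full_def[OF u] less_irrefl)
  have ne: "full qs \<Longrightarrow> length qs = t \<Longrightarrow> prescribed qs > 0" for qs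
    using t2 by (simp add: full_def[OF u])
  consider (1) "prescribed pa > 0" "\<not> full (pm @ pc)"
    | (2) "prescribed pc > 0" "\<not> full (pa @ pm)"
    | (3) "prescribed pa = 0" "prescribed pc = 0"
    using nf ne lens full_append[OF u] by (metis gr0I)
  then show ?thesis
  proof cases
    case 1
    then show ?thesis using closed_sum_anchor[OF lens 1] ps \<gamma>0 by simp
  next
    case 2
    have "closed_sum (\<lambda>xs. of_bool (matches ps xs)) = closed_sum (\<lambda>xs. of_bool (matches ps (rev xs)))" by (rule closed_sum_rev)
    also have "\<dots> \<le> closed_sum (\<lambda>xs. of_bool (matches (rswap pc @ rswap pm @ rswap pa) xs))"
    proof (rule closed_sum_mono)
      fix xs assume "closed_walk xs"
      then have "matches ps (rev xs) \<longleftrightarrow> matches (rswap ps) xs"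
        using len by (intro matches_rev) (simp add: closed_walk_def)
      then show "of_bool (matches ps (rev xs)) \<le>
          (of_bool (matches (rswap pc @ rswap pm @ rswap pa) xs) :: real)"
        by (simp add: ps rswap_append)
    qed
    also have "\<dots> \<le> \<gamma> ^ (prescribed (rswap pc @ rswap pm @ rswap pa) - 1)"
      by (rule closed_sum_anchor) (use lens 2 full_append[OF u] full_rswap[OF u] in auto)
    also have "\<dots> = \<gamma> ^ (prescribed ps - 1)" by (simp add: ps add_ac)
    finally show ?thesis using \<gamma>0 by simp
  next
    case 3
    then have e: "pa = replicate t None" "pc = replicate t None"
      using prescribed_0[of pa] prescribed_0[of pc] lens by auto
    show ?thesis
      using closed_sum_mid[OF lens(2)] j 3 by (simp add: ps e[symmetric]) (simp add: e)
  qed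
qed

lemma chain_bound_even: "chain_bound (2 * k) = (\<gamma> * \<gamma>') ^ k * ((1 / \<Delta>) ^ t / \<theta>)"
proof -
  obtain u where u: "u \<in> V" using VE by blast
  show ?thesis by (induction k) (auto simp: chain_bound.simps[OF u])
qed

text \<open>The powers of \<open>G\<close> have to add up exactly. Two zigzag steps cost \<gamma>
  \<gamma>', which has a single factor \<open>G\<close>, so the zigzag contributes l - t of them and
  1 / \<theta> another t - 1. Then \<Delta> G ^ (l - 1) = 2 nn eliminates \<open>G\<close>. With
  \<gamma> in place of \<gamma>' there would be too many factors.\<close>

lemma closed_sum_full:
  assumes len: "length ps = 2 * l" and j: "prescribed ps = 2 * l"
  shows "closed_sum (\<lambda>xs. of_bool (matches ps xs)) \<le> (8 / \<eta> 0) ^ (2 * l) * (2 * nn) / \<Delta> ^ (2 * l - 1)"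
proof -
  obtain u where u: "u \<in> V" using VE by blast
  define pa where "pa = take t ps"
  define pm where "pm = take steps (drop t ps)"
  define pc where "pc = drop steps (drop t ps)"
  have ps: "ps = pa @ pm @ pc" by (simp only: pa_def pm_def pc_def append_take_drop_id)
  have lens: "length pa = t" "length pm = steps" "length pc = t"
    using len tl by (auto simp: pa_def pm_def pc_def steps_def)
  have "full ps" using len j by (simp add: full_def[OF u])
  then have f: "full pa" "full pm" "full pc" using ps full_append[OF u] by auto
  have "closed_sum (\<lambda>xs. of_bool (matches (pa @ pm @ pc) xs)) \<le> (1 / \<Delta>) ^ (prescribed pa - 1) * chain_bound steps"
  proof (rule closed_sum_matches_le[OF lens])
    show "rest u steps (True, last P) (\<lambda>L P'. of_bool (matches pm (map snd L) \<and> matches pc (rev P'))) \<le> chain_bound steps"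
      if "u \<in> V" for u P
      by (rule rest_full[OF that lens(2,3) f(2,3)]) (simp add: steps_def)
    show "0 \<le> chain_bound steps" by (rule chain_bound_nonneg[OF u])
    show "0 < prescribed pa" using f lens t2 by (simp add: full_def[OF u])
  qed
  also have "prescribed pa = t" using f lens by (simp add: full_def[OF u])
  also have "chain_bound steps = (\<gamma> * \<gamma>') ^ (l - t) * ((1 / \<Delta>) ^ t / \<theta>)" unfolding steps_def by (rule chain_bound_even)
  finally have 1: "closed_sum (\<lambda>xs. of_bool (matches ps xs)) \<le>
    (1 / \<Delta>) ^ (t - 1) * ((\<gamma> * \<gamma>') ^ (l - t) * ((1 / \<Delta>) ^ t / \<theta>))" unfolding ps .
  define e where "e = 8 / \<eta> t"
  have e1: "1 \<le> e" using \<eta>_pos[of t] \<eta>_le_1[of t] by (simp add: e_def le_divide_eq)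
  have loss_const: "e \<le> 8 / \<eta> 0" unfolding e_def
    using \<eta>_mono[OF tl] \<eta>_pos[of 0] \<eta>_pos[of t] by (intro divide_left_mono) auto
  have gg: "\<gamma> * \<gamma>' = e ^ 2 * G / \<Delta> ^ 2"
    by (simp add: \<gamma>_def \<gamma>'_def e_def power2_eq_square)
  have th: "(1 / \<Delta>) ^ t / \<theta> = e * (\<Delta> * G ^ (t - 1)) / \<Delta> ^ t"
    using t2 \<Delta>1 G1 \<eta>_pos[of t] by (simp add: \<theta>_def \<kappa>_def e_def power_divide)
  have pl: "\<Delta> ^ (t - 1) * \<Delta> ^ (2 * (l - t)) * \<Delta> ^ t = \<Delta> ^ (2 * l - 1)"
  proof -
    have "(t - 1) + 2 * (l - t) + t = 2 * l - 1" using tl t2 by simp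
    then show ?thesis by (simp only: power_add[symmetric])
  qed
  have pg: "G ^ (l - t) * G ^ (t - 1) = G ^ (l - 1)"
    using tl t2 by (simp flip: power_add)
  have "(1 / \<Delta>) ^ (t - 1) * ((\<gamma> * \<gamma>') ^ (l - t) * ((1 / \<Delta>) ^ t / \<theta>)) =
    e ^ (2 * (l - t)) * e * (\<Delta> * (G ^ (l - t) * G ^ (t - 1))) / (\<Delta> ^ (t - 1) * \<Delta> ^ (2 * (l - t)) * \<Delta> ^ t)"
    unfolding gg th by (simp add: power_divide power_mult_distrib mult_ac flip: power_mult)
  also have "\<dots> = e ^ (2 * (l - t) + 1) * (2 * nn) / \<Delta> ^ (2 * l - 1)"
    unfolding pl pg G_eq by simp
  also have "\<dots> \<le> (8 / \<eta> 0) ^ (2 * l) * (2 * nn) / \<Delta> ^ (2 * l - 1)"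
  proof -
    have "e ^ (2 * (l - t) + 1) \<le> e ^ (2 * l)" using e1 t2 tl by (intro power_increasing) auto
    also have "\<dots> \<le> (8 / \<eta> 0) ^ (2 * l)" using loss_const e1 by (intro power_mono) auto
    finally have *: "e ^ (2 * (l - t) + 1) \<le> (8 / \<eta> 0) ^ (2 * l)" .
    have "0 \<le> nn" using cardV by linarith
    then show ?thesis using * \<Delta>1 by (intro divide_right_mono mult_right_mono) auto
  qed
  finally show ?thesis using 1 by linarith
qed

text \<open>This turns the functional into a weight on vertex lists: its values on indicators of
  single lists, restricted to closed walks without repetition, are the weights used from here
  on.\<close>

lemma closed_sum_fibres:
  "(\<Sum>xs \<in> long_lists. closed_sum (\<lambda>ys. of_bool (ys = xs \<and> closed_walk ys \<and> distinct (butlast ys))) * F xs) =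
    closed_sum (\<lambda>ys. of_bool (distinct (butlast ys)) * F ys)"
proof -
  have *: "(\<Sum>xs \<in> long_lists. F xs * of_bool (ys = xs \<and> closed_walk ys \<and> distinct (butlast ys))) =
    of_bool (distinct (butlast ys)) * F ys" if "closed_walk ys" for ys
  proof -
    have ys: "ys \<in> long_lists" using that by (simp add: closed_walk_def long_lists_def)
    have "(\<Sum>xs \<in> long_lists. F xs * of_bool (ys = xs \<and> closed_walk ys \<and> distinct (butlast ys))) =
      (\<Sum>xs \<in> long_lists. if xs = ys then of_bool (distinct (butlast ys)) * F ys else 0)"
      using that by (intro sum.cong) auto
    then show ?thesis using ys finite_long_lists by simp
  qed
  have "(\<Sum>xs \<in> long_lists. closed_sum (\<lambda>ys. of_bool (ys = xs \<and> closed_walk ys \<and> distinct (butlast ys))) * F xs) =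
    (\<Sum>xs \<in> long_lists. closed_sum (\<lambda>ys. F xs * of_bool (ys = xs \<and> closed_walk ys \<and> distinct (butlast ys))))"
    by (simp only: closed_sum_cmult mult.commute)
  also have "\<dots> = closed_sum (\<lambda>ys. \<Sum>xs \<in> long_lists. F xs * of_bool (ys = xs \<and> closed_walk ys \<and> distinct (butlast ys)))"
    by (rule closed_sum_sum[symmetric])
  also have "\<dots> = closed_sum (\<lambda>ys. of_bool (distinct (butlast ys)) * F ys)"
  proof (rule antisym)
    show "closed_sum (\<lambda>ys. \<Sum>xs \<in> long_lists. F xs * of_bool (ys = xs \<and> closed_walk ys \<and> distinct (butlast ys))) \<le>
      closed_sum (\<lambda>ys. of_bool (distinct (butlast ys)) * F ys)"
    proof (rule closed_sum_mono)
      fix ys assume "closed_walk ys"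
      from *[OF this] show "(\<Sum>xs \<in> long_lists. F xs * of_bool (ys = xs \<and> closed_walk ys \<and> distinct (butlast ys)))
        \<le> of_bool (distinct (butlast ys)) * F ys" by (rule eq_refl)
    qed
    show "closed_sum (\<lambda>ys. of_bool (distinct (butlast ys)) * F ys) \<le>
      closed_sum (\<lambda>ys. \<Sum>xs \<in> long_lists. F xs * of_bool (ys = xs \<and> closed_walk ys \<and> distinct (butlast ys)))"
    proof (rule closed_sum_mono)
      fix ys assume "closed_walk ys"
      from *[OF this, symmetric] show "of_bool (distinct (butlast ys)) * F ys \<le>
        (\<Sum>xs \<in> long_lists. F xs * of_bool (ys = xs \<and> closed_walk ys \<and> distinct (butlast ys)))"
        by (rule eq_refl)
    qed
  qed
  finally show ?thesis .
qed

lemma \<gamma>_le: "\<gamma> \<le> 8 / \<eta> 0 * (G / \<Delta>)"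
  unfolding \<gamma>_def using \<eta>_mono[OF tl] \<eta>_pos[of 0] \<eta>_pos[of t] G1 \<Delta>1
  by (intro mult_right_mono divide_left_mono) auto

text \<open>By \<open>small\<close> and \<open>closed_sum_collision\<close>, walks with a repeated
  vertex carry at most half of the mass and can be discarded. Replacing \<eta> t by the smaller
  \<eta> 0 makes all bounds independent of the level.\<close>

lemma ray_weights:
  assumes small: "real (2 * l) * real (2 * l + 1) * (8 / \<eta> 0 * (G / \<Delta>)) \<le> 1 / 2"
  shows "\<exists>W. (\<forall>xs. 0 \<le> W xs) \<and>
    (\<forall>xs. W xs \<noteq> 0 \<longrightarrow> set xs \<subseteq> V \<and> length xs = Suc (2 * l) \<and> hd xs = last xs \<and>
      distinct (butlast xs) \<and> successively (\<lambda>a b. b \<in> N a) xs) \<and>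
    \<eta> 0 / 8 * deg_total \<le> sum W long_lists \<and>
    (\<forall>ps. length ps = 2 * l \<longrightarrow> 0 < prescribed ps \<longrightarrow> prescribed ps < 2 * l \<longrightarrow>
      (\<Sum>xs \<in> long_lists. W xs * of_bool (matches ps xs)) \<le> 2 * (8 / \<eta> 0 * (G / \<Delta>)) ^ (prescribed ps - 1)) \<and>
    (\<forall>ps. length ps = 2 * l \<longrightarrow> prescribed ps = 2 * l \<longrightarrow>
      (\<Sum>xs \<in> long_lists. W xs * of_bool (matches ps xs)) \<le> (8 / \<eta> 0) ^ (2 * l) * (2 * nn) / \<Delta> ^ (2 * l - 1))"
proof -
  define W where "W xs = closed_sum (\<lambda>ys. of_bool (ys = xs \<and> closed_walk ys \<and> distinct (butlast ys)))" for xs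
  have W0: "0 \<le> W xs" for xs
    using closed_sum_mono[of "\<lambda>_. 0" "\<lambda>ys. of_bool (ys = xs \<and> closed_walk ys \<and> distinct (butlast ys))"] TT_0
    by (simp add: W_def)
  have Wsup: "set xs \<subseteq> V \<and> length xs = Suc (2 * l) \<and> hd xs = last xs \<and>
      distinct (butlast xs) \<and> successively (\<lambda>a b. b \<in> N a) xs" if "W xs \<noteq> 0" for xs
  proof (rule ccontr)
    assume "\<not> ?thesis"
    then have "(\<lambda>ys. of_bool (ys = xs \<and> closed_walk ys \<and> distinct (butlast ys)) :: real) = (\<lambda>_. 0)"
      by (auto simp: closed_walk_def fun_eq_iff)
    then show False using that TT_0 by (simp add: W_def)
  qed
  have sumW: "(\<Sum>xs \<in> long_lists. W xs * F xs) = closed_sum (\<lambda>ys. of_bool (distinct (butlast ys)) * F ys)" for F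
    unfolding W_def by (rule closed_sum_fibres)
  have pat: "(\<Sum>xs \<in> long_lists. W xs * of_bool (matches ps xs)) \<le> closed_sum (\<lambda>ys. of_bool (matches ps ys))" for ps
    unfolding sumW by (rule closed_sum_mono) simp
  have T1: "0 \<le> closed_sum (\<lambda>_. 1)" using closed_sum_mono[of "\<lambda>_. 0" "\<lambda>_. 1"] TT_0 by simp
  have "\<eta> 0 / 4 * deg_total \<le> \<eta> t / 4 * deg_total"
    using \<eta>_mono[OF tl] deg_total_nonneg by (intro mult_right_mono) auto
  also have "\<dots> \<le> closed_sum (\<lambda>_. 1)" using R_mass by (simp add: closed_sum_one)
  finally have m: "\<eta> 0 / 4 * deg_total \<le> closed_sum (\<lambda>_. 1)" .
  have "closed_sum (\<lambda>_. 1) = closed_sum (\<lambda>ys. of_bool (distinct (butlast ys)) + of_bool (\<not> distinct (butlast ys)))"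
    by (rule arg_cong[of _ _ closed_sum]) auto
  also have "\<dots> = closed_sum (\<lambda>ys. of_bool (distinct (butlast ys))) + closed_sum (\<lambda>ys. of_bool (\<not> distinct (butlast ys)))"
    by (rule closed_sum_add)
  finally have m2: "closed_sum (\<lambda>_. 1) = closed_sum (\<lambda>ys. of_bool (distinct (butlast ys))) +
    closed_sum (\<lambda>ys. of_bool (\<not> distinct (butlast ys)))" .
  have "real (2 * l) * real (2 * l + 1) * \<gamma> \<le> 1 / 2"
    using mult_left_mono[OF \<gamma>_le, of "real (2 * l) * real (2 * l + 1)"] small by simp
  then have "real (2 * l) * real (2 * l + 1) * \<gamma> * closed_sum (\<lambda>_. 1) \<le> 1 / 2 * closed_sum (\<lambda>_. 1)"
    using T1 by (rule mult_right_mono)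
  then have "closed_sum (\<lambda>ys. of_bool (\<not> distinct (butlast ys))) \<le> 1 / 2 * closed_sum (\<lambda>_. 1)"
    using closed_sum_collision by linarith
  then have "\<eta> 0 / 8 * deg_total \<le> closed_sum (\<lambda>ys. of_bool (distinct (butlast ys)))"
    using m m2 by linarith
  moreover have "sum W long_lists = closed_sum (\<lambda>ys. of_bool (distinct (butlast ys)))"
    using sumW[of "\<lambda>_. 1"] by simp
  ultimately have mass: "\<eta> 0 / 8 * deg_total \<le> sum W long_lists" by simp
  have p1: "(\<Sum>xs \<in> long_lists. W xs * of_bool (matches ps xs)) \<le> 2 * (8 / \<eta> 0 * (G / \<Delta>)) ^ (prescribed ps - 1)"
    if "length ps = 2 * l" "0 < prescribed ps" "prescribed ps < 2 * l" for ps
  proof -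
    have "2 * \<gamma> ^ (prescribed ps - 1) \<le> 2 * (8 / \<eta> 0 * (G / \<Delta>)) ^ (prescribed ps - 1)"
      using \<gamma>_le \<gamma>_pos by (intro mult_left_mono power_mono) auto
    then show ?thesis using pat[of ps] closed_sum_pattern[OF that] by linarith
  qed
  have p2: "(\<Sum>xs \<in> long_lists. W xs * of_bool (matches ps xs)) \<le> (8 / \<eta> 0) ^ (2 * l) * (2 * nn) / \<Delta> ^ (2 * l - 1)"
    if "length ps = 2 * l" "prescribed ps = 2 * l" for ps
    using pat[of ps] closed_sum_full[OF that] by linarith
  show ?thesis using W0 Wsup mass p1 p2 by (intro exI[of _ W]) blast
qed

end

theorem (in flat_walks) closed_walk_weights:
  assumes big: "4 * (real l + 1) ^ 2 \<le> \<Delta> * \<eta> 0"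
    and small: "real (2 * l) * real (2 * l + 1) * (8 / \<eta> 0 * (G / \<Delta>)) \<le> 1 / 2"
  shows "\<exists>W. (\<forall>xs. 0 \<le> W xs) \<and>
    (\<forall>xs. W xs \<noteq> 0 \<longrightarrow> set xs \<subseteq> V \<and> length xs = Suc (2 * l) \<and> hd xs = last xs \<and>
      distinct (butlast xs) \<and> successively (\<lambda>a b. b \<in> N a) xs) \<and>
    \<eta> 0 / 8 * deg_total \<le> sum W {xs. set xs \<subseteq> V \<and> length xs = Suc (2 * l)} \<and>
    (\<forall>ps. length ps = 2 * l \<longrightarrow> 0 < prescribed ps \<longrightarrow> prescribed ps < 2 * l \<longrightarrow>
      (\<Sum>xs | set xs \<subseteq> V \<and> length xs = Suc (2 * l). W xs * of_bool (matches ps xs)) \<le>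
        2 * (8 / \<eta> 0 * (G / \<Delta>)) ^ (prescribed ps - 1)) \<and>
    (\<forall>ps. length ps = 2 * l \<longrightarrow> prescribed ps = 2 * l \<longrightarrow>
      (\<Sum>xs | set xs \<subseteq> V \<and> length xs = Suc (2 * l). W xs * of_bool (matches ps xs)) \<le>
        (8 / \<eta> 0) ^ (2 * l) * (2 * nn) / \<Delta> ^ (2 * l - 1))"
proof (rule exists_rays[OF big])
  fix t R
  assume *: "2 \<le> t" "t \<le> l"
    "\<And>u. u \<in> V \<Longrightarrow> R u \<subseteq> walks t u"
    "\<And>u P. u \<in> V \<Longrightarrow> P \<in> R u \<Longrightarrow> distinct P \<and> flat_walk t P"
    "\<And>u P. u \<in> V \<Longrightarrow> P \<in> R u \<Longrightarrow> \<eta> t / 8 * \<kappa> t \<le> sum wt {Q \<in> R u. last Q = last P}"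
    "\<And>u P. u \<in> V \<Longrightarrow> P \<in> R u \<Longrightarrow>
      \<eta> t / 8 * tr (t - 1) u (P ! (t - 1)) \<le> sum wt {Q \<in> R u. Q ! (t - 1) = P ! (t - 1)}"
    "\<eta> t / 4 * deg_total \<le> (\<Sum>u \<in> V. dg u * sum wt (R u))"
  interpret ray_system V N \<Delta> l nn G t R
    by unfold_locales (rule *; assumption)+
  show ?thesis using ray_weights[OF small] unfolding long_lists_def .
qed

section \<open>From closed walks to linear cycles\<close>

text \<open>The closed list repeats its first vertex at the end, so no index is reduced modulo
  \<open>k\<close>. Its entries are the joints of a linear cycle: an edge meets the list only in two
  consecutive joints, and two edges meet each other only on the list.\<close>

definition cycle_seq :: "nat \<Rightarrow> 'v list \<Rightarrow> (nat \<Rightarrow> 'v set) \<Rightarrow> bool" where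
  "cycle_seq k xs es \<longleftrightarrow> length xs = Suc k \<and> hd xs = last xs \<and> distinct (butlast xs) \<and>
    (\<forall>i<k. xs ! i \<in> es i \<and> xs ! Suc i \<in> es i \<and> es i \<inter> set xs \<subseteq> {xs ! i, xs ! Suc i}) \<and>
    (\<forall>i<k. \<forall>j<k. i \<noteq> j \<longrightarrow> es i \<inter> es j \<subseteq> set xs)"

text \<open>An edge with at least three vertices has a vertex besides its two joints. It lies off
  the list and therefore in no other edge.\<close>

lemma cycle_seq_inj:
  assumes c: "cycle_seq k xs es" and r: "\<And>i. i < k \<Longrightarrow> card (es i) \<ge> 3"
  shows "inj_on es {..<k}"
proof (rule inj_onI, rule ccontr)
  fix i j assume ij: "i \<in> {..<k}" "j \<in> {..<k}" "es i = es j" "i \<noteq> j"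
  then have "i < k" "j < k" by simp_all
  then have "es i \<inter> es j \<subseteq> set xs" "es i \<inter> set xs \<subseteq> {xs ! i, xs ! Suc i}"
    using c ij(4) unfolding cycle_seq_def by (elim conjE; blast)+
  then have "es i \<subseteq> {xs ! i, xs ! Suc i}" using ij by auto
  then have "card (es i) \<le> card {xs ! i, xs ! Suc i}" by (intro card_mono) auto
  also have "\<dots> \<le> 2" by (simp add: card_insert_if)
  finally show False using r[of i] ij by simp
qed

lemma cycle_seq_copy:
  assumes c: "cycle_seq k xs es" and k: "k \<ge> 3" and r: "r \<ge> 2"
    and es: "\<And>i. i < k \<Longrightarrow> card (es i) = r \<and> es i \<in> edges F \<and> es i \<subseteq> verts F"
  shows "contains_copy F (linear_cycle r k)"
proof -
  have len: "length xs = Suc k" and hl: "hd xs = last xs" and d: "distinct (butlast xs)"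
    and in1: "\<And>i. i < k \<Longrightarrow> xs ! i \<in> es i" and in2: "\<And>i. i < k \<Longrightarrow> xs ! Suc i \<in> es i"
    and in3: "\<And>i. i < k \<Longrightarrow> es i \<inter> set xs \<subseteq> {xs ! i, xs ! Suc i}"
    and in4: "\<And>i j. i < k \<Longrightarrow> j < k \<Longrightarrow> i \<noteq> j \<Longrightarrow> es i \<inter> es j \<subseteq> set xs"
    using c by (auto simp: cycle_seq_def)
  have ne: "xs \<noteq> []" using len by auto
  have wrap: "xs ! (Suc i mod k) = xs ! Suc i" if i: "i < k" for i
  proof (cases "Suc i = k")
    case True
    have "xs ! 0 = xs ! k" using hl ne len by (simp add: hd_conv_nth last_conv_nth)
    then show ?thesis using True by simp
  qed (use i in simp)
  have dnth: "xs ! i = xs ! j \<longleftrightarrow> i = j" if "i < k" "j < k" for i j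
    using nth_eq_iff_index_eq[OF d, of i j] that len by (simp add: nth_butlast)
  have neq: "xs ! i \<noteq> xs ! Suc i" if i: "i < k" for i
  proof -
    have "Suc i mod k < k" "Suc i mod k \<noteq> i"
      using i k by (auto simp: mod_Suc)
    then show ?thesis using dnth[of i "Suc i mod k"] wrap[OF i] i by auto
  qed
  have "\<exists>g. bij_betw g {..<r - 2} (es i - {xs ! i, xs ! Suc i})" if i: "i < k" for i
  proof -
    have "finite (es i)" using es[OF i] r by (intro card_ge_0_finite) auto
    then have "card (es i - {xs ! i, xs ! Suc i}) = r - 2" "finite (es i - {xs ! i, xs ! Suc i})"
      using es[OF i] in1[OF i] in2[OF i] neq[OF i] by (simp_all add: card_Diff_subset)
    then show ?thesis using ex_bij_betw_nat_finite[of "es i - {xs ! i, xs ! Suc i}"]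
      by (simp add: atLeast0LessThan)
  qed
  then obtain g where g: "\<And>i. i < k \<Longrightarrow> bij_betw (g i) {..<r - 2} (es i - {xs ! i, xs ! Suc i})"
    by metis
  define \<phi> where "\<phi> = case_sum (\<lambda>i. xs ! i) (\<lambda>(i, j). g i j)"
  have gim: "g i ` {..<r - 2} = es i - {xs ! i, xs ! Suc i}" if "i < k" for i
    using g[OF that] by (simp add: bij_betw_def)
  have gin: "g i j \<in> es i - {xs ! i, xs ! Suc i}" if "i < k" "j < r - 2" for i j
    using gim[OF that(1)] that by auto
  have gnot: "g i j \<notin> set xs" if "i < k" "j < r - 2" for i j
    using gin[OF that] in3[OF that(1)] by auto
  have edge: "\<phi> ` linear_cycle_edge r k i = es i" if i: "i < k" for i
  proof -
    have "\<phi> ` linear_cycle_edge r k i = {xs ! i, xs ! Suc i} \<union> g i ` {..<r - 2}"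
      using wrap[OF i] by (simp add: linear_cycle_edge_def \<phi>_def image_Un image_image)
    then show ?thesis using gim[OF i] in1[OF i] in2[OF i] by auto
  qed
  have xset: "xs ! i \<in> set xs" if "i < k" for i using that len by simp
  have "inj_on \<phi> (verts (linear_cycle r k))"
  proof (rule inj_onI)
    fix a b assume ab: "a \<in> verts (linear_cycle r k)" "b \<in> verts (linear_cycle r k)" "\<phi> a = \<phi> b"
    have A: "(\<exists>i<k. a = Inl i) \<or> (\<exists>i<k. \<exists>j<r - 2. a = Inr (i, j))"
      and B: "(\<exists>i<k. b = Inl i) \<or> (\<exists>i<k. \<exists>j<r - 2. b = Inr (i, j))"
      using ab by (auto simp: linear_cycle_def)
    have two: "i = i' \<and> j = j'" if "i < k" "j < r - 2" "i' < k" "j' < r - 2" "g i j = g i' j'" for i j i' j'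
    proof -
      have "i = i'"
      proof (rule ccontr)
        assume "i \<noteq> i'"
        then have "g i j \<in> set xs"
          using in4[OF that(1,3)] gin[OF that(1,2)] gin[OF that(3,4)] that(5) by auto
        then show False using gnot[OF that(1,2)] by simp
      qed
      then show ?thesis using g[OF that(1)] that by (auto simp: bij_betw_def inj_on_def)
    qed
    show "a = b"
      using A
    proof (elim disjE exE conjE)
      fix i assume i: "i < k" "a = Inl i"
      from B show "a = b"
      proof (elim disjE exE conjE)
        fix j assume "j < k" "b = Inl j"
        then show "a = b" using ab(3) i dnth[of i j] by (simp add: \<phi>_def)
      next
        fix i' j' assume "i' < k" "j' < r - 2" "b = Inr (i', j')"
        then show "a = b" using ab(3) i gnot[of i' j'] xset[of i] by (simp add: \<phi>_def)
      qed
    next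
      fix i j assume i: "i < k" "j < r - 2" "a = Inr (i, j)"
      from B show "a = b"
      proof (elim disjE exE conjE)
        fix i' assume "i' < k" "b = Inl i'"
        then show "a = b" using ab(3) i gnot[of i j] xset[of i'] by (simp add: \<phi>_def)
      next
        fix i' j' assume "i' < k" "j' < r - 2" "b = Inr (i', j')"
        then show "a = b" using ab(3) i two[of i j i' j'] by (simp add: \<phi>_def)
      qed
    qed
  qed
  moreover have "\<phi> ` verts (linear_cycle r k) \<subseteq> verts F"
  proof
    fix y assume "y \<in> \<phi> ` verts (linear_cycle r k)"
    then obtain a where a: "a \<in> verts (linear_cycle r k)" "y = \<phi> a" by blast
    then obtain i where "i < k" "a \<in> linear_cycle_edge r k i"
      by (auto simp: linear_cycle_def linear_cycle_edge_def)
    then show "y \<in> verts F" using edge[of i] es[of i] a by blast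
  qed
  moreover have "\<forall>e \<in> edges (linear_cycle r k). \<phi> ` e \<in> edges F"
    using edge es by (auto simp: linear_cycle_def)
  ultimately show ?thesis unfolding contains_copy_def by blast
qed

section \<open>Random extension of closed walks by edges\<close>

lemma prescribed_map:
  "prescribed (map f [0..<k]) = card {i. i < k \<and> f i \<noteq> None}"
proof -
  have "prescribed (map f [0..<k]) = card {i. i < length (map f [0..<k]) \<and> map f [0..<k] ! i \<noteq> None}"
    unfolding prescribed_def by (rule length_filter_conv_card)
  also have "{i. i < length (map f [0..<k]) \<and> map f [0..<k] ! i \<noteq> None} = {i. i < k \<and> f i \<noteq> None}"
    by auto
  finally show ?thesis .
qed

text \<open>For independent uniform choices from the sets \<open>E i\<close>, the left side is the
  probability that each edge of \<open>T\<close> is drawn at its position; every position in the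
  image of \<tau> contributes a factor at most 1 / D.\<close>

lemma prescribed_choices:
  fixes E :: "nat \<Rightarrow> 'e set" and D :: real
  assumes fin: "\<And>i. i < k \<Longrightarrow> finite (E i)" and D: "D > 0" "\<And>i. i < k \<Longrightarrow> D \<le> real (card (E i))"
    and T: "finite T" and \<tau>: "inj_on \<tau> T" "\<tau> ` T \<subseteq> {..<k}"
  shows "real (card {es \<in> PiE {..<k} E. \<forall>e \<in> T. es (\<tau> e) = e}) / (\<Prod>i<k. real (card (E i))) \<le>
    (1 / D) ^ card T * of_bool (\<forall>e \<in> T. e \<in> E (\<tau> e))"
proof (cases "\<forall>e \<in> T. e \<in> E (\<tau> e)")
  case False
  then obtain e where e: "e \<in> T" "e \<notin> E (\<tau> e)" by blast
  have "\<tau> e < k" using e(1) \<tau>(2) by auto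
  then have "es (\<tau> e) \<noteq> e" if "es \<in> PiE {..<k} E" for es
    using PiE_mem[OF that, of "\<tau> e"] e(2) by auto
  then have em: "{es \<in> PiE {..<k} E. \<forall>e \<in> T. es (\<tau> e) = e} = {}"
    using e(1) by blast
  show ?thesis unfolding em using False D(1) by simp
next
  case True
  define E' where "E' i = (if i \<in> \<tau> ` T then {the_inv_into T \<tau> i} else E i)" for i
  have pos: "0 < real (card (E i))" if "i < k" for i using D(1) D(2)[OF that] by linarith
  have "{es \<in> PiE {..<k} E. \<forall>e \<in> T. es (\<tau> e) = e} \<subseteq> PiE {..<k} E'"
    using \<tau> by (auto simp: E'_def PiE_def Pi_def the_inv_into_f_f)
  moreover have fE': "finite (PiE {..<k} E')"
    using fin by (intro finite_PiE) (auto simp: E'_def)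
  ultimately have "real (card {es \<in> PiE {..<k} E. \<forall>e \<in> T. es (\<tau> e) = e}) \<le> real (card (PiE {..<k} E'))"
    using card_mono by fastforce
  also have "card (PiE {..<k} E') = (\<Prod>i<k. card (E' i))" by (rule card_PiE) simp
  finally have "real (card {es \<in> PiE {..<k} E. \<forall>e \<in> T. es (\<tau> e) = e}) / (\<Prod>i<k. real (card (E i))) \<le>
    (\<Prod>i<k. real (card (E' i))) / (\<Prod>i<k. real (card (E i)))"
    by (intro divide_right_mono) (auto intro: prod_nonneg)
  also have "\<dots> = (\<Prod>i<k. real (card (E' i)) / real (card (E i)))" by (simp add: prod_dividef)
  also have "\<dots> \<le> (\<Prod>i<k. if i \<in> \<tau> ` T then 1 / D else 1)"
  proof (rule prod_mono)
    fix i assume i: "i \<in> {..<k}"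
    show "0 \<le> real (card (E' i)) / real (card (E i)) \<and>
      real (card (E' i)) / real (card (E i)) \<le> (if i \<in> \<tau> ` T then 1 / D else 1)"
      using pos[of i] D(2)[of i] D(1) i by (auto simp: E'_def intro: divide_left_mono)
  qed
  also have "\<dots> = (\<Prod>i \<in> {..<k} \<inter> \<tau> ` T. 1 / D)"
    by (subst prod.inter_restrict) auto
  also have "{..<k} \<inter> \<tau> ` T = \<tau> ` T" using \<tau> by auto
  also have "(\<Prod>i \<in> \<tau> ` T. 1 / D) = (1 / D) ^ card T"
    using \<tau> by (simp add: card_image)
  finally show ?thesis using True by simp
qed

lemma card_fibres:
  assumes "finite S" "finite B" "f ` S \<subseteq> B"
  shows "card S = (\<Sum>b \<in> B. card {x \<in> S. f x = b})"
  using sum.group[OF assms, of "\<lambda>_. 1::nat"] by simp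

context flat_walks
begin

text \<open>Every step of a weighted closed walk is extended to an edge drawn uniformly and
  independently from \<open>ext\<close>; the weight of a set of edges is its probability summed over
  the walks. An edge of \<open>T\<close> costs 1 / D for being drawn and prescribes one step of the
  walk, with 2 l choices of the position and r ^ 2 choices of the ordered pair of its
  vertices.\<close>

theorem cycle_weights:
  fixes ext :: "'v \<Rightarrow> 'v \<Rightarrow> 'v set set" and H :: "'v set set" and D M :: real and r :: nat
  assumes big: "4 * (real l + 1) ^ 2 \<le> \<Delta> * \<eta> 0"
    and small: "real (2 * l) * real (2 * l + 1) * (8 / \<eta> 0 * (G / \<Delta>)) \<le> 1 / 2"
    and H: "finite H" "\<And>e. e \<in> H \<Longrightarrow> card e = r" and r: "r \<ge> 3"
    and ext: "\<And>u v. u \<in> V \<Longrightarrow> v \<in> N u \<Longrightarrow> ext u v \<subseteq> {e \<in> H. u \<in> e \<and> v \<in> e}"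
    and D: "0 < D" "\<And>u v. u \<in> V \<Longrightarrow> v \<in> N u \<Longrightarrow> D \<le> real (card (ext u v))"
    and M: "8 * real l ^ 2 * (real r + 1) \<le> M"
      "\<And>u v w. u \<in> V \<Longrightarrow> v \<in> N u \<Longrightarrow> w \<noteq> u \<Longrightarrow> w \<noteq> v \<Longrightarrow>
        M * real (card {e \<in> ext u v. w \<in> e}) \<le> real (card (ext u v))"
  shows "\<exists>w. (\<forall>C. 0 \<le> w C) \<and>
    (\<forall>C. w C \<noteq> 0 \<longrightarrow> (\<exists>xs es. cycle_seq (2 * l) xs es \<and> C = es ` {..<2 * l} \<and> es ` {..<2 * l} \<subseteq> H)) \<and>
    \<eta> 0 / 16 * deg_total \<le> wdeg H w {} \<and>
    (\<forall>T. T \<noteq> {} \<longrightarrow> T \<subseteq> H \<longrightarrow> card T < 2 * l \<longrightarrow>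
      wdeg H w T \<le> (2 * real l * real r ^ 2 / D) ^ card T * (2 * (8 / \<eta> 0 * (G / \<Delta>)) ^ (card T - 1))) \<and>
    (\<forall>T. T \<subseteq> H \<longrightarrow> card T = 2 * l \<longrightarrow>
      wdeg H w T \<le> (2 * real l * real r ^ 2 / D) ^ card T * ((8 / \<eta> 0) ^ (2 * l) * (2 * nn) / \<Delta> ^ (2 * l - 1))) \<and>
    (\<forall>T. T \<subseteq> H \<longrightarrow> 2 * l < card T \<longrightarrow> wdeg H w T = 0)"
proof -
  let ?k = "2 * l"
  obtain W where W0: "\<And>xs. 0 \<le> W xs"
    and Wsup: "\<And>xs. W xs \<noteq> 0 \<Longrightarrow> set xs \<subseteq> V \<and> length xs = Suc ?k \<and> hd xs = last xs \<and>
      distinct (butlast xs) \<and> successively (\<lambda>a b. b \<in> N a) xs"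
    and Wmass: "\<eta> 0 / 8 * deg_total \<le> sum W long_lists"
    and Wpat: "\<And>ps. length ps = ?k \<Longrightarrow> 0 < prescribed ps \<Longrightarrow> prescribed ps < ?k \<Longrightarrow>
      (\<Sum>xs \<in> long_lists. W xs * of_bool (matches ps xs)) \<le> 2 * (8 / \<eta> 0 * (G / \<Delta>)) ^ (prescribed ps - 1)"
    and Wfull: "\<And>ps. length ps = ?k \<Longrightarrow> prescribed ps = ?k \<Longrightarrow>
      (\<Sum>xs \<in> long_lists. W xs * of_bool (matches ps xs)) \<le> (8 / \<eta> 0) ^ ?k * (2 * nn) / \<Delta> ^ (?k - 1)"
    using closed_walk_weights[OF big small] unfolding long_lists_def[symmetric] by blast
  define E where "E xs i = ext (xs ! i) (xs ! Suc i)" for xs :: "'v list" and i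
  have adj: "xs ! i \<in> V \<and> xs ! Suc i \<in> N (xs ! i)" if "W xs \<noteq> 0" "i < ?k" for xs i
    using Wsup[OF that(1)] that(2)
    by (auto simp: successively_conv_nth intro: subsetD nth_mem)
  have finE: "finite (E xs i)" and DE: "D \<le> real (card (E xs i))"
    and subE: "E xs i \<subseteq> {e \<in> H. xs ! i \<in> e \<and> xs ! Suc i \<in> e}"
    if "W xs \<noteq> 0" "i < ?k" for xs i
  proof -
    note a = adj[OF that]
    show "E xs i \<subseteq> {e \<in> H. xs ! i \<in> e \<and> xs ! Suc i \<in> e}"
      unfolding E_def using ext a by blast
    then show "finite (E xs i)" using H(1) by (auto intro: finite_subset)
    show "D \<le> real (card (E xs i))" unfolding E_def using D(2) a by blast
  qed
  define Pr where "Pr xs = (\<Prod>i<?k. real (card (E xs i)))" for xs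
  have Pr0: "0 < Pr xs" if "W xs \<noteq> 0" for xs
    unfolding Pr_def
  proof (rule prod_pos)
    fix i assume "i \<in> {..<?k}"
    then have "D \<le> real (card (E xs i))" using DE[OF that, of i] by simp
    then show "0 < real (card (E xs i))" using D(1) by linarith
  qed
  define ch where "ch xs = PiE {..<?k} (E xs)" for xs
  have finch: "finite (ch xs)" if "W xs \<noteq> 0" for xs
    unfolding ch_def using finE[OF that] by (intro finite_PiE) auto
  have cardch: "real (card (ch xs)) = Pr xs" for xs
    by (simp add: ch_def Pr_def card_PiE)
  define w where "w C = (\<Sum>xs \<in> long_lists. W xs *
    (real (card {es \<in> ch xs. cycle_seq ?k xs es \<and> es ` {..<?k} = C}) / Pr xs))" for C
  have w0: "0 \<le> w C" for C
    unfolding w_def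
  proof (rule sum_nonneg)
    fix xs
    have "0 \<le> Pr xs" unfolding Pr_def by (rule prod_nonneg) simp
    then show "0 \<le> W xs * (real (card {es \<in> ch xs. cycle_seq ?k xs es \<and> es ` {..<?k} = C}) / Pr xs)"
      using W0[of xs] by simp
  qed
  have chH: "es ` {..<?k} \<subseteq> H" if "W xs \<noteq> 0" "es \<in> ch xs" for xs es
    using that subE[OF that(1)] by (fastforce simp: ch_def PiE_def Pi_def)
  have wsup: "\<exists>xs es. cycle_seq ?k xs es \<and> C = es ` {..<?k} \<and> es ` {..<?k} \<subseteq> H" if "w C \<noteq> 0" for C
  proof -
    note nz = that
    obtain xs where "xs \<in> long_lists" and xs: "W xs * (real (card {es \<in> ch xs. cycle_seq ?k xs es \<and> es ` {..<?k} = C}) / Pr xs) \<noteq> 0"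
      using nz unfolding w_def by (rule sum.not_neutral_contains_not_neutral)
    then have "{es \<in> ch xs. cycle_seq ?k xs es \<and> es ` {..<?k} = C} \<noteq> {}" by (auto simp del: Collect_empty_eq)
    then show ?thesis using chH[of xs] xs by fastforce
  qed
  have wd: "wdeg H w T = (\<Sum>xs \<in> long_lists. W xs *
    (real (card {es \<in> ch xs. cycle_seq ?k xs es \<and> T \<subseteq> es ` {..<?k}}) / Pr xs))" for T
  proof -
    have "wdeg H w T = (\<Sum>xs \<in> long_lists. \<Sum>C \<in> {C \<in> Pow H. T \<subseteq> C}. W xs *
      (real (card {es \<in> ch xs. cycle_seq ?k xs es \<and> es ` {..<?k} = C}) / Pr xs))"
      unfolding wdeg_def w_def by (rule sum.swap)
    also have "\<dots> = (\<Sum>xs \<in> long_lists. W xs *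
    (real (card {es \<in> ch xs. cycle_seq ?k xs es \<and> T \<subseteq> es ` {..<?k}}) / Pr xs))"
    proof (rule sum.cong[OF refl])
      fix xs
      show "(\<Sum>C \<in> {C \<in> Pow H. T \<subseteq> C}. W xs *
      (real (card {es \<in> ch xs. cycle_seq ?k xs es \<and> es ` {..<?k} = C}) / Pr xs)) =
      W xs * (real (card {es \<in> ch xs. cycle_seq ?k xs es \<and> T \<subseteq> es ` {..<?k}}) / Pr xs)"
      proof (cases "W xs = 0")
        case False
        let ?S = "{es \<in> ch xs. cycle_seq ?k xs es \<and> T \<subseteq> es ` {..<?k}}"
        have "card ?S = (\<Sum>C \<in> {C \<in> Pow H. T \<subseteq> C}. card {es \<in> ?S. es ` {..<?k} = C})"
          using finch[OF False] H(1) chH[OF False]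
          by (intro card_fibres) auto
        also have "\<dots> = (\<Sum>C \<in> {C \<in> Pow H. T \<subseteq> C}. card {es \<in> ch xs. cycle_seq ?k xs es \<and> es ` {..<?k} = C})"
          by (intro sum.cong refl arg_cong[of _ _ card]) auto
        finally show ?thesis by (simp add: sum_distrib_left sum_divide_distrib)
      qed simp
    qed
    finally show ?thesis .
  qed
  \<comment> \<open>An extension fails if an edge meets a walk vertex other than its two joints,
    with at most 4 l ^ 2 choices, or if two edges meet off the walk, with at most 4 l ^ 2 choices
    and \<open>r\<close> candidates for the common vertex. Each event has probability at most 1 / M,
    so the lower bound on \<open>M\<close> leaves a half.\<close>
  have valid_half: "1 / 2 \<le> real (card {es \<in> ch xs. cycle_seq ?k xs es}) / Pr xs" if xs: "W xs \<noteq> 0" for xs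
  proof -
    note sup = Wsup[OF xs]
    have xi: "xs ! i \<in> set xs" if "i \<le> ?k" for i using sup that by auto
    have M0: "0 < M" 
    proof -
      have "0 < 8 * real l ^ 2 * (real r + 1)" using l2 by simp
      then show ?thesis using M(1) by linarith
    qed
    define B1 where "B1 i v = {es \<in> ch xs. v \<in> es i}" for i v
    define B2 where "B2 i j = {es \<in> ch xs. \<not> es i \<inter> es j \<subseteq> set xs}" for i j
    have hit: "M * real (card {e \<in> E xs i. v \<in> e}) \<le> real (card (E xs i))"
      if "i < ?k" "v \<noteq> xs ! i" "v \<noteq> xs ! Suc i" for i v
      unfolding E_def using M(2) adj[OF xs that(1)] that by blast
    have upd: "real (card (PiE {..<?k} (\<lambda>m. if m = i then B else E xs m))) = Pr xs * (real (card B) / real (card (E xs i)))"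
      if i: "i < ?k" for i B
    proof -
      have "(\<Prod>m<?k. real (card (if m = i then B else E xs m))) =
        real (card B) * (\<Prod>m \<in> {..<?k} - {i}. real (card (if m = i then B else E xs m)))"
        using i by (subst prod.remove[of _ i]) auto
      also have "(\<Prod>m \<in> {..<?k} - {i}. real (card (if m = i then B else E xs m))) =
        (\<Prod>m \<in> {..<?k} - {i}. real (card (E xs m)))" by (rule prod.cong) auto
      finally have 1: "(\<Prod>m<?k. real (card (if m = i then B else E xs m))) =
        real (card B) * (\<Prod>m \<in> {..<?k} - {i}. real (card (E xs m)))" .
      have "Pr xs = real (card (E xs i)) * (\<Prod>m \<in> {..<?k} - {i}. real (card (E xs m)))"
        unfolding Pr_def using i by (subst prod.remove[of _ i]) auto
      moreover have "0 < real (card (E xs i))" using DE[OF xs i] D(1) by linarith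
      ultimately show ?thesis using 1 by (simp add: card_PiE)
    qed
    have b1: "real (card (B1 i v)) \<le> Pr xs / M" if i: "i < ?k" "v \<noteq> xs ! i" "v \<noteq> xs ! Suc i" for i v
    proof -
      have Ei: "0 < real (card (E xs i))" using DE[OF xs i(1)] D(1) by linarith
      have "B1 i v \<subseteq> PiE {..<?k} (\<lambda>m. if m = i then {e \<in> E xs i. v \<in> e} else E xs m)"
        using i by (auto simp: B1_def ch_def PiE_def Pi_def)
      moreover have "finite (PiE {..<?k} (\<lambda>m. if m = i then {e \<in> E xs i. v \<in> e} else E xs m))"
        using finE[OF xs] by (intro finite_PiE) auto
      ultimately have "card (B1 i v) \<le> card (PiE {..<?k} (\<lambda>m. if m = i then {e \<in> E xs i. v \<in> e} else E xs m))"
        by (rule card_mono[rotated])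
      then have "real (card (B1 i v)) \<le> Pr xs * (real (card {e \<in> E xs i. v \<in> e}) / real (card (E xs i)))"
        unfolding upd[OF i(1), of "{e \<in> E xs i. v \<in> e}", symmetric] by (rule of_nat_mono)
      also have "\<dots> \<le> Pr xs * (1 / M)"
        using hit[OF i] Ei M0 Pr0[OF xs] by (intro mult_left_mono) (auto simp: field_simps)
      finally show ?thesis by simp
    qed
    have b2: "real (card (B2 i j)) \<le> real r * (Pr xs / M)" if ij: "i < ?k" "j < ?k" "i \<noteq> j" for i j
    proof -
      have Ei: "0 < real (card (E xs i))" "0 < real (card (E xs j))"
        using DE[OF xs] D(1) ij by (metis order_less_le_trans)+
      define U where "U = (\<Union>e \<in> E xs i. \<Union>v \<in> e - set xs.
        {es \<in> ch xs. es i = e \<and> v \<in> es j})"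
      have "B2 i j \<subseteq> U" using ij by (auto simp: B2_def U_def ch_def PiE_def Pi_def)
      have one: "real (card {es \<in> ch xs. es i = e \<and> v \<in> es j}) \<le> Pr xs / real (card (E xs i)) / M"
        if e: "e \<in> E xs i" and v: "v \<notin> set xs" for e v
      proof -
        let ?F = "\<lambda>m. if m = i then {e} else if m = j then {e \<in> E xs j. v \<in> e} else E xs m"
        have sub: "{es \<in> ch xs. es i = e \<and> v \<in> es j} \<subseteq> PiE {..<?k} ?F"
          using ij by (auto simp: ch_def PiE_def Pi_def)
        have fin: "finite (PiE {..<?k} ?F)" using finE[OF xs] by (intro finite_PiE) auto
        have "(\<Prod>m<?k. real (card (?F m))) = real (card (?F i)) * (real (card (?F j)) * (\<Prod>m \<in> {..<?k} - {i} - {j}. real (card (?F m))))"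
          using ij by (subst prod.remove[of _ i], simp, simp, subst prod.remove[of _ j]) auto
        also have "(\<Prod>m \<in> {..<?k} - {i} - {j}. real (card (?F m))) = (\<Prod>m \<in> {..<?k} - {i} - {j}. real (card (E xs m)))"
          by (rule prod.cong) auto
        finally have F: "(\<Prod>m<?k. real (card (?F m))) = real (card {e \<in> E xs j. v \<in> e}) * (\<Prod>m \<in> {..<?k} - {i} - {j}. real (card (E xs m)))"
          using ij by simp
        have P: "Pr xs = real (card (E xs i)) * (real (card (E xs j)) * (\<Prod>m \<in> {..<?k} - {i} - {j}. real (card (E xs m))))"
          unfolding Pr_def using ij by (subst prod.remove[of _ i], simp, simp, subst prod.remove[of _ j]) auto
        have "v \<noteq> xs ! j" "v \<noteq> xs ! Suc j" using v xi[of j] xi[of "Suc j"] ij by auto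
        then have h: "real (card {e \<in> E xs j. v \<in> e}) \<le> real (card (E xs j)) / M"
          using hit[OF ij(2)] M0 by (simp add: field_simps)
        have "real (card {es \<in> ch xs. es i = e \<and> v \<in> es j}) \<le> real (card (PiE {..<?k} ?F))"
          using card_mono[OF fin sub] by simp
        also have "\<dots> = (\<Prod>m<?k. real (card (?F m)))" by (simp add: card_PiE)
        also have "\<dots> \<le> real (card (E xs j)) / M * (\<Prod>m \<in> {..<?k} - {i} - {j}. real (card (E xs m)))"
          unfolding F by (intro mult_right_mono h prod_nonneg) auto
        also have "\<dots> = Pr xs / real (card (E xs i)) / M" using P Ei by simp
        finally show ?thesis .
      qed
      have finU: "finite (e - set xs)" "card (e - set xs) \<le> r" if "e \<in> E xs i" for e
      proof -
        have c: "card e = r" using subE[OF xs ij(1)] H(2) that by blast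
        then have "finite e" using r by (intro card_ge_0_finite) simp
        then show "finite (e - set xs)" "card (e - set xs) \<le> r" using c card_mono[of e "e - set xs"] by auto
      qed
      have "card (B2 i j) \<le> card U"
        using \<open>B2 i j \<subseteq> U\<close> finE[OF xs ij(1)] finU(1) finch[OF xs] by (intro card_mono) (auto simp: U_def)
      also have "\<dots> \<le> (\<Sum>e \<in> E xs i. card (\<Union>v \<in> e - set xs. {es \<in> ch xs. es i = e \<and> v \<in> es j}))"
        unfolding U_def by (rule card_UN_le[OF finE[OF xs ij(1)]])
      also have "\<dots> \<le> (\<Sum>e \<in> E xs i. \<Sum>v \<in> e - set xs. card {es \<in> ch xs. es i = e \<and> v \<in> es j})"
        by (intro sum_mono card_UN_le finU)
      finally have "real (card (B2 i j)) \<le> (\<Sum>e \<in> E xs i. \<Sum>v \<in> e - set xs. real (card {es \<in> ch xs. es i = e \<and> v \<in> es j}))"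
        by (simp flip: of_nat_sum)
      also have "\<dots> \<le> (\<Sum>e \<in> E xs i. \<Sum>v \<in> e - set xs. Pr xs / real (card (E xs i)) / M)"
        by (intro sum_mono one) auto
      also have "\<dots> = (\<Sum>e \<in> E xs i. real (card (e - set xs)) * (Pr xs / real (card (E xs i)) / M))" by simp
      also have "\<dots> \<le> (\<Sum>e \<in> E xs i. real r * (Pr xs / real (card (E xs i)) / M))"
        using finU(2) M0 Pr0[OF xs] by (intro sum_mono mult_right_mono) auto
      also have "\<dots> = real r * (Pr xs / M)" using Ei by simp
      finally show ?thesis .
    qed
    let ?bad = "(\<Union>i<?k. \<Union>v \<in> set xs - {xs ! i, xs ! Suc i}. B1 i v) \<union>
      (\<Union>i<?k. \<Union>j \<in> {..<?k} - {i}. B2 i j)"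
    have "ch xs \<subseteq> {es \<in> ch xs. cycle_seq ?k xs es} \<union> ?bad"
    proof
      fix es assume es: "es \<in> ch xs"
      have E: "es i \<in> E xs i" if "i < ?k" for i using es that by (auto simp: ch_def)
      show "es \<in> {es \<in> ch xs. cycle_seq ?k xs es} \<union> ?bad"
      proof (cases "es \<in> ?bad")
        case False
        then have n1: "\<And>i v. i < ?k \<Longrightarrow> v \<in> set xs \<Longrightarrow> v \<noteq> xs ! i \<Longrightarrow> v \<noteq> xs ! Suc i \<Longrightarrow> v \<notin> es i"
          and n2: "\<And>i j. i < ?k \<Longrightarrow> j < ?k \<Longrightarrow> i \<noteq> j \<Longrightarrow> es i \<inter> es j \<subseteq> set xs"
          using es by (auto simp: B1_def B2_def)
        have "cycle_seq ?k xs es"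
          unfolding cycle_seq_def using sup n1 n2 E subE[OF xs] by blast
        then show ?thesis using es by simp
      qed simp
    qed
    then have "card (ch xs) \<le> card ({es \<in> ch xs. cycle_seq ?k xs es} \<union> ?bad)"
      using finch[OF xs] by (intro card_mono) (auto simp: B1_def B2_def)
    also have "\<dots> \<le> card {es \<in> ch xs. cycle_seq ?k xs es} + card ?bad" by (rule card_Un_le)
    finally have tot: "Pr xs \<le> real (card {es \<in> ch xs. cycle_seq ?k xs es}) + real (card ?bad)"
      unfolding cardch[symmetric] by linarith
    have "card ?bad \<le> card (\<Union>i<?k. \<Union>v \<in> set xs - {xs ! i, xs ! Suc i}. B1 i v) +
      card (\<Union>i<?k. \<Union>j \<in> {..<?k} - {i}. B2 i j)" by (rule card_Un_le)
    also have "\<dots> \<le> (\<Sum>i<?k. \<Sum>v \<in> set xs - {xs ! i, xs ! Suc i}. card (B1 i v)) +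
      (\<Sum>i<?k. \<Sum>j \<in> {..<?k} - {i}. card (B2 i j))"
      by (intro add_mono order_trans[OF card_UN_le] sum_mono card_UN_le) auto
    finally have "real (card ?bad) \<le> (\<Sum>i<?k. \<Sum>v \<in> set xs - {xs ! i, xs ! Suc i}. real (card (B1 i v))) +
      (\<Sum>i<?k. \<Sum>j \<in> {..<?k} - {i}. real (card (B2 i j)))"
      by (simp flip: of_nat_sum of_nat_add)
    also have "\<dots> \<le> (\<Sum>i<?k. \<Sum>v \<in> set xs - {xs ! i, xs ! Suc i}. Pr xs / M) +
      (\<Sum>i<?k. \<Sum>j \<in> {..<?k} - {i}. real r * (Pr xs / M))"
      by (intro add_mono sum_mono b1 b2) auto
    also have "\<dots> \<le> (\<Sum>i<?k. real ?k * (Pr xs / M)) + (\<Sum>i<?k. real ?k * (real r * (Pr xs / M)))"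
    proof (intro add_mono sum_mono)
      fix i assume i: "i \<in> {..<?k}"
      have "card (set xs - {xs ! i, xs ! Suc i}) \<le> card (set xs - {xs ! i})"
        by (intro card_mono) auto
      also have "\<dots> = card (set xs) - 1" using xi[of i] i by simp
      also have "\<dots> \<le> ?k" using card_length[of xs] sup by simp
      finally show "(\<Sum>v \<in> set xs - {xs ! i, xs ! Suc i}. Pr xs / M) \<le> real ?k * (Pr xs / M)"
        using M0 Pr0[OF xs] unfolding sum_constant by (intro mult_right_mono) (simp_all flip: of_nat_mult)
      have "card ({..<?k} - {i}) \<le> ?k" using i by simp
      then show "(\<Sum>j \<in> {..<?k} - {i}. real r * (Pr xs / M)) \<le> real ?k * (real r * (Pr xs / M))"
        using M0 Pr0[OF xs] unfolding sum_constant by (intro mult_right_mono) (simp_all flip: of_nat_mult)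
    qed
    also have "\<dots> = 4 * real l ^ 2 * (real r + 1) * (Pr xs / M)"
      by (simp add: power2_eq_square algebra_simps)
    also have "\<dots> \<le> M / 2 * (Pr xs / M)"
      using M(1) M0 Pr0[OF xs] by (intro mult_right_mono) auto
    also have "\<dots> = Pr xs / 2" using M0 by simp
    finally show ?thesis using tot Pr0[OF xs] by (simp add: field_simps)
  qed
  have mass: "\<eta> 0 / 16 * deg_total \<le> wdeg H w {}"
  proof -
    have "\<eta> 0 / 16 * deg_total \<le> (\<Sum>xs \<in> long_lists. W xs * (1 / 2))"
      using Wmass by (simp add: sum_divide_distrib[symmetric] mult.commute)
    also have "\<dots> \<le> wdeg H w {}"
      unfolding wd
    proof (rule sum_mono)
      fix xs
      show "W xs * (1 / 2) \<le> W xs * (real (card {es \<in> ch xs. cycle_seq ?k xs es \<and> {} \<subseteq> es ` {..<?k}}) / Pr xs)"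
      proof (cases "W xs = 0")
        case False
        show ?thesis using mult_left_mono[OF valid_half[OF False] W0[of xs]] by simp
      qed simp
    qed
    finally show ?thesis .
  qed
  have degT: "wdeg H w T \<le> (2 * real l * real r ^ 2 / D) ^ card T * B"
    if T: "T \<subseteq> H" and B: "0 \<le> B"
      and pat: "\<And>ps. length ps = ?k \<Longrightarrow> prescribed ps = card T \<Longrightarrow> (\<Sum>xs \<in> long_lists. W xs * of_bool (matches ps xs)) \<le> B"
    for T B
  proof -
    have finT: "finite T" using T H(1) finite_subset by blast
    \<comment> \<open>\<open>TI\<close> describes at which positions the edges of \<open>T\<close>
      occur, and \<open>RH\<close> which pairs of their vertices are the corresponding steps; both
      together determine a pattern \<open>pt\<close>.\<close>
    define TI where "TI = {\<tau> \<in> PiE T (\<lambda>_. {..<?k}). inj_on \<tau> T}"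
    define RH where "RH = PiE T (\<lambda>e. e \<times> e)"
    have fe: "finite e" if "e \<in> T" for e using T H(2) that r by (intro card_ge_0_finite) auto
    have finTI: "finite TI" using finT by (simp add: TI_def finite_PiE)
    have finRH: "finite RH" unfolding RH_def using finT fe by (intro finite_PiE) auto
    define pt where "pt \<tau> \<rho> = map (\<lambda>i. if i \<in> \<tau> ` T then Some (\<rho> (the_inv_into T \<tau> i)) else None) [0..<?k]"
      for \<tau> :: "'v set \<Rightarrow> nat" and \<rho> :: "'v set \<Rightarrow> 'v \<times> 'v"
    have ptl: "length (pt \<tau> \<rho>) = ?k" for \<tau> \<rho> by (simp add: pt_def)
    have ptp: "prescribed (pt \<tau> \<rho>) = card T" if "\<tau> \<in> TI" for \<tau> \<rho>
    proof -
      have "{i. i < ?k \<and> (if i \<in> \<tau> ` T then Some (\<rho> (the_inv_into T \<tau> i)) else None) \<noteq> None} = \<tau> ` T"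
        using that by (auto simp: TI_def)
      then show ?thesis unfolding pt_def prescribed_map using that by (simp add: TI_def card_image)
    qed
    have step: "W xs * (real (card {es \<in> ch xs. cycle_seq ?k xs es \<and> T \<subseteq> es ` {..<?k}}) / Pr xs) \<le>
      (\<Sum>\<tau> \<in> TI. \<Sum>\<rho> \<in> RH. (1 / D) ^ card T * (W xs * of_bool (matches (pt \<tau> \<rho>) xs)))" for xs
    proof (cases "W xs = 0")
      case False
      note nz = False
      have "{es \<in> ch xs. cycle_seq ?k xs es \<and> T \<subseteq> es ` {..<?k}} \<subseteq> (\<Union>\<tau> \<in> TI. {es \<in> ch xs. \<forall>e \<in> T. es (\<tau> e) = e})"
      proof
        fix es assume es: "es \<in> {es \<in> ch xs. cycle_seq ?k xs es \<and> T \<subseteq> es ` {..<?k}}"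
        then have "\<forall>e \<in> T. \<exists>i<?k. es i = e" by auto
        then obtain f where f: "\<forall>e \<in> T. f e < ?k \<and> es (f e) = e" by metis
        define \<tau> where "\<tau> = restrict f T"
        have "inj_on f T" by (rule inj_onI) (metis f)
        then have "\<tau> \<in> TI" using f by (auto simp: TI_def \<tau>_def)
        moreover have "\<forall>e \<in> T. es (\<tau> e) = e" using f by (simp add: \<tau>_def)
        ultimately show "es \<in> (\<Union>\<tau> \<in> TI. {es \<in> ch xs. \<forall>e \<in> T. es (\<tau> e) = e})" using es by blast
      qed
      then have "card {es \<in> ch xs. cycle_seq ?k xs es \<and> T \<subseteq> es ` {..<?k}} \<le>
        card (\<Union>\<tau> \<in> TI. {es \<in> ch xs. \<forall>e \<in> T. es (\<tau> e) = e})"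
        using finTI finch[OF nz] by (intro card_mono) auto
      also have "\<dots> \<le> (\<Sum>\<tau> \<in> TI. card {es \<in> ch xs. \<forall>e \<in> T. es (\<tau> e) = e})"
        by (rule card_UN_le[OF finTI])
      finally have "real (card {es \<in> ch xs. cycle_seq ?k xs es \<and> T \<subseteq> es ` {..<?k}}) \<le>
        (\<Sum>\<tau> \<in> TI. real (card {es \<in> ch xs. \<forall>e \<in> T. es (\<tau> e) = e}))"
        by (simp flip: of_nat_sum)
      then have "real (card {es \<in> ch xs. cycle_seq ?k xs es \<and> T \<subseteq> es ` {..<?k}}) / Pr xs \<le>
        (\<Sum>\<tau> \<in> TI. real (card {es \<in> ch xs. \<forall>e \<in> T. es (\<tau> e) = e}) / Pr xs)"
        unfolding sum_divide_distrib[symmetric] using Pr0[OF nz] by (intro divide_right_mono) auto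
      also have "\<dots> \<le> (\<Sum>\<tau> \<in> TI. \<Sum>\<rho> \<in> RH. (1 / D) ^ card T * of_bool (matches (pt \<tau> \<rho>) xs))"
      proof (rule sum_mono)
        fix \<tau> assume \<tau>: "\<tau> \<in> TI"
        then have \<tau>': "inj_on \<tau> T" "\<tau> ` T \<subseteq> {..<?k}" by (auto simp: TI_def)
        have "real (card {es \<in> ch xs. \<forall>e \<in> T. es (\<tau> e) = e}) / Pr xs \<le>
          (1 / D) ^ card T * of_bool (\<forall>e \<in> T. e \<in> E xs (\<tau> e))"
          unfolding ch_def Pr_def
          by (rule prescribed_choices[OF finE[OF nz] D(1) DE[OF nz] finT \<tau>'])
        also have "\<dots> \<le> (1 / D) ^ card T * (\<Sum>\<rho> \<in> RH. of_bool (matches (pt \<tau> \<rho>) xs))"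
        proof (rule mult_left_mono)
          show "of_bool (\<forall>e \<in> T. e \<in> E xs (\<tau> e)) \<le> (\<Sum>\<rho> \<in> RH. of_bool (matches (pt \<tau> \<rho>) xs) :: real)"
          proof (cases "\<forall>e \<in> T. e \<in> E xs (\<tau> e)")
            case True
            define \<rho> where "\<rho> = restrict (\<lambda>e. (xs ! \<tau> e, xs ! Suc (\<tau> e))) T"
            have in_e: "xs ! \<tau> e \<in> e \<and> xs ! Suc (\<tau> e) \<in> e" if "e \<in> T" for e
              using subE[OF nz, of "\<tau> e"] True \<tau>' that by blast
            have "\<rho> \<in> RH" using in_e by (auto simp: RH_def \<rho>_def)
            have "matches (pt \<tau> \<rho>) xs"
            proof (subst matches_nth)
              show "length xs = Suc (length (pt \<tau> \<rho>))" using Wsup[OF nz] ptl by simp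
              show "\<forall>i<length (pt \<tau> \<rho>). pt \<tau> \<rho> ! i = None \<or> pt \<tau> \<rho> ! i = Some (xs ! i, xs ! Suc i)"
                using \<tau>' by (auto simp: pt_def \<rho>_def the_inv_into_f_f)
            qed
            then have "(1::real) = of_bool (matches (pt \<tau> \<rho>) xs)" by simp
            also have "\<dots> \<le> (\<Sum>\<rho> \<in> RH. of_bool (matches (pt \<tau> \<rho>) xs))"
              by (rule member_le_sum[OF \<open>\<rho> \<in> RH\<close>]) (auto simp: finRH)
            finally show ?thesis using True by simp
          next
            case False
            show ?thesis unfolding eq_False[THEN iffD2, OF False] by (simp add: sum_nonneg)
          qed
        qed (use D in simp)
        finally show "real (card {es \<in> ch xs. \<forall>e \<in> T. es (\<tau> e) = e}) / Pr xs \<le>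
          (\<Sum>\<rho> \<in> RH. (1 / D) ^ card T * of_bool (matches (pt \<tau> \<rho>) xs))" by (simp add: sum_distrib_left)
      qed
      finally have "W xs * (real (card {es \<in> ch xs. cycle_seq ?k xs es \<and> T \<subseteq> es ` {..<?k}}) / Pr xs) \<le>
        W xs * (\<Sum>\<tau> \<in> TI. \<Sum>\<rho> \<in> RH. (1 / D) ^ card T * of_bool (matches (pt \<tau> \<rho>) xs))"
        by (intro mult_left_mono W0)
      then show ?thesis by (simp add: sum_distrib_left mult_ac)
    qed simp
    have "wdeg H w T \<le> (\<Sum>xs \<in> long_lists. \<Sum>\<tau> \<in> TI. \<Sum>\<rho> \<in> RH. (1 / D) ^ card T * (W xs * of_bool (matches (pt \<tau> \<rho>) xs)))"
      unfolding wd by (intro sum_mono step)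
    also have "\<dots> = (\<Sum>\<tau> \<in> TI. \<Sum>xs \<in> long_lists. \<Sum>\<rho> \<in> RH. (1 / D) ^ card T * (W xs * of_bool (matches (pt \<tau> \<rho>) xs)))"
      by (rule sum.swap)
    also have "\<dots> = (\<Sum>\<tau> \<in> TI. \<Sum>\<rho> \<in> RH. \<Sum>xs \<in> long_lists. (1 / D) ^ card T * (W xs * of_bool (matches (pt \<tau> \<rho>) xs)))"
      by (intro sum.cong[OF refl] sum.swap)
    also have "\<dots> = (\<Sum>\<tau> \<in> TI. \<Sum>\<rho> \<in> RH. (1 / D) ^ card T * (\<Sum>xs \<in> long_lists. W xs * of_bool (matches (pt \<tau> \<rho>) xs)))"
      by (simp only: sum_distrib_left)
    also have "\<dots> \<le> (\<Sum>\<tau> \<in> TI. \<Sum>\<rho> \<in> RH. (1 / D) ^ card T * B)"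
      using D pat ptl ptp by (intro sum_mono mult_left_mono) auto
    also have "\<dots> = real (card TI) * real (card RH) * ((1 / D) ^ card T * B)" by simp
    also have "\<dots> \<le> real ?k ^ card T * (real r ^ 2) ^ card T * ((1 / D) ^ card T * B)"
    proof (intro mult_right_mono mult_mono)
      have "card TI \<le> card (PiE T (\<lambda>_. {..<?k}))"
        using finT by (intro card_mono finite_PiE) (auto simp: TI_def)
      also have "\<dots> = ?k ^ card T" using finT by (simp add: card_PiE)
      finally have "real (card TI) \<le> real (?k ^ card T)" by (rule of_nat_mono)
      then show "real (card TI) \<le> real ?k ^ card T" by simp
      have "card RH = (\<Prod>e \<in> T. card e * card e)" using finT by (simp add: RH_def card_PiE card_cartesian_product)
      also have "\<dots> = (\<Prod>e \<in> T. r * r)" using T H(2) by (intro prod.cong) auto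
      finally show "real (card RH) \<le> (real r ^ 2) ^ card T" by (simp add: power2_eq_square)
    qed (use B D in auto)
    also have "\<dots> = (2 * real l * real r ^ 2 / D) ^ card T * B"
      by (simp add: power_mult_distrib power_divide)
    finally show ?thesis .
  qed
  have zero: "wdeg H w T = 0" if "T \<subseteq> H" "?k < card T" for T
  proof -
    have em: "{es \<in> ch xs. cycle_seq ?k xs es \<and> T \<subseteq> es ` {..<?k}} = {}" for xs
    proof -
      have "\<not> T \<subseteq> es ` {..<?k}" for es
        using that(2) card_mono[of "es ` {..<?k}" T] card_image_le[of "{..<?k}" es] by fastforce
      then show ?thesis by blast
    qed
    show ?thesis unfolding wd em by simp
  qed
  have nn0: "0 \<le> nn" using cardV by linarith
  show ?thesis
  proof (intro exI[of _ w] conjI allI impI)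
    fix T assume T: "T \<noteq> {}" "T \<subseteq> H" "card T < ?k"
    have "finite T" using T H(1) finite_subset by blast
    then have cT: "0 < card T" using T by (simp add: card_gt_0_iff)
    show "wdeg H w T \<le> (2 * real l * real r ^ 2 / D) ^ card T * (2 * (8 / \<eta> 0 * (G / \<Delta>)) ^ (card T - 1))"
    proof (rule degT[OF T(2)])
      show "0 \<le> 2 * (8 / \<eta> 0 * (G / \<Delta>)) ^ (card T - 1)"
        using \<eta>_pos[of 0] G1 \<Delta>1 by simp
      show "(\<Sum>xs \<in> long_lists. W xs * of_bool (matches ps xs)) \<le> 2 * (8 / \<eta> 0 * (G / \<Delta>)) ^ (card T - 1)"
        if "length ps = ?k" "prescribed ps = card T" for ps
        using Wpat[of ps] that T(3) cT by (simp only:)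
    qed
  next
    fix T assume T: "T \<subseteq> H" "card T = ?k"
    show "wdeg H w T \<le> (2 * real l * real r ^ 2 / D) ^ card T * ((8 / \<eta> 0) ^ ?k * (2 * nn) / \<Delta> ^ (?k - 1))"
    proof (rule degT[OF T(1)])
      show "0 \<le> (8 / \<eta> 0) ^ ?k * (2 * nn) / \<Delta> ^ (?k - 1)"
        using \<eta>_pos[of 0] \<Delta>1 nn0 by simp
      show "(\<Sum>xs \<in> long_lists. W xs * of_bool (matches ps xs)) \<le> (8 / \<eta> 0) ^ ?k * (2 * nn) / \<Delta> ^ (?k - 1)"
        if "length ps = ?k" "prescribed ps = card T" for ps
        using Wfull[of ps] that T(2) by (simp only:)
    qed
  qed (use w0 wsup mass zero in auto)
qed

end

section \<open>Skeletons of dense hypergraphs\<close>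

definition codeg :: "'v set set \<Rightarrow> 'v set \<Rightarrow> nat" where
  "codeg H f = card {e \<in> H. f \<subseteq> e}"

lemma card_subsets_le_pow:
  assumes "finite A"
  shows "card {B. B \<subseteq> A \<and> card B = k} \<le> card A ^ k"
proof (cases "k \<le> card A")
  case True
  then show ?thesis using n_subsets[OF assms, of k] binomial_le_pow[OF True] by simp
next
  case False
  then have "card A choose k = 0" by (intro binomial_eq_0) simp
  then show ?thesis using n_subsets[OF assms, of k] by (metis zero_le)
qed

lemma codeg_le_pow:
  assumes V0: "finite V0" and H: "H \<subseteq> {e. e \<subseteq> V0 \<and> card e = r}" and f: "f \<subseteq> V0"
  shows "codeg H f \<le> card V0 ^ (r - card f)"
proof -
  have finf: "finite f" using f V0 finite_subset by blast
  have "codeg H f \<le> card {B. B \<subseteq> V0 \<and> card B = r - card f}"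
    unfolding codeg_def
  proof (rule card_inj_on_le[where f = "\<lambda>e. e - f"])
    show "inj_on (\<lambda>e. e - f) {e \<in> H. f \<subseteq> e}"
      by (rule inj_onI) (metis (no_types, lifting) Diff_partition mem_Collect_eq)
    show "(\<lambda>e. e - f) ` {e \<in> H. f \<subseteq> e} \<subseteq> {B. B \<subseteq> V0 \<and> card B = r - card f}"
      using H finf by (auto simp: card_Diff_subset)
    show "finite {B. B \<subseteq> V0 \<and> card B = r - card f}" using V0 by simp
  qed
  also have "\<dots> \<le> card V0 ^ (r - card f)" by (rule card_subsets_le_pow[OF V0])
  finally show ?thesis .
qed

lemma dyadic_class:
  fixes d :: nat
  assumes "0 < d" "d < 2 ^ \<Lambda>"
  shows "\<exists>i<\<Lambda>. 2 ^ i \<le> d \<and> d < 2 ^ Suc i"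
proof -
  obtain i where i: "2 ^ i \<le> d" "d < 2 ^ (i + 1)" using ex_power_ivl1[of 2 d] assms by auto
  then have "(2::nat) ^ i < 2 ^ \<Lambda>" using assms by (meson le_less_trans)
  then have "i < \<Lambda>" by simp
  then show ?thesis using i by auto
qed

lemma pigeonhole_class:
  fixes c :: real and \<Lambda> :: nat
  assumes L: "finite L" "L \<subseteq> (\<Union>i<\<Lambda>. A i)" and \<Lambda>: "0 < \<Lambda>" and c: "c \<le> card L"
  shows "\<exists>i<\<Lambda>. c / \<Lambda> \<le> card (L \<inter> A i)"
proof (rule ccontr)
  assume "\<not> ?thesis"
  then have *: "\<And>i. i < \<Lambda> \<Longrightarrow> real (card (L \<inter> A i)) < c / \<Lambda>" by (auto simp: not_le)
  have "card L \<le> card (\<Union>i<\<Lambda>. L \<inter> A i)" using L by (intro card_mono) auto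
  also have "\<dots> \<le> (\<Sum>i<\<Lambda>. card (L \<inter> A i))" by (rule card_UN_le) simp
  finally have "real (card L) \<le> (\<Sum>i<\<Lambda>. real (card (L \<inter> A i)))" by (simp flip: of_nat_sum)
  also have "\<dots> < (\<Sum>i<\<Lambda>. c / \<Lambda>)" using * \<Lambda> by (intro sum_strict_mono) auto
  also have "\<dots> = c" using \<Lambda> by simp
  finally show False using c by simp
qed

lemma three_elements:
  assumes "card e \<ge> 3"
  shows "\<exists>x y z. x \<in> e \<and> y \<in> e \<and> z \<in> e \<and> x \<noteq> y \<and> x \<noteq> z \<and> y \<noteq> z"
proof -
  obtain T where T: "T \<subseteq> e" "card T = 3" by (rule obtain_subset_with_card_n[OF assms])
  then show ?thesis unfolding card_3_iff by blast
qed

locale full_hypergraph =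
  fixes V0 :: "'v set" and n r :: nat and H :: "'v set set" and h t :: real and \<Lambda> :: nat
  assumes V0: "finite V0" "card V0 = n" and r3: "3 \<le> r" and H: "H \<subseteq> {e. e \<subseteq> V0 \<and> card e = r}"
    and h: "0 < h" "h = t * real n ^ (r - 1)" and t: "0 < t"
    and Hh: "h / 2 \<le> card H" "card H \<le> h"
    and full: "\<And>e g. e \<in> H \<Longrightarrow> g \<subseteq> e \<Longrightarrow> card g = r - 1 \<Longrightarrow> t / 2 \<le> codeg H g"
    and \<Lambda>: "n ^ (r - 2) < 2 ^ \<Lambda>" "0 < \<Lambda>"
begin

lemma finH: "finite H"
  using H V0 by (auto intro: finite_subset)

lemma n_pos: "0 < n"
proof (rule ccontr)
  assume "\<not> 0 < n"
  then have "h = 0" using h(2) r3 by simp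
  then show False using h(1) by (simp only: less_irrefl)
qed

lemma H_edge: "e \<in> H \<Longrightarrow> finite e \<and> card e = r \<and> e \<subseteq> V0"
  using H V0 finite_subset by blast

text \<open>For an edge \<open>e\<close> through \<open>f\<close> and \<open>w\<close>, the set e -
  {w} still contains \<open>f\<close> and lies in at least t / 2 edges. Counted from the other side,
  an edge through \<open>f\<close> has only \<open>r\<close> subsets of size r - 1, so few edges
  through \<open>f\<close> contain \<open>w\<close>.\<close>

lemma spread:
  assumes w: "w \<notin> f" and f: "card f = 2"
  shows "t * card {e \<in> H. f \<subseteq> e \<and> w \<in> e} \<le> 2 * real r * codeg H f"
proof -
  define S where "S = {e \<in> H. f \<subseteq> e \<and> w \<in> e}"
  define D where "D = {e \<in> H. f \<subseteq> e}"
  have fin: "finite S" "finite D" using finH by (auto simp: S_def D_def)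
  have "(t / 2) * card S = (\<Sum>e \<in> S. t / 2)" by simp
  also have "\<dots> \<le> (\<Sum>e \<in> S. real (card {e' \<in> D. e - {w} \<subseteq> e'}))"
  proof (rule sum_mono)
    fix e assume e: "e \<in> S"
    have "t / 2 \<le> codeg H (e - {w})"
      using e H_edge[of e] by (intro full[of e]) (auto simp: S_def)
    also have "codeg H (e - {w}) = card {e' \<in> D. e - {w} \<subseteq> e'}"
      unfolding codeg_def D_def using e w by (intro arg_cong[of _ _ card]) (auto simp: S_def)
    finally show "t / 2 \<le> real (card {e' \<in> D. e - {w} \<subseteq> e'})" .
  qed
  also have "\<dots> = (\<Sum>e \<in> S. \<Sum>e' \<in> D. of_bool (e - {w} \<subseteq> e'))"
    using fin by (intro sum.cong refl) (simp add: of_bool_def sum.If_cases Int_def)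
  also have "\<dots> = (\<Sum>e' \<in> D. \<Sum>e \<in> S. of_bool (e - {w} \<subseteq> e'))" by (rule sum.swap)
  also have "\<dots> = (\<Sum>e' \<in> D. real (card {e \<in> S. e - {w} \<subseteq> e'}))"
    using fin by (intro sum.cong refl) (simp add: of_bool_def sum.If_cases Int_def)
  also have "\<dots> \<le> (\<Sum>e' \<in> D. real r)"
  proof (rule sum_mono)
    fix e' assume e': "e' \<in> D"
    have "card {e \<in> S. e - {w} \<subseteq> e'} \<le> card {g. g \<subseteq> e' \<and> card g = r - 1}"
    proof (rule card_inj_on_le[where f = "\<lambda>e. e - {w}"])
      show "inj_on (\<lambda>e. e - {w}) {e \<in> S. e - {w} \<subseteq> e'}"
        by (rule inj_onI) (auto simp: S_def)
      show "(\<lambda>e. e - {w}) ` {e \<in> S. e - {w} \<subseteq> e'} \<subseteq> {g. g \<subseteq> e' \<and> card g = r - 1}"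
        using H_edge by (auto simp: S_def)
      show "finite {g. g \<subseteq> e' \<and> card g = r - 1}" using e' H_edge by (auto simp: D_def)
    qed
    also have "\<dots> = r choose (r - 1)"
      using n_subsets[of e' "r - 1"] e' H_edge[of e'] by (simp add: D_def)
    also have "\<dots> = r" using r3 binomial_symmetric[of "r - 1" r] by simp
    finally show "real (card {e \<in> S. e - {w} \<subseteq> e'}) \<le> real r" by simp
  qed
  also have "\<dots> = real r * codeg H f" by (simp add: D_def codeg_def)
  finally show ?thesis by (simp add: S_def)
qed

text \<open>The codegree at which the two cases balance. A pair of codegree above \<open>D0\<close>
  has at least about sqrt (t n) third vertices, since a triple lies in at most n ^ (r - 3) edges.
  Pairs of codegree at most \<open>D0\<close> that cover most edges number at least about n sqrt (t
  n), since D0 sqrt (t n) = h / n.\<close>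

definition D0 :: real where "D0 = real n ^ (r - 3) * sqrt (t * real n)"

lemma D0_sq: "sqrt (t * real n) * D0 = h / real n" and D0_pos: "0 < D0"
proof -
  have e: "r - 1 = Suc (Suc (r - 3))" using r3 by simp
  have "sqrt (t * real n) * D0 = real n ^ (r - 3) * (t * real n)"
    using t by (simp add: D0_def)
  also have "\<dots> = h / real n" unfolding h(2) e using n_pos by simp
  finally show "sqrt (t * real n) * D0 = h / real n" .
  show "0 < D0" using n_pos t by (simp add: D0_def)
qed

definition light :: "'v set \<Rightarrow> bool" where
  "light e \<longleftrightarrow> (\<exists>f. f \<subseteq> e \<and> card f = 2 \<and> real (codeg H f) \<le> D0)"

text \<open>Chosen so that the cleaning in \<open>skeleton_heavy\<close> costs at most h / (8
  \<Lambda>): there are three kinds of labelled pairs, and codegrees sum to at most r ^ 2 h for each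
  kind.\<close>

definition K1 :: real where "K1 = 24 * real r ^ 2 * real \<Lambda>"

lemma K1_ge: "48 * real \<Lambda> \<le> K1" "real r \<le> K1" "1 \<le> K1"
proof -
  have L: "1 \<le> real \<Lambda>" using \<Lambda>(2) by simp
  have r: "3 \<le> real r" using r3 by simp
  have r2: "2 * 1 \<le> real r * real r" using r by (intro mult_mono) auto
  have "24 * (2 * 1) * real \<Lambda> \<le> 24 * (real r * real r) * real \<Lambda>"
    using r2 L by (intro mult_right_mono mult_left_mono) auto
  then show a: "48 * real \<Lambda> \<le> K1" by (simp add: K1_def power2_eq_square)
  have "real r * (1 * 1) \<le> 24 * real r * (real r * real \<Lambda>)"
    using r L by (intro mult_mono) auto
  then show "real r \<le> K1" by (simp add: K1_def power2_eq_square mult_ac)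
  show "1 \<le> K1" using a L by linarith
qed

text \<open>\<open>K\<close> collects all constant and polylogarithmic losses. The bound on edges of
  \<open>ext u v\<close> through a third vertex is what keeps random extensions of a walk from
  colliding.\<close>

definition skeleton :: "'v set \<Rightarrow> ('v \<Rightarrow> 'v set) \<Rightarrow> ('v \<Rightarrow> 'v \<Rightarrow> 'v set set) \<Rightarrow> real \<Rightarrow> real \<Rightarrow> real \<Rightarrow> bool" where
  "skeleton V N ext \<Delta> D K \<longleftrightarrow> V \<noteq> {} \<and> V \<subseteq> V0 \<and>
    (\<forall>u\<in>V. N u \<subseteq> V \<and> (\<forall>v\<in>N u. u \<in> N v) \<and> \<Delta> \<le> card (N u)) \<and>
    (\<forall>u\<in>V. \<forall>v\<in>N u. ext u v \<subseteq> {e \<in> H. u \<in> e \<and> v \<in> e} \<and> D \<le> card (ext u v) \<and>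
      (\<forall>w. w \<noteq> u \<longrightarrow> w \<noteq> v \<longrightarrow> t / K * card {e \<in> ext u v. w \<in> e} \<le> card (ext u v))) \<and>
    0 < D \<and> sqrt (t * real n) / K \<le> \<Delta> \<and> h / K \<le> (\<Sum>u\<in>V. real (card (N u))) * D \<and> h / (real n * K) \<le> \<Delta> * D"

text \<open>\<open>ex f\<close> contains at least a 1 / K1 share of the edges over \<open>f\<close>,
  so the bound of \<open>spread\<close> for all edges over \<open>f\<close> passes to
  \<open>ex f\<close> at the price of a factor \<open>K1\<close>.\<close>

lemma skeleton_of_pairs:
  fixes J :: "'v set set" and \<Delta> D :: real
  assumes J: "J \<noteq> {}" "\<And>f. f \<in> J \<Longrightarrow> f \<subseteq> V0 \<and> card f = 2"
    and deg: "\<And>u. u \<in> \<Union>J \<Longrightarrow> \<Delta> \<le> card {f \<in> J. u \<in> f}"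
    and ex: "\<And>f. f \<in> J \<Longrightarrow> ex f \<subseteq> {e \<in> H. f \<subseteq> e} \<and> D \<le> card (ex f) \<and> real (codeg H f) \<le> K1 * card (ex f)"
    and D: "0 < D" and \<Delta>: "sqrt (t * real n) / K \<le> \<Delta>" and K: "2 * real r * K1 \<le> K"
    and E: "h / K \<le> real (card J) * D" "h / (real n * K) \<le> \<Delta> * D"
  shows "\<exists>V N ext. skeleton V N ext \<Delta> D K"
proof -
  define V where "V = \<Union>J"
  define N where "N u = {v. {u, v} \<in> J}" for u
  define ext where "ext u v = ex {u, v}" for u v
  have finJ: "finite J" using J(2) V0 by (intro finite_subset[of J "Pow V0"]) auto
  have VV: "V \<subseteq> V0" using J(2) by (auto simp: V_def)
  have ne: "u \<noteq> v" if "{u, v} \<in> J" for u v using J(2)[OF that] by auto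
  have cN: "card (N u) = card {f \<in> J. u \<in> f}" for u
  proof (rule bij_betw_same_card[of "\<lambda>v. {u, v}"])
    show "bij_betw (\<lambda>v. {u, v}) (N u) {f \<in> J. u \<in> f}"
      unfolding bij_betw_def
    proof
      show "inj_on (\<lambda>v. {u, v}) (N u)" by (rule inj_onI) (auto simp: doubleton_eq_iff)
      show "(\<lambda>v. {u, v}) ` N u = {f \<in> J. u \<in> f}"
      proof
        show "{f \<in> J. u \<in> f} \<subseteq> (\<lambda>v. {u, v}) ` N u"
        proof
          fix f assume f: "f \<in> {f \<in> J. u \<in> f}"
          then obtain a b where "f = {a, b}" using J(2)[of f] by (auto simp: card_2_iff)
          then have "\<exists>v. f = {u, v}" using f by auto
          then show "f \<in> (\<lambda>v. {u, v}) ` N u" using f by (auto simp: N_def)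
        qed
      qed (auto simp: N_def)
    qed
  qed
  have "card J \<le> card (\<Union>u \<in> V. {f \<in> J. u \<in> f})"
  proof (rule card_mono)
    show "finite (\<Union>u \<in> V. {f \<in> J. u \<in> f})" using finJ by (rule finite_subset[rotated]) auto
    show "J \<subseteq> (\<Union>u \<in> V. {f \<in> J. u \<in> f})"
    proof
      fix f assume f: "f \<in> J"
      then obtain a b where "f = {a, b}" using J(2)[of f] by (auto simp: card_2_iff)
      then have "a \<in> f" by simp
      then show "f \<in> (\<Union>u \<in> V. {f \<in> J. u \<in> f})" using f unfolding V_def by blast
    qed
  qed
  also have "\<dots> \<le> (\<Sum>u \<in> V. card {f \<in> J. u \<in> f})"
    using VV V0 finite_subset by (intro card_UN_le) blast
  finally have "real (card J) \<le> (\<Sum>u \<in> V. real (card (N u)))" by (simp add: cN flip: of_nat_sum)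
  then have E1: "h / K \<le> (\<Sum>u \<in> V. real (card (N u))) * D"
    using E(1) mult_right_mono[of "real (card J)" "\<Sum>u \<in> V. real (card (N u))" D] D by linarith
  have Kp: "0 < K" using K K1_ge r3 by (smt (verit) mult_pos_pos of_nat_0_less_iff zero_less_numeral gr0I not_numeral_le_zero)
  have sp: "t / K * card {e \<in> ex {u, v}. w \<in> e} \<le> card (ex {u, v})"
    if uv: "{u, v} \<in> J" and w: "w \<noteq> u" "w \<noteq> v" for u v w
  proof -
    have "{e \<in> ex {u, v}. w \<in> e} \<subseteq> {e \<in> H. {u, v} \<subseteq> e \<and> w \<in> e}" using ex[OF uv] by auto
    then have "card {e \<in> ex {u, v}. w \<in> e} \<le> card {e \<in> H. {u, v} \<subseteq> e \<and> w \<in> e}"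
      using finH by (intro card_mono) auto
    then have "t * card {e \<in> ex {u, v}. w \<in> e} \<le> t * card {e \<in> H. {u, v} \<subseteq> e \<and> w \<in> e}"
      using t by simp
    also have "\<dots> \<le> 2 * real r * codeg H {u, v}"
      using w J(2)[OF uv] by (intro spread) auto
    also have "\<dots> \<le> 2 * real r * (K1 * card (ex {u, v}))"
      using ex[OF uv] by (intro mult_left_mono) auto
    also have "\<dots> = (2 * real r * K1) * card (ex {u, v})" by simp
    also have "\<dots> \<le> K * card (ex {u, v})" using K by (intro mult_right_mono) auto
    finally show ?thesis using Kp by (simp add: field_simps)
  qed
  have "skeleton V N ext \<Delta> D K"
    unfolding skeleton_def
  proof (intro conjI ballI allI impI)
    show "V \<noteq> {}"
    proof -
      obtain f where f: "f \<in> J" using J(1) by blast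
      then have "f \<noteq> {}" using J(2)[OF f] by auto
      then show ?thesis using f by (auto simp: V_def)
    qed
    fix u assume u: "u \<in> V"
    show "N u \<subseteq> V" by (auto simp: N_def V_def)
    show "\<Delta> \<le> real (card (N u))" using deg u by (simp add: cN V_def)
    fix v assume v: "v \<in> N u"
    then have uv: "{u, v} \<in> J" by (simp add: N_def)
    show "u \<in> N v" using uv by (simp add: N_def insert_commute)
    show "ext u v \<subseteq> {e \<in> H. u \<in> e \<and> v \<in> e}" using ex[OF uv] by (auto simp: ext_def)
    show "D \<le> real (card (ext u v))" using ex[OF uv] by (simp add: ext_def)
    fix w assume "w \<noteq> u" "w \<noteq> v"
    then show "t / K * real (card {e \<in> ext u v. w \<in> e}) \<le> real (card (ext u v))"
      unfolding ext_def by (intro sp uv)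
  qed (use VV D \<Delta> E1 E(2) in auto)
  then show ?thesis by blast
qed

lemma codeg_pair: "f \<subseteq> V0 \<Longrightarrow> card f = 2 \<Longrightarrow> codeg H f < 2 ^ \<Lambda>"
  using codeg_le_pow[OF V0(1) H, of f] V0(2) \<Lambda>(1) by simp

lemma codeg_pos: "e \<in> H \<Longrightarrow> f \<subseteq> e \<Longrightarrow> 0 < codeg H f"
  unfolding codeg_def using finH by (auto simp: card_gt_0_iff)

text \<open>The pairs of one dyadic class, of codegree about D = 2 ^ i, cover a 1 / \<Lambda> share
  of the light edges, so there are at least h / (8 \<Lambda> D) of them. Deleting vertices that lie
  in fewer than \<Delta> pairs removes at most half of the pairs. As D is at most \<open>D0\<close>,
  this \<Delta> is at least about sqrt (t n).\<close>

lemma skeleton_light: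
  assumes "h / 4 \<le> card {e \<in> H. light e}" and K: "K = 2 * K1 ^ 2"
  shows "\<exists>V N ext \<Delta> D. skeleton V N ext \<Delta> D K"
proof -
  define J0 where "J0 i = {f. f \<subseteq> V0 \<and> card f = 2 \<and> real (codeg H f) \<le> D0 \<and> 2 ^ i \<le> codeg H f \<and> codeg H f < 2 ^ Suc i}" for i :: nat
  define A where "A i = {e. \<exists>f \<in> J0 i. f \<subseteq> e}" for i
  have "{e \<in> H. light e} \<subseteq> (\<Union>i<\<Lambda>. A i)"
  proof
    fix e assume e: "e \<in> {e \<in> H. light e}"
    then obtain f where f: "f \<subseteq> e" "card f = 2" "real (codeg H f) \<le> D0" by (auto simp: light_def)
    have fV: "f \<subseteq> V0" using f e H_edge by blast
    obtain i where "i < \<Lambda>" "2 ^ i \<le> codeg H f" "codeg H f < 2 ^ Suc i"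
      using dyadic_class[OF codeg_pos codeg_pair] f e fV by blast
    then have "e \<in> A i" using f fV by (auto simp: A_def J0_def)
    then show "e \<in> (\<Union>i<\<Lambda>. A i)" using \<open>i < \<Lambda>\<close> by blast
  qed
  then obtain i where i: "i < \<Lambda>" "h / 4 / \<Lambda> \<le> card ({e \<in> H. light e} \<inter> A i)"
    using pigeonhole_class[of "{e \<in> H. light e}" A \<Lambda> "h / 4"] finH \<Lambda>(2) assms(1) by auto
  define D :: real where "D = 2 ^ i"
  have finJ0: "finite (J0 i)" using V0 by (auto simp: J0_def intro: finite_subset[of _ "Pow V0"])
  have "card ({e \<in> H. light e} \<inter> A i) \<le> card (\<Union>f \<in> J0 i. {e \<in> H. f \<subseteq> e})"
    using finH finJ0 by (intro card_mono) (auto simp: A_def)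
  also have "\<dots> \<le> (\<Sum>f \<in> J0 i. codeg H f)" unfolding codeg_def by (rule card_UN_le[OF finJ0])
  also have "\<dots> \<le> (\<Sum>f \<in> J0 i. 2 ^ Suc i)" by (rule sum_mono) (auto simp: J0_def)
  finally have "real (card ({e \<in> H. light e} \<inter> A i)) \<le> real (card (J0 i) * 2 ^ Suc i)"
    by (subst of_nat_le_iff) simp
  then have J0c: "h / (8 * \<Lambda>) \<le> card (J0 i) * D"
    using i(2) by (simp add: D_def)
  have Lp: "0 < real \<Lambda>" using \<Lambda> by simp
  have "0 < h / (8 * \<Lambda>)" using h Lp by simp
  then have J0ne: "J0 i \<noteq> {}" using J0c by auto
  define \<Delta> where "\<Delta> = real (card (J0 i)) / (2 * n)"
  have \<Delta>p: "0 < \<Delta>" using J0ne finJ0 n_pos by (simp add: \<Delta>_def card_gt_0_iff)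
  obtain J where J: "J \<subseteq> J0 i" "\<And>u. u \<in> V0 \<Longrightarrow> J \<inter> {f. u \<in> f} \<noteq> {} \<Longrightarrow> \<Delta> \<le> sum (\<lambda>_. 1) (J \<inter> {f. u \<in> f})"
    "sum (\<lambda>_. 1) (J0 i) - sum (\<lambda>_. \<Delta>) V0 \<le> sum (\<lambda>_. 1) J"
    by (rule weighted_cleaning[of "J0 i" V0 "\<lambda>_. 1" "\<lambda>_. \<Delta>" "\<lambda>u. {f. u \<in> f}"])
      (use finJ0 V0 \<Delta>p in auto)
  have cJ: "card (J0 i) / 2 \<le> card J"
    using J(3) V0(2) n_pos by (simp add: \<Delta>_def)
  have "card (J0 i) > 0" using J0ne finJ0 by (simp add: card_gt_0_iff)
  then have Jne: "J \<noteq> {}" using cJ by auto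
  have Dp: "0 < D" by (simp add: D_def)
  have KK: "16 * real \<Lambda> \<le> K" "2 * real r * K1 \<le> K"
  proof -
    have "16 * real \<Lambda> * 1 \<le> K1 * (2 * K1)" using K1_ge by (intro mult_mono) auto
    then show "16 * real \<Lambda> \<le> K" by (simp add: K power2_eq_square)
    have "2 * real r * K1 \<le> 2 * K1 * K1" using K1_ge by (intro mult_mono) auto
    then show "2 * real r * K1 \<le> K" by (simp add: K power2_eq_square)
  qed
  have Kp: "0 < K" using KK(1) Lp by linarith
  have \<Delta>D: "h / (real n * (16 * \<Lambda>)) \<le> \<Delta> * D"
  proof -
    have "h / (8 * \<Lambda>) / (2 * n) \<le> card (J0 i) * D / (2 * n)" using J0c by (intro divide_right_mono) auto
    then show ?thesis by (simp add: \<Delta>_def mult_ac)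
  qed
  have hK: "h / (c * K) \<le> h / (c * (16 * real \<Lambda>))" if "0 < c" for c
    using that KK(1) Lp h Kp by (intro divide_left_mono mult_left_mono mult_pos_pos) auto
  have "\<exists>V N ext. skeleton V N ext \<Delta> D K"
  proof (rule skeleton_of_pairs[OF Jne, where ex = "\<lambda>f. {e \<in> H. f \<subseteq> e}"])
    show "f \<subseteq> V0 \<and> card f = 2" if "f \<in> J" for f using that J(1) by (auto simp: J0_def)
    show "\<Delta> \<le> real (card {f \<in> J. u \<in> f})" if "u \<in> \<Union>J" for u
    proof -
      have "u \<in> V0" using that J(1) by (auto simp: J0_def)
      moreover have "J \<inter> {f. u \<in> f} = {f \<in> J. u \<in> f}" by auto
      ultimately show ?thesis using J(2)[of u] that by auto
    qed
    show "{e \<in> H. f \<subseteq> e} \<subseteq> {e \<in> H. f \<subseteq> e} \<and> D \<le> real (card {e \<in> H. f \<subseteq> e}) \<and>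
        real (codeg H f) \<le> K1 * real (card {e \<in> H. f \<subseteq> e})" if "f \<in> J" for f
    proof -
      have "2 ^ i \<le> codeg H f" using that J(1) by (auto simp: J0_def)
      then have "real (2 ^ i) \<le> real (codeg H f)" by (simp only: of_nat_le_iff)
      moreover have "1 * real (codeg H f) \<le> K1 * real (codeg H f)" using K1_ge by (intro mult_right_mono) auto
      ultimately show ?thesis by (simp add: D_def codeg_def)
    qed
    have "h / (1 * K) \<le> h / (1 * (16 * real \<Lambda>))" by (rule hK) simp
    also have "\<dots> = h / (8 * \<Lambda>) / 2" by simp
    also have "\<dots> \<le> card (J0 i) / 2 * D" using J0c by simp
    also have "\<dots> \<le> card J * D" using cJ Dp by (intro mult_right_mono) auto
    finally show "h / K \<le> real (card J) * D" by simp
    show "h / (real n * K) \<le> \<Delta> * D" using hK[of "real n"] n_pos \<Delta>D by simp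
    obtain f where "f \<in> J0 i" using J0ne by blast
    then have f: "2 ^ i \<le> codeg H f" "real (codeg H f) \<le> D0" by (auto simp: J0_def)
    from f(1) have "real (2 ^ i) \<le> real (codeg H f)" by (simp only: of_nat_le_iff)
    then have "real (2 ^ i) \<le> real (codeg H f)" by (simp only: of_nat_le_iff)
    from order_trans[OF this f(2)] have DD0: "D \<le> D0" by (simp add: D_def)
    have "h / n / (16 * \<Lambda>) \<le> \<Delta> * D" using \<Delta>D by simp
    also have "\<dots> \<le> \<Delta> * D0" using DD0 \<Delta>p by simp
    finally have "sqrt (t * real n) * D0 / (16 * \<Lambda>) \<le> \<Delta> * D0" by (simp add: D0_sq)
    then have "sqrt (t * real n) / (16 * \<Lambda>) * D0 \<le> \<Delta> * D0" by simp
    then have "sqrt (t * real n) / (16 * \<Lambda>) \<le> \<Delta>" using D0_pos by (rule mult_right_le_imp_le)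
    moreover have "sqrt (t * real n) / K \<le> sqrt (t * real n) / (16 * \<Lambda>)"
      using KK(1) Lp Kp t by (intro divide_left_mono mult_pos_pos) auto
    ultimately show "sqrt (t * real n) / K \<le> \<Delta>" by simp
  qed (use Dp KK in auto)
  then show ?thesis by blast
qed

lemma sum_codeg_le:
  "(\<Sum>(x, y) \<in> {(x, y). x \<in> V0 \<and> y \<in> V0}. real (codeg H {x, y})) \<le> real r ^ 2 * h"
proof -
  let ?P = "{(x, y). x \<in> V0 \<and> y \<in> V0}"
  have finP: "finite ?P" using V0 by (simp add: case_prod_unfold flip: mem_Times_iff)
  have "(\<Sum>(x, y) \<in> ?P. real (codeg H {x, y})) = (\<Sum>p \<in> ?P. \<Sum>e \<in> H. of_bool (fst p \<in> e \<and> snd p \<in> e))"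
    unfolding codeg_def using finH
    by (intro sum.cong refl) (auto simp: of_bool_def sum.If_cases Int_def)
  also have "\<dots> = (\<Sum>e \<in> H. \<Sum>p \<in> ?P. of_bool (fst p \<in> e \<and> snd p \<in> e))" by (rule sum.swap)
  also have "\<dots> \<le> (\<Sum>e \<in> H. real r ^ 2)"
  proof (rule sum_mono)
    fix e assume e: "e \<in> H"
    have "(\<Sum>p \<in> ?P. of_bool (fst p \<in> e \<and> snd p \<in> e)) = real (card {p \<in> ?P. fst p \<in> e \<and> snd p \<in> e})"
      using finP by (simp add: of_bool_def sum.If_cases Int_def)
    also have "card {p \<in> ?P. fst p \<in> e \<and> snd p \<in> e} \<le> card (e \<times> e)"
      using H_edge[OF e] by (intro card_mono) auto
    also have "card (e \<times> e) = r ^ 2" using H_edge[OF e] by (simp add: card_cartesian_product power2_eq_square)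
    finally show "(\<Sum>p \<in> ?P. of_bool (fst p \<in> e \<and> snd p \<in> e)) \<le> real r ^ 2" by simp
  qed
  also have "\<dots> = real r ^ 2 * card H" by simp
  also have "\<dots> \<le> real r ^ 2 * h" using Hh(2) by (intro mult_left_mono) auto
  finally show ?thesis .
qed

text \<open>Three vertices a, b, c are fixed in every edge, and the pairs {a, b} form the skeleton.
  To find many neighbours of \<open>a e\<close>, the vertex \<open>c e\<close> is held fixed as
  well: after cleaning, many edges share both labels, and a triple lies in at most n ^ (r - 3)
  edges, so their b-labels take many values. For \<open>b e\<close> the roles of a and b are
  exchanged. This is why cleaning treats all three kinds of labelled pairs.\<close>

lemma skeleton_heavy:
  assumes "h / 4 \<le> card {e \<in> H. \<not> light e}" and K: "K = 2 * K1 ^ 2"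
  shows "\<exists>V N ext \<Delta> D. skeleton V N ext \<Delta> D K"
proof -
  define H1 where "H1 = {e \<in> H. \<not> light e}"
  have "\<exists>abc. fst abc \<in> e \<and> fst (snd abc) \<in> e \<and> snd (snd abc) \<in> e \<and> fst abc \<noteq> fst (snd abc) \<and>
      fst abc \<noteq> snd (snd abc) \<and> fst (snd abc) \<noteq> snd (snd abc)" if "e \<in> H" for e
    using three_elements[of e] H_edge[OF that] r3 by (metis fst_conv snd_conv)
  then obtain abc where abc: "\<And>e. e \<in> H \<Longrightarrow> fst (abc e) \<in> e \<and> fst (snd (abc e)) \<in> e \<and> snd (snd (abc e)) \<in> e \<and>
      fst (abc e) \<noteq> fst (snd (abc e)) \<and> fst (abc e) \<noteq> snd (snd (abc e)) \<and> fst (snd (abc e)) \<noteq> snd (snd (abc e))"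
    by metis
  define a b c where "a e = fst (abc e)" and "b e = fst (snd (abc e))" and "c e = snd (snd (abc e))" for e
  have abc_in: "a e \<in> e" "b e \<in> e" "c e \<in> e" and abc_ne: "a e \<noteq> b e" "a e \<noteq> c e" "b e \<noteq> c e"
    if "e \<in> H" for e
    using abc[OF that] by (auto simp: a_def b_def c_def)
  have heavy: "D0 < codeg H {x, y}" if "e \<in> H1" "x \<in> e" "y \<in> e" "x \<noteq> y" for e x y
    using that by (auto simp: H1_def light_def not_le)
  define A where "A i = {e. 2 ^ i \<le> codeg H {a e, b e} \<and> codeg H {a e, b e} < 2 ^ Suc i}" for i :: nat
  have "H1 \<subseteq> (\<Union>i<\<Lambda>. A i)"
  proof
    fix e assume e: "e \<in> H1"
    then have eH: "e \<in> H" by (simp add: H1_def)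
    have sub: "{a e, b e} \<subseteq> e" using abc_in[OF eH] by auto
    have "{a e, b e} \<subseteq> V0" using sub H_edge[OF eH] by auto
    moreover have "card {a e, b e} = 2" using abc_ne[OF eH] by simp
    ultimately obtain i where "i < \<Lambda>" "2 ^ i \<le> codeg H {a e, b e}" "codeg H {a e, b e} < 2 ^ Suc i"
      using dyadic_class[OF codeg_pos[OF eH sub] codeg_pair] by blast
    then show "e \<in> (\<Union>i<\<Lambda>. A i)" by (auto simp: A_def)
  qed
  then obtain i where i: "i < \<Lambda>" "h / 4 / \<Lambda> \<le> card (H1 \<inter> A i)"
    using pigeonhole_class[of H1 A \<Lambda> "h / 4"] finH \<Lambda>(2) assms(1) by (auto simp: H1_def)
  define D1 :: real where "D1 = 2 ^ i"
  define L where "L = H1 \<inter> A i"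
  have LH: "L \<subseteq> H" by (auto simp: L_def H1_def)
  have finL: "finite L" using LH finH finite_subset by blast
  let ?P = "{(x, y). x \<in> V0 \<and> y \<in> V0}"
  have finP: "finite ?P" using V0 by (simp add: case_prod_unfold flip: mem_Times_iff)
  have K1p: "0 < K1" using K1_ge by linarith
  have Lp: "0 < real \<Lambda>" using \<Lambda> by simp
  define \<tau> :: "nat \<times> 'v \<times> 'v \<Rightarrow> real" where "\<tau> q = codeg H {fst (snd q), snd (snd q)} / K1" for q
  define M where "M q = {e. (if fst q = 0 then (a e, b e) else if fst q = 1 then (a e, c e) else (b e, c e)) = snd q}"
    for q :: "nat \<times> 'v \<times> 'v"
  obtain L' where L': "L' \<subseteq> L"
    "\<And>q. q \<in> {..<3} \<times> ?P \<Longrightarrow> L' \<inter> M q \<noteq> {} \<Longrightarrow> \<tau> q \<le> sum (\<lambda>_. 1) (L' \<inter> M q)"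
    "sum (\<lambda>_. 1) L - sum \<tau> ({..<3} \<times> ?P) \<le> sum (\<lambda>_. 1) L'"
    by (rule weighted_cleaning[of L "{..<3} \<times> ?P" "\<lambda>_. 1" \<tau> M])
      (use finL finP K1p in \<open>auto simp: \<tau>_def\<close>)
  have finL': "finite L'" using L'(1) finL finite_subset by blast
  have L'H: "L' \<subseteq> H" using L'(1) LH by blast
  have "sum \<tau> ({..<3} \<times> ?P) = (\<Sum>j\<in>{..<3::nat}. \<Sum>p \<in> ?P. codeg H {fst p, snd p} / K1)"
    unfolding sum.cartesian_product by (intro sum.cong refl) (simp add: \<tau>_def case_prod_unfold)
  also have "\<dots> = 3 * ((\<Sum>(x, y) \<in> ?P. real (codeg H {x, y})) / K1)"
    by (simp add: sum_divide_distrib case_prod_unfold)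
  also have "\<dots> \<le> 3 * (real r ^ 2 * h / K1)"
    using sum_codeg_le K1p by (intro mult_left_mono divide_right_mono) auto
  also have "\<dots> = h / (8 * \<Lambda>)" using r3 Lp by (simp add: K1_def)
  finally have "sum \<tau> ({..<3} \<times> ?P) \<le> h / (8 * \<Lambda>)" .
  then have cL': "h / (8 * \<Lambda>) \<le> card L'"
    using L'(3) i(2) by (simp add: L_def[symmetric])
  have L'q: "codeg H {x, y} / K1 \<le> card (L' \<inter> M (j, x, y))"
    if "e \<in> L'" "e \<in> M (j, x, y)" "x \<in> e" "y \<in> e" "j < 3" for e j x y
  proof -
    have "x \<in> V0" "y \<in> V0" using that L'H H_edge by blast+
    then have "(j, x, y) \<in> {..<3} \<times> ?P" using that by simp
    from L'(2)[OF this] show ?thesis using that by (auto simp: \<tau>_def)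
  qed
  define J where "J = (\<lambda>e. {a e, b e}) ` L'"
  define ex where "ex f = {e \<in> L'. {a e, b e} = f}" for f
  have cls: "2 ^ i \<le> codeg H f \<and> codeg H f < 2 ^ Suc i" if "f \<in> J" for f
    using that L'(1) by (auto simp: J_def L_def A_def)
  have clsr: "D1 \<le> codeg H f" "real (codeg H f) \<le> 2 * D1" if "f \<in> J" for f
  proof -
    have "real (2 ^ i) \<le> real (codeg H f)" "real (codeg H f) \<le> real (2 ^ Suc i)"
      using cls[OF that] by (simp_all only: of_nat_le_iff less_imp_le_nat)
    then show "D1 \<le> codeg H f" "real (codeg H f) \<le> 2 * D1" by (simp_all add: D1_def)
  qed
  have exc: "codeg H f / K1 \<le> card (ex f)" if "f \<in> J" for f
  proof -
    obtain e where e: "e \<in> L'" "f = {a e, b e}" using \<open>f \<in> J\<close> by (auto simp: J_def)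
    have "codeg H {a e, b e} / K1 \<le> card (L' \<inter> M (0, a e, b e))"
      using L'q[of e 0 "a e" "b e"] e abc_in L'H by (auto simp: M_def)
    also have "\<dots> \<le> card (ex f)"
      using finL' e by (intro of_nat_mono card_mono) (auto simp: ex_def M_def)
    finally show ?thesis using e by simp
  qed
  have exH: "ex f \<subseteq> {e \<in> H. f \<subseteq> e}" for f using abc_in L'H by (auto simp: ex_def)
  define D where "D = D1 / K1"
  define \<Delta> where "\<Delta> = sqrt (t * real n) / K1"
  have D1p: "0 < D1" by (simp add: D1_def)
  have Dp: "0 < D" using D1p K1p by (simp add: D_def)
  have L'ne: "L' \<noteq> {}" using cL' h Lp by (auto simp: divide_le_0_iff)
  have KK: "16 * real \<Lambda> * K1 \<le> K" "2 * real r * K1 \<le> K" "K1 \<le> K"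
  proof -
    have "16 * real \<Lambda> * K1 \<le> 2 * K1 * K1" using K1_ge by (intro mult_right_mono) auto
    then show "16 * real \<Lambda> * K1 \<le> K" by (simp add: K power2_eq_square)
    have "2 * real r * K1 \<le> 2 * K1 * K1" using K1_ge by (intro mult_mono) auto
    then show "2 * real r * K1 \<le> K" by (simp add: K power2_eq_square)
    have "1 * K1 \<le> 2 * K1 * K1" using K1_ge by (intro mult_right_mono) auto
    then show "K1 \<le> K" by (simp add: K power2_eq_square)
  qed
  have Kp: "0 < K" using KK(3) K1p by linarith
  have many: "\<Delta> \<le> card (g ` (L' \<inter> M (j, x, y)))"
    if e: "e \<in> L'" "e \<in> M (j, x, y)" "x \<in> e" "y \<in> e" "x \<noteq> y" "j < 3"
      and g: "\<And>e'. e' \<in> L' \<inter> M (j, x, y) \<Longrightarrow> g e' \<in> e' \<and> g e' \<noteq> x \<and> g e' \<noteq> y \<and> x \<in> e' \<and> y \<in> e'"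
    for g e j x y
  proof -
    let ?S = "L' \<inter> M (j, x, y)"
    have eH1: "e \<in> H1" using e L'(1) by (auto simp: L_def)
    have finS: "finite ?S" using finL' by simp
    have "D0 / K1 \<le> codeg H {x, y} / K1"
      using heavy[OF eH1 e(3,4,5)] K1p by (intro divide_right_mono) auto
    also have "\<dots> \<le> card ?S" by (rule L'q[OF e(1-4,6)])
    also have "card ?S = (\<Sum>v \<in> g ` ?S. card {e' \<in> ?S. g e' = v})"
      using sum.group[OF finS finite_imageI[OF finS] subset_refl, of "\<lambda>_. 1::nat" g] by simp
    also have "\<dots> \<le> (\<Sum>v \<in> g ` ?S. n ^ (r - 3))"
    proof (rule sum_mono)
      fix v assume "v \<in> g ` ?S"
      then obtain e' where e': "e' \<in> ?S" "v = g e'" by blast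
      have v: "v \<noteq> x" "v \<noteq> y" using g[OF e'(1)] e' by auto
      have "{x, y, v} \<subseteq> e'" using g[OF e'(1)] e' by auto
      then have sub: "{x, y, v} \<subseteq> V0" using e' L'H H_edge by blast
      have "card {e' \<in> ?S. g e' = v} \<le> codeg H {x, y, v}"
        unfolding codeg_def using finH g L'H by (intro card_mono) auto
      also have "\<dots> \<le> card V0 ^ (r - card {x, y, v})" by (rule codeg_le_pow[OF V0(1) H sub])
      also have "card {x, y, v} = 3" using v e(5) by simp
      finally show "card {e' \<in> ?S. g e' = v} \<le> n ^ (r - 3)" using V0 by simp
    qed
    finally have "D0 / K1 \<le> real (card (g ` ?S)) * real n ^ (r - 3)" by simp
    then have "\<Delta> * real n ^ (r - 3) \<le> real (card (g ` ?S)) * real n ^ (r - 3)"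
      by (simp add: \<Delta>_def D0_def mult_ac)
    then show ?thesis using n_pos by (simp add: mult_le_cancel_right)
  qed
  have "\<exists>V N ext. skeleton V N ext \<Delta> D K"
  proof (rule skeleton_of_pairs[where J = J and ex = ex])
    show "J \<noteq> {}" using L'ne by (simp add: J_def)
    show "f \<subseteq> V0 \<and> card f = 2" if "f \<in> J" for f
    proof -
      note fJ = that
      obtain e where e: "e \<in> L'" "f = {a e, b e}" using fJ by (auto simp: J_def)
      then have eH: "e \<in> H" using L'H by blast
      show ?thesis using abc_in[OF eH] abc_ne[OF eH] H_edge[OF eH] e(2) by auto
    qed
    have finJ: "finite J" using finL' by (simp add: J_def)
    show "\<Delta> \<le> real (card {f \<in> J. u \<in> f})" if u: "u \<in> \<Union>J" for u
    proof -
      obtain e where e: "e \<in> L'" "u = a e \<or> u = b e" using u by (auto simp: J_def)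
      have eH: "e \<in> H" using e L'H by blast
      from e(2) show ?thesis
      proof
        assume ua: "u = a e"
        let ?S = "L' \<inter> M (1, a e, c e)"
        have SM: "e' \<in> H" "a e' = a e" "c e' = c e" "e' \<in> L'" if "e' \<in> ?S" for e'
          using that L'H by (auto simp: M_def)
        have "\<Delta> \<le> card (b ` ?S)"
        proof (rule many[OF e(1)])
          show "e \<in> M (1, a e, c e)" by (simp add: M_def)
          show "b e' \<in> e' \<and> b e' \<noteq> a e \<and> b e' \<noteq> c e \<and> a e \<in> e' \<and> c e \<in> e'"
            if "e' \<in> ?S" for e'
            using abc_in[OF SM(1)[OF that]] abc_ne[OF SM(1)[OF that]] SM(2,3)[OF that] by auto
        qed (use abc_in[OF eH] abc_ne[OF eH] in simp_all)
        also have "card (b ` ?S) \<le> card {f \<in> J. u \<in> f}"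
        proof (rule card_inj_on_le[where f = "\<lambda>v. {u, v}"])
          show "inj_on (\<lambda>v. {u, v}) (b ` ?S)" by (rule inj_onI) (auto simp: doubleton_eq_iff)
          show "(\<lambda>v. {u, v}) ` b ` ?S \<subseteq> {f \<in> J. u \<in> f}"
          proof (rule image_subsetI)
            fix v assume "v \<in> b ` ?S"
            then obtain e' where e': "e' \<in> ?S" "v = b e'" by blast
            have "{u, v} = {a e', b e'}" using SM(2)[OF e'(1)] ua e'(2) by simp
            then show "{u, v} \<in> {f \<in> J. u \<in> f}" using SM(4)[OF e'(1)] unfolding J_def by blast
          qed
        qed (use finJ in simp)
        finally show ?thesis by simp
      next
        assume ub: "u = b e"
        let ?S = "L' \<inter> M (2, b e, c e)"
        have SM: "e' \<in> H" "b e' = b e" "c e' = c e" "e' \<in> L'" if "e' \<in> ?S" for e'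
          using that L'H by (auto simp: M_def)
        have "\<Delta> \<le> card (a ` ?S)"
        proof (rule many[OF e(1)])
          show "e \<in> M (2, b e, c e)" by (simp add: M_def)
          show "a e' \<in> e' \<and> a e' \<noteq> b e \<and> a e' \<noteq> c e \<and> b e \<in> e' \<and> c e \<in> e'"
            if "e' \<in> ?S" for e'
            using abc_in[OF SM(1)[OF that]] abc_ne[OF SM(1)[OF that]] SM(2,3)[OF that] by auto
        qed (use abc_in[OF eH] abc_ne[OF eH] in simp_all)
        also have "card (a ` ?S) \<le> card {f \<in> J. u \<in> f}"
        proof (rule card_inj_on_le[where f = "\<lambda>v. {v, u}"])
          show "inj_on (\<lambda>v. {v, u}) (a ` ?S)" by (rule inj_onI) (auto simp: doubleton_eq_iff)
          show "(\<lambda>v. {v, u}) ` a ` ?S \<subseteq> {f \<in> J. u \<in> f}"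
          proof (rule image_subsetI)
            fix v assume "v \<in> a ` ?S"
            then obtain e' where e': "e' \<in> ?S" "v = a e'" by blast
            have "{v, u} = {a e', b e'}" using SM(2)[OF e'(1)] ub e'(2) by simp
            then show "{v, u} \<in> {f \<in> J. u \<in> f}" using SM(4)[OF e'(1)] unfolding J_def by blast
          qed
        qed (use finJ in simp)
        finally show ?thesis by simp
      qed
    qed
    show "ex f \<subseteq> {e \<in> H. f \<subseteq> e} \<and> D \<le> real (card (ex f)) \<and> real (codeg H f) \<le> K1 * real (card (ex f))"
      if f: "f \<in> J" for f
    proof -
      have "D \<le> codeg H f / K1" unfolding D_def using clsr[OF f] K1p by (intro divide_right_mono) auto
      then have "D \<le> real (card (ex f))" using exc[OF f] by linarith
      moreover have "real (codeg H f) \<le> K1 * real (card (ex f))"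
        using exc[OF f] K1p by (simp add: divide_le_eq mult.commute)
      ultimately show ?thesis using exH[of f] by blast
    qed
    have "L' = (\<Union>f \<in> J. ex f)" by (auto simp: J_def ex_def)
    then have "card L' \<le> (\<Sum>f \<in> J. card (ex f))" using card_UN_le[OF finJ, of ex] by simp
    then have "real (card L') \<le> (\<Sum>f \<in> J. real (card (ex f)))" by (simp flip: of_nat_sum)
    also have "\<dots> \<le> (\<Sum>f \<in> J. 2 * D1)"
    proof (rule sum_mono)
      fix f assume f: "f \<in> J"
      have "card (ex f) \<le> codeg H f" unfolding codeg_def using exH finH by (intro card_mono) auto
      then show "real (card (ex f)) \<le> 2 * D1" using clsr(2)[OF f] by linarith
    qed
    finally have "h / (8 * \<Lambda>) \<le> card J * (2 * D1)" using cL' by simp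
    then have "h / (8 * \<Lambda>) / (2 * K1) \<le> card J * (2 * D1) / (2 * K1)" using K1p by (intro divide_right_mono) auto
    then have "h / (16 * \<Lambda> * K1) \<le> card J * D" by (simp add: D_def)
    moreover have "h / K \<le> h / (16 * \<Lambda> * K1)"
      using KK(1) Kp K1p Lp h by (intro divide_left_mono mult_pos_pos) auto
    ultimately show "h / K \<le> real (card J) * D" by simp
    show "sqrt (t * real n) / K \<le> \<Delta>"
      unfolding \<Delta>_def using KK(3) Kp K1p t by (intro divide_left_mono mult_pos_pos) auto
    obtain e where e: "e \<in> L'" using L'ne by blast
    have eJ: "{a e, b e} \<in> J" using e by (auto simp: J_def)
    have "e \<in> H1" "e \<in> H" using e L'(1) LH by (auto simp: L_def)
    then have "D0 < codeg H {a e, b e}" using heavy abc_in abc_ne by blast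
    \<comment> \<open>The pair {a, b} of an edge in \<open>H1\<close> has codegree above
      \<open>D0\<close>, which forces the dyadic class up to that size.\<close>
    then have D01: "D0 \<le> 2 * D1" using clsr(2)[OF eJ] by linarith
    have "h / (real n * K) = sqrt (t * real n) * D0 / K" by (simp add: D0_sq)
    also have "\<dots> \<le> sqrt (t * real n) * (2 * D1) / K"
      using D01 Kp t by (intro divide_right_mono mult_left_mono) auto
    also have "\<dots> = \<Delta> * D" using K1p by (simp add: K \<Delta>_def D_def power2_eq_square)
    finally show "h / (real n * K) \<le> \<Delta> * D" .
  qed (use Dp KK in auto)
  then show ?thesis by blast
qed

theorem exists_skeleton: "\<exists>V N ext \<Delta> D. skeleton V N ext \<Delta> D (2 * K1 ^ 2)"
proof -
  have "card H = card {e \<in> H. light e} + card {e \<in> H. \<not> light e}"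
    using finH by (subst card_Un_disjoint[symmetric]) (auto intro: arg_cong[of _ _ card])
  then have "h / 4 \<le> card {e \<in> H. light e} \<or> h / 4 \<le> card {e \<in> H. \<not> light e}"
    using Hh(1) by linarith
  then show ?thesis using skeleton_light skeleton_heavy by blast
qed

end

section \<open>One container step\<close>

text \<open>The value of \<eta> 0, stated outside the locale. Among the constants after it,
  \<open>ratio_const\<close> bounds G / \<Delta> so that collisions cost at most half of the mass,
  \<open>pattern_const\<close> counts positions and steps for a prescribed edge, and
  \<open>decay_const\<close> and \<open>mass_const\<close> come from \<gamma> and from the
  normalisation of the mass.\<close>

definition loss_const :: "nat \<Rightarrow> real" where "loss_const l = 1 / 2 * (1 / (8 * real l ^ 2)) ^ l"

definition ratio_const :: "nat \<Rightarrow> real" where "ratio_const l = loss_const l / (32 * real l * (2 * real l + 1))"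

definition pattern_const :: "nat \<Rightarrow> nat \<Rightarrow> real" where "pattern_const l r = 2 * real l * real r ^ 2"

definition decay_const :: "nat \<Rightarrow> real" where "decay_const l = 8 / loss_const l"

definition mass_const :: "nat \<Rightarrow> real" where "mass_const l = 32 / loss_const l"

text \<open>The summands are the demands on t / K ^ 2 made by the bound on G / \<Delta>, by the
  lower bound on \<Delta>, and by the number of extensions needed to avoid collisions.\<close>

definition density_const :: "nat \<Rightarrow> nat \<Rightarrow> real" where
  "density_const l r = 2 / ratio_const l ^ (l - 1) + (4 * (real l + 1) ^ 2 / loss_const l) ^ 2 + 8 * real l ^ 2 * (real r + 1)"

lemma loss_const: assumes "2 \<le> l" shows "0 < loss_const l" "loss_const l \<le> 1"
proof -
  have "1 / (8 * real l ^ 2) \<le> 1" 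
    using mult_mono[of 1 "real l" 1 "real l"] assms by (simp add: power2_eq_square)
  then have "(1 / (8 * real l ^ 2)) ^ l \<le> 1" by (intro power_le_one) auto
  then show "loss_const l \<le> 1" by (simp add: loss_const_def)
  show "0 < loss_const l" using assms by (simp add: loss_const_def)
qed

lemma ratio_const: assumes "2 \<le> l" shows "0 < ratio_const l" "ratio_const l \<le> 1"
proof -
  have "1 * 1 \<le> 32 * real l * (2 * real l + 1)" using assms by (intro mult_mono) auto
  then show "ratio_const l \<le> 1" using loss_const[OF assms] by (simp add: ratio_const_def divide_le_eq)
  show "0 < ratio_const l" using loss_const[OF assms] assms by (simp add: ratio_const_def)
qed

lemma const_ge_1: assumes "2 \<le> l" "1 \<le> r" shows "1 \<le> pattern_const l r" "1 \<le> decay_const l" "1 \<le> mass_const l"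
proof -
  have "1 * 1 \<le> 2 * real l * real r ^ 2" using assms by (intro mult_mono) auto
  then show "1 \<le> pattern_const l r" by (simp add: pattern_const_def)
  show "1 \<le> decay_const l" "1 \<le> mass_const l" using loss_const[OF assms(1)] by (simp_all add: decay_const_def mass_const_def le_divide_eq)
qed

lemma density_const_ge:
  assumes "2 \<le> l"
  shows "2 / ratio_const l ^ (l - 1) \<le> density_const l r" "(4 * (real l + 1) ^ 2 / loss_const l) ^ 2 \<le> density_const l r"
    "8 * real l ^ 2 * (real r + 1) \<le> density_const l r" "0 < density_const l r"
proof -
  have p: "0 < 2 / ratio_const l ^ (l - 1)" "0 \<le> (4 * (real l + 1) ^ 2 / loss_const l) ^ 2" "0 \<le> 8 * real l ^ 2 * (real r + 1)"
    using ratio_const[OF assms] by simp_all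
  show "2 / ratio_const l ^ (l - 1) \<le> density_const l r" "(4 * (real l + 1) ^ 2 / loss_const l) ^ 2 \<le> density_const l r"
    "8 * real l ^ 2 * (real r + 1) \<le> density_const l r" "0 < density_const l r"
    unfolding density_const_def using p by linarith+
qed

text \<open>Constants aside, the weights below depend on the skeleton only through \<open>\<Delta> D\<close> and the
  number of its edges times \<open>D\<close>, both of which are controlled by the size of the hypergraph.\<close>

lemma degree_product_bound:
  fixes D \<Delta> d h n K x :: real
  assumes pos: "0 < D" "0 < \<Delta>" "0 < d" "0 < h" "0 < n" "0 < K" "0 \<le> x"
    and X: "h / (n * K) \<le> \<Delta> * D" and Y: "h / K \<le> d * D"
  shows "x / (D ^ Suc i * \<Delta> ^ i * d) \<le> x * (n * K) ^ i * K / h ^ Suc i"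
proof -
  have "(h / (n * K)) ^ i * (h / K) \<le> (\<Delta> * D) ^ i * (d * D)"
    using pos X Y by (intro mult_mono power_mono) auto
  also have "\<dots> = D ^ Suc i * \<Delta> ^ i * d" by (simp add: power_mult_distrib)
  finally have "x / (D ^ Suc i * \<Delta> ^ i * d) \<le> x / ((h / (n * K)) ^ i * (h / K))"
    using pos by (intro divide_left_mono mult_pos_pos) auto
  also have "\<dots> = x * (n * K) ^ i * K / h ^ Suc i" by (simp add: power_divide mult_ac)
  finally show ?thesis .
qed

context full_hypergraph
begin

text \<open>\<open>b1\<close> answers for sets of fewer than 2 l edges, where each further edge
  costs about n G / h, and \<open>b2\<close> for whole cycles, where \<open>G\<close> has
  cancelled.\<close>

lemma normalised_cycle_weights:
  fixes b :: real
  assumes l: "2 \<le> l" and sk: "skeleton V N ext \<Delta> D K" and K: "1 \<le> K" and tK: "density_const l r * K ^ 2 \<le> t"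
    and b1: "2 * pattern_const l r * decay_const l * K ^ 2 * (real n * (real n / t) powr (1 / (2 * real l - 2))) \<le> b"
    and b2: "(pattern_const l r * decay_const l) ^ 2 * K * real n powr (1 + 1 / (2 * real l - 1)) \<le> b"
  shows "\<exists>w. (\<forall>C. 0 \<le> w C) \<and>
    (\<forall>C. w C \<noteq> 0 \<longrightarrow> (\<exists>xs es. cycle_seq (2 * l) xs es \<and> C = es ` {..<2 * l} \<and> es ` {..<2 * l} \<subseteq> H)) \<and>
    1 \<le> wdeg H w {} \<and>
    (\<forall>T. T \<noteq> {} \<longrightarrow> T \<subseteq> H \<longrightarrow> wdeg H w T \<le> mass_const l * pattern_const l r * K * b ^ (card T - 1) / h ^ card T)"
proof -
  have skV: "V \<noteq> {}" "V \<subseteq> V0" and skN: "\<And>u. u \<in> V \<Longrightarrow> N u \<subseteq> V" "\<And>u v. u \<in> V \<Longrightarrow> v \<in> N u \<Longrightarrow> u \<in> N v"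
    "\<And>u. u \<in> V \<Longrightarrow> \<Delta> \<le> card (N u)"
    and skE: "\<And>u v. u \<in> V \<Longrightarrow> v \<in> N u \<Longrightarrow> ext u v \<subseteq> {e \<in> H. u \<in> e \<and> v \<in> e}"
      "\<And>u v. u \<in> V \<Longrightarrow> v \<in> N u \<Longrightarrow> D \<le> card (ext u v)"
      "\<And>u v w. u \<in> V \<Longrightarrow> v \<in> N u \<Longrightarrow> w \<noteq> u \<Longrightarrow> w \<noteq> v \<Longrightarrow>
        t / K * card {e \<in> ext u v. w \<in> e} \<le> card (ext u v)"
    and skD: "0 < D" "sqrt (t * real n) / K \<le> \<Delta>" "h / K \<le> (\<Sum>u\<in>V. real (card (N u))) * D"
      "h / (real n * K) \<le> \<Delta> * D"
    using sk unfolding skeleton_def by simp_all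
  have n1: "1 \<le> real n" using n_pos by simp
  have e0p: "0 < loss_const l" "loss_const l \<le> 1" by (rule loss_const[OF l])+
  have r1: "1 \<le> r" using r3 by simp
  note cc = const_ge_1[OF l r1]
  have finV: "finite V" using skV V0 finite_subset by blast
  have cV: "real (card V) \<le> real n" using skV V0 card_mono[of V0 V] by simp
  have \<Delta>n: "\<Delta> \<le> real n"
  proof -
    obtain u where u: "u \<in> V" using skV by blast
    have "card (N u) \<le> card V" using skN(1)[OF u] finV by (intro card_mono)
    then show ?thesis using skN(3)[OF u] cV by linarith
  qed
  have "(sqrt (t * real n) / K) ^ 2 \<le> \<Delta> ^ 2" using skD(2) K t by (intro power_mono) auto
  then have "t * real n / K ^ 2 \<le> \<Delta> ^ 2" using t by (simp add: power_divide)
  moreover have "density_const l r * real n \<le> t * real n / K ^ 2"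
    using mult_right_mono[OF tK, of "real n"] K by (simp add: le_divide_eq mult_ac)
  ultimately have \<Delta>2: "density_const l r * real n \<le> \<Delta> ^ 2" by linarith
  have \<Delta>0: "0 < \<Delta>"
  proof -
    have "0 < sqrt (t * real n) / K" using K t n_pos by simp
    then show ?thesis using skD(2) by linarith
  qed
  have \<Delta>big: "4 * (real l + 1) ^ 2 / loss_const l \<le> \<Delta>"
  proof (rule power2_le_imp_le)
    have "(4 * (real l + 1) ^ 2 / loss_const l) ^ 2 \<le> density_const l r * 1" using density_const_ge(2)[OF l] by simp
    also have "\<dots> \<le> density_const l r * real n" using n1 density_const_ge(4)[OF l, of r] by (intro mult_left_mono) auto
    finally show "(4 * (real l + 1) ^ 2 / loss_const l) ^ 2 \<le> \<Delta> ^ 2" using \<Delta>2 by linarith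
  qed (use \<Delta>0 in simp)
  have "1 \<le> 4 * (real l + 1) ^ 2 / loss_const l"
  proof -
    have "1 * 1 \<le> 4 * (real l + 1) ^ 2" by (intro mult_mono one_le_power) auto
    then show ?thesis using e0p by (simp add: le_divide_eq)
  qed
  then have \<Delta>1: "1 \<le> \<Delta>" using \<Delta>big by linarith
  \<comment> \<open>The solution of \<Delta> G ^ (l - 1) = 2 n, as the locale of flat walks
    requires.\<close>
  define G where "G = root (l - 1) (2 * real n / \<Delta>)"
  have lp: "0 < l - 1" using l by simp
  have Gpow: "G ^ (l - 1) = 2 * real n / \<Delta>"
    unfolding G_def using \<Delta>0 by (intro real_root_pow_pos2[OF lp]) simp
  have "1 \<le> 2 * real n / \<Delta>" using \<Delta>n \<Delta>0 by (simp add: le_divide_eq)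
  then have G1: "1 \<le> G" unfolding G_def using lp by simp
  \<comment> \<open>The power of G / \<Delta> with exponent l - 1 is 2 n / \<Delta> ^ l, hence at
    most 2 n / \<Delta> ^ 2, and \<Delta> ^ 2 is at least \<open>density_const l r\<close> times
    n.\<close>
  have G\<Delta>c: "G / \<Delta> \<le> ratio_const l"
  proof -
    have "(G / \<Delta>) ^ (l - 1) = 2 * real n / (\<Delta> * \<Delta> ^ (l - 1))" 
      by (simp only: power_divide Gpow divide_divide_eq_left)
    also have "\<Delta> * \<Delta> ^ (l - 1) = \<Delta> ^ l" using l by (simp add: power_eq_if)
    also have "2 * real n / \<Delta> ^ l \<le> 2 * real n / \<Delta> ^ 2"
      using \<Delta>1 l by (intro divide_left_mono power_increasing mult_pos_pos) auto
    also have "\<dots> \<le> 2 * real n / (density_const l r * real n)"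
      using \<Delta>2 density_const_ge(4)[OF l, of r] n1 \<Delta>0 by (intro divide_left_mono mult_pos_pos) auto
    also have "\<dots> = 2 / density_const l r" using n_pos by simp
    also have "\<dots> \<le> ratio_const l ^ (l - 1)"
      using density_const_ge(1,4)[OF l, of r] ratio_const[OF l] by (simp add: divide_le_eq mult.commute)
    finally show ?thesis using power_mono_iff[of "G / \<Delta>" "ratio_const l" "l - 1"] lp G1 \<Delta>0 ratio_const[OF l] by simp
  qed
  have "G / \<Delta> \<le> 1" using G\<Delta>c ratio_const[OF l] by linarith
  then have G\<Delta>: "G \<le> \<Delta>" using \<Delta>0 by (simp add: divide_le_eq)
  interpret fw: flat_walks V N \<Delta> l "real n" G
  proof
    show "\<Delta> * G ^ (l - 1) = 2 * real n" unfolding Gpow using \<Delta>0 by simp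
  qed (use finV skN \<Delta>1 l cV skV G1 G\<Delta> in auto)
  have \<eta>0: "fw.\<eta> 0 = loss_const l" by (simp add: fw.\<eta>_def loss_const_def)
  define d where "d = fw.deg_total"
  have d: "d = (\<Sum>u\<in>V. real (card (N u)))" by (simp add: d_def fw.deg_total_def)
  have hK: "0 < h / K" using h K by simp
  have "0 < d * D" using skD(3) hK unfolding d by linarith
  then have d0: "0 < d" using skD(1) by (simp add: zero_less_mult_iff)
  obtain w where w0: "\<And>C. 0 \<le> w C"
    and wsup: "\<And>C. w C \<noteq> 0 \<Longrightarrow> \<exists>xs es. cycle_seq (2 * l) xs es \<and> C = es ` {..<2 * l} \<and> es ` {..<2 * l} \<subseteq> H"
    and wm: "loss_const l / 16 * d \<le> wdeg H w {}"
    and wT: "\<And>T. T \<noteq> {} \<Longrightarrow> T \<subseteq> H \<Longrightarrow> card T < 2 * l \<Longrightarrow>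
      wdeg H w T \<le> (pattern_const l r / D) ^ card T * (2 * (decay_const l * (G / \<Delta>)) ^ (card T - 1))"
    and wF: "\<And>T. T \<subseteq> H \<Longrightarrow> card T = 2 * l \<Longrightarrow>
      wdeg H w T \<le> (pattern_const l r / D) ^ card T * (decay_const l ^ (2 * l) * (2 * real n) / \<Delta> ^ (2 * l - 1))"
    and wZ: "\<And>T. T \<subseteq> H \<Longrightarrow> 2 * l < card T \<Longrightarrow> wdeg H w T = 0"
  proof -
    have "\<exists>w. (\<forall>C. 0 \<le> w C) \<and>
      (\<forall>C. w C \<noteq> 0 \<longrightarrow> (\<exists>xs es. cycle_seq (2 * l) xs es \<and> C = es ` {..<2 * l} \<and> es ` {..<2 * l} \<subseteq> H)) \<and>
      fw.\<eta> 0 / 16 * fw.deg_total \<le> wdeg H w {} \<and>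
      (\<forall>T. T \<noteq> {} \<longrightarrow> T \<subseteq> H \<longrightarrow> card T < 2 * l \<longrightarrow>
        wdeg H w T \<le> (2 * real l * real r ^ 2 / D) ^ card T * (2 * (8 / fw.\<eta> 0 * (G / \<Delta>)) ^ (card T - 1))) \<and>
      (\<forall>T. T \<subseteq> H \<longrightarrow> card T = 2 * l \<longrightarrow>
        wdeg H w T \<le> (2 * real l * real r ^ 2 / D) ^ card T * ((8 / fw.\<eta> 0) ^ (2 * l) * (2 * real n) / \<Delta> ^ (2 * l - 1))) \<and>
      (\<forall>T. T \<subseteq> H \<longrightarrow> 2 * l < card T \<longrightarrow> wdeg H w T = 0)"
    proof (rule fw.cycle_weights[where ext = ext and M = "t / K"])
      show "4 * (real l + 1) ^ 2 \<le> \<Delta> * fw.\<eta> 0"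
        unfolding \<eta>0 using \<Delta>big e0p by (simp add: divide_le_eq)
      have "real (2 * l) * real (2 * l + 1) * (8 / loss_const l * (G / \<Delta>)) \<le>
        real (2 * l) * real (2 * l + 1) * (8 / loss_const l * ratio_const l)"
        using G\<Delta>c e0p by (intro mult_left_mono) auto
      also have "\<dots> = 1 / 2"
      proof -
        have "0 < real l * 32 + real l * (real l * 64)" using l by (intro add_pos_pos) auto
        then show ?thesis using e0p by (simp add: ratio_const_def field_simps)
      qed
      finally show "real (2 * l) * real (2 * l + 1) * (8 / fw.\<eta> 0 * (G / \<Delta>)) \<le> 1 / 2" unfolding \<eta>0 .
      show "8 * real l ^ 2 * (real r + 1) \<le> t / K"
      proof -
        have "8 * real l ^ 2 * (real r + 1) * (K * 1) \<le> density_const l r * (K * K)"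
          using density_const_ge(3,4)[OF l, of r] K by (intro mult_mono) auto
        then have "8 * real l ^ 2 * (real r + 1) * K \<le> t" using tK by (simp add: power2_eq_square)
        then show ?thesis using K by (simp add: le_divide_eq)
      qed
    qed (use finH H_edge r3 skE skD(1) in auto)
    then show thesis
      unfolding \<eta>0 pattern_const_def[symmetric] decay_const_def[symmetric] d_def[symmetric]
    proof (elim exE conjE, goal_cases)
      case (1 w)
      show thesis
      proof (rule that[of w])
        show "0 \<le> w C" for C by (rule 1(1)[rule_format])
        show "\<exists>xs es. cycle_seq (2 * l) xs es \<and> C = es ` {..<2 * l} \<and> es ` {..<2 * l} \<subseteq> H"
          if "w C \<noteq> 0" for C by (rule 1(2)[rule_format, OF that])
        show "loss_const l / 16 * d \<le> wdeg H w {}" by (rule 1(3))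
        show "wdeg H w T \<le> (pattern_const l r / D) ^ card T * (2 * (decay_const l * (G / \<Delta>)) ^ (card T - 1))"
          if "T \<noteq> {}" "T \<subseteq> H" "card T < 2 * l" for T by (rule 1(4)[rule_format, OF that])
        show "wdeg H w T \<le> (pattern_const l r / D) ^ card T * (decay_const l ^ (2 * l) * (2 * real n) / \<Delta> ^ (2 * l - 1))"
          if "T \<subseteq> H" "card T = 2 * l" for T by (rule 1(5)[rule_format, OF that])
        show "wdeg H w T = 0" if "T \<subseteq> H" "2 * l < card T" for T by (rule 1(6)[rule_format, OF that])
      qed
    qed
  qed
  define c where "c = loss_const l / 16 * d"
  have cp: "0 < c" using e0p d0 by (simp add: c_def)
  have wd: "wdeg H (\<lambda>C. w C / c) T = wdeg H w T / c" for T
    by (simp add: wdeg_def sum_divide_distrib)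
  \<comment> \<open>Here the bound sqrt (t n) / K on \<Delta> enters: n / sqrt (t n) is the square
    root of n / t, and taking the root of order l - 1 turns the exponent 1 / 2 into 1 / (2 l -
    2).\<close>
  have GK: "G \<le> 2 * K * (real n / t) powr (1 / (2 * real l - 2))"
  proof -
    have "0 < sqrt (t * real n) / K" using K t n_pos by simp
    then have "G ^ (l - 1) \<le> 2 * real n / (sqrt (t * real n) / K)"
      unfolding Gpow using skD(2) \<Delta>0 by (intro divide_left_mono mult_pos_pos) auto
    also have "\<dots> = 2 * K * (real n / (sqrt t * sqrt (real n)))" by (simp add: real_sqrt_mult)
    also have "real n / (sqrt t * sqrt (real n)) = sqrt (real n) / sqrt t"
      using n_pos by (metis div_by_0 divide_divide_eq_left' mult.commute of_nat_0_le_iff real_div_sqrt)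
    also have "\<dots> = (real n / t) powr (1 / 2)" using t by (simp add: powr_half_sqrt real_sqrt_divide)
    also have "2 * K * (real n / t) powr (1 / 2) \<le> (2 * K) ^ (l - 1) * (real n / t) powr (1 / 2)"
      using K lp by (intro mult_right_mono self_le_power) auto
    also have "(real n / t) powr (1 / 2) = ((real n / t) powr (1 / (2 * real l - 2))) ^ (l - 1)"
    proof -
      have "((real n / t) powr (1 / (2 * real l - 2))) ^ (l - 1) =
        (real n / t) powr (real (l - 1) * (1 / (2 * real l - 2)))" using t n_pos by (intro powr_power) simp
      also have "real (l - 1) * (1 / (2 * real l - 2)) = 1 / 2" using l by (simp add: of_nat_diff field_simps)
      finally show ?thesis by (rule sym)
    qed
    finally have "G ^ (l - 1) \<le> (2 * K * (real n / t) powr (1 / (2 * real l - 2))) ^ (l - 1)"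
      by (simp add: power_mult_distrib)
    then show ?thesis using power_mono_iff[of G "2 * K * (real n / t) powr (1 / (2 * real l - 2))" "l - 1"] lp G1 K
      by simp
  qed
  have b0: "0 \<le> b"
  proof -
    have "0 \<le> (pattern_const l r * decay_const l) ^ 2 * K * real n powr (1 + 1 / (2 * real l - 1))" using K by simp
    then show ?thesis using b2 by linarith
  qed
  have bG: "pattern_const l r * decay_const l * G * (real n * K) \<le> b"
  proof -
    have "pattern_const l r * decay_const l * G * (real n * K) \<le>
      pattern_const l r * decay_const l * (2 * K * (real n / t) powr (1 / (2 * real l - 2))) * (real n * K)"
      using GK cc K by (intro mult_right_mono mult_left_mono) auto
    also have "\<dots> = 2 * pattern_const l r * decay_const l * K ^ 2 * (real n * (real n / t) powr (1 / (2 * real l - 2)))"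
      by (simp add: power2_eq_square)
    finally show ?thesis using b1 by linarith
  qed
  \<comment> \<open>For a whole cycle b ^ (2 l - 1) must dominate n ^ (2 l) up to the loss factors,
    whence the exponent 1 + 1 / (2 l - 1) in \<open>b2\<close>.\<close>
  have bF: "(pattern_const l r * decay_const l) ^ (2 * l) * real n * (real n * K) ^ (2 * l - 1) \<le> pattern_const l r * b ^ (2 * l - 1)"
  proof -
    have k: "2 * l = Suc (2 * l - 1)" using l by simp
    have c12: "1 \<le> pattern_const l r * decay_const l" using mult_mono[OF cc(1,2)] cc by simp
    have "(pattern_const l r * decay_const l) ^ (2 * l) * real n * (real n * K) ^ (2 * l - 1) =
      (pattern_const l r * decay_const l) ^ (2 * l) * K ^ (2 * l - 1) * real n ^ (2 * l)"
      by (subst (3) k) (simp add: power_mult_distrib)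
    also have "\<dots> \<le> (pattern_const l r * decay_const l) ^ (2 * (2 * l - 1)) * K ^ (2 * l - 1) * real n ^ (2 * l)"
      using c12 K l by (intro mult_right_mono power_increasing) auto
    also have "real n ^ (2 * l) = (real n powr (1 + 1 / (2 * real l - 1))) ^ (2 * l - 1)"
    proof -
      have "(1 + 1 / (2 * real l - 1)) * real (2 * l - 1) = real (2 * l)"
        using l by (simp add: of_nat_diff field_simps)
      then show ?thesis using n_pos by (simp add: powr_powr flip: powr_realpow)
    qed
    also have "(pattern_const l r * decay_const l) ^ (2 * (2 * l - 1)) * K ^ (2 * l - 1) * (real n powr (1 + 1 / (2 * real l - 1))) ^ (2 * l - 1) =
      ((pattern_const l r * decay_const l) ^ 2 * K * real n powr (1 + 1 / (2 * real l - 1))) ^ (2 * l - 1)"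
      by (simp only: power_mult_distrib power_mult)
    also have "\<dots> \<le> b ^ (2 * l - 1)" using b2 K by (intro power_mono) auto
    also have "\<dots> \<le> pattern_const l r * b ^ (2 * l - 1)" using cc(1) b0 mult_right_mono[OF cc(1), of "b ^ (2 * l - 1)"] by simp
    finally show ?thesis .
  qed
  have prod: "x / (D ^ Suc i * \<Delta> ^ i * d) \<le> x * (real n * K) ^ i * K / h ^ Suc i" if "0 \<le> x" for x i
    using that skD(1,3,4) \<Delta>0 d0 h n_pos K unfolding d[symmetric] by (intro degree_product_bound) auto
  have bound: "wdeg H w T / c \<le> mass_const l * pattern_const l r * K * b ^ (card T - 1) / h ^ card T"
    if T: "T \<noteq> {}" "T \<subseteq> H" for T
  proof -
    have "finite T" using T finH finite_subset by blast
    then obtain i where i: "card T = Suc i" using T by (cases "card T") auto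
    consider "card T < 2 * l" | "card T = 2 * l" | "2 * l < card T" by linarith
    then show ?thesis
    proof cases
      case 1
      have "wdeg H w T / c \<le> (pattern_const l r / D) ^ Suc i * (2 * (decay_const l * (G / \<Delta>)) ^ i) / c"
        using wT[OF T 1] cp i by (intro divide_right_mono) auto
      also have "\<dots> = mass_const l * pattern_const l r * (pattern_const l r * decay_const l * G) ^ i / (D ^ Suc i * \<Delta> ^ i * d)"
        using e0p by (simp add: c_def mass_const_def power_divide power_mult_distrib mult_ac)
      also have "\<dots> \<le> mass_const l * pattern_const l r * (pattern_const l r * decay_const l * G) ^ i * (real n * K) ^ i * K / h ^ Suc i"
        using cc G1 by (intro prod) simp
      also have "\<dots> = mass_const l * pattern_const l r * K * (pattern_const l r * decay_const l * G * (real n * K)) ^ i / h ^ Suc i"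
        by (simp add: power_mult_distrib)
      also have "\<dots> \<le> mass_const l * pattern_const l r * K * b ^ i / h ^ Suc i"
        using bG cc K G1 h by (intro divide_right_mono mult_left_mono power_mono) auto
      finally show ?thesis using i by simp
    next
      case 2
      then have i': "2 * l = Suc i" "2 * l - 1 = i" using i by simp_all
      have "wdeg H w T / c \<le> (pattern_const l r / D) ^ Suc i * (decay_const l ^ Suc i * (2 * real n) / \<Delta> ^ i) / c"
        using wF[OF T(2) 2] cp unfolding i i' by (intro divide_right_mono) auto
      also have "\<dots> = mass_const l * ((pattern_const l r * decay_const l) ^ Suc i * real n) / (D ^ Suc i * \<Delta> ^ i * d)"
        using e0p by (simp add: c_def mass_const_def power_divide power_mult_distrib mult_ac)
      also have "\<dots> \<le> mass_const l * ((pattern_const l r * decay_const l) ^ Suc i * real n) * (real n * K) ^ i * K / h ^ Suc i"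
        using cc by (intro prod) simp
      also have "\<dots> = mass_const l * ((pattern_const l r * decay_const l) ^ Suc i * real n * (real n * K) ^ i) * K / h ^ Suc i" by simp
      also have "\<dots> \<le> mass_const l * (pattern_const l r * b ^ i) * K / h ^ Suc i"
        using bF cc K h unfolding i' by (intro divide_right_mono mult_right_mono mult_left_mono) auto
      finally show ?thesis using i by (simp add: mult_ac)
    next
      case 3
      then show ?thesis using wZ[OF T(2) 3] cc K b0 h by simp
    qed
  qed
  show ?thesis
  proof (rule exI[of _ "\<lambda>C. w C / c"], intro conjI allI impI)
    show "0 \<le> w C / c" for C using w0[of C] cp by simp
    show "\<exists>xs es. cycle_seq (2 * l) xs es \<and> C = es ` {..<2 * l} \<and> es ` {..<2 * l} \<subseteq> H" if "w C / c \<noteq> 0" for C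
      using that by (intro wsup) auto
    show "1 \<le> wdeg H (\<lambda>C. w C / c) {}" unfolding wd using wm cp by (simp add: c_def le_divide_eq)
    show "wdeg H (\<lambda>C. w C / c) T \<le> mass_const l * pattern_const l r * K * b ^ (card T - 1) / h ^ card T"
      if "T \<noteq> {}" "T \<subseteq> H" for T unfolding wd by (rule bound[OF that])
  qed
qed

end

definition cycle_free :: "nat \<Rightarrow> 'v set set \<Rightarrow> bool" where
  "cycle_free k I \<longleftrightarrow> (\<forall>xs es. cycle_seq k xs es \<longrightarrow> \<not> es ` {..<k} \<subseteq> I)"

text \<open>A single constant above all thresholds of \<open>one_container_step\<close>. The term 2
  * 576 * r ^ 4 is 2 K1 ^ 2 without its factor \<Lambda> ^ 2.\<close>

definition container_const :: "nat \<Rightarrow> nat \<Rightarrow> real" where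
  "container_const l r = (2 * 576 * real r ^ 4) ^ 2 * (density_const l r + 2 * (pattern_const l r * decay_const l) ^ 2) + 2 * mass_const l * pattern_const l r * (2 * 576 * real r ^ 4) * 2 ^ ((2 * l + 2) ^ 2)"

text \<open>Cleaning passes from \<open>A\<close> to \<open>H\<close>, where (r - 1)-subsets of
  edges have codegree at least t / 2. It costs at most half of the edges, since there are at most n
  ^ (r - 1) such subsets. The edges lost are put into every container, so a shrinking of
  \<open>H\<close> by a fixed share is one of \<open>A\<close> by at least half of that
  share.\<close>

theorem one_container_step:
  fixes V0 :: "'v set" and n r l \<Lambda> b :: nat and t :: real
  assumes V0: "finite V0" "card V0 = n" and r3: "3 \<le> r" and l: "2 \<le> l"
    and A: "A \<subseteq> {e. e \<subseteq> V0 \<and> card e = r}" and t: "card A = t * real n ^ (r - 1)" and \<Lambda>: "n ^ (r - 2) < 2 ^ \<Lambda>" "0 < \<Lambda>"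
    and tC: "container_const l r * real \<Lambda> ^ 4 \<le> t" and n: "0 < n"
    and b1: "container_const l r * real \<Lambda> ^ 4 * (real n * (real n / t) powr (1 / (2 * real l - 2))) \<le> b"
    and b2: "container_const l r * real \<Lambda> ^ 4 * real n powr (1 + 1 / (2 * real l - 1)) \<le> b"
  shows "\<exists>f. (\<forall>xs. f xs \<subseteq> A \<and> real (card (f xs)) \<le> (1 - 1 / (container_const l r * real \<Lambda> ^ 2)) * card A) \<and>
    (\<forall>I. I \<subseteq> A \<longrightarrow> cycle_free (2 * l) I \<longrightarrow> (\<exists>xs. set xs \<subseteq> I \<and> length xs \<le> 2 * l * b \<and> I - set xs \<subseteq> f xs))"
proof -
  have r1: "1 \<le> r" using r3 by simp
  note cc = const_ge_1[OF l r1]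
  have L1: "1 \<le> real \<Lambda>" using \<Lambda> by simp
  define K where "K = 2 * (24 * real r ^ 2 * real \<Lambda>) ^ 2"
  have KL: "K = 2 * 576 * real r ^ 4 * real \<Lambda> ^ 2" by (simp add: K_def power_mult_distrib flip: power_mult)
  have r4: "1 \<le> real r ^ 4" using r1 by simp
  have "1 * 1 \<le> 2 * 576 * real r ^ 4 * real \<Lambda> ^ 2" using r4 L1 by (intro mult_mono one_le_power) auto
  then have K1: "1 \<le> K" by (simp add: KL)
  define cr where "cr = 2 * 576 * real r ^ 4"
  have cr1: "1 \<le> cr" using r4 by (simp add: cr_def)
  have Kcr: "K = cr * real \<Lambda> ^ 2" "K ^ 2 = cr ^ 2 * real \<Lambda> ^ 4" by (simp_all add: KL cr_def power_mult_distrib flip: power_mult)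
  define m where "m = mass_const l * pattern_const l r * cr * 2 ^ ((2 * l + 2) ^ 2)"
  have mp: "1 \<le> m"
  proof -
    have "1 * 1 * 1 * 1 \<le> mass_const l * pattern_const l r * cr * 2 ^ ((2 * l + 2) ^ 2)" using cc cr1 by (intro mult_mono) auto
    then show ?thesis by (simp add: m_def)
  qed
  have cCeq: "container_const l r = cr ^ 2 * (density_const l r + 2 * (pattern_const l r * decay_const l) ^ 2) + 2 * m" by (simp add: container_const_def cr_def m_def)
  have c12: "1 \<le> pattern_const l r * decay_const l" using mult_mono[OF cc(1,2)] cc by simp
  have c12': "pattern_const l r * decay_const l \<le> (pattern_const l r * decay_const l) ^ 2" using mult_right_mono[OF c12, of "pattern_const l r * decay_const l"] c12 by (simp add: power2_eq_square)
  have cCp: "0 < container_const l r" "cr ^ 2 * density_const l r \<le> container_const l r" "cr ^ 2 * (2 * (pattern_const l r * decay_const l) ^ 2) \<le> container_const l r" "2 * m \<le> container_const l r"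
  proof -
    have "0 \<le> cr ^ 2 * density_const l r" "0 \<le> cr ^ 2 * (2 * (pattern_const l r * decay_const l) ^ 2)" using density_const_ge(4)[OF l, of r] by simp_all
    then show "0 < container_const l r" "cr ^ 2 * density_const l r \<le> container_const l r" "cr ^ 2 * (2 * (pattern_const l r * decay_const l) ^ 2) \<le> container_const l r" "2 * m \<le> container_const l r"
      unfolding cCeq distrib_left using mp by linarith+
  qed
  have t0: "0 < t"
  proof -
    have "0 < container_const l r * real \<Lambda> ^ 4" using cCp(1) L1 by simp
    then show ?thesis using tC by linarith
  qed
  have finA: "finite A" using A V0 by (auto intro: finite_subset)
  have cA: "0 < real (card A)" using t t0 n by simp
  let ?P = "{g. g \<subseteq> V0 \<and> card g = r - 1}"
  have finP: "finite ?P" using V0 by simp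
  obtain H where H: "H \<subseteq> A"
    "\<And>g. g \<in> ?P \<Longrightarrow> H \<inter> {e. g \<subseteq> e} \<noteq> {} \<Longrightarrow> t / 2 \<le> sum (\<lambda>_. 1) (H \<inter> {e. g \<subseteq> e})"
    "sum (\<lambda>_. 1) A - sum (\<lambda>_. t / 2) ?P \<le> sum (\<lambda>_. 1) H"
    by (rule weighted_cleaning[of A ?P "\<lambda>_. 1" "\<lambda>_. t / 2" "\<lambda>g. {e. g \<subseteq> e}"]) (use finA finP t0 in auto)
  note HsubA = H(1)
  have finH: "finite H" using H(1) finA finite_subset by blast
  have "real (card ?P) \<le> real (n ^ (r - 1))"
    using card_subsets_le_pow[OF V0(1), of "r - 1"] V0(2) by (simp only: of_nat_le_iff)
  then have "real (card ?P) * (t / 2) \<le> real n ^ (r - 1) * (t / 2)" using t0 by (intro mult_right_mono) auto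
  also have "\<dots> = card A / 2" by (simp add: t)
  finally have Hhalf: "card A / 2 \<le> card H" using H(3) by simp
  have HA: "card H \<le> card A" using H(1) finA by (rule card_mono[rotated])
  interpret full_hypergraph V0 n r H "card A" t \<Lambda>
  proof
    show "t / 2 \<le> real (codeg H g)" if "e \<in> H" "g \<subseteq> e" "card g = r - 1" for e g
    proof -
      have "g \<in> ?P" using that H(1) A by blast
      moreover have "H \<inter> {e. g \<subseteq> e} \<noteq> {}" using that by blast
      ultimately have "t / 2 \<le> sum (\<lambda>_. 1) (H \<inter> {e. g \<subseteq> e})" by (rule H(2))
      also have "\<dots> = real (codeg H g)" by (simp add: codeg_def Int_def)
      finally show ?thesis .
    qed
  qed (use V0 r3 H(1) A cA t t0 Hhalf HA \<Lambda> in auto)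
  obtain V N ext \<Delta> D where sk: "skeleton V N ext \<Delta> D K"
    using exists_skeleton unfolding K1_def K_def by blast
  have L2: "real \<Lambda> ^ 2 \<le> real \<Lambda> ^ 4" using L1 by (intro power_increasing) auto
  have "density_const l r * K ^ 2 \<le> container_const l r * real \<Lambda> ^ 4"
    using mult_right_mono[OF cCp(2), of "real \<Lambda> ^ 4"] by (simp add: Kcr(2) mult_ac)
  then have tK: "density_const l r * K ^ 2 \<le> t" using tC by linarith
  have bb1: "2 * pattern_const l r * decay_const l * K ^ 2 * (real n * (real n / t) powr (1 / (2 * real l - 2))) \<le> real b"
  proof -
    have "2 * pattern_const l r * decay_const l * K ^ 2 = cr ^ 2 * (2 * (pattern_const l r * decay_const l)) * real \<Lambda> ^ 4" by (simp add: Kcr(2))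
    also have "\<dots> \<le> cr ^ 2 * (2 * (pattern_const l r * decay_const l) ^ 2) * real \<Lambda> ^ 4"
      using c12' by (intro mult_right_mono mult_left_mono) auto
    also have "\<dots> \<le> container_const l r * real \<Lambda> ^ 4" using cCp(3) by (intro mult_right_mono) auto
    finally have "2 * pattern_const l r * decay_const l * K ^ 2 * (real n * (real n / t) powr (1 / (2 * real l - 2))) \<le>
      container_const l r * real \<Lambda> ^ 4 * (real n * (real n / t) powr (1 / (2 * real l - 2)))"
      by (intro mult_right_mono) auto
    then show ?thesis using b1 by linarith
  qed
  have bb2: "(pattern_const l r * decay_const l) ^ 2 * K * real n powr (1 + 1 / (2 * real l - 1)) \<le> real b"
  proof -
    have "(pattern_const l r * decay_const l) ^ 2 * K \<le> (pattern_const l r * decay_const l) ^ 2 * (2 * cr ^ 2 * real \<Lambda> ^ 4)"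
    proof (rule mult_left_mono)
      have "K = 1 * cr * real \<Lambda> ^ 2" by (simp add: Kcr)
      also have "\<dots> \<le> (2 * cr) * cr * real \<Lambda> ^ 4" using cr1 L2 by (intro mult_mono) auto
      finally show "K \<le> 2 * cr ^ 2 * real \<Lambda> ^ 4" by (simp add: power2_eq_square)
    qed simp
    also have "\<dots> = cr ^ 2 * (2 * (pattern_const l r * decay_const l) ^ 2) * real \<Lambda> ^ 4" by simp
    also have "\<dots> \<le> container_const l r * real \<Lambda> ^ 4" using cCp(3) by (intro mult_right_mono) auto
    finally have "(pattern_const l r * decay_const l) ^ 2 * K * real n powr (1 + 1 / (2 * real l - 1)) \<le>
      container_const l r * real \<Lambda> ^ 4 * real n powr (1 + 1 / (2 * real l - 1))"
      by (intro mult_right_mono) auto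
    then show ?thesis using b2 by linarith
  qed
  obtain w where w0: "\<And>C. 0 \<le> w C"
    and wsup: "\<And>C. w C \<noteq> 0 \<Longrightarrow> \<exists>xs es. cycle_seq (2 * l) xs es \<and> C = es ` {..<2 * l} \<and> es ` {..<2 * l} \<subseteq> H"
    and wm: "1 \<le> wdeg H w {}"
    and wT: "\<And>T. T \<noteq> {} \<Longrightarrow> T \<subseteq> H \<Longrightarrow>
      wdeg H w T \<le> mass_const l * pattern_const l r * K * real b ^ (card T - 1) / real (card A) ^ card T"
    using normalised_cycle_weights[OF l sk K1 tK bb1 bb2]
  proof (elim exE conjE, goal_cases)
    case (1 w)
    show thesis
    proof (rule 1(1))
      show "0 \<le> w C" for C by (rule 1(2)[rule_format])
      show "\<exists>xs es. cycle_seq (2 * l) xs es \<and> C = es ` {..<2 * l} \<and> es ` {..<2 * l} \<subseteq> H"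
        if "w C \<noteq> 0" for C by (rule 1(3)[rule_format, OF that])
      show "1 \<le> wdeg H w {}" by (rule 1(4))
      show "wdeg H w T \<le> mass_const l * pattern_const l r * K * real b ^ (card T - 1) / real (card A) ^ card T"
        if "T \<noteq> {}" "T \<subseteq> H" for T by (rule 1(5)[rule_format, OF that])
    qed
  qed
  have cH: "0 < real (card H)" using Hhalf cA by linarith
  then have Hne: "H \<noteq> {}" by auto
  \<comment> \<open>With this q the bound b ^ (j - 1) / card A ^ j, relaxed from
    \<open>card A\<close> to the smaller \<open>card H\<close>, reads q ^ (j - 1) / card H as
    \<open>container\<close> expects.\<close>
  define q where "q = real b / real (card H)"
  have b0: "0 < real b"
  proof -
    have "0 < container_const l r * real \<Lambda> ^ 4 * real n powr (1 + 1 / (2 * real l - 1))" using cCp(1) L1 n by simp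
    then show ?thesis using b2 by linarith
  qed
  obtain f where f: "\<And>xs. f xs \<subseteq> H"
    "\<And>xs. real (card (f xs)) \<le> (1 - 1 / (mass_const l * pattern_const l r * K * 2 ^ ((2 * l + 2) ^ 2))) * card H"
    "\<And>I. I \<subseteq> H \<Longrightarrow> (\<And>C. w C \<noteq> 0 \<Longrightarrow> \<not> C \<subseteq> I) \<Longrightarrow>
      \<exists>xs. set xs \<subseteq> I \<and> length xs \<le> 2 * l * b \<and> I - set xs \<subseteq> f xs"
  proof (rule container[OF finH Hne w0, where k = "2 * l" and q = q and K = "mass_const l * pattern_const l r * K" and b = b])
    show "C \<subseteq> H \<and> card C = 2 * l" if nz: "w C \<noteq> 0" for C
    proof -
      obtain xs es where x: "cycle_seq (2 * l) xs es" "C = es ` {..<2 * l}" "es ` {..<2 * l} \<subseteq> H"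
        using wsup[OF nz] by blast
      have "inj_on es {..<2 * l}"
      proof (rule cycle_seq_inj[OF x(1)])
        fix i assume "i < 2 * l"
        then have "es i \<in> H" using x(3) by blast
        then show "3 \<le> card (es i)" using H_edge r3 by simp
      qed
      then show ?thesis using x by (simp add: card_image)
    qed
    show "0 < mass_const l * pattern_const l r * K" using cc K1 by simp
    show "q * real (card H) \<le> real b" using cH by (simp add: q_def)
    show "0 < q" using b0 cH by (simp add: q_def)
    show "wdeg H w T \<le> mass_const l * pattern_const l r * K * q ^ (card T - 1) / real (card H)" if T: "T \<noteq> {}" "T \<subseteq> H" for T
    proof -
      have "finite T" using T finH finite_subset by blast
      then obtain i where i: "card T = Suc i" using T by (cases "card T") auto
      have "wdeg H w T \<le> mass_const l * pattern_const l r * K * real b ^ i / real (card A) ^ Suc i" using wT[OF T] i by simp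
      also have "\<dots> \<le> mass_const l * pattern_const l r * K * real b ^ i / real (card H) ^ Suc i"
        using cc K1 cH HA by (intro divide_left_mono power_mono mult_pos_pos) auto
      also have "\<dots> = mass_const l * pattern_const l r * K * q ^ i / real (card H)" by (simp add: q_def power_divide)
      finally show ?thesis using i by simp
    qed
  qed (use l wm in auto)
  have mK: "mass_const l * pattern_const l r * K * 2 ^ ((2 * l + 2) ^ 2) = m * real \<Lambda> ^ 2" by (simp add: m_def Kcr)
  show ?thesis
  proof (rule exI[of _ "\<lambda>xs. (A - H) \<union> f xs"], intro conjI allI impI)
    fix xs
    show "A - H \<union> f xs \<subseteq> A" using f(1)[of xs] HsubA by blast
    have mL: "0 < m * real \<Lambda> ^ 2" using mp L1 by simp
    have "card (A - H \<union> f xs) \<le> card (A - H) + card (f xs)" by (rule card_Un_le)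
    then have "real (card (A - H \<union> f xs)) \<le> real (card (A - H)) + real (card (f xs))" by linarith
    also have "card (A - H) = card A - card H" using HsubA finH by (simp add: card_Diff_subset)
    also have "real (card A - card H) = real (card A) - real (card H)" using HA by simp
    also have "real (card A) - real (card H) + real (card (f xs)) \<le>
      real (card A) - real (card H) + (1 - 1 / (m * real \<Lambda> ^ 2)) * card H" using f(2)[of xs] unfolding mK by simp
    also have "\<dots> = real (card A) - 1 / (m * real \<Lambda> ^ 2) * card H" by (simp add: algebra_simps)
    also have "\<dots> \<le> real (card A) - 1 / (m * real \<Lambda> ^ 2) * (card A / 2)"
      using Hhalf mL by (intro diff_left_mono mult_left_mono) auto
    also have "\<dots> = real (card A) - 1 / (2 * m * real \<Lambda> ^ 2) * card A" by simp
    also have "\<dots> \<le> real (card A) - 1 / (container_const l r * real \<Lambda> ^ 2) * card A"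
      using cCp(1,4) mp L1 by (intro diff_left_mono mult_right_mono divide_left_mono mult_pos_pos) auto
    finally show "real (card (A - H \<union> f xs)) \<le> (1 - 1 / (container_const l r * real \<Lambda> ^ 2)) * real (card A)"
      by (simp add: algebra_simps)
  next
    fix I assume I: "I \<subseteq> A" "cycle_free (2 * l) I"
    have "\<not> C \<subseteq> I \<inter> H" if nz: "w C \<noteq> 0" for C
      using wsup[OF nz]
    proof (elim exE conjE)
      fix xs es assume x: "cycle_seq (2 * l) xs es" "C = es ` {..<2 * l}"
      then show "\<not> C \<subseteq> I \<inter> H" using I(2)[unfolded cycle_free_def, rule_format, OF x(1)] by simp
    qed
    then obtain xs where xs: "set xs \<subseteq> I \<inter> H" "length xs \<le> 2 * l * b" "I \<inter> H - set xs \<subseteq> f xs"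
      using f(3)[of "I \<inter> H"] by blast
    then show "\<exists>xs. set xs \<subseteq> I \<and> length xs \<le> 2 * l * b \<and> I - set xs \<subseteq> A - H \<union> f xs"
      using I(1) by blast
  qed
qed

section \<open>Random hypergraphs\<close>

lemma cycle_free_mono: "cycle_free k I \<Longrightarrow> J \<subseteq> I \<Longrightarrow> cycle_free k J"
  unfolding cycle_free_def by (meson subset_trans)

lemma sum_power_le: "(\<Sum>i\<le>m. a ^ i) \<le> (a + 1) ^ m" for a m :: nat
proof (induction m)
  case (Suc m)
  have "a * a ^ m \<le> a * (a + 1) ^ m" by (intro mult_left_mono power_mono) auto
  have "(\<Sum>i\<le>Suc m. a ^ i) = (\<Sum>i\<le>m. a ^ i) + a * a ^ m" by simp
  also have "\<dots> \<le> (a + 1) ^ m + a * (a + 1) ^ m" using Suc \<open>a * a ^ m \<le> a * (a + 1) ^ m\<close> by (rule add_mono)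
  also have "\<dots> = (a + 1) ^ Suc m" by simp
  finally show ?case .
qed simp

text \<open>A container with at least \<open>N0\<close> elements is refined, a smaller one is kept.
  A round multiplies the number of containers by at most the number \<open>M\<close> of fingerprints
  and puts the at most \<open>m\<close> fingerprint elements back into each container.\<close>

lemma iterate_containers:
  fixes N0 \<delta> :: real and E :: "'e set" and M m :: nat
  assumes E: "finite E" and N0: "0 \<le> N0" and \<delta>: "\<delta> \<le> 1"
    and mono: "\<And>I J. free I \<Longrightarrow> J \<subseteq> I \<Longrightarrow> free J"
    and step: "\<And>A. A \<subseteq> E \<Longrightarrow> N0 \<le> card A \<Longrightarrow>
      \<exists>f. (\<forall>xs. f xs \<subseteq> A \<and> real (card (f xs)) \<le> (1 - \<delta>) * card A) \<and>
        (\<forall>I. I \<subseteq> A \<longrightarrow> free I \<longrightarrow> (\<exists>xs. set xs \<subseteq> I \<and> length xs \<le> m \<and> I - set xs \<subseteq> f xs))"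
    and M: "M = (card E + 1) ^ m"
  shows "A \<subseteq> E \<Longrightarrow> (1 - \<delta>) ^ k * card A \<le> N0 \<Longrightarrow>
    \<exists>\<C>. finite \<C> \<and> card \<C> \<le> M ^ k \<and> (\<forall>C \<in> \<C>. C \<subseteq> E \<and> real (card C) \<le> N0 + real k * real m) \<and>
      (\<forall>I. I \<subseteq> A \<longrightarrow> free I \<longrightarrow> (\<exists>C \<in> \<C>. I \<subseteq> C))"
proof (induction k arbitrary: A)
  case 0
  then show ?case by (intro exI[of _ "{A}"]) auto
next
  case (Suc k)
  show ?case
  proof (cases "N0 \<le> card A")
    case False
    have "1 \<le> M ^ Suc k" by (simp add: M)
    moreover have "real (card A) \<le> N0 + real (Suc k) * real m"
    proof -
      have "0 \<le> real (Suc k) * real m" by simp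
      then show ?thesis using False by linarith
    qed
    ultimately show ?thesis using Suc.prems(1) by (intro exI[of _ "{A}"]) (auto simp del: of_nat_Suc power_Suc)
  next
    case True
    from step[OF Suc.prems(1) True]
    obtain f where ff: "(\<forall>xs. f xs \<subseteq> A \<and> real (card (f xs)) \<le> (1 - \<delta>) * card A) \<and>
        (\<forall>I. I \<subseteq> A \<longrightarrow> free I \<longrightarrow> (\<exists>xs. set xs \<subseteq> I \<and> length xs \<le> m \<and> I - set xs \<subseteq> f xs))"
      by (rule exE)
    have f: "f xs \<subseteq> A" "real (card (f xs)) \<le> (1 - \<delta>) * card A"
      "I \<subseteq> A \<Longrightarrow> free I \<Longrightarrow> \<exists>xs. set xs \<subseteq> I \<and> length xs \<le> m \<and> I - set xs \<subseteq> f xs" for xs I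
      using ff by simp_all
    have "\<exists>\<C>. finite \<C> \<and> card \<C> \<le> M ^ k \<and> (\<forall>C \<in> \<C>. C \<subseteq> E \<and> real (card C) \<le> N0 + real k * real m) \<and>
      (\<forall>I. I \<subseteq> f xs \<longrightarrow> free I \<longrightarrow> (\<exists>C \<in> \<C>. I \<subseteq> C))" for xs
    proof (rule Suc.IH)
      show "f xs \<subseteq> E" using f(1)[of xs] Suc.prems(1) by (rule subset_trans)
      have "(1 - \<delta>) ^ k * real (card (f xs)) \<le> (1 - \<delta>) ^ k * ((1 - \<delta>) * card A)"
        using f(2)[of xs] \<delta> by (intro mult_left_mono) auto
      also have "\<dots> = (1 - \<delta>) ^ Suc k * card A" by simp
      finally show "(1 - \<delta>) ^ k * real (card (f xs)) \<le> N0" using Suc.prems(2) by linarith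
    qed
    then have "\<forall>xs. \<exists>\<C>. finite \<C> \<and> card \<C> \<le> M ^ k \<and> (\<forall>C \<in> \<C>. C \<subseteq> E \<and> real (card C) \<le> N0 + real k * real m) \<and>
      (\<forall>I. I \<subseteq> f xs \<longrightarrow> free I \<longrightarrow> (\<exists>C \<in> \<C>. I \<subseteq> C))" by (rule allI)
    from choice[OF this] obtain \<C> where c0: "\<forall>xs. finite (\<C> xs) \<and> card (\<C> xs) \<le> M ^ k \<and>
      (\<forall>C \<in> \<C> xs. C \<subseteq> E \<and> real (card C) \<le> N0 + real k * real m) \<and>
      (\<forall>I. I \<subseteq> f xs \<longrightarrow> free I \<longrightarrow> (\<exists>C \<in> \<C> xs. I \<subseteq> C))"
      by (rule exE)
    note c = spec[OF c0]
    define L where "L = {xs. set xs \<subseteq> E \<and> length xs \<le> m}"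
    have finL: "finite L" unfolding L_def by (rule finite_lists_length_le[OF E])
    have cL: "card L \<le> M" unfolding L_def card_lists_length_le[OF E] M by (rule sum_power_le)
    define \<D> where "\<D> = (\<Union>xs \<in> L. (\<lambda>C. set xs \<union> C) ` \<C> xs)"
    have "card \<D> \<le> (\<Sum>xs \<in> L. card ((\<lambda>C. set xs \<union> C) ` \<C> xs))" unfolding \<D>_def by (rule card_UN_le[OF finL])
    also have "\<dots> \<le> (\<Sum>xs \<in> L. M ^ k)"
    proof (rule sum_mono)
      fix xs
      have "card ((\<lambda>C. set xs \<union> C) ` \<C> xs) \<le> card (\<C> xs)" using c[of xs] by (intro card_image_le) simp
      then show "card ((\<lambda>C. set xs \<union> C) ` \<C> xs) \<le> M ^ k" using c[of xs] by linarith
    qed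
    also have "\<dots> \<le> M ^ Suc k" using cL by simp
    finally have "card \<D> \<le> M ^ Suc k" .
    moreover have "finite \<D>" unfolding \<D>_def using finL c by simp
    moreover have "C \<subseteq> E \<and> real (card C) \<le> N0 + real (Suc k) * real m" if "C \<in> \<D>" for C
    proof -
      note CD = that
      obtain xs C' where x: "xs \<in> L" "C' \<in> \<C> xs" "C = set xs \<union> C'" using CD unfolding \<D>_def by blast
      have C': "C' \<subseteq> E" "real (card C') \<le> N0 + real k * real m" using c[of xs] x(2) by simp_all
      have "card C \<le> card (set xs) + card C'" unfolding x(3) by (rule card_Un_le)
      also have "card (set xs) \<le> m" using card_length[of xs] x(1) unfolding L_def by simp
      finally have "real (card C) \<le> real m + real (card C')" by linarith
      then have "real (card C) \<le> N0 + real (Suc k) * real m" using C'(2) by (simp add: algebra_simps)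
      then show ?thesis using C'(1) x(1,3) by (simp add: L_def)
    qed
    moreover have "\<exists>C \<in> \<D>. I \<subseteq> C" if I: "I \<subseteq> A" "free I" for I
    proof -
      obtain xs where xs: "set xs \<subseteq> I" "length xs \<le> m" "I - set xs \<subseteq> f xs" using f(3)[OF I] by blast
      have "free (I - set xs)" by (rule mono[OF I(2)]) simp
      then obtain C where C: "C \<in> \<C> xs" "I - set xs \<subseteq> C" using c[of xs] xs(3) by meson
      have "set xs \<subseteq> E" using xs(1) I(1) Suc.prems(1) by (meson subset_trans)
      then have "xs \<in> L" using xs(2) by (simp add: L_def)
      then have "set xs \<union> C \<in> \<D>" using C(1) unfolding \<D>_def by blast
      moreover have "I \<subseteq> set xs \<union> C" using C(2) by blast
      ultimately show ?thesis by blast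
    qed
    ultimately show ?thesis by (intro exI[of _ \<D>]) simp
  qed
qed

text \<open>Markov's inequality applied to the exponential of the number of elements.\<close>

lemma random_subset_tail:
  fixes p s :: real
  assumes K: "finite K" and C: "C \<subseteq> K" and p: "0 \<le> p" "p \<le> 1"
  shows "measure_pmf.prob (Pi_pmf K False (\<lambda>_. bernoulli_pmf p)) {\<omega>. s \<le> card {e \<in> C. \<omega> e}}
    \<le> exp (2 * p * card C - s)"
proof -
  let ?Q = "Pi_pmf K False (\<lambda>_. bernoulli_pmf p)"
  let ?f = "\<lambda>e b. if e \<in> C \<and> b then exp 1 else (1::real)"
  have "set_pmf ?Q = PiE_dflt K False (set_pmf \<circ> (\<lambda>_. bernoulli_pmf p))" by (rule set_Pi_pmf[OF K])
  also have "finite \<dots>" using K by (intro finite_PiE_dflt) auto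
  finally have fin: "finite (set_pmf ?Q)" .
  have finC: "finite C" using C K finite_subset by blast
  have g: "(\<Prod>e \<in> K. ?f e (\<omega> e)) = exp (card {e \<in> C. \<omega> e})" for \<omega>
  proof -
    have "(\<Prod>e \<in> K. ?f e (\<omega> e)) = (\<Prod>e \<in> {e \<in> K. e \<in> C \<and> \<omega> e}. exp 1)"
      by (rule prod.inter_filter[symmetric, OF K])
    also have "{e \<in> K. e \<in> C \<and> \<omega> e} = {e \<in> C. \<omega> e}" using C by blast
    finally show ?thesis by (simp add: exp_of_nat_mult[symmetric])
  qed
  have "measure_pmf.prob ?Q {\<omega>. s \<le> card {e \<in> C. \<omega> e}} =
    measure_pmf.expectation ?Q (indicator {\<omega>. s \<le> card {e \<in> C. \<omega> e}})" by simp
  also have "\<dots> \<le> measure_pmf.expectation ?Q (\<lambda>\<omega>. (\<Prod>e \<in> K. ?f e (\<omega> e)) * exp (- s))"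
  proof (rule integral_mono)
    fix \<omega>
    have "(1::real) \<le> exp (card {e \<in> C. \<omega> e}) * exp (- s)" if "s \<le> card {e \<in> C. \<omega> e}"
      using that by (simp flip: exp_add)
    then show "indicator {\<omega>. s \<le> card {e \<in> C. \<omega> e}} \<omega> \<le> (\<Prod>e \<in> K. ?f e (\<omega> e)) * exp (- s)"
      unfolding g by (auto simp: indicator_def)
  qed (use fin in \<open>auto intro: integrable_measure_pmf_finite\<close>)
  also have "\<dots> = measure_pmf.expectation ?Q (\<lambda>\<omega>. \<Prod>e \<in> K. ?f e (\<omega> e)) * exp (- s)" by simp
  also have "measure_pmf.expectation ?Q (\<lambda>\<omega>. \<Prod>e \<in> K. ?f e (\<omega> e)) =
    (\<Prod>e \<in> K. measure_pmf.expectation (bernoulli_pmf p) (?f e))"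
    using K by (intro expectation_prod_Pi_pmf) (auto intro: integrable_measure_pmf_finite)
  also have "\<dots> = (\<Prod>e \<in> K. if e \<in> C then exp 1 * p + (1 - p) else 1)"
    using p by (intro prod.cong refl) simp
  also have "\<dots> = (\<Prod>e \<in> C. exp 1 * p + (1 - p))"
    using prod.inter_restrict[OF K, of "\<lambda>_. exp 1 * p + (1 - p)" C] C by (simp add: Int_absorb1)
  also have "\<dots> \<le> (\<Prod>e \<in> C. exp (2 * p))"
  proof (rule prod_mono)
    fix e
    have "exp 1 * p + (1 - p) \<le> 3 * p + (1 - p)" using exp_le p by (intro add_right_mono mult_right_mono) auto
    also have "\<dots> = 1 + 2 * p" by simp
    also have "\<dots> \<le> exp (2 * p)" by (rule exp_ge_add_one_self)
    finally show "0 \<le> exp 1 * p + (1 - p) \<and> exp 1 * p + (1 - p) \<le> exp (2 * p)" using p by simp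
  qed
  also have "\<dots> = exp (2 * p * card C)" by (simp add: exp_of_nat_mult[symmetric] mult_ac)
  finally show ?thesis by (simp add: exp_diff exp_minus divide_inverse mult_right_mono)
qed

text \<open>By \<open>cycle_seq_copy\<close> an extremal subhypergraph has a
  \<open>cycle_free\<close> edge set. It exists because the set of sizes is finite and contains 0,
  from the empty hypergraph.\<close>

lemma turan_le:
  fixes G :: "'a hypergraph"
  assumes G: "finite (verts G)" "finite (edges G)" "\<And>e. e \<in> edges G \<Longrightarrow> card e = r"
    and l: "2 \<le> l" and r: "3 \<le> r"
    and I: "\<And>I. I \<subseteq> edges G \<Longrightarrow> cycle_free (2 * l) I \<Longrightarrow> real (card I) \<le> s"
  shows "real (turan_number G (linear_cycle r (2 * l))) \<le> s"
proof -
  let ?S = "{card (edges F) | F. subhypergraph F G \<and> \<not> contains_copy F (linear_cycle r (2 * l))}"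
  have "?S \<subseteq> card ` edges ` (Pow (verts G) \<times> Pow (edges G))"
    by (force simp: subhypergraph_def image_iff)
  then have fin: "finite ?S" by (rule finite_subset) (use G in simp)
  let ?E0 = "({}, {}) :: 'a hypergraph"
  have "Inl 0 \<in> verts (linear_cycle r (2 * l))" using l by (simp add: linear_cycle_def)
  then have "\<not> contains_copy ?E0 (linear_cycle r (2 * l))" unfolding contains_copy_def by auto
  moreover have "subhypergraph ?E0 G" by (simp add: subhypergraph_def)
  ultimately have "card (edges ?E0) \<in> ?S" by blast
  then have ne: "?S \<noteq> {}" by blast
  obtain F where F: "turan_number G (linear_cycle r (2 * l)) = card (edges F)"
    "subhypergraph F G" "\<not> contains_copy F (linear_cycle r (2 * l))"
    using Max_in[OF fin ne] unfolding turan_number_def by blast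
  have "cycle_free (2 * l) (edges F)"
    unfolding cycle_free_def
  proof (intro allI impI notI)
    fix xs es assume x: "cycle_seq (2 * l) xs es" "es ` {..<2 * l} \<subseteq> edges F"
    have "contains_copy F (linear_cycle r (2 * l))"
    proof (rule cycle_seq_copy[OF x(1)])
      fix i assume "i < 2 * l"
      then have "es i \<in> edges F" using x(2) by blast
      then show "card (es i) = r \<and> es i \<in> edges F \<and> es i \<subseteq> verts F"
        using F(2) G(3) by (auto simp: subhypergraph_def)
    qed (use l r in auto)
    then show False using F(3) by contradiction
  qed
  then show ?thesis unfolding F(1) using F(2) by (intro I) (auto simp: subhypergraph_def)
qed

text \<open>If the bound fails, some container has at least \<open>s\<close> present edges. By the
  hypothesis on \<open>s\<close>, half of \<open>s\<close> pays for twice the expected number of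
  present edges in a container and for the logarithm of the number of containers; the other half
  remains in the probability.\<close>

lemma random_turan_bound:
  fixes p t s :: real and n l r k b \<Lambda> :: nat
  assumes l: "2 \<le> l" and r: "3 \<le> r" and p: "0 \<le> p" "p \<le> 1" and n: "0 < n"
    and \<Lambda>: "n ^ (r - 2) < 2 ^ \<Lambda>" "0 < \<Lambda>" and tC: "container_const l r * real \<Lambda> ^ 4 \<le> t" "0 < t"
    and b1: "container_const l r * real \<Lambda> ^ 4 * (real n * (real n / t) powr (1 / (2 * real l - 2))) \<le> b"
    and b2: "container_const l r * real \<Lambda> ^ 4 * real n powr (1 + 1 / (2 * real l - 1)) \<le> b"
    and container_const: "1 \<le> container_const l r * real \<Lambda> ^ 2"
    and k: "(1 - 1 / (container_const l r * real \<Lambda> ^ 2)) ^ k * real n ^ r \<le> t * real n ^ (r - 1)"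
    and s: "2 * (2 * p * (t * real n ^ (r - 1) + real k * (2 * l * b)) + real k * (2 * l * b) * ln (real n ^ r + 1)) \<le> s"
  shows "1 - exp (- s / 2) \<le> measure_pmf.prob (random_hypergraph r n p)
    {G. real (turan_number G (linear_cycle r (2 * l))) \<le> s}"
proof -
  define K where "K = {e. e \<subseteq> {..<n} \<and> card e = r}"
  have finK: "finite K" by (simp add: K_def)
  have cK: "card K \<le> n ^ r" using card_subsets_le_pow[of "{..<n}" r] by (simp add: K_def)
  let ?Q = "Pi_pmf K False (\<lambda>_. bernoulli_pmf p)"
  define N0 where "N0 = t * real n ^ (r - 1)"
  define \<delta> where "\<delta> = 1 / (container_const l r * real \<Lambda> ^ 2)"
  define M where "M = (card K + 1) ^ (2 * l * b)"
  have N0: "0 \<le> N0" using tC(2) by (simp add: N0_def)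
  have \<delta>: "0 \<le> \<delta>" "\<delta> \<le> 1" using container_const by (simp_all add: \<delta>_def)
  have cCp: "0 \<le> container_const l r"
  proof (rule ccontr)
    assume "\<not> 0 \<le> container_const l r"
    then have "container_const l r * real \<Lambda> ^ 2 \<le> 0" by (intro mult_nonpos_nonneg) auto
    then show False using container_const by linarith
  qed
  have "\<exists>\<C>. finite \<C> \<and> card \<C> \<le> M ^ k \<and> (\<forall>C \<in> \<C>. C \<subseteq> K \<and> card C \<le> N0 + real k * (2 * l * b)) \<and>
      (\<forall>I. I \<subseteq> K \<longrightarrow> cycle_free (2 * l) I \<longrightarrow> (\<exists>C \<in> \<C>. I \<subseteq> C))"
  proof (rule iterate_containers[OF finK N0 \<delta>(2) cycle_free_mono _ M_def subset_refl])
    have "(1 - \<delta>) ^ k * real (card K) \<le> (1 - \<delta>) ^ k * real n ^ r"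
    proof (rule mult_left_mono)
      have "real (card K) \<le> real (n ^ r)" using cK by (rule of_nat_mono)
      then show "real (card K) \<le> real n ^ r" by simp
    qed (use \<delta> in simp)
    then show "(1 - \<delta>) ^ k * real (card K) \<le> N0" using k unfolding \<delta>_def N0_def by linarith
    fix A assume A: "A \<subseteq> K" "N0 \<le> real (card A)"
    \<comment> \<open>A set to be refined may be denser than \<open>t\<close>, which only relaxes
      the demand on \<open>b\<close>.\<close>
    define t' where "t' = card A / real n ^ (r - 1)"
    have t': "card A = t' * real n ^ (r - 1)" using n by (simp add: t'_def)
    have tt: "t \<le> t'" using A(2) n by (simp add: t'_def N0_def le_divide_eq)
    have m: "(real n / t') powr (1 / (2 * real l - 2)) \<le> (real n / t) powr (1 / (2 * real l - 2))"
      using tt tC(2) l by (intro powr_mono2 divide_left_mono mult_pos_pos) auto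
    show "\<exists>f. (\<forall>xs. f xs \<subseteq> A \<and> real (card (f xs)) \<le> (1 - \<delta>) * real (card A)) \<and>
      (\<forall>I. I \<subseteq> A \<longrightarrow> cycle_free (2 * l) I \<longrightarrow> (\<exists>xs. set xs \<subseteq> I \<and> length xs \<le> 2 * l * b \<and> I - set xs \<subseteq> f xs))"
      unfolding \<delta>_def
    proof (rule one_container_step[of "{..<n}" n r l A t' \<Lambda> b, OF _ _ r l _ t' \<Lambda> _ n _ b2])
      have "container_const l r * real \<Lambda> ^ 4 * (real n * (real n / t') powr (1 / (2 * real l - 2))) \<le>
        container_const l r * real \<Lambda> ^ 4 * (real n * (real n / t) powr (1 / (2 * real l - 2)))"
        using m cCp by (intro mult_left_mono) auto
      then show "container_const l r * real \<Lambda> ^ 4 * (real n * (real n / t') powr (1 / (2 * real l - 2))) \<le> real b"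
        using b1 by linarith
    qed (use A(1) tC tt in \<open>auto simp: K_def\<close>)
  qed
  then obtain \<C> where c: "finite \<C>" "card \<C> \<le> M ^ k" "\<And>C. C \<in> \<C> \<Longrightarrow> C \<subseteq> K \<and> card C \<le> N0 + real k * (2 * l * b)"
      "\<And>I. I \<subseteq> K \<Longrightarrow> cycle_free (2 * l) I \<Longrightarrow> \<exists>C \<in> \<C>. I \<subseteq> C"
    by (elim exE conjE) simp
  define G where "G \<omega> = ({..<n}, {e \<in> K. \<omega> e})" for \<omega>
  have rh: "random_hypergraph r n p = map_pmf G ?Q" by (simp add: random_hypergraph_def K_def G_def[abs_def] Let_def)
  let ?good = "{G. real (turan_number G (linear_cycle r (2 * l))) \<le> s}"
  define bad where "bad C = {\<omega>. s \<le> card {e \<in> C. \<omega> e}}" for C :: "nat set set"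
  have "- (G -` ?good) \<subseteq> (\<Union>C \<in> \<C>. bad C)"
  proof
    fix \<omega> assume w: "\<omega> \<in> - (G -` ?good)"
    show "\<omega> \<in> (\<Union>C \<in> \<C>. bad C)"
    proof (rule ccontr)
      assume nb: "\<omega> \<notin> (\<Union>C \<in> \<C>. bad C)"
      have "real (turan_number (G \<omega>) (linear_cycle r (2 * l))) \<le> s"
      proof (rule turan_le[OF _ _ _ l r])
        fix I assume I: "I \<subseteq> edges (G \<omega>)" "cycle_free (2 * l) I"
        then have "I \<subseteq> K" by (auto simp: G_def)
        then obtain C where C: "C \<in> \<C>" "I \<subseteq> C" using c(4) I(2) by blast
        have "finite C" using c(3)[OF C(1)] finK finite_subset by blast
        moreover have "I \<subseteq> {e \<in> C. \<omega> e}" using I(1) C(2) by (auto simp: G_def)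
        ultimately have "card I \<le> card {e \<in> C. \<omega> e}" by (intro card_mono) auto
        moreover have "real (card {e \<in> C. \<omega> e}) < s" using nb C(1) by (auto simp: bad_def not_le)
        ultimately show "real (card I) \<le> s" by linarith
      qed (auto simp: G_def finK, simp add: K_def)
      then show False using w by simp
    qed
  qed
  then have "measure_pmf.prob ?Q (- (G -` ?good)) \<le> measure_pmf.prob ?Q (\<Union>C \<in> \<C>. bad C)"
    by (intro measure_pmf.finite_measure_mono) auto
  also have "\<dots> \<le> (\<Sum>C \<in> \<C>. measure_pmf.prob ?Q (bad C))"
    by (rule measure_pmf.finite_measure_subadditive_finite[OF c(1)]) auto
  also have "\<dots> \<le> (\<Sum>C \<in> \<C>. exp (2 * p * (N0 + real k * (2 * l * b)) - s))"
  proof (rule sum_mono)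
    fix C assume C: "C \<in> \<C>"
    have "measure_pmf.prob ?Q (bad C) \<le> exp (2 * p * card C - s)"
      unfolding bad_def using c(3)[OF C] by (intro random_subset_tail finK p) simp
    also have "\<dots> \<le> exp (2 * p * (N0 + real k * (2 * l * b)) - s)"
      using c(3)[OF C] p by (simp only: exp_le_cancel_iff) (intro diff_right_mono mult_left_mono, auto)
    finally show "measure_pmf.prob ?Q (bad C) \<le> exp (2 * p * (N0 + real k * (2 * l * b)) - s)" .
  qed
  also have "\<dots> = real (card \<C>) * exp (2 * p * (N0 + real k * (2 * l * b)) - s)" by simp
  also have "\<dots> \<le> exp (real k * (2 * l * b) * ln (real n ^ r + 1)) * exp (2 * p * (N0 + real k * (2 * l * b)) - s)"
  proof (rule mult_right_mono)
    have "real (card \<C>) \<le> real (M ^ k)" using c(2) by (rule of_nat_mono)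
    also have "\<dots> = (real (card K) + 1) ^ (2 * l * b * k)" by (simp add: M_def power_mult add.commute)
    also have "\<dots> \<le> (real n ^ r + 1) ^ (2 * l * b * k)"
    proof (rule power_mono)
      have "real (card K) \<le> real (n ^ r)" using cK by (rule of_nat_mono)
      then show "real (card K) + 1 \<le> real n ^ r + 1" by simp
    qed simp
    also have "\<dots> = exp (real (2 * l * b * k) * ln (real n ^ r + 1))"
      by (subst exp_of_nat_mult) (simp add: add_nonneg_pos)
    finally show "real (card \<C>) \<le> exp (real k * (2 * l * b) * ln (real n ^ r + 1))" by (simp add: mult_ac)
  qed simp
  also have "\<dots> \<le> exp (- s / 2)"
    using s unfolding N0_def by (simp flip: exp_add)
  finally have "measure_pmf.prob ?Q (- (G -` ?good)) \<le> exp (- s / 2)" .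
  moreover have "measure_pmf.prob ?Q (- (G -` ?good)) = 1 - measure_pmf.prob ?Q (G -` ?good)"
    using measure_pmf.prob_compl[of "G -` ?good" ?Q] by (simp add: Compl_eq_Diff_UNIV)
  ultimately show ?thesis unfolding rh measure_map_pmf by linarith
qed

section \<open>Choice of the parameters and optimisation of the density\<close>

lemma container_const_ge_1: assumes "2 \<le> l" "1 \<le> r" shows "1 \<le> container_const l r"
proof -
  note cc = const_ge_1[OF assms]
  have r4: "1 \<le> 2 * 576 * real r ^ 4"
  proof -
    have "1 \<le> real r ^ 4" using assms by simp
    then show ?thesis by linarith
  qed
  have "1 * 1 * 1 * 1 * 1 \<le> 2 * mass_const l * pattern_const l r * (2 * 576 * real r ^ 4) * 2 ^ ((2 * l + 2) ^ 2)"
    using cc r4 by (intro mult_mono) auto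
  moreover have "0 \<le> (2 * 576 * real r ^ 4) ^ 2 * (density_const l r + 2 * (pattern_const l r * decay_const l) ^ 2)"
    using density_const_ge(4)[OF assms(1), of r] by simp
  ultimately show ?thesis unfolding container_const_def by linarith
qed

text \<open>\<open>t\<close> stays free here: the value that balances the first two summands depends
  on p and is chosen in \<open>exponent_bound\<close>.\<close>

theorem turan_whp:
  assumes l: "2 \<le> l" and r: "3 \<le> r"
  shows "\<exists>C\<ge>1. \<forall>n\<ge>3. \<forall>p. 0 \<le> p \<longrightarrow> p \<le> 1 \<longrightarrow> (\<forall>t. C * ln (real n) ^ 4 \<le> t \<longrightarrow>
    1 - exp (- real n / 2) \<le> measure_pmf.prob (random_hypergraph r n p)
      {G. real (turan_number G (linear_cycle r (2 * l))) \<le> C * ln (real n) ^ 8 *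
        (p * (t * real n ^ (r - 1)) + real n * (real n / t) powr (1 / (2 * real l - 2)) +
          real n powr (1 + 1 / (2 * real l - 1)))})"
proof -
  define c where "c = container_const l r"
  define C1 where "C1 = c * 81 * real r ^ 4"
  define C2 where "C2 = 320 * real l * real r ^ 3 * c * C1"
  define C where "C = 4 + C1 + C2"
  have c1: "1 \<le> c" unfolding c_def using l r by (intro container_const_ge_1) auto
  have r1: "1 \<le> real r" using r by simp
  have "1 * 1 * 1 \<le> c * 81 * real r ^ 4" using c1 r1 by (intro mult_mono one_le_power) auto
  then have C11: "1 \<le> C1" by (simp add: C1_def)
  have C20: "0 \<le> C2" using c1 C11 by (simp add: C2_def)
  have CC: "1 \<le> C" "4 \<le> C" "C1 \<le> C" "C2 \<le> C" using C11 C20 by (simp_all add: C_def)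
  have main: "1 - exp (- real n / 2) \<le> measure_pmf.prob (random_hypergraph r n p)
      {G. real (turan_number G (linear_cycle r (2 * l))) \<le> C * ln (real n) ^ 8 *
        (p * (t * real n ^ (r - 1)) + real n * (real n / t) powr (1 / (2 * real l - 2)) +
          real n powr (1 + 1 / (2 * real l - 1)))}"
    if n: "3 \<le> n" and p: "0 \<le> p" "p \<le> 1" and t: "C * ln (real n) ^ 4 \<le> t" for n p t
  proof -
    define L where "L = ln (real n)"
    have "exp 1 \<le> real n" using exp_le n by linarith
    then have L1: "1 \<le> L" unfolding L_def using n by (subst ln_ge_iff) auto
    have rL: "1 \<le> real r * L" using mult_mono[OF r1 L1] r1 by simp
    \<comment> \<open>2 ^ \<Lambda> has to exceed n ^ (r - 2); since ln 2 is at least 2 / 3, twice r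
      L is ample.\<close>
    define \<Lambda> where "\<Lambda> = nat \<lceil>2 * real r * L\<rceil>"
    have \<Lambda>1: "2 * real r * L \<le> real \<Lambda>" using rL by (simp add: \<Lambda>_def real_nat_ceiling_ge)
    have "real \<Lambda> \<le> 2 * real r * L + 1"
      unfolding \<Lambda>_def using rL of_int_ceiling_le_add_one[of "2 * real r * L"] by (simp add: of_nat_nat)
    then have \<Lambda>2: "real \<Lambda> \<le> 3 * real r * L" using rL by linarith
    have \<Lambda>0: "1 \<le> real \<Lambda>" using \<Lambda>1 rL by linarith
    then have \<Lambda>p: "0 < \<Lambda>" by simp
    have "real (n ^ (r - 2)) < real (2 ^ \<Lambda>)"
    proof -
      have "real (n ^ (r - 2)) < real n ^ r" using n r by (simp add: power_strict_increasing)
      also have "\<dots> = exp (real r * L)" using n by (simp add: L_def exp_of_nat_mult)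
      also have "\<dots> \<le> exp (real \<Lambda> * ln 2)"
      proof -
        have "(2 * real r * L) * (2 / 3) = 4 / 3 * (real r * L)" by simp
        then have "real r * L \<le> (2 * real r * L) * (2 / 3)" using rL by linarith
        also have "\<dots> \<le> real \<Lambda> * ln 2" using \<Lambda>1 ln2_ge_two_thirds rL by (intro mult_mono) auto
        finally show ?thesis by simp
      qed
      also have "\<dots> = real (2 ^ \<Lambda>)" by (simp add: exp_of_nat_mult)
      finally show ?thesis .
    qed
    then have \<Lambda>n: "n ^ (r - 2) < 2 ^ \<Lambda>" by (simp only: of_nat_less_iff)
    have "real \<Lambda> ^ 4 \<le> (3 * real r * L) ^ 4" using \<Lambda>2 by (intro power_mono) auto
    then have \<Lambda>4: "c * real \<Lambda> ^ 4 \<le> C1 * L ^ 4" using c1 mult_left_mono[of _ _ c] by (simp add: C1_def power_mult_distrib mult_ac)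
    have "real \<Lambda> ^ 2 \<le> (3 * real r * L) ^ 2" using \<Lambda>2 by (intro power_mono) auto
    then have \<Lambda>sq: "c * real \<Lambda> ^ 2 \<le> 9 * c * real r ^ 2 * L ^ 2" using c1 mult_left_mono[of _ _ c] by (simp add: power_mult_distrib mult_ac)
    have cL: "1 \<le> c * real \<Lambda> ^ 2" using mult_mono[OF c1 one_le_power[OF \<Lambda>0, of 2]] c1 by simp
    have L4: "1 \<le> L ^ 4" using L1 by simp
    have "1 * 1 \<le> C * L ^ 4" using CC(1) L4 by (intro mult_mono) auto
    then have t1: "1 \<le> t" using t by (simp add: L_def)
    have "C1 * L ^ 4 \<le> C * L ^ 4" using CC(3) by (intro mult_right_mono) auto
    then have tC: "c * real \<Lambda> ^ 4 \<le> t" using \<Lambda>4 t by (simp add: L_def)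
    define x where "x = real n * (real n / t) powr (1 / (2 * real l - 2))"
    define y where "y = real n powr (1 + 1 / (2 * real l - 1))"
    have x0: "0 \<le> x" by (simp add: x_def)
    have "real n powr 1 \<le> y" unfolding y_def using n l by (intro powr_mono) auto
    then have yn: "real n \<le> y" using n by simp
    have xy: "1 \<le> x + y" using x0 yn n by linarith
    define B where "B = C1 * L ^ 4 * (x + y)"
    have "1 * 1 * 1 \<le> C1 * L ^ 4 * (x + y)" using C11 L4 xy by (intro mult_mono) auto
    then have B1: "1 \<le> B" by (simp add: B_def)
    define b where "b = nat \<lceil>B\<rceil>"
    have b1: "B \<le> real b" by (simp add: b_def real_nat_ceiling_ge)
    have "real b \<le> B + 1" unfolding b_def using B1 of_int_ceiling_le_add_one[of B] by (simp add: of_nat_nat)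
    then have b2: "real b \<le> 2 * B" using B1 by linarith
    \<comment> \<open>Each round keeps at most the share 1 - 1 / (c \<Lambda> ^ 2), so this many
      rounds leave at most 1 / n of the initial n ^ r edges.\<close>
    define k where "k = nat \<lceil>c * real \<Lambda> ^ 2 * L\<rceil>"
    have k1: "c * real \<Lambda> ^ 2 * L \<le> real k" by (simp add: k_def real_nat_ceiling_ge)
    have cLL: "1 \<le> c * real \<Lambda> ^ 2 * L" using mult_mono[OF cL L1] c1 by simp
    have "real k \<le> c * real \<Lambda> ^ 2 * L + 1"
      unfolding k_def using cLL of_int_ceiling_le_add_one[of "c * real \<Lambda> ^ 2 * L"] by (simp add: of_nat_nat)
    also have "c * real \<Lambda> ^ 2 * L \<le> 9 * c * real r ^ 2 * L ^ 2 * L" using \<Lambda>sq L1 by (intro mult_right_mono) auto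
    also have "9 * c * real r ^ 2 * L ^ 2 * L + 1 \<le> 10 * c * real r ^ 2 * L ^ 3"
    proof -
      have "1 * 1 * 1 \<le> c * real r ^ 2 * L ^ 3" using c1 r1 L1 by (intro mult_mono one_le_power) auto
      then show ?thesis by (simp add: power3_eq_cube power2_eq_square mult_ac)
    qed
    finally have k2: "real k \<le> 10 * c * real r ^ 2 * L ^ 3" by simp
    \<comment> \<open>The power 8 of L arises from \<open>k\<close> of order L ^ 3, \<open>b\<close>
      of order L ^ 4 (x + y), and one more L from the logarithm of the number of edges.\<close>
    define s where "s = C * L ^ 8 * (p * (t * real n ^ (r - 1)) + x + y)"
    have L8: "1 \<le> L ^ 8" using L1 by simp
    have CL8: "4 \<le> C * L ^ 8" using mult_mono[OF CC(2) L8] CC by simp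
    have ptn: "0 \<le> p * (t * real n ^ (r - 1))" using p t1 by simp
    have "1 - exp (- s / 2) \<le> measure_pmf.prob (random_hypergraph r n p)
      {G. real (turan_number G (linear_cycle r (2 * l))) \<le> s}"
    proof (rule random_turan_bound[OF l r p _ \<Lambda>n \<Lambda>p, where t = t and b = b and k = k])
      show "0 < n" "0 < t" using n t1 by simp_all
      show "container_const l r * real \<Lambda> ^ 4 \<le> t" using tC by (simp add: c_def)
      have *: "c * real \<Lambda> ^ 4 * z \<le> real b" if "0 \<le> z" "z \<le> x + y" for z
      proof -
        have "c * real \<Lambda> ^ 4 * z \<le> C1 * L ^ 4 * (x + y)"
          by (rule mult_mono[OF \<Lambda>4 that(2)]) (use that C11 L4 in auto)
        then show ?thesis using b1 by (simp add: B_def)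
      qed
      have y0: "0 \<le> y" using yn by linarith
      show "container_const l r * real \<Lambda> ^ 4 * (real n * (real n / t) powr (1 / (2 * real l - 2))) \<le> real b"
        using *[of x] x0 y0 by (simp add: c_def x_def)
      show "container_const l r * real \<Lambda> ^ 4 * real n powr (1 + 1 / (2 * real l - 1)) \<le> real b"
        using *[of y] x0 y0 by (simp add: c_def y_def)
      show "1 \<le> container_const l r * real \<Lambda> ^ 2" using cL by (simp add: c_def)
      define \<delta> where "\<delta> = 1 / (c * real \<Lambda> ^ 2)"
      have d: "0 \<le> \<delta>" "\<delta> \<le> 1" using cL by (simp_all add: \<delta>_def)
      have "(1 - \<delta>) ^ k \<le> exp (- \<delta>) ^ k"
        using d exp_ge_add_one_self[of "- \<delta>"] by (intro power_mono) auto
      also have "\<dots> = exp (- (real k * \<delta>))" by (simp flip: exp_of_nat_mult)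
      also have "\<dots> \<le> exp (- L)" using k1 cL by (simp add: \<delta>_def le_divide_eq mult.commute)
      also have "\<dots> = 1 / real n" using n by (simp add: L_def exp_minus inverse_eq_divide)
      finally have "(1 - \<delta>) ^ k * real n ^ r \<le> 1 / real n * real n ^ r" by (intro mult_right_mono) auto
      also have "\<dots> = real n ^ (r - 1)" using n r by (simp add: power_eq_if)
      also have "\<dots> \<le> t * real n ^ (r - 1)" using t1 mult_right_mono[OF t1, of "real n ^ (r - 1)"] by simp
      finally show "(1 - 1 / (container_const l r * real \<Lambda> ^ 2)) ^ k * real n ^ r \<le> t * real n ^ (r - 1)"
        by (simp add: \<delta>_def c_def)
      have lnb: "ln (real n ^ r + 1) \<le> 2 * real r * L"
      proof -
        have "real n ^ r + 1 \<le> real n ^ r + real n ^ r" using n by simp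
        also have "\<dots> = 2 * real n ^ r" by simp
        also have "\<dots> \<le> real n * real n ^ r" using n by (intro mult_right_mono) auto
        also have "\<dots> = real n ^ (r + 1)" by simp
        finally have "ln (real n ^ r + 1) \<le> ln (real n ^ (r + 1))" using n by (subst ln_le_cancel_iff) (auto intro: add_pos_pos)
        also have "\<dots> = (real r + 1) * L" by (subst ln_realpow) (use n in \<open>simp_all add: L_def add.commute\<close>)
        also have "\<dots> \<le> 2 * real r * L" using r1 L1 by (intro mult_right_mono) auto
        finally show ?thesis .
      qed
      have kb: "real k * real b \<le> 20 * c * real r ^ 2 * C1 * L ^ 7 * (x + y)"
      proof -
        have "real k * real b \<le> (10 * c * real r ^ 2 * L ^ 3) * (2 * B)"
          using c1 L1 by (intro mult_mono k2 b2) auto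
        also have "\<dots> = 20 * c * real r ^ 2 * C1 * (L ^ 3 * L ^ 4) * (x + y)" by (simp add: B_def)
        also have "L ^ 3 * L ^ 4 = L ^ 7" by (simp flip: power_add)
        finally show ?thesis .
      qed
      have "2 * (2 * p * (t * real n ^ (r - 1) + real k * real (2 * l * b)) + real k * real (2 * l * b) * ln (real n ^ r + 1))
        = 4 * (p * (t * real n ^ (r - 1))) + 4 * real l * (real k * real b) * (2 * p + ln (real n ^ r + 1))"
        by (simp add: algebra_simps)
      also have "\<dots> \<le> 4 * (p * (t * real n ^ (r - 1))) + 4 * real l * (20 * c * real r ^ 2 * C1 * L ^ 7 * (x + y)) * (4 * (real r * L))"
      proof (intro add_left_mono mult_mono[OF mult_left_mono[OF kb]])
        show "0 \<le> 2 * p + ln (real n ^ r + 1)" using p by simp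
        have "0 \<le> real k * real b" by simp
        then have "0 \<le> 20 * c * real r ^ 2 * C1 * L ^ 7 * (x + y)" using kb by linarith
        then show "0 \<le> 4 * real l * (20 * c * real r ^ 2 * C1 * L ^ 7 * (x + y))"
          by (intro mult_nonneg_nonneg[of "4 * real l"]) simp_all
        show "2 * p + ln (real n ^ r + 1) \<le> 4 * (real r * L)" using lnb p rL by simp
      qed simp
      also have "\<dots> = 4 * (p * (t * real n ^ (r - 1))) + C2 * (L ^ 7 * L) * (x + y)"
        by (simp add: C2_def power2_eq_square power3_eq_cube)
      also have "L ^ 7 * L = L ^ 8" by (simp flip: power_Suc2)
      also have "4 * (p * (t * real n ^ (r - 1))) + C2 * L ^ 8 * (x + y) \<le>
        C * L ^ 8 * (p * (t * real n ^ (r - 1))) + C * L ^ 8 * (x + y)"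
        using CL8 CC(4) ptn xy L8 by (intro add_mono mult_right_mono) auto
      also have "\<dots> = s" by (simp add: s_def algebra_simps)
      finally show "2 * (2 * p * (t * real n ^ (r - 1) + real k * real (2 * l * b)) +
        real k * real (2 * l * b) * ln (real n ^ r + 1)) \<le> s" .
    qed
    moreover have "real n \<le> s"
    proof -
      have "1 * real n \<le> C * L ^ 8 * (p * (t * real n ^ (r - 1)) + x + y)"
        using CL8 yn ptn x0 by (intro mult_mono) auto
      then show ?thesis by (simp add: s_def)
    qed
    then have "exp (- s / 2) \<le> exp (- real n / 2)" by simp
    ultimately have "1 - exp (- real n / 2) \<le> measure_pmf.prob (random_hypergraph r n p)
      {G. real (turan_number G (linear_cycle r (2 * l))) \<le> s}" by linarith
    then show ?thesis unfolding s_def x_def y_def L_def .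
  qed
  then show ?thesis using CC(1) by (intro exI[of _ C]) simp
qed

text \<open>With p = n powr x, the exponent \<tau> of \<open>t\<close> is chosen so that p t n powr
  (\<rho> - 1) and n (n / t) powr B both become n powr W. The summand 1 keeps \<open>t\<close> above
  the polylogarithmic threshold when \<tau> is negative and contributes the exponent x + \<rho> - 1.
  The remaining factors total 4 C ^ 2 L ^ 12, at most L ^ 13 = n powr (13 \<theta>).\<close>

lemma exponent_bound:
  fixes n x A B c \<theta> C \<rho> Z L t \<tau> W :: real
  assumes n: "3 \<le> n" and L: "L = ln n" "4 * C ^ 2 \<le> L" "\<theta> = ln L / L" and C: "1 \<le> C"
    and AB: "0 < B" "B * (1 - A) = A"
    and \<tau>: "\<tau> = - (1 - A) * x - (\<rho> - 2) + (\<rho> - 1) * A" and t: "t = C * L ^ 4 * (1 + n powr \<tau>)"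
    and W: "W = A * x + 1 + (\<rho> - 1) * A"
    and Z: "x + \<rho> - 1 \<le> Z + c * \<theta>" "W \<le> Z + c * \<theta>" "1 + A \<le> Z + c * \<theta>"
  shows "C * L ^ 8 * (n powr x * (t * n powr (\<rho> - 1)) + n * (n / t) powr B + n powr (1 + A)) \<le>
    n powr (Z + (13 + c) * \<theta>)"
proof -
  define Q where "Q = n powr (Z + c * \<theta>)"
  have "1 * 1 \<le> C * C" using C by (intro mult_mono) auto
  then have L1: "1 \<le> L" using L(2) by (simp add: power2_eq_square)
  have L4: "1 \<le> L ^ 4" using L1 by simp
  have Q: "n powr z \<le> Q" if "z \<le> Z + c * \<theta>" for z
    unfolding Q_def using n that by (intro powr_mono) auto
  have Q0: "0 \<le> Q" by (simp add: Q_def)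
  have CL: "1 \<le> C * L ^ 4" using mult_mono[OF C L4] C by simp
  have "n powr x * (t * n powr (\<rho> - 1)) = C * L ^ 4 * (n powr (x + \<rho> - 1) + n powr (x + \<tau> + \<rho> - 1))"
    unfolding t by (simp add: powr_add powr_diff algebra_simps)
  also have "x + \<tau> + \<rho> - 1 = W" by (simp add: \<tau> W algebra_simps)
  also have "C * L ^ 4 * (n powr (x + \<rho> - 1) + n powr W) \<le> C * L ^ 4 * (Q + Q)"
    using Z CL by (intro mult_left_mono add_mono Q) auto
  finally have 1: "n powr x * (t * n powr (\<rho> - 1)) \<le> C * L ^ 4 * (2 * Q)" by simp
  have tp: "n powr \<tau> \<le> t"
  proof -
    have "1 * n powr \<tau> \<le> C * L ^ 4 * (1 + n powr \<tau>)" using CL by (intro mult_mono) auto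
    then show ?thesis by (simp add: t)
  qed
  have "0 < n powr \<tau>" using n by simp
  then have t0: "0 < t" using tp by linarith
  have "n * (n / t) powr B \<le> n * (n / n powr \<tau>) powr B"
    using tp t0 n AB by (intro mult_left_mono powr_mono2 divide_left_mono mult_pos_pos) auto
  also have "\<dots> = n powr (1 + B * (1 - \<tau>))"

  proof -
    have "n / n powr \<tau> = n powr (1 - \<tau>)" using n by (simp add: powr_diff)
    then show ?thesis using n by (simp add: powr_add powr_powr mult.commute)
  qed
  also have "1 + B * (1 - \<tau>) = W"
  proof -
    have "1 - \<tau> = (1 - A) * (x + \<rho> - 1)" by (simp add: \<tau> algebra_simps)
    then have "B * (1 - \<tau>) = A * (x + \<rho> - 1)" using AB(2) by (metis mult.assoc)
    then show ?thesis by (simp add: W algebra_simps)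
  qed
  also have "n powr W \<le> Q" by (rule Q[OF Z(2)])
  finally have 2: "n * (n / t) powr B \<le> Q" .
  have 3: "n powr (1 + A) \<le> Q" by (rule Q[OF Z(3)])
  have "n powr x * (t * n powr (\<rho> - 1)) + n * (n / t) powr B + n powr (1 + A) \<le> C * L ^ 4 * (2 * Q) + Q + Q"
    using 1 2 3 by linarith
  also have "\<dots> \<le> C * L ^ 4 * (4 * Q)" using mult_right_mono[OF CL Q0] by (simp add: algebra_simps)
  finally have "C * L ^ 8 * (n powr x * (t * n powr (\<rho> - 1)) + n * (n / t) powr B + n powr (1 + A)) \<le>
    C * L ^ 8 * (C * L ^ 4 * (4 * Q))" using C L1 by (intro mult_left_mono) auto
  also have "\<dots> = (4 * C ^ 2) * (L ^ 8 * L ^ 4) * Q" by (simp add: power2_eq_square)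
  also have "\<dots> \<le> L * (L ^ 8 * L ^ 4) * Q" using L(2) L1 Q0 by (intro mult_right_mono) auto
  also have "L * (L ^ 8 * L ^ 4) = L ^ 13" by (simp flip: power_add power_Suc)
  also have "L ^ 13 = n powr (13 * \<theta>)"
  proof -
    have "n powr (13 * \<theta>) = exp (13 * ln L)" using n L1 by (simp add: powr_def L(1,3) flip: L(1))
    also have "\<dots> = L ^ 13" using exp_of_nat_mult[of 13 "ln L"] L1 by simp
    finally show ?thesis by simp
  qed
  also have "n powr (13 * \<theta>) * Q = n powr (Z + (13 + c) * \<theta>)"
    by (simp add: Q_def algebra_simps flip: powr_add)
  finally show ?thesis .
qed

theorem theorem2p1:
  fixes l r :: nat and \<epsilon>\<^sub>1 \<epsilon>\<^sub>2 :: "nat \<Rightarrow> real"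
  assumes "l \<ge> 2" and "r \<ge> 3"
    and "\<epsilon>\<^sub>1 \<in> exponent_errors" and "\<epsilon>\<^sub>2 \<in> exponent_errors"
  shows "\<exists>\<delta>\<^sub>1\<in>exponent_errors. \<exists>\<delta>\<^sub>2\<in>exponent_errors. \<forall>p :: nat \<Rightarrow> real.
    (\<forall>n. 0 \<le> p n \<and> p n \<le> 1) \<longrightarrow>
    (\<forall>\<^sub>F n in sequentially. real n powr (- (real r - 2) + \<epsilon>\<^sub>1 n) \<le> p n) \<longrightarrow>
    asymptotically_almost_surely (\<lambda>n. random_hypergraph r n (p n))
      (\<lambda>n G. real (turan_number G (linear_cycle r (2 * l))) \<le>
        (if real n powr (- (real r - 2) + \<epsilon>\<^sub>1 n) \<le> p n \<and>
            p n \<le> real n powr (- (real r - 2) + 1 / (2 * real l - 2) + \<epsilon>\<^sub>2 n)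
         then p n powr (1 / (2 * real l - 1)) *
                real n powr (1 + (real r - 1) / (2 * real l - 1) + \<delta>\<^sub>1 n)
         else p n * real n powr (real r - 1 + \<delta>\<^sub>2 n)))"
proof -
  define \<theta> where "\<theta> n = ln (ln (real n)) / ln (real n)" for n
  obtain a1 where a1: "0 < a1" "eventually (\<lambda>n. norm (\<epsilon>\<^sub>1 n) \<le> a1 * norm (\<theta> n)) sequentially"
    using landau_o.bigE[OF assms(3)[unfolded exponent_errors_def]] unfolding \<theta>_def by blast
  obtain a2 where a2: "0 < a2" "eventually (\<lambda>n. norm (\<epsilon>\<^sub>2 n) \<le> a2 * norm (\<theta> n)) sequentially"
    using landau_o.bigE[OF assms(4)[unfolded exponent_errors_def]] unfolding \<theta>_def by blast
  \<comment> \<open>c \<theta> bounds both given error terms, by which the ends of the range of p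
    are shifted.\<close>
  define c where "c = a1 + a2"
  obtain C where C: "1 \<le> C" "\<And>n p t. 3 \<le> n \<Longrightarrow> 0 \<le> p \<Longrightarrow> p \<le> 1 \<Longrightarrow> C * ln (real n) ^ 4 \<le> t \<Longrightarrow>
    1 - exp (- real n / 2) \<le> measure_pmf.prob (random_hypergraph r n p)
      {G. real (turan_number G (linear_cycle r (2 * l))) \<le> C * ln (real n) ^ 8 *
        (p * (t * real n ^ (r - 1)) + real n * (real n / t) powr (1 / (2 * real l - 2)) +
          real n powr (1 + 1 / (2 * real l - 1)))}"
    using turan_whp[OF assms(1,2)] by blast
  \<comment> \<open>13 \<theta> absorbs the polylogarithmic factors and c \<theta> the shifted ends
    of the range; the same error serves in both cases.\<close>
  define \<delta> where "\<delta> n = (13 + c) * \<theta> n" for n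
  have \<delta>: "\<delta> \<in> exponent_errors"
    unfolding exponent_errors_def \<delta>_def \<theta>_def 
    by (rule landau_o.bigI[of "13 + c"]) (use a1(1) a2(1) in \<open>simp_all add: abs_mult c_def\<close>)
  define A where "A = 1 / (2 * real l - 1)"
  define B where "B = 1 / (2 * real l - 2)"
  have AB: "0 < A" "A \<le> 1" "0 < B" "B * (1 - A) = A" "A \<le> B"
    using assms(1) by (simp_all add: A_def B_def field_simps)
  show ?thesis
  proof (intro bexI[OF _ \<delta>] allI impI)
    fix p :: "nat \<Rightarrow> real"
    assume p: "\<forall>n. 0 \<le> p n \<and> p n \<le> 1"
      and lo: "\<forall>\<^sub>F n in sequentially. real n powr (- (real r - 2) + \<epsilon>\<^sub>1 n) \<le> p n"
    define bnd where "bnd n = (if real n powr (- (real r - 2) + \<epsilon>\<^sub>1 n) \<le> p n \<and>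
            p n \<le> real n powr (- (real r - 2) + 1 / (2 * real l - 2) + \<epsilon>\<^sub>2 n)
         then p n powr (1 / (2 * real l - 1)) *
                real n powr (1 + (real r - 1) / (2 * real l - 1) + \<delta> n)
         else p n * real n powr (real r - 1 + \<delta> n))" for n
    let ?P = "\<lambda>n. measure_pmf.prob (random_hypergraph r n (p n)) {G. real (turan_number G (linear_cycle r (2 * l))) \<le> bnd n}"
    have "eventually (\<lambda>n. 4 * C ^ 2 \<le> ln (real n)) sequentially"
      by real_asymp
    then have ev: "eventually (\<lambda>n. 1 - exp (- real n / 2) \<le> ?P n) sequentially"
      using a1(2) a2(2) lo eventually_ge_at_top[of 3]
    proof eventually_elim
      case (elim n)
      define L where "L = ln (real n)"
      have n: "3 \<le> real n" using elim by simp
      have "1 * 1 \<le> C * C" using C(1) by (intro mult_mono) auto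
      then have L1: "1 \<le> L" using elim by (simp add: L_def power2_eq_square)
      then have \<theta>0: "0 \<le> \<theta> n" by (simp add: \<theta>_def L_def)
      have "a1 * \<theta> n \<le> c * \<theta> n" "a2 * \<theta> n \<le> c * \<theta> n"
        using a1(1) a2(1) \<theta>0 by (simp_all add: c_def mult_right_mono)
      then have \<epsilon>: "\<bar>\<epsilon>\<^sub>1 n\<bar> \<le> c * \<theta> n" "\<bar>\<epsilon>\<^sub>2 n\<bar> \<le> c * \<theta> n"
        using elim \<theta>0 by simp_all
      have c\<theta>: "0 \<le> c * \<theta> n" using \<epsilon>(1) by linarith
      define x where "x = ln (p n) / L"
      \<comment> \<open>The lower bound on p makes it positive, so that it can be written as a power
        of n.\<close>
      have "0 < real n powr (- (real r - 2) + \<epsilon>\<^sub>1 n)" using n by simp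
      then have pp: "0 < p n" using elim by linarith
      have px: "p n = real n powr x" using n pp L1 by (simp add: powr_def x_def L_def)
      have lox: "- (real r - 2) + \<epsilon>\<^sub>1 n \<le> x"
        using elim n unfolding px by (subst (asm) powr_le_cancel_iff) auto
      define \<tau> where "\<tau> = - (1 - A) * x - (real r - 2) + (real r - 1) * A"
      define t where "t = C * L ^ 4 * (1 + real n powr \<tau>)"
      define W where "W = A * x + 1 + (real r - 1) * A"
      have tC: "C * ln (real n) ^ 4 \<le> t"
        using C(1) L1 unfolding t_def L_def[symmetric] by (simp add: distrib_left)
      have nr: "real n ^ (r - 1) = real n powr (real r - 1)"
        using n assms(2) by (simp add: of_nat_diff flip: powr_realpow)
      have B1: "(1 - A) * B = A" using AB(4) by (simp add: mult.commute)
      have main: "C * L ^ 8 * (p n * (t * real n ^ (r - 1)) + real n * (real n / t) powr B + real n powr (1 + A)) \<le> bnd n"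
      proof (cases "p n \<le> real n powr (- (real r - 2) + 1 / (2 * real l - 2) + \<epsilon>\<^sub>2 n)")
        case True
        then have hix: "x \<le> - (real r - 2) + B + \<epsilon>\<^sub>2 n"
          using n unfolding px B_def by (subst (asm) powr_le_cancel_iff) auto
        have "C * L ^ 8 * (real n powr x * (t * real n powr (real r - 1)) + real n * (real n / t) powr B + real n powr (1 + A))
          \<le> real n powr (W + (13 + c) * \<theta> n)"
        proof (rule exponent_bound[OF n L_def _ _ C(1) AB(3,4) \<tau>_def t_def W_def])
          show "4 * C ^ 2 \<le> L" using elim by (simp add: L_def)
          show "\<theta> n = ln L / L" by (simp add: \<theta>_def L_def)
          \<comment> \<open>The difference of x + r - 1 and W is (1 - A) (x + r - 2) - A. It
            vanishes at x = - (r - 2) + B because (1 - A) B = A, which is the upper end of the range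
            of p.\<close>
          have "(1 - A) * (x + real r - 2) \<le> (1 - A) * (B + c * \<theta> n)"
            using hix \<epsilon> AB by (intro mult_left_mono) auto
          also have "\<dots> = A + (1 - A) * (c * \<theta> n)" by (simp only: distrib_left B1)
          also have "\<dots> \<le> A + 1 * (c * \<theta> n)" using AB(1) c\<theta> by (intro add_left_mono mult_right_mono) auto
          finally show "x + real r - 1 \<le> W + c * \<theta> n" by (simp add: W_def algebra_simps)
          \<comment> \<open>The difference of W and 1 + A is A (x + r - 2), which vanishes at the
            lower end of the range of p.\<close>
          have "A * (- (c * \<theta> n)) \<le> A * (x + real r - 2)"
            using lox \<epsilon> AB by (intro mult_left_mono) auto
          moreover have "- (c * \<theta> n) \<le> A * (- (c * \<theta> n))" using AB(2) c\<theta> mult_right_mono[of A 1 "c * \<theta> n"] by simp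
          ultimately show "1 + A \<le> W + c * \<theta> n" by (simp add: W_def algebra_simps)
          show "W \<le> W + c * \<theta> n" using c\<theta> by simp
        qed
        also have "\<dots> = real n powr (x * A) * real n powr (1 + (real r - 1) * A + \<delta> n)"
          by (simp add: W_def \<delta>_def algebra_simps flip: powr_add)
        also have "\<dots> = bnd n" using True elim unfolding bnd_def A_def
          by (simp add: px powr_powr)
        finally show ?thesis unfolding nr px .
      next
        case False
        then have hix: "- (real r - 2) + B + \<epsilon>\<^sub>2 n \<le> x"
          using n unfolding px B_def by (subst (asm) powr_le_cancel_iff) auto
        have "C * L ^ 8 * (real n powr x * (t * real n powr (real r - 1)) + real n * (real n / t) powr B + real n powr (1 + A))
          \<le> real n powr ((x + real r - 1) + (13 + c) * \<theta> n)"
        proof (rule exponent_bound[OF n L_def _ _ C(1) AB(3,4) \<tau>_def t_def W_def])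
          show "4 * C ^ 2 \<le> L" using elim by (simp add: L_def)
          show "\<theta> n = ln L / L" by (simp add: \<theta>_def L_def)
          show "x + real r - 1 \<le> x + real r - 1 + c * \<theta> n" using c\<theta> by simp
          have "A - 1 * (c * \<theta> n) \<le> A - (1 - A) * (c * \<theta> n)"
            using AB(1) c\<theta> by (intro diff_left_mono mult_right_mono) auto
          also have "\<dots> = (1 - A) * (B - c * \<theta> n)" by (simp only: right_diff_distrib B1)
          also have "\<dots> \<le> (1 - A) * (x + real r - 2)"
            using hix \<epsilon> AB by (intro mult_left_mono) auto
          finally show "W \<le> x + real r - 1 + c * \<theta> n" by (simp add: W_def algebra_simps)
          show "1 + A \<le> x + real r - 1 + c * \<theta> n" using hix \<epsilon>(2) AB(5) by linarith
        qed
        also have "\<dots> = real n powr x * real n powr (real r - 1 + \<delta> n)"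
          by (simp add: \<delta>_def algebra_simps flip: powr_add)
        also have "\<dots> = bnd n" using False unfolding bnd_def by (simp add: px)
        finally show ?thesis unfolding nr px .
      qed
      have "1 - exp (- real n / 2) \<le> measure_pmf.prob (random_hypergraph r n (p n))
        {G. real (turan_number G (linear_cycle r (2 * l))) \<le> C * L ^ 8 *
          (p n * (t * real n ^ (r - 1)) + real n * (real n / t) powr B + real n powr (1 + A))}"
        unfolding A_def B_def L_def using C(2)[OF _ _ _ tC, of "p n"] p elim by simp
      also have "\<dots> \<le> ?P n"
        using main by (intro measure_pmf.finite_measure_mono) auto
      finally show ?case .
    qed
    have "?P \<longlonglongrightarrow> 1"
    proof (rule tendsto_sandwich[OF ev _ _ tendsto_const])
      show "(\<lambda>n. 1 - exp (- real n / 2)) \<longlonglongrightarrow> 1" by real_asymp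
      show "\<forall>\<^sub>F n in sequentially. ?P n \<le> 1" by (intro always_eventually allI measure_pmf.prob_le_1)
    qed
    then show "asymptotically_almost_surely (\<lambda>n. random_hypergraph r n (p n))
      (\<lambda>n G. real (turan_number G (linear_cycle r (2 * l))) \<le>
        (if real n powr (- (real r - 2) + \<epsilon>\<^sub>1 n) \<le> p n \<and>
            p n \<le> real n powr (- (real r - 2) + 1 / (2 * real l - 2) + \<epsilon>\<^sub>2 n)
         then p n powr (1 / (2 * real l - 1)) *
                real n powr (1 + (real r - 1) / (2 * real l - 1) + \<delta> n)
         else p n * real n powr (real r - 1 + \<delta> n)))"
      unfolding asymptotically_almost_surely_def bnd_def .
  qed
qed

end
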